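(* Let $\lambda>0$. For every measurable $f:\mathbb R_+\times[n]\to\mathbb R$ that is bounded or nonnegative and every $x\in\mathbb R_+$, $$\big(\mathcal U_\lambda f(x,i)\big)^\top_{i=1,\dots,n}=\big(Q_\lambda f(x,i)\big)^\top_{i=1,\dots,n}+e^{-\lambda x}\,\boldsymbol\Phi^+(\lambda)^{-1}\cdot\boldsymbol\psi(f,\lambda),$$ where $$\boldsymbol\psi(f,\lambda)=\Big(d_i^+f(0,i)+\int_0^\infty Q_\lambda f(x,i)\,\Pi_i^+(dx)+\sum_{j\ne i}q^+_{i,j}\,\mathbb E\big[Q_\lambda f(\Delta^+_{i,j},j)\big]\Big)^\top_{i=1,\dots,n}$$ and $Q_\lambda f(x,i)=\int_0^x e^{-\lambda t}f(x-t,i)\,dt$ for $(x,i)\in\mathbb R_+\times[n]$.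
   Context: MAP. Let $[n]=\{1,\dots,n\}$, $\mathbb R_+=[0,\infty)$. $(\xi,J)$ is a Markov additive process (MAP) on $\mathbb R\times[n]$: a càdlàg Feller process with laws $(\mathbb P^{x,i})$ and right-continuous complete filtration $(\mathcal F_t)$ such that for all $s,t\ge 0$ and bounded measurable $f$, $\mathbb E^{x,i}[f(\xi_{t+s}-\xi_t,J_{t+s})\mid\mathcal F_t]=\mathbb E^{0,J_t}[f(\xi_s,J_s)]$ a.s. It has infinite lifetime and $\xi$ does not have lattice support. Overshoots. $T_t=\inf\{s\ge 0:\xi_s>t\}$ and $(\mathcal O_t,\mathcal J_t)=(\xi_{T_t}-t,J_{T_t})$, $t\ge 0$, regarded as a Markov process on $\mathbb R_+\times[n]$ under $\mathbb P^{x,i}$, $(x,i)\in\mathbb R_+\times[n]$. Its resolvent is $\mathcal U_\lambda f(x,i)=\int_0^\infty e^{-\lambda t}\mathbb E^{x,i}[f(\mathcal O_t,\mathcal J_t)]\,dt$. Ascending ladder height MAP. With $\overline\xi_t=\sup_{s\le t}\xi_s$, let $\mathsf L^{(i)}$ be a version of the local time at $(0,i)$ of the strong Markov process $(\overline\xi-\xi,J)$, $\mathsf L=\sum_{i}\mathsf L^{(i)}$, $\mathsf L^{-1}_t=\inf\{s:\mathsf L_s>t\}$, and $(H^+_t,J^+_t)=(\xi_{\mathsf L^{-1}_t},J_{\mathsf L_t^{-1}})$. It is a Markov additive subordinator: $J^+$ is a Markov chain with intensity matrix $\boldsymbol Q^+=(q^+_{i,j})$; while $J^+$ is in state $i$,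 $H^+$ evolves as a Lévy subordinator $H^{+,(i)}$ with drift $d_i^+\ge 0$ and Lévy measure $\Pi_i^+$; at a jump of $J^+$ from $i$ to $j\neq i$, $H^+$ makes an additional independent jump distributed as $\Delta^+_{i,j}\ge 0$, with law $F^+_{i,j}$ ($\Delta^+_{i,i}=0$, and $\Delta^+_{i,j}=0$ if $q^+_{i,j}=0$). Let $\Phi^+_i$ be the Laplace exponent of $H^{+,(i)}$, i.e. $\mathbb E[e^{-\theta H^{+,(i)}_1}]=e^{-\Phi_i^+(\theta)}$, $\boldsymbol G^+(\theta)=(\mathbb E[e^{-\theta\Delta^+_{i,j}}])_{i,j}$, and $$\boldsymbol\Phi^+(\theta)=\mathrm{diag}(\Phi^+_1(\theta),\dots,\Phi^+_n(\theta))-\boldsymbol Q^+\odot\boldsymbol G^+(\theta),\quad\theta\ge 0,$$ with $\odot$ the entrywise product, so that $\mathbb E^{0,i}[e^{-\theta H_t^+};J^+_t=j]=(e^{-t\boldsymbol\Phi^+(\theta)})_{i,j}$. Standing assumptions. (1) Upward regularity: $\mathbb P^{0,i}(T_0=0)=1$ for all $i\in[n]$. (2) $\limsup_{t\to\infty}\xi_t=\infty$ $\mathbb P^{x,i}$-a.s. for all $(x,i)$ (so nothing is killed). (3) $J^+$ is irreducible. (Under these assumptions $\boldsymbol\Phi^+(\lambda)$ is invertible for $\lambda>0$.) *)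

theory Defs
  imports "HOL-Probability.Probability"
begin

text \<open>
  Conventions. The phase space \<open>[n]\<close> is a type \<open>'n :: finite\<close> with the discrete \<open>\<sigma>\<close>-algebra. Time is
  \<^typ>\<open>real\<close>, and processes are only looked at for times \<open>t \<ge> 0\<close>. First passage and inverse times are
  extended reals (\<open>\<infinity>\<close> for the infimum of the empty set); a process is evaluated at such a time
  through \<^const>\<open>real_of_ereal\<close>, whose value at \<open>\<infinity>\<close> only matters on null sets when
  \<open>limsup \<xi> = \<infinity>\<close>.
\<close>

abbreviation state_space :: "(real \<times> 'n::finite) measure" where
  "state_space \<equiv> borel \<Otimes>\<^sub>M count_space UNIV"

definition cadlag :: "(real \<Rightarrow> real) \<Rightarrow> bool" where
  "cadlag g \<longleftrightarrow> (\<forall>t\<ge>0. (g \<longlongrightarrow> g t) (at_right t)) \<and> (\<forall>t>0. \<exists>l. (g \<longlongrightarrow> l) (at_left t))"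

text \<open>The same for the discrete topology on the target.\<close>

definition cadlag_discrete :: "(real \<Rightarrow> 'n) \<Rightarrow> bool" where
  "cadlag_discrete g \<longleftrightarrow>
     (\<forall>t\<ge>0. \<forall>\<^sub>F s in at_right t. g s = g t) \<and> (\<forall>t>0. \<exists>j. \<forall>\<^sub>F s in at_left t. g s = j)"

text \<open>Law of a process indexed by \<open>[0,\<infinity>)\<close>, on the product \<open>\<sigma>\<close>-algebra.\<close>

definition process_law :: "'w measure \<Rightarrow> 's measure \<Rightarrow> (real \<Rightarrow> 'w \<Rightarrow> 's) \<Rightarrow> (real \<Rightarrow> 's) measure" where
  "process_law \<mu> S X = distr \<mu> (\<Pi>\<^sub>M t\<in>{0..}. S) (\<lambda>\<omega>. \<lambda>t\<in>{0..}. X t \<omega>)"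


section \<open>Markov additive processes\<close>

definition C0 :: "(real \<times> 'n::finite \<Rightarrow> real) set" where
  "C0 = {f. \<forall>i. continuous_on UNIV (\<lambda>x. f (x, i)) \<and> ((\<lambda>x. f (x, i)) \<longlongrightarrow> 0) at_infinity}"

definition transition_op ::
  "(real \<Rightarrow> 'n \<Rightarrow> 'w measure) \<Rightarrow> (real \<Rightarrow> 'w \<Rightarrow> real) \<Rightarrow> (real \<Rightarrow> 'w \<Rightarrow> 'n) \<Rightarrow>
   real \<Rightarrow> (real \<times> 'n \<Rightarrow> real) \<Rightarrow> real \<times> 'n \<Rightarrow> real" where
  "transition_op P \<xi> J t f = (\<lambda>(x, i). \<integral>\<omega>. f (\<xi> t \<omega>, J t \<omega>) \<partial>P x i)"

text \<open>
  \<open>P x i\<close> is the law \<open>\<bbbP>\<^sup>x\<^sup>,\<^sup>i\<close>; all the laws live on the measurable space of \<open>M\<close>, whose own measure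
  is irrelevant. Completeness refers to the whole family of laws: \<open>F 0\<close> contains every subset of a
  measurable set that is null under all of them. The values of \<open>F\<close> at negative times carry no
  information (any filtration on \<open>[0,\<infinity>)\<close> extends by \<open>F 0\<close>).
\<close>

locale markov_additive_process = filtration "space M" F
  for M :: "'w measure" and F :: "real \<Rightarrow> 'w measure" +
  fixes P :: "real \<Rightarrow> 'n::finite \<Rightarrow> 'w measure"
    and \<xi> :: "real \<Rightarrow> 'w \<Rightarrow> real"
    and J :: "real \<Rightarrow> 'w \<Rightarrow> 'n"
  assumes prob_space_P: "prob_space (P x i)"
    and sets_P: "sets (P x i) = sets M"
    and filtration_sub: "sets (F t) \<subseteq> sets M"
    and filtration_right_cont: "t \<ge> 0 \<Longrightarrow> sets (F t) = (\<Inter>s\<in>{t<..}. sets (F s))"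
    and filtration_complete:
      "N \<in> sets M \<Longrightarrow> (\<And>x i. emeasure (P x i) N = 0) \<Longrightarrow> A \<subseteq> N \<Longrightarrow> A \<in> sets (F 0)"
    and adapted_xi: "t \<ge> 0 \<Longrightarrow> \<xi> t \<in> F t \<rightarrow>\<^sub>M borel"
    and adapted_J: "t \<ge> 0 \<Longrightarrow> J t \<in> F t \<rightarrow>\<^sub>M count_space UNIV"
    and cadlag_xi: "\<omega> \<in> space M \<Longrightarrow> cadlag (\<lambda>t. \<xi> t \<omega>)"
    and cadlag_J: "\<omega> \<in> space M \<Longrightarrow> cadlag_discrete (\<lambda>t. J t \<omega>)"
    and initial: "AE \<omega> in P x i. \<xi> 0 \<omega> = x \<and> J 0 \<omega> = i"
    and markov:
      "s \<ge> 0 \<Longrightarrow> t \<ge> 0 \<Longrightarrow> f \<in> borel_measurable state_space \<Longrightarrow> bounded (range f) \<Longrightarrow>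
       AE \<omega> in P x i. real_cond_exp (P x i) (F t) (\<lambda>\<omega>. f (\<xi> (t + s) \<omega>, J (t + s) \<omega>)) \<omega> =
         transition_op P \<xi> J s f (\<xi> t \<omega>, J t \<omega>)"
    and feller_C0: "f \<in> C0 \<Longrightarrow> t \<ge> 0 \<Longrightarrow> transition_op P \<xi> J t f \<in> C0"
    and feller_continuous:
      "f \<in> C0 \<Longrightarrow> uniform_limit UNIV (\<lambda>t. transition_op P \<xi> J t f) f (at_right 0)"
    and markov_additive:
      "s \<ge> 0 \<Longrightarrow> t \<ge> 0 \<Longrightarrow> f \<in> borel_measurable state_space \<Longrightarrow> bounded (range f) \<Longrightarrow>
       AE \<omega> in P x i. real_cond_exp (P x i) (F t) (\<lambda>\<omega>. f (\<xi> (t + s) \<omega> - \<xi> t \<omega>, J (t + s) \<omega>)) \<omega> =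
         (\<integral>\<omega>'. f (\<xi> s \<omega>', J s \<omega>') \<partial>P 0 (J t \<omega>))"

definition lattice_support :: "(real \<Rightarrow> 'n \<Rightarrow> 'w measure) \<Rightarrow> (real \<Rightarrow> 'w \<Rightarrow> real) \<Rightarrow> bool" where
  "lattice_support P \<xi> \<longleftrightarrow> (\<exists>h>0. \<forall>i. \<forall>t\<ge>0. AE \<omega> in P 0 i. \<exists>k::int. \<xi> t \<omega> = h * of_int k)"


section \<open>Overshoots\<close>

definition passage_time :: "(real \<Rightarrow> 'w \<Rightarrow> real) \<Rightarrow> real \<Rightarrow> 'w \<Rightarrow> ereal" where
  "passage_time \<xi> t \<omega> = Inf (ereal ` {s. 0 \<le> s \<and> t < \<xi> s \<omega>})"

definition overshoot ::
  "(real \<Rightarrow> 'w \<Rightarrow> real) \<Rightarrow> (real \<Rightarrow> 'w \<Rightarrow> 'n) \<Rightarrow> real \<Rightarrow> 'w \<Rightarrow> real \<times> 'n" where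
  "overshoot \<xi> J t \<omega> =
     (let T = real_of_ereal (passage_time \<xi> t \<omega>) in (\<xi> T \<omega> - t, J T \<omega>))"

text \<open>
  The resolvent and the other functionals of \<open>f\<close> come in two versions: a real one for bounded \<open>f\<close>,
  and one with values in \<open>[0,\<infinity>]\<close> (prefix \<open>nn_\<close>) for nonnegative \<open>f\<close>.
\<close>

definition resolvent ::
  "(real \<Rightarrow> 'n \<Rightarrow> 'w measure) \<Rightarrow> (real \<Rightarrow> 'w \<Rightarrow> real) \<Rightarrow> (real \<Rightarrow> 'w \<Rightarrow> 'n) \<Rightarrow>
   real \<Rightarrow> (real \<times> 'n \<Rightarrow> real) \<Rightarrow> real \<times> 'n \<Rightarrow> real" where
  "resolvent P \<xi> J l f = (\<lambda>(x, i).
     LINT t:{0..}|lborel. exp (- l * t) * (\<integral>\<omega>. f (overshoot \<xi> J t \<omega>) \<partial>P x i))"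

definition nn_resolvent ::
  "(real \<Rightarrow> 'n \<Rightarrow> 'w measure) \<Rightarrow> (real \<Rightarrow> 'w \<Rightarrow> real) \<Rightarrow> (real \<Rightarrow> 'w \<Rightarrow> 'n) \<Rightarrow>
   real \<Rightarrow> (real \<times> 'n \<Rightarrow> real) \<Rightarrow> real \<times> 'n \<Rightarrow> ennreal" where
  "nn_resolvent P \<xi> J l f = (\<lambda>(x, i).
     \<integral>\<^sup>+t\<in>{0..}. ennreal (exp (- l * t)) * (\<integral>\<^sup>+\<omega>. ennreal (f (overshoot \<xi> J t \<omega>)) \<partial>P x i) \<partial>lborel)"

definition Q_op :: "real \<Rightarrow> (real \<times> 'n \<Rightarrow> real) \<Rightarrow> real \<times> 'n \<Rightarrow> real" where
  "Q_op l f = (\<lambda>(x, i). LINT t:{0..x}|lborel. exp (- l * t) * f (x - t, i))"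

definition nn_Q_op :: "real \<Rightarrow> (real \<times> 'n \<Rightarrow> real) \<Rightarrow> real \<times> 'n \<Rightarrow> ennreal" where
  "nn_Q_op l f = (\<lambda>(x, i). \<integral>\<^sup>+t\<in>{0..x}. ennreal (exp (- l * t) * f (x - t, i)) \<partial>lborel)"


section \<open>Local time and the ascending ladder height process\<close>

text \<open>
  Local time at a point \<open>b\<close> that is regular for itself, for a strong Markov process \<open>X\<close> with respect
  to the filtration \<open>F\<close>; \<open>laws\<close> are the laws under consideration and \<open>Pb\<close> is one of them under which
  \<open>X\<close> starts in \<open>b\<close>. As in Bertoin's book on Levy processes (Chapter IV), it is a continuous,
  nondecreasing, adapted process whose set of points of increase is the closure of
  \<open>{t. X t = b}\<close> and such that, at every stopping time \<open>T\<close> with \<open>X T = b\<close>, the pair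
  \<open>(X (T + s), L (T + s) - L T)\<close>, \<open>s \<ge> 0\<close>, is independent of the past of \<open>T\<close> and distributed as
  \<open>(X, L)\<close> under \<open>Pb\<close>. Letting \<open>A\<close> range over the events of the past of \<open>T\<close> contained
  in \<open>{X T = b}\<close> lets real-valued \<open>T\<close> suffice: an infinite \<open>T\<close> is covered by \<open>min T m\<close> on \<open>{T \<le> m}\<close>.
  This determines \<open>L\<close> up to a positive constant factor.
\<close>

definition local_time ::
  "'w set \<Rightarrow> (real \<Rightarrow> 'w measure) \<Rightarrow> 'w measure set \<Rightarrow> 's measure \<Rightarrow> (real \<Rightarrow> 'w \<Rightarrow> 's) \<Rightarrow> 's \<Rightarrow>
   'w measure \<Rightarrow> (real \<Rightarrow> 'w \<Rightarrow> real) \<Rightarrow> bool" where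
  "local_time \<Omega> F laws S X b Pb L \<longleftrightarrow>
     (\<forall>t\<ge>0. L t \<in> borel_measurable (F t)) \<and>
     (\<forall>\<omega>\<in>\<Omega>. L 0 \<omega> = 0 \<and> continuous_on {0..} (\<lambda>t. L t \<omega>) \<and> mono_on {0..} (\<lambda>t. L t \<omega>)) \<and>
     (\<forall>\<mu>\<in>laws. AE \<omega> in \<mu>.
        {t. 0 \<le> t \<and> (\<forall>e>0. L (max 0 (t - e)) \<omega> < L (t + e) \<omega>)} = closure {t. 0 \<le> t \<and> X t \<omega> = b}) \<and>
     (\<forall>\<mu>\<in>laws. \<forall>T. stopping_time F T \<and> (\<forall>\<omega>\<in>\<Omega>. 0 \<le> T \<omega>) \<longrightarrow>
        (\<forall>A\<in>sets (filtration.pre_sigma \<Omega> F T). (\<forall>\<omega>\<in>A. X (T \<omega>) \<omega> = b) \<longrightarrow>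
          (\<forall>B\<in>sets (\<Pi>\<^sub>M s\<in>{0..}. S \<Otimes>\<^sub>M borel).
             measure \<mu> {\<omega>\<in>A. (\<lambda>s\<in>{0..}. (X (T \<omega> + s) \<omega>, L (T \<omega> + s) \<omega> - L (T \<omega>) \<omega>)) \<in> B} =
             measure \<mu> A * measure Pb {\<omega>\<in>\<Omega>. (\<lambda>s\<in>{0..}. (X s \<omega>, L s \<omega>)) \<in> B})))"

definition reflected ::
  "(real \<Rightarrow> 'w \<Rightarrow> real) \<Rightarrow> (real \<Rightarrow> 'w \<Rightarrow> 'n) \<Rightarrow> real \<Rightarrow> 'w \<Rightarrow> real \<times> 'n" where
  "reflected \<xi> J t \<omega> = ((SUP s\<in>{0..t}. \<xi> s \<omega>) - \<xi> t \<omega>, J t \<omega>)"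

definition inverse_time :: "(real \<Rightarrow> 'w \<Rightarrow> real) \<Rightarrow> real \<Rightarrow> 'w \<Rightarrow> ereal" where
  "inverse_time L t \<omega> = Inf (ereal ` {s. 0 \<le> s \<and> t < L s \<omega>})"

definition ladder ::
  "(real \<Rightarrow> 'w \<Rightarrow> real) \<Rightarrow> (real \<Rightarrow> 'w \<Rightarrow> 'n::finite) \<Rightarrow> ('n \<Rightarrow> real \<Rightarrow> 'w \<Rightarrow> real) \<Rightarrow>
   real \<Rightarrow> 'w \<Rightarrow> real \<times> 'n" where
  "ladder \<xi> J L t \<omega> =
     (let T = real_of_ereal (inverse_time (\<lambda>s \<omega>. \<Sum>i\<in>UNIV. L i s \<omega>) t \<omega>) in (\<xi> T \<omega>, J T \<omega>))"


section \<open>Markov additive subordinators\<close>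

definition levy_measure :: "real measure \<Rightarrow> bool" where
  "levy_measure \<nu> \<longleftrightarrow>
     sets \<nu> = sets borel \<and> emeasure \<nu> {..0} = 0 \<and> (\<integral>\<^sup>+x. ennreal (min 1 x) \<partial>\<nu>) < \<infinity>"

definition laplace_exponent :: "real \<Rightarrow> real measure \<Rightarrow> real \<Rightarrow> real" where
  "laplace_exponent d \<nu> \<theta> = d * \<theta> + (\<integral>x. (1 - exp (- \<theta> * x)) \<partial>\<nu>)"

definition levy_subordinator ::
  "'v measure \<Rightarrow> (real \<Rightarrow> 'v \<Rightarrow> real) \<Rightarrow> real \<Rightarrow> real measure \<Rightarrow> bool" where
  "levy_subordinator N Y d \<nu> \<longleftrightarrow>
     (\<forall>t\<ge>0. Y t \<in> borel_measurable N) \<and>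
     (\<forall>\<omega>\<in>space N. Y 0 \<omega> = 0 \<and> cadlag (\<lambda>t. Y t \<omega>) \<and> mono_on {0..} (\<lambda>t. Y t \<omega>)) \<and>
     (\<forall>s t. 0 \<le> s \<and> s \<le> t \<longrightarrow>
        prob_space.indep_set N
          (sets (vimage_algebra (space N) (\<lambda>\<omega>. \<lambda>u\<in>{0..s}. Y u \<omega>) (\<Pi>\<^sub>M u\<in>{0..s}. borel)))
          (sets (vimage_algebra (space N) (\<lambda>\<omega>. Y t \<omega> - Y s \<omega>) borel)) \<and>
        distr N borel (\<lambda>\<omega>. Y t \<omega> - Y s \<omega>) = distr N borel (Y (t - s))) \<and>
     (\<forall>\<theta>\<ge>0. (\<integral>\<omega>. exp (- \<theta> * Y 1 \<omega>) \<partial>N) = exp (- laplace_exponent d \<nu> \<theta>))"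

text \<open>Conservative: the rows of an intensity matrix sum to zero, there is no killing.\<close>

definition intensity_matrix :: "real^'n^'n \<Rightarrow> bool" where
  "intensity_matrix Q \<longleftrightarrow> (\<forall>i j. i \<noteq> j \<longrightarrow> 0 \<le> Q $ i $ j) \<and> (\<forall>i. (\<Sum>j\<in>UNIV. Q $ i $ j) = 0)"

definition irreducible_intensity :: "real^'n^'n \<Rightarrow> bool" where
  "irreducible_intensity Q \<longleftrightarrow> (\<forall>i j. (i, j) \<in> {(k, l). k \<noteq> l \<and> 0 < Q $ k $ l}\<^sup>*)"

definition matrix_exp :: "real^'n^'n \<Rightarrow> real^'n^'n" where
  "matrix_exp A = (\<Sum>k. (1 / fact k) *\<^sub>R (((\<lambda>B. A ** B) ^^ k) (mat 1)))"

definition markov_chain ::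
  "'v measure \<Rightarrow> (real \<Rightarrow> 'v \<Rightarrow> 'n) \<Rightarrow> 'n::finite \<Rightarrow> real^'n^'n \<Rightarrow> bool" where
  "markov_chain N K i0 Q \<longleftrightarrow>
     (\<forall>t\<ge>0. K t \<in> N \<rightarrow>\<^sub>M count_space UNIV) \<and>
     (\<forall>\<omega>\<in>space N. cadlag_discrete (\<lambda>t. K t \<omega>)) \<and>
     (AE \<omega> in N. K 0 \<omega> = i0) \<and>
     (\<forall>s\<ge>0. \<forall>t\<ge>0. \<forall>i j. \<forall>A\<in>sets (\<Pi>\<^sub>M u\<in>{0..s}. count_space UNIV).
        measure N {\<omega>\<in>space N. (\<lambda>u\<in>{0..s}. K u \<omega>) \<in> A \<and> K s \<omega> = i \<and> K (s + t) \<omega> = j} =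
        measure N {\<omega>\<in>space N. (\<lambda>u\<in>{0..s}. K u \<omega>) \<in> A \<and> K s \<omega> = i} * matrix_exp (t *\<^sub>R Q) $ i $ j)"

definition ma_characteristics ::
  "real^'n^'n \<Rightarrow> ('n::finite \<Rightarrow> real) \<Rightarrow> ('n \<Rightarrow> real measure) \<Rightarrow> ('n \<Rightarrow> 'n \<Rightarrow> real measure) \<Rightarrow> bool" where
  "ma_characteristics Q d \<nu> G \<longleftrightarrow>
     intensity_matrix Q \<and> (\<forall>i. 0 \<le> d i) \<and> (\<forall>i. levy_measure (\<nu> i)) \<and>
     (\<forall>i j. prob_space (G i j) \<and> sets (G i j) = sets borel \<and> emeasure (G i j) {..<0} = 0) \<and>
     (\<forall>i j. i = j \<or> Q $ i $ j = 0 \<longrightarrow> G i j = return borel 0)"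

text \<open>
  A Markov additive subordinator is glued together from a chain \<open>K\<close>, Levy subordinators \<open>Y m i\<close>
  (the copy of \<open>H\<^sup>+\<^sup>,\<^sup>(\<^sup>i\<^sup>)\<close> used between the \<open>m\<close>-th and the next jump of \<open>K\<close> if \<open>K\<close> is in \<open>i\<close> there), and
  variables \<open>U m i j\<close> (the copy of \<open>\<Delta>\<^sup>+\<^sub>i\<^sub>,\<^sub>j\<close> used at the end of that interval if \<open>K\<close> then jumps from
  \<open>i\<close> to \<open>j\<close>). \<open>jump_time\<close> is only meaningful up to the number of jumps of \<open>K\<close>, and only
  used there.
\<close>

definition jump_set :: "(real \<Rightarrow> 'v \<Rightarrow> 'n) \<Rightarrow> 'v \<Rightarrow> real set" where
  "jump_set K \<omega> = {s. 0 < s \<and> \<not> (\<forall>\<^sub>F u in at_left s. K u \<omega> = K s \<omega>)}"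

primrec jump_time :: "(real \<Rightarrow> 'v \<Rightarrow> 'n) \<Rightarrow> 'v \<Rightarrow> nat \<Rightarrow> real" where
  "jump_time K \<omega> 0 = 0"
| "jump_time K \<omega> (Suc m) = Inf (jump_set K \<omega> \<inter> {jump_time K \<omega> m<..})"

definition jump_count :: "(real \<Rightarrow> 'v \<Rightarrow> 'n) \<Rightarrow> real \<Rightarrow> 'v \<Rightarrow> nat" where
  "jump_count K t \<omega> = card (jump_set K \<omega> \<inter> {..t})"

primrec value_at_jump ::
  "(real \<Rightarrow> 'v \<Rightarrow> 'n) \<Rightarrow> (nat \<Rightarrow> 'n \<Rightarrow> real \<Rightarrow> 'v \<Rightarrow> real) \<Rightarrow> (nat \<Rightarrow> 'n \<Rightarrow> 'n \<Rightarrow> 'v \<Rightarrow> real) \<Rightarrow>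
   'v \<Rightarrow> nat \<Rightarrow> real" where
  "value_at_jump K Y U \<omega> 0 = 0"
| "value_at_jump K Y U \<omega> (Suc m) =
     (let r = jump_time K \<omega> m; s = jump_time K \<omega> (Suc m) in
        value_at_jump K Y U \<omega> m + Y m (K r \<omega>) (s - r) \<omega> + U m (K r \<omega>) (K s \<omega>) \<omega>)"

definition ma_path ::
  "(real \<Rightarrow> 'v \<Rightarrow> 'n) \<Rightarrow> (nat \<Rightarrow> 'n \<Rightarrow> real \<Rightarrow> 'v \<Rightarrow> real) \<Rightarrow> (nat \<Rightarrow> 'n \<Rightarrow> 'n \<Rightarrow> 'v \<Rightarrow> real) \<Rightarrow>
   real \<Rightarrow> 'v \<Rightarrow> real \<times> 'n" where
  "ma_path K Y U t \<omega> =
     (let m = jump_count K t \<omega>; r = jump_time K \<omega> m in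
        (value_at_jump K Y U \<omega> m + Y m (K r \<omega>) (t - r) \<omega>, K t \<omega>))"

datatype 'n ingredient = Chain | Levy nat 'n | Jump nat 'n 'n

primrec ingredient_events ::
  "'v measure \<Rightarrow> (real \<Rightarrow> 'v \<Rightarrow> 'n) \<Rightarrow> (nat \<Rightarrow> 'n \<Rightarrow> real \<Rightarrow> 'v \<Rightarrow> real) \<Rightarrow>
   (nat \<Rightarrow> 'n \<Rightarrow> 'n \<Rightarrow> 'v \<Rightarrow> real) \<Rightarrow> 'n ingredient \<Rightarrow> 'v set set" where
  "ingredient_events N K Y U Chain =
     sets (vimage_algebra (space N) (\<lambda>\<omega>. \<lambda>t\<in>{0..}. K t \<omega>) (\<Pi>\<^sub>M t\<in>{0..}. count_space UNIV))"
| "ingredient_events N K Y U (Levy m i) =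
     sets (vimage_algebra (space N) (\<lambda>\<omega>. \<lambda>t\<in>{0..}. Y m i t \<omega>) (\<Pi>\<^sub>M t\<in>{0..}. borel))"
| "ingredient_events N K Y U (Jump m i j) = sets (vimage_algebra (space N) (U m i j) borel)"

definition ma_ingredients ::
  "'v measure \<Rightarrow> 'n::finite \<Rightarrow> real^'n^'n \<Rightarrow> ('n \<Rightarrow> real) \<Rightarrow> ('n \<Rightarrow> real measure) \<Rightarrow>
   ('n \<Rightarrow> 'n \<Rightarrow> real measure) \<Rightarrow> (real \<Rightarrow> 'v \<Rightarrow> 'n) \<Rightarrow> (nat \<Rightarrow> 'n \<Rightarrow> real \<Rightarrow> 'v \<Rightarrow> real) \<Rightarrow>
   (nat \<Rightarrow> 'n \<Rightarrow> 'n \<Rightarrow> 'v \<Rightarrow> real) \<Rightarrow> bool" where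
  "ma_ingredients N i0 Q d \<nu> G K Y U \<longleftrightarrow>
     prob_space N \<and> markov_chain N K i0 Q \<and>
     (\<forall>m i. levy_subordinator N (Y m i) (d i) (\<nu> i)) \<and>
     (\<forall>m i j. U m i j \<in> borel_measurable N \<and> distr N borel (U m i j) = G i j) \<and>
     prob_space.indep_sets N (ingredient_events N K Y U) UNIV"

definition matrix_exponent ::
  "real^'n^'n \<Rightarrow> ('n::finite \<Rightarrow> real) \<Rightarrow> ('n \<Rightarrow> real measure) \<Rightarrow> ('n \<Rightarrow> 'n \<Rightarrow> real measure) \<Rightarrow>
   real \<Rightarrow> real^'n^'n" where
  "matrix_exponent Q d \<nu> G \<theta> =
     (\<chi> i j. (if i = j then laplace_exponent (d i) (\<nu> i) \<theta> else 0)
             - Q $ i $ j * (\<integral>y. exp (- \<theta> * y) \<partial>G i j))"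

definition psi ::
  "real^'n^'n \<Rightarrow> ('n::finite \<Rightarrow> real) \<Rightarrow> ('n \<Rightarrow> real measure) \<Rightarrow> ('n \<Rightarrow> 'n \<Rightarrow> real measure) \<Rightarrow>
   (real \<times> 'n \<Rightarrow> real) \<Rightarrow> real \<Rightarrow> real^'n" where
  "psi Q d \<nu> G f l =
     (\<chi> i. d i * f (0, i) + (\<integral>x. Q_op l f (x, i) \<partial>\<nu> i)
           + (\<Sum>j\<in>UNIV - {i}. Q $ i $ j * (\<integral>y. Q_op l f (y, j) \<partial>G i j)))"

definition nn_psi ::
  "real^'n^'n \<Rightarrow> ('n::finite \<Rightarrow> real) \<Rightarrow> ('n \<Rightarrow> real measure) \<Rightarrow> ('n \<Rightarrow> 'n \<Rightarrow> real measure) \<Rightarrow>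
   (real \<times> 'n \<Rightarrow> real) \<Rightarrow> real \<Rightarrow> 'n \<Rightarrow> ennreal" where
  "nn_psi Q d \<nu> G f l i =
     ennreal (d i * f (0, i)) + (\<integral>\<^sup>+x. nn_Q_op l f (x, i) \<partial>\<nu> i)
     + (\<Sum>j\<in>UNIV - {i}. ennreal (Q $ i $ j) * (\<integral>\<^sup>+y. nn_Q_op l f (y, j) \<partial>G i j))"

end

theory Submission
  imports Defs
begin

text \<open>
  By time \<open>s\<close> of its own clock the ladder process \<open>(H, K)\<close> has seen exactly the records of \<open>\<xi>\<close>, so the
  position of \<open>\<xi>\<close> at its first passage above a level \<open>t\<close> is the position of \<open>H\<close> at its first passage
  above \<open>t\<close>. The resolvent of the overshoot process is therefore a functional of \<open>H\<close> alone, and it is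
  computed here for exponential functions and then extended by uniqueness of Laplace transforms.

  \<^emph>\<open>Exponential functions, start at the origin.\<close> Fix \<open>\<epsilon> = 2\<^sup>-\<^sup>p\<close> and look at \<open>(H, K)\<close> only at the times
  \<open>m \<epsilon>\<close>. A level \<open>t\<close> between \<open>H (m \<epsilon>)\<close> and \<open>H ((m + 1) \<epsilon>)\<close> has skeleton overshoot \<open>H ((m + 1) \<epsilon>) - t\<close>,
  and integrating \<open>exp (- l t) exp (- \<theta> (H ((m + 1) \<epsilon>) - t))\<close> over these levels produces
  \<open>exp (- l H (m \<epsilon>))\<close> times a difference quotient of exponentials of the increment. With the matrix \<open>B(\<theta>)\<close>
  of Laplace transforms of \<open>(H \<epsilon>, K \<epsilon>)\<close>, the sum over \<open>m\<close> has expectation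
  \<open>(\<Sum>m. B(l)\<^sup>m (B(\<theta>) - B(l))) / (l - \<theta>)\<close>, which solves a renewal equation. Since
  \<open>(1 - B(\<theta>)) / \<epsilon>\<close> tends to the matrix exponent \<open>\<Phi>(\<theta>)\<close> (\<open>laplace_matrix_generator\<close>) and the skeleton
  overshoots tend to the overshoots (\<open>skeleton_brackets_passage\<close>), the vector \<open>u\<close> of resolvents satisfies
  \<open>\<Phi>(l) u = (\<Phi>(l) - \<Phi>(\<theta>)) / (l - \<theta>)\<close> column by column (\<open>potential_equation\<close>). The right hand side is \<open>\<psi>\<close>
  of the exponential function (\<open>jump_functional_exp_test\<close>).

  \<^emph>\<open>Why skeleton overshoots converge.\<close> The total local time must increase strictly right after every
  first passage time; otherwise the ladder process could skip the passage. At a first passage time the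
  reflected process is at zero, so the regeneration property of the local time applies and gives the
  strict increase for fixed levels, hence for all rational ones, and then for all levels by
  right-continuity (\<open>total_local_time_increases_at_passage\<close>).

  \<^emph>\<open>Invertibility.\<close> \<open>\<Phi>(l)\<close> has nonpositive off-diagonal entries and nonnegative row sums, and
  irreducibility of the chain carries over to it. If all row sums vanished, \<open>H\<close> would have the law of
  a process that never moves and the overshoot resolvent would be zero, whereas it maps \<open>1\<close> to \<open>1 / l\<close>.
  So some row sum is positive and \<open>\<Phi>(l)\<close> is an invertible M-matrix with nonnegative inverse.

  \<^emph>\<open>Other starting points.\<close> Spatial homogeneity identifies the law of the overshoot above \<open>t\<close> from \<open>x\<close>
  with that above \<open>t - x\<close> from the origin (\<open>overshoot_shift\<close>); the levels below \<open>x\<close> are overshot at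
  once and give the term \<open>Q f\<close>.

  \<^emph>\<open>Other functions.\<close> Both sides of the identity are integrals of \<open>f\<close> with respect to measures on the
  right half line, and the left one is finite. They agree on \<open>exp (- 2 l k y)\<close>, \<open>k = 0, 1, \<dots>\<close>, in each
  state, hence for all nonnegative \<open>f\<close> (\<open>overshoot_resolvent_identity\<close>), and for bounded \<open>f\<close> by adding a
  constant.
\<close>

section \<open>Matrix powers and M-matrices\<close>

definition mat_pow :: "real^'n^'n \<Rightarrow> nat \<Rightarrow> real^'n^'n" where
  "mat_pow A k = ((\<lambda>B. A ** B) ^^ k) (mat 1)"

lemma mat_pow_0 [simp]: "mat_pow A 0 = mat 1"
  and mat_pow_Suc: "mat_pow A (Suc k) = A ** mat_pow A k"
  by (simp_all add: mat_pow_def)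

lemma mat_pow_add: "mat_pow A (m + k) = mat_pow A m ** mat_pow A k"
  by (induction m) (simp_all add: mat_pow_Suc matrix_mul_assoc)

lemma mat_pow_1 [simp]: "mat_pow A (Suc 0) = A"
  by (simp add: mat_pow_Suc)

lemma mat_pow_Suc2: "mat_pow A (Suc k) = mat_pow A k ** A"
  using mat_pow_add[of A k 1] by simp

lemma mat_pow_mult: "mat_pow A (m * k) = mat_pow (mat_pow A k) m"
  by (induction m) (simp_all add: mat_pow_Suc mat_pow_add)

text \<open>The sum norm is submultiplicative and bounds every entry.\<close>

definition entry_norm :: "real^'n^'n \<Rightarrow> real" where
  "entry_norm A = (\<Sum>i\<in>UNIV. \<Sum>j\<in>UNIV. \<bar>A $ i $ j\<bar>)"

lemma entry_norm_nonneg [simp]: "0 \<le> entry_norm A"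
  by (simp add: entry_norm_def sum_nonneg)

lemma entry_le_entry_norm: "\<bar>A $ i $ j\<bar> \<le> entry_norm A"
proof -
  have "\<bar>A $ i $ j\<bar> \<le> (\<Sum>j\<in>UNIV. \<bar>A $ i $ j\<bar>)"
    by (rule member_le_sum) auto
  also have "\<dots> \<le> entry_norm A"
    unfolding entry_norm_def by (rule member_le_sum) (auto intro: sum_nonneg)
  finally show ?thesis .
qed

lemma entry_norm_add: "entry_norm (A + B) \<le> entry_norm A + entry_norm B"
  unfolding entry_norm_def sum.distrib[symmetric]
  by (intro sum_mono) (simp add: abs_triangle_ineq)

lemma entry_norm_scaleR: "entry_norm (c *\<^sub>R A) = \<bar>c\<bar> * entry_norm A"
  unfolding entry_norm_def by (simp add: abs_mult sum_distrib_left)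

lemma entry_norm_mult: "entry_norm (A ** B) \<le> entry_norm A * entry_norm B"
proof -
  have "entry_norm (A ** B) \<le> (\<Sum>i\<in>UNIV. \<Sum>j\<in>UNIV. \<Sum>k\<in>UNIV. \<bar>A $ i $ k\<bar> * \<bar>B $ k $ j\<bar>)"
    unfolding entry_norm_def matrix_matrix_mult_def
    by (intro sum_mono) (auto intro!: order_trans[OF sum_abs] simp: abs_mult)
  also have "\<dots> = (\<Sum>i\<in>UNIV. \<Sum>k\<in>UNIV. \<bar>A $ i $ k\<bar> * (\<Sum>j\<in>UNIV. \<bar>B $ k $ j\<bar>))"
  proof (rule sum.cong[OF refl])
    show "(\<Sum>j\<in>UNIV. \<Sum>k\<in>UNIV. \<bar>A $ i $ k\<bar> * \<bar>B $ k $ j\<bar>) =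
        (\<Sum>k\<in>UNIV. \<bar>A $ i $ k\<bar> * (\<Sum>j\<in>UNIV. \<bar>B $ k $ j\<bar>))" for i
      by (subst sum.swap) (simp add: sum_distrib_left)
  qed
  also have "\<dots> \<le> (\<Sum>i\<in>UNIV. \<Sum>k\<in>UNIV. \<bar>A $ i $ k\<bar> * entry_norm B)"
    unfolding entry_norm_def
    by (intro sum_mono mult_left_mono member_le_sum[where f="\<lambda>k. \<Sum>j\<in>UNIV. \<bar>B $ k $ j\<bar>"])
       (auto intro: sum_nonneg)
  also have "\<dots> = entry_norm A * entry_norm B"
    by (simp add: entry_norm_def[of A] sum_distrib_right)
  finally show ?thesis .
qed

lemma matrix_add_rdistrib: "(A + B) ** C = A ** C + B ** (C :: real^'n^'n)"
  by (simp add: vec_eq_iff matrix_matrix_mult_def sum.distrib algebra_simps)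

lemma matrix_mult_scaleR: "A ** (c *\<^sub>R B) = c *\<^sub>R (A ** (B :: real^'n^'n))"
  by (simp add: vec_eq_iff matrix_matrix_mult_def sum_distrib_left algebra_simps)

text \<open>
  The bound depends on \<open>k\<close> and \<open>E\<close> only through \<open>k\<close> times the norm of \<open>E\<close>, so it survives the limit in which
  \<open>k\<close> tends to infinity and \<open>k *\<^sub>R E\<close> converges.
\<close>

lemma mat_pow_linear_remainder:
  fixes E :: "real^'n^'n"
  shows "entry_norm (mat_pow (mat 1 + E) k - mat 1 - real k *\<^sub>R E)
      \<le> (real k * entry_norm E)\<^sup>2 * exp (real k * entry_norm E)"
proof -
  define e where "e = entry_norm E"
  have e: "0 \<le> e" by (simp add: e_def)
  define R where "R k = mat_pow (mat 1 + E) k - mat 1 - real k *\<^sub>R E" for k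
  have R: "entry_norm (R k) \<le> (real k)\<^sup>2 * e\<^sup>2 * (1 + e) ^ k" for k
  proof (induction k)
    case 0
    show ?case by (simp add: R_def entry_norm_def)
  next
    case (Suc k)
    have P: "mat_pow (mat 1 + E) k = mat 1 + real k *\<^sub>R E + R k" by (simp add: R_def)
    have "mat_pow (mat 1 + E) (Suc k) = mat_pow (mat 1 + E) k + E ** mat_pow (mat 1 + E) k"
      by (simp add: mat_pow_Suc matrix_add_rdistrib)
    also have "E ** mat_pow (mat 1 + E) k = E + real k *\<^sub>R (E ** E) + E ** R k"
      by (subst P) (simp add: matrix_add_ldistrib matrix_mult_scaleR)
    finally have "mat_pow (mat 1 + E) (Suc k)
        = mat 1 + real k *\<^sub>R E + R k + (E + real k *\<^sub>R (E ** E) + E ** R k)"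
      by (simp only: P)
    then have 1: "R (Suc k) = R k + (E ** R k + real k *\<^sub>R (E ** E))"
      by (subst R_def) (simp add: scaleR_left_distrib)
    have "entry_norm (R (Suc k)) \<le> entry_norm (R k) + (e * entry_norm (R k) + real k * e\<^sup>2)"
    proof -
      have "entry_norm (R (Suc k)) \<le> entry_norm (R k) + (entry_norm (E ** R k) + entry_norm (real k *\<^sub>R (E ** E)))"
        unfolding 1 using entry_norm_add[of "R k" "E ** R k + real k *\<^sub>R (E ** E)"]
          entry_norm_add[of "E ** R k" "real k *\<^sub>R (E ** E)"] by linarith
      moreover have "entry_norm (E ** R k) \<le> e * entry_norm (R k)"
        unfolding e_def by (rule entry_norm_mult)
      moreover have "entry_norm (real k *\<^sub>R (E ** E)) \<le> real k * e\<^sup>2"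
        unfolding entry_norm_scaleR e_def power2_eq_square
        by (auto intro!: mult_left_mono entry_norm_mult)
      ultimately show ?thesis by linarith
    qed
    also have "\<dots> = entry_norm (R k) * (1 + e) + real k * e\<^sup>2 * 1"
      by (simp add: algebra_simps)
    also have "\<dots> \<le> (real k)\<^sup>2 * e\<^sup>2 * (1 + e) ^ k * (1 + e) + real k * e\<^sup>2 * (1 + e) ^ Suc k"
      using e by (intro add_mono mult_right_mono mult_left_mono Suc one_le_power) auto
    also have "\<dots> = ((real k)\<^sup>2 + real k) * e\<^sup>2 * (1 + e) ^ Suc k"
      by (simp add: algebra_simps)
    also have "\<dots> \<le> (real (Suc k))\<^sup>2 * e\<^sup>2 * (1 + e) ^ Suc k"
      using e by (intro mult_right_mono) (auto simp: power2_eq_square algebra_simps)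
    finally show ?case .
  qed
  have "(1 + e) ^ k \<le> exp e ^ k"
    using e exp_ge_add_one_self[of e] by (intro power_mono) auto
  also have "\<dots> = exp (real k * e)" by (simp add: exp_of_nat_mult)
  finally have "(real k)\<^sup>2 * e\<^sup>2 * (1 + e) ^ k \<le> (real k)\<^sup>2 * e\<^sup>2 * exp (real k * e)"
    by (intro mult_left_mono) auto
  then show ?thesis
    using R[of k] by (simp add: R_def e_def power_mult_distrib)
qed

lemma entry_norm_mat_pow: "entry_norm (mat_pow A (Suc k)) \<le> entry_norm A ^ Suc k"
proof (induction k)
  case (Suc k)
  have "entry_norm (mat_pow A (Suc (Suc k))) \<le> entry_norm A * entry_norm (mat_pow A (Suc k))"
    by (subst mat_pow_Suc) (rule entry_norm_mult)
  also have "\<dots> \<le> entry_norm A * entry_norm A ^ Suc k"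
    by (intro mult_left_mono Suc) auto
  finally show ?case by simp
qed simp

lemma mat_pow_scaleR: "mat_pow (h *\<^sub>R A) k = h ^ k *\<^sub>R mat_pow A k"
  by (induction k) (simp_all add: mat_pow_Suc vec_eq_iff matrix_matrix_mult_def sum_distrib_left mult_ac)


lemma matrix_exp_entry_sums:
  fixes A :: "real^'n^'n"
  shows "(\<lambda>k. (1 / fact k) * mat_pow A k $ i $ j) sums (matrix_exp A $ i $ j)"
proof -
  have summ: "summable (\<lambda>k. (1 / fact k) * mat_pow A k $ i $ j)" for i j
  proof (subst summable_Suc_iff[symmetric], rule summable_comparison_test')
    show "summable (\<lambda>k. entry_norm A ^ Suc k /\<^sub>R fact (Suc k))"
      by (subst summable_Suc_iff) (rule summable_exp_generic)
    show "norm ((1 / fact (Suc k)) * mat_pow A (Suc k) $ i $ j) \<le> entry_norm A ^ Suc k /\<^sub>R fact (Suc k)" for k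
      using order_trans[OF entry_le_entry_norm entry_norm_mat_pow, of A k i j]
      by (simp add: abs_mult divide_inverse mult_ac mult_right_mono)
  qed
  define S where "S = (\<chi> i j. \<Sum>k. (1 / fact k) * mat_pow A k $ i $ j)"
  have "(\<lambda>k. (1 / fact k) *\<^sub>R mat_pow A k) sums S"
    unfolding sums_def
    using summ by (intro vec_tendstoI) (auto simp: S_def sums_def[symmetric] summable_sums)
  then have "matrix_exp A = S"
    by (simp add: matrix_exp_def mat_pow_def[symmetric] sums_iff)
  then show ?thesis
    using summ by (simp add: S_def summable_sums)
qed

text \<open>Termwise differentiation at zero of the power series in \<open>h\<close> of each entry.\<close>

lemma matrix_exp_entry_derivative:
  fixes A :: "real^'n^'n"
  shows "((\<lambda>h. matrix_exp (h *\<^sub>R A) $ i $ j) has_real_derivative A $ i $ j) (at 0)"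
proof -
  define c where "c k = (1 / fact k) * mat_pow A k $ i $ j" for k
  have s: "(\<lambda>k. c k * h ^ k) sums (matrix_exp (h *\<^sub>R A) $ i $ j)" for h
    using matrix_exp_entry_sums[of "h *\<^sub>R A" i j] by (simp add: c_def mat_pow_scaleR mult_ac)
  have "((\<lambda>h. \<Sum>k. c k * h ^ k) has_field_derivative (\<Sum>k. diffs c k * 0 ^ k)) (at 0)"
    by (rule termdiffs_strong_converges_everywhere) (use s in \<open>simp add: sums_iff\<close>)
  moreover have "(\<Sum>k. diffs c k * 0 ^ k) = A $ i $ j"
    using powser_zero[of "diffs c"] by (simp add: diffs_def c_def)
  ultimately show ?thesis
    using s by (simp add: sums_iff)
qed

text \<open>
  If the minimum of \<open>y\<close> were negative, then \<open>(A y) i \<ge> 0\<close> at a minimising \<open>i\<close> would force a zero row sum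
  there and the same minimal value at every \<open>j\<close> with \<open>A i j < 0\<close>. By irreducibility the minimum would be
  attained everywhere, also in the row with positive sum.
\<close>

lemma irreducible_minimum_principle:
  fixes A :: "real^'n^'n"
  assumes offdiag: "\<And>i j. i \<noteq> j \<Longrightarrow> A $ i $ j \<le> 0"
    and rowsum: "\<And>i. 0 \<le> (\<Sum>j\<in>UNIV. A $ i $ j)"
    and strict: "0 < (\<Sum>j\<in>UNIV. A $ i0 $ j)"
    and irred: "\<And>i j. (i, j) \<in> {(k, l). k \<noteq> l \<and> A $ k $ l < 0}\<^sup>*"
    and nonneg: "\<And>i. 0 \<le> (A *v y) $ i"
  shows "0 \<le> y $ k"
proof (rule ccontr)
  assume "\<not> 0 \<le> y $ k"
  define m where "m = Min (range (\<lambda>i. y $ i))"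
  have m_le: "m \<le> y $ i" for i by (simp add: m_def)
  have m: "m < 0" using m_le[of k] \<open>\<not> 0 \<le> y $ k\<close> by simp
  have "m \<in> range (\<lambda>i. y $ i)" unfolding m_def by (intro Min_in) auto
  then obtain i1 where i1: "y $ i1 = m" by auto
  have step: "(\<Sum>j\<in>UNIV. A $ i $ j) = 0 \<and> (\<forall>j. i \<noteq> j \<and> A $ i $ j < 0 \<longrightarrow> y $ j = m)" if i: "y $ i = m" for i
  proof -
    have eq: "(A *v y) $ i = m * (\<Sum>j\<in>UNIV. A $ i $ j) + (\<Sum>j\<in>UNIV. A $ i $ j * (y $ j - m))"
      by (simp add: matrix_vector_mult_def sum_distrib_left algebra_simps flip: sum.distrib)
    have t: "A $ i $ j * (y $ j - m) \<le> 0" for j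
      using offdiag[of i j] m_le[of j] i by (cases "i = j") (auto intro: mult_nonpos_nonneg)
    then have le: "(\<Sum>j\<in>UNIV. A $ i $ j * (y $ j - m)) \<le> 0" by (intro sum_nonpos) auto
    have le': "m * (\<Sum>j\<in>UNIV. A $ i $ j) \<le> 0" using m rowsum[of i] by (intro mult_nonpos_nonneg) auto
    have z: "m * (\<Sum>j\<in>UNIV. A $ i $ j) = 0" "(\<Sum>j\<in>UNIV. - (A $ i $ j * (y $ j - m))) = 0"
      using eq le le' nonneg[of i] by (linarith, simp add: sum_negf)
    have "- (A $ i $ j * (y $ j - m)) = 0" for j
      using z(2) t sum_nonneg_eq_0_iff[of UNIV "\<lambda>j. - (A $ i $ j * (y $ j - m))"] by simp
    then have "A $ i $ j * (y $ j - m) = 0" for j by (simp only: neg_equal_0_iff_equal)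
    then have "A $ i $ j = 0 \<or> y $ j = m" for j by auto
    with z(1) m show ?thesis by (metis less_irrefl mult_eq_0_iff)
  qed
  have "y $ j = m" if "(i1, j) \<in> {(k, l). k \<noteq> l \<and> A $ k $ l < 0}\<^sup>*" for j
    using that by induction (use i1 step in auto)
  with irred step[of i0] strict show False by auto
qed

lemma matrix_matrix_inv:
  fixes A :: "real^'n^'n"
  assumes "invertible A"
  shows "A ** matrix_inv A = mat 1" "matrix_inv A ** A = mat 1"
  using someI_ex[OF assms[unfolded invertible_def]] by (auto simp: matrix_inv_def)

text \<open>
  The minimum principle for \<open>y\<close> and \<open>- y\<close> gives a trivial kernel; applied to the columns of the
  inverse it gives nonnegative entries.
\<close>

lemma irreducible_M_matrix:
  fixes A :: "real^'n^'n"
  assumes offdiag: "\<And>i j. i \<noteq> j \<Longrightarrow> A $ i $ j \<le> 0"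
    and rowsum: "\<And>i. 0 \<le> (\<Sum>j\<in>UNIV. A $ i $ j)"
    and strict: "0 < (\<Sum>j\<in>UNIV. A $ i0 $ j)"
    and irred: "\<And>i j. (i, j) \<in> {(k, l). k \<noteq> l \<and> A $ k $ l < 0}\<^sup>*"
  shows "invertible A" and "0 \<le> matrix_inv A $ i $ j"
proof -
  note pos = irreducible_minimum_principle[OF offdiag rowsum strict irred]
  have "y = 0" if y: "A *v y = 0" for y
  proof -
    have "A *v (- y) = 0" using y by (simp add: matrix_vector_mult_def vec_eq_iff sum_negf)
    then have "0 \<le> y $ k" "0 \<le> (- y) $ k" for k
      using pos[of y k] pos[of "- y" k] y by simp_all
    then show ?thesis by (auto simp: vec_eq_iff intro: antisym)
  qed
  then show inv: "invertible A"
    by (simp add: invertible_left_inverse matrix_left_invertible_ker)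
  have "A *v (matrix_inv A *v axis j 1) = axis j 1"
    using matrix_matrix_inv(1)[OF inv] by (simp add: matrix_vector_mul_assoc)
  then have "0 \<le> (matrix_inv A *v axis j 1) $ i"
    using pos[of "matrix_inv A *v axis j 1" i] by (simp add: axis_def)
  then show "0 \<le> matrix_inv A $ i $ j"
    by (simp add: matrix_vector_mult_basis column_def)
qed

section \<open>Measures determined by their Laplace transforms\<close>

text \<open>
  By the Weierstrass approximation theorem equal moments give equal integrals of continuous functions,
  and indicators of half lines are limits of those.
\<close>

lemma finite_measure_eqI_moments:
  fixes M N :: "real measure"
  assumes M: "finite_measure M" "sets M = sets borel" "AE x in M. x \<in> {0..1}"
    and N: "finite_measure N" "sets N = sets borel" "AE x in N. x \<in> {0..1}"
    and mom: "\<And>k::nat. (\<integral>x. x ^ k \<partial>M) = (\<integral>x. x ^ k \<partial>N)"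
  shows "M = N"
proof -
  note [measurable_cong] = M(2) N(2)
  interpret M: finite_measure M by fact
  interpret N: finite_measure N by fact
  have intM: "integrable M g" if "g \<in> borel_measurable borel" "\<And>x. x \<in> {0..1} \<Longrightarrow> \<bar>g x\<bar> \<le> B" for g :: "real \<Rightarrow> real" and B
    using that M(3) by (intro M.integrable_const_bound[of _ B]) auto
  have intN: "integrable N g" if "g \<in> borel_measurable borel" "\<And>x. x \<in> {0..1} \<Longrightarrow> \<bar>g x\<bar> \<le> B" for g :: "real \<Rightarrow> real" and B
    using that N(3) by (intro N.integrable_const_bound[of _ B]) auto
  have pw: "\<bar>x ^ k\<bar> \<le> 1" if "x \<in> {0..1}" for x :: real and k
    using that by (auto simp: power_le_one)
  have poly: "(\<integral>x. p x \<partial>M) = (\<integral>x. p x \<partial>N)" if p: "real_polynomial_function p" for p :: "real \<Rightarrow> real"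
  proof -
    obtain a n where a: "p = (\<lambda>x. \<Sum>i\<le>n. a i * x ^ i)"
      using p by (auto simp: real_polynomial_function_iff_sum)
    show ?thesis
    proof -
      have iM: "integrable M (\<lambda>x. a k * x ^ k)" and iN: "integrable N (\<lambda>x. a k * x ^ k)" for k
        by (rule integrable_mult_right, rule intM[of _ 1], measurable, erule pw,
            rule integrable_mult_right, rule intN[of _ 1], measurable, erule pw)
      show ?thesis
        unfolding a Bochner_Integration.integral_sum[OF iM] Bochner_Integration.integral_sum[OF iN]
        by (rule sum.cong[OF refl], subst (1 2) integral_mult_right_zero, simp only: mom)
    qed
  qed
  have cont: "(\<integral>x. g x \<partial>M) = (\<integral>x. g x \<partial>N)" if g: "continuous_on UNIV g" for g :: "real \<Rightarrow> real"
  proof (rule ccontr)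
    assume neq: "(\<integral>x. g x \<partial>M) \<noteq> (\<integral>x. g x \<partial>N)"
    define D where "D = \<bar>(\<integral>x. g x \<partial>M) - (\<integral>x. g x \<partial>N)\<bar>"
    define C where "C = measure M (space M) + measure N (space N)"
    have C: "0 \<le> C" by (simp add: C_def)
    have D: "0 < D" using neq by (simp add: D_def)
    define e where "e = D / (2 * (C + 1))"
    have e: "0 < e" using C D by (simp add: e_def)
    obtain p where p: "real_polynomial_function p" "\<And>x. x \<in> {0..1} \<Longrightarrow> \<bar>g x - p x\<bar> < e"
      using Stone_Weierstrass_real_polynomial_function[of "{0..1::real}" g e] g e continuous_on_subset
      by (metis compact_Icc subset_UNIV)
    have gm[measurable]: "g \<in> borel_measurable borel" using g by (rule borel_measurable_continuous_onI)
    have pc: "continuous_on UNIV p"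
      using p(1) continuous_on_polymonial_function by (auto simp: real_polynomial_function_eq)
    then have pm[measurable]: "p \<in> borel_measurable borel" by (rule borel_measurable_continuous_onI)
    have bdd: "\<exists>B. \<forall>x\<in>{0..1}. \<bar>h x\<bar> \<le> B" if h: "continuous_on UNIV h" for h :: "real \<Rightarrow> real"
    proof -
      have "bounded (h ` {0..1})"
        using h by (intro compact_imp_bounded compact_continuous_image) (auto intro: continuous_on_subset)
      then obtain B where "\<forall>y\<in>h ` {0..1}. norm y \<le> B" unfolding bounded_iff by blast
      then show ?thesis by (intro exI[of _ B]) simp
    qed
    obtain B where B: "\<And>x. x \<in> {0..1} \<Longrightarrow> \<bar>g x\<bar> \<le> B" using bdd[OF g] by blast
    obtain B' where B': "\<And>x. x \<in> {0..1} \<Longrightarrow> \<bar>p x\<bar> \<le> B'" using bdd[OF pc] by blast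
    note iM = intM[OF gm B] intM[OF pm B'] and iN = intN[OF gm B] intN[OF pm B']
    have 1: "\<bar>(\<integral>x. g x \<partial>M) - (\<integral>x. p x \<partial>M)\<bar> \<le> e * measure M (space M)"
    proof -
      have "\<bar>\<integral>x. g x - p x \<partial>M\<bar> \<le> (\<integral>x. e \<partial>M)"
        using iM p(2) M(3)
        by (intro order_trans[OF integral_abs_bound] integral_mono_AE) (auto intro: less_imp_le)
      then show ?thesis using iM by (simp add: mult.commute)
    qed
    have 2: "\<bar>(\<integral>x. g x \<partial>N) - (\<integral>x. p x \<partial>N)\<bar> \<le> e * measure N (space N)"
    proof -
      have "\<bar>\<integral>x. g x - p x \<partial>N\<bar> \<le> (\<integral>x. e \<partial>N)"
        using iN p(2) N(3)
        by (intro order_trans[OF integral_abs_bound] integral_mono_AE) (auto intro: less_imp_le)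
      then show ?thesis using iN by (simp add: mult.commute)
    qed
    have "D \<le> e * C"
      using 1 2 poly[OF p(1)] by (simp add: D_def C_def algebra_simps)
    also have "\<dots> \<le> e * (C + 1)" using e by (simp add: algebra_simps)
    also have "\<dots> = D / 2" using C by (simp add: e_def divide_simps)
    finally show False using D by simp
  qed
  show ?thesis
  proof (rule measure_eqI_lessThan)
    fix a :: real
    define g where "g n x = min 1 (max 0 (real n * (x - a)))" for n :: nat and x
    have gc: "continuous_on UNIV (g n)" for n unfolding g_def by (intro continuous_intros)
    have gm[measurable]: "g n \<in> borel_measurable borel" for n using gc by (rule borel_measurable_continuous_onI)
    have lim: "(\<lambda>n. g n x) \<longlonglongrightarrow> indicator {a<..} x" for x
    proof (cases "a < x")
      case True
      have "\<forall>\<^sub>F n in sequentially. 1 / (x - a) \<le> real n" 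
        using eventually_ge_at_top[of "nat \<lceil>1 / (x - a)\<rceil>"] by eventually_elim linarith
      then have "\<forall>\<^sub>F n in sequentially. g n x = 1"
        by eventually_elim (use True in \<open>auto simp: g_def field_simps\<close>)
      then show ?thesis using True by (auto intro: tendsto_eventually)
    next
      case False
      then have "real n * (x - a) \<le> 0" for n by (intro mult_nonneg_nonpos) auto
      then have "g n x = 0" for n by (simp add: g_def max_absorb1)
      with False show ?thesis by simp
    qed
    have "(\<lambda>n. \<integral>x. g n x \<partial>M) \<longlonglongrightarrow> (\<integral>x. indicator {a<..} x \<partial>M)"
      by (rule integral_dominated_convergence[where w="\<lambda>_. 1"]) (use lim in \<open>auto simp: g_def\<close>)
    moreover have "(\<lambda>n. \<integral>x. g n x \<partial>N) \<longlonglongrightarrow> (\<integral>x. indicator {a<..} x \<partial>N)"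
      by (rule integral_dominated_convergence[where w="\<lambda>_. 1"]) (use lim in \<open>auto simp: g_def\<close>)
    ultimately have "(\<integral>x. indicator {a<..} x \<partial>M) = (\<integral>x. indicator {a<..} x \<partial>N :: real)"
      using cont[OF gc] by (simp add: LIMSEQ_unique)
    then show "emeasure M {a<..} = emeasure N {a<..}"
      by (simp add: M.emeasure_eq_measure N.emeasure_eq_measure)
  qed (auto simp: M(2) N(2) top.not_eq_extremum M.emeasure_eq_measure)
qed

text \<open>Reparametrise by \<open>v = exp (- c * y)\<close>, which maps \<open>[0,\<infinity>)\<close> into the unit interval.\<close>

lemma finite_measure_eqI_laplace:
  fixes M N :: "real measure"
  assumes M: "finite_measure M" "sets M = sets borel" "AE x in M. 0 \<le> x"
    and N: "finite_measure N" "sets N = sets borel" "AE x in N. 0 \<le> x"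
    and c: "0 < c"
    and lap: "\<And>k::nat. (\<integral>x. exp (- (c * real k) * x) \<partial>M) = (\<integral>x. exp (- (c * real k) * x) \<partial>N)"
  shows "M = N"
proof -
  note [measurable_cong] = M(2) N(2)
  define h where "h y = exp (- c * y)" for y :: real
  have h[measurable]: "h \<in> borel_measurable borel" unfolding h_def by measurable
  have eq: "distr M borel h = distr N borel h"
  proof (rule finite_measure_eqI_moments)
    show "finite_measure (distr M borel h)" "finite_measure (distr N borel h)"
      using M N by (auto intro!: finite_measure.finite_measure_distr)
    show "AE x in distr M borel h. x \<in> {0..1}" "AE x in distr N borel h. x \<in> {0..1}"
      using M(3) N(3) c by (auto simp: AE_distr_iff h_def)
    show "(\<integral>x. x ^ k \<partial>distr M borel h) = (\<integral>x. x ^ k \<partial>distr N borel h)" for k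
      using lap[of k] by (simp add: integral_distr h_def exp_of_nat_mult[symmetric] mult_ac)
  qed auto
  have inv: "distr (distr K borel h) borel (\<lambda>v. - ln v / c) = K" if [measurable_cong]: "sets K = sets borel" for K
  proof -
    have "distr (distr K borel h) borel (\<lambda>v. - ln v / c) = distr K borel (\<lambda>x. x)"
      using c by (subst distr_distr) (auto simp: h_def o_def)
    also have "\<dots> = K" using that by (intro distr_id2) simp
    finally show ?thesis .
  qed
  show ?thesis using inv[OF M(2)] inv[OF N(2)] eq by simp
qed

definition add_measure :: "'a measure \<Rightarrow> 'a measure \<Rightarrow> 'a measure" where
  "add_measure M N = measure_of (space M) (sets M) (\<lambda>A. emeasure M A + emeasure N A)"

lemma sets_add_measure [simp, measurable_cong]: "sets (add_measure M N) = sets M"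
  and space_add_measure [simp]: "space (add_measure M N) = space M"
  by (simp_all add: add_measure_def)

lemma emeasure_add_measure:
  assumes "sets M = sets N" "A \<in> sets M"
  shows "emeasure (add_measure M N) A = emeasure M A + emeasure N A"
proof (rule emeasure_measure_of[OF add_measure_def])
  show "countably_additive (sets (add_measure M N)) (\<lambda>A. emeasure M A + emeasure N A)"
  proof (rule countably_additiveI)
    fix A :: "nat \<Rightarrow> 'a set"
    assume A: "range A \<subseteq> sets (add_measure M N)" "disjoint_family A"
    then have "(\<Sum>i. emeasure M (A i)) = emeasure M (\<Union>i. A i)" "(\<Sum>i. emeasure N (A i)) = emeasure N (\<Union>i. A i)"
      using assms(1) by (auto intro!: suminf_emeasure)
    then show "(\<Sum>i. emeasure M (A i) + emeasure N (A i)) = emeasure M (\<Union>i. A i) + emeasure N (\<Union>i. A i)"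
      by (simp add: suminf_add[symmetric])
  qed
qed (use assms sets.space_closed[of M] in \<open>auto simp: positive_def\<close>)

lemma nn_integral_add_measure:
  assumes sets: "sets M = sets N" and f: "f \<in> borel_measurable M"
  shows "(\<integral>\<^sup>+x. f x \<partial>add_measure M N) = (\<integral>\<^sup>+x. f x \<partial>M) + (\<integral>\<^sup>+x. f x \<partial>N)"
  using f
proof induction
  case (cong f g)
  then show ?case
    using sets_eq_imp_space_eq[OF sets] by (simp cong: nn_integral_cong_simp)
next
  case (set A)
  then show ?case using sets by (simp add: emeasure_add_measure)
next
  case (mult u c)
  then have "u \<in> borel_measurable N" using sets by (simp cong: measurable_cong_sets)
  with mult show ?case
    by (simp add: nn_integral_cmult distrib_left cong: measurable_cong_sets)
next
  case (add u v)
  then have "u \<in> borel_measurable N" "v \<in> borel_measurable N" using sets by (simp_all cong: measurable_cong_sets)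
  with add show ?case
    by (simp add: nn_integral_add add_ac cong: measurable_cong_sets)
next
  case (seq U)
  then have "U i \<in> borel_measurable N" for i using sets by (simp cong: measurable_cong_sets)
  moreover have "incseq (\<lambda>i. integral\<^sup>N K (U i))" for K
    using seq by (auto simp: incseq_def le_fun_def intro!: nn_integral_mono)
  ultimately show ?case using seq
    by (simp add: SUP_apply[abs_def] nn_integral_monotone_convergence_SUP ennreal_SUP_add cong: measurable_cong_sets)
qed

text \<open>
  Both sides of the identity are iterated integrals of \<open>f\<close>. Recording only that each is the integral
  with respect to some measure makes the class closed under the operations that occur, without ever
  naming the measure.
\<close>

definition is_integral :: "((real \<times> 'n::finite \<Rightarrow> ennreal) \<Rightarrow> ennreal) \<Rightarrow> bool" where
  "is_integral \<Lambda> \<longleftrightarrow> (\<exists>\<mu>. sets \<mu> = sets state_space \<and>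
     (\<forall>g\<in>borel_measurable state_space. \<Lambda> g = (\<integral>\<^sup>+z. g z \<partial>\<mu>)))"

lemma is_integral_add:
  assumes "is_integral \<Lambda>" "is_integral \<Lambda>'"
  shows "is_integral (\<lambda>g. \<Lambda> g + \<Lambda>' g)"
proof -
  obtain \<mu> \<mu>' where "sets \<mu> = sets state_space" "sets \<mu>' = sets state_space"
    "\<forall>g\<in>borel_measurable state_space. \<Lambda> g = (\<integral>\<^sup>+z. g z \<partial>\<mu>)"
    "\<forall>g\<in>borel_measurable state_space. \<Lambda>' g = (\<integral>\<^sup>+z. g z \<partial>\<mu>')"
    using assms by (auto simp: is_integral_def)
  then show ?thesis
    unfolding is_integral_def
    by (intro exI[of _ "add_measure \<mu> \<mu>'"])
       (auto simp: nn_integral_add_measure cong: measurable_cong_sets)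
qed

lemma is_integral_cmult:
  assumes "is_integral \<Lambda>"
  shows "is_integral (\<lambda>g. c * \<Lambda> g)"
proof -
  obtain \<mu> where "sets \<mu> = sets state_space"
    "\<forall>g\<in>borel_measurable state_space. \<Lambda> g = (\<integral>\<^sup>+z. g z \<partial>\<mu>)"
    using assms by (auto simp: is_integral_def)
  then show ?thesis
    unfolding is_integral_def
    by (intro exI[of _ "scale_measure c \<mu>"])
       (auto simp: nn_integral_scale_measure cong: measurable_cong_sets)
qed

lemma is_integral_zero: "is_integral (\<lambda>g. 0)"
  unfolding is_integral_def by (intro exI[of _ "null_measure state_space"]) (auto simp: nn_integral_null_measure)

lemma is_integral_sum:
  "finite I \<Longrightarrow> (\<And>i. i \<in> I \<Longrightarrow> is_integral (\<Lambda> i)) \<Longrightarrow> is_integral (\<lambda>g. \<Sum>i\<in>I. \<Lambda> i g)"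
  by (induction I rule: finite_induct) (auto intro: is_integral_add is_integral_zero)

lemma is_integral_kernel:
  fixes h :: "'a \<times> 'b \<Rightarrow> real \<times> 'n::finite"
  assumes B: "sigma_finite_measure B"
    and w: "w \<in> borel_measurable (A \<Otimes>\<^sub>M B)" and h: "h \<in> A \<Otimes>\<^sub>M B \<rightarrow>\<^sub>M state_space"
  shows "is_integral (\<lambda>g. \<integral>\<^sup>+a. \<integral>\<^sup>+b. w (a, b) * g (h (a, b)) \<partial>B \<partial>A)"
  unfolding is_integral_def
proof (intro exI[of _ "distr (density (A \<Otimes>\<^sub>M B) w) state_space h"] conjI ballI)
  fix g :: "real \<times> 'n \<Rightarrow> ennreal" assume g: "g \<in> borel_measurable state_space"
  have m: "(\<lambda>z. w z * g (h z)) \<in> borel_measurable (A \<Otimes>\<^sub>M B)"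
    using w measurable_compose[OF h g] by (rule borel_measurable_times_ennreal)
  show "(\<integral>\<^sup>+a. \<integral>\<^sup>+b. w (a, b) * g (h (a, b)) \<partial>B \<partial>A) = (\<integral>\<^sup>+z. g z \<partial>distr (density (A \<Otimes>\<^sub>M B) w) state_space h)"
    using sigma_finite_measure.nn_integral_fst[OF B m] g h w measurable_compose[OF h g]
    by (simp add: nn_integral_distr nn_integral_density)
qed simp

text \<open>
  The representing measures live on the half line and have the same finite total mass; restricted to
  each state they have the same Laplace transform along an arithmetic progression, which determines
  them.
\<close>

lemma is_integral_eqI_laplace:
  fixes \<Lambda> \<Lambda>' :: "(real \<times> 'n::finite \<Rightarrow> ennreal) \<Rightarrow> ennreal"
  assumes I: "is_integral \<Lambda>" "is_integral \<Lambda>'" and c: "0 < c"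
    and neg: "\<Lambda> (indicator ({..<0} \<times> UNIV)) = 0" "\<Lambda>' (indicator ({..<0} \<times> UNIV)) = 0"
    and fin: "\<Lambda> (\<lambda>_. 1) < \<infinity>"
    and lap: "\<And>(k::nat) j. \<Lambda> (\<lambda>z. ennreal (exp (- (c * real k) * fst z)) * indicator {j} (snd z)) =
        \<Lambda>' (\<lambda>z. ennreal (exp (- (c * real k) * fst z)) * indicator {j} (snd z))"
    and g: "g \<in> borel_measurable state_space"
  shows "\<Lambda> g = \<Lambda>' g"
proof -
  obtain M N where MN[measurable_cong]: "sets M = sets state_space" "sets N = sets state_space"
    and M: "\<And>g. g \<in> borel_measurable state_space \<Longrightarrow> \<Lambda> g = (\<integral>\<^sup>+z. g z \<partial>M)"
    and N: "\<And>g. g \<in> borel_measurable state_space \<Longrightarrow> \<Lambda>' g = (\<integral>\<^sup>+z. g z \<partial>N)"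
    using I by (auto simp: is_integral_def)
  have sp: "space M = UNIV" "space N = UNIV"
    using sets_eq_imp_space_eq[OF MN(1)] sets_eq_imp_space_eq[OF MN(2)] by (auto simp: space_pair_measure)
  have ex[measurable]: "(\<lambda>z. ennreal (exp (- (c * real k) * fst z)) * indicator {j} (snd z))
      \<in> borel_measurable state_space" for k and j :: 'n
    by measurable
  have "emeasure M UNIV < \<infinity>" using fin M[of "\<lambda>_. 1"] sp by simp
  then have finM: "finite_measure M" using sp by (intro finite_measureI) auto
  have one: "(\<Sum>j\<in>UNIV. indicator {j} (snd z) :: ennreal) = 1" for z :: "real \<times> 'n"
    by (simp add: indicator_def)
  have tot: "(\<Sum>j\<in>UNIV. \<integral>\<^sup>+z. ennreal (exp (- (c * real 0) * fst z)) * indicator {j} (snd z) \<partial>K) = emeasure K UNIV"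
    if [measurable_cong]: "sets K = sets state_space" and "space K = UNIV" for K :: "(real \<times> 'n) measure"
    by (subst nn_integral_sum[symmetric]) (use one that in \<open>simp_all\<close>)
  have "emeasure N UNIV = emeasure M UNIV"
    using tot[OF MN(1) sp(1)] tot[OF MN(2) sp(2)] lap[of 0] M[OF ex[of 0]] N[OF ex[of 0]] by simp
  with \<open>emeasure M UNIV < \<infinity>\<close> have finN: "finite_measure N" using sp by (intro finite_measureI) auto
  define S where "S K j = distr (density K (indicator (UNIV \<times> {j}))) borel fst"
    for K :: "(real \<times> 'n) measure" and j :: 'n
  have S_em: "emeasure (S K j) A = emeasure K (A \<times> {j})"
    if [measurable_cong]: "sets K = sets state_space" and "space K = UNIV" and A[measurable]: "A \<in> sets borel"
    for K :: "(real \<times> 'n) measure" and j :: 'n and A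
  proof -
    have "emeasure (S K j) A = (\<integral>\<^sup>+z. indicator (UNIV \<times> {j}) z * indicator (fst -` A) z \<partial>K)"
      using that(2) measurable_sets[of fst K borel A] unfolding S_def
      by (subst emeasure_distr) (auto simp: emeasure_density space_pair_measure)
    also have "\<dots> = (\<integral>\<^sup>+z. indicator (A \<times> {j}) z \<partial>K)"
      by (intro nn_integral_cong) (auto simp: indicator_def)
    also have "\<dots> = emeasure K (A \<times> {j})"
      by (intro nn_integral_indicator) (simp add: that)
    finally show ?thesis .
  qed
  have S_eq: "S M j = S N j" for j
  proof (rule finite_measure_eqI_laplace[OF _ _ _ _ _ _ c])
    show "finite_measure (S M j)" "finite_measure (S N j)"
      using S_em[OF MN(1) sp(1), of UNIV j] S_em[OF MN(2) sp(2), of UNIV j] finM finN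
      by (auto intro!: finite_measureI simp: S_def finite_measure.emeasure_finite)
    have nn: "AE z in K. 0 \<le> fst z" if [measurable_cong]: "sets K = sets state_space" and "space K = UNIV"
      and "(\<integral>\<^sup>+z. indicator ({..<0} \<times> UNIV) z \<partial>K) = 0" for K :: "(real \<times> 'n) measure"
    proof -
      have "{..<0::real} \<times> (UNIV::'n set) \<in> sets K" by (simp add: that)
      then have "{..<0::real} \<times> (UNIV::'n set) \<in> null_sets K"
        using that(3) by (auto simp: null_sets_def)
      then show ?thesis by (rule AE_I'[rotated 0]) (auto simp: that)
    qed
    have "AE z in M. 0 \<le> fst z" "AE z in N. 0 \<le> fst z"
      using neg M[of "indicator ({..<0} \<times> UNIV)"] N[of "indicator ({..<0} \<times> UNIV)"] by (auto intro!: nn MN sp)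
    then show "AE x in S M j. 0 \<le> x" "AE x in S N j. 0 \<le> x"
      unfolding S_def by (auto simp: AE_distr_iff AE_density elim: AE_mp)
    have e: "(\<integral>x. exp (- (c * real k) * x) \<partial>S K j) =
        enn2real (\<integral>\<^sup>+z. ennreal (exp (- (c * real k) * fst z)) * indicator {j} (snd z) \<partial>K)"
      if [measurable_cong]: "sets K = sets state_space" for K :: "(real \<times> 'n) measure" and k
      unfolding S_def
      by (subst integral_eq_nn_integral)
         (auto simp: nn_integral_distr nn_integral_density indicator_def intro!: arg_cong[where f=enn2real] nn_integral_cong)
    show "(\<integral>x. exp (- (c * real k) * x) \<partial>S M j) = (\<integral>x. exp (- (c * real k) * x) \<partial>S N j)" for k
      unfolding e[OF MN(1)] e[OF MN(2)] using lap[of k j] M[OF ex[of k j]] N[OF ex[of k j]] by simp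
  qed (simp_all add: S_def)
  have "M = N"
  proof (rule measure_eqI)
    fix A assume "A \<in> sets M"
    then have A: "A \<in> sets (borel \<Otimes>\<^sub>M count_space UNIV)" by (simp add: MN)
    have sec: "(\<lambda>x. (x, j)) -` A \<in> sets borel" for j
      using measurable_sets[OF measurable_Pair2'[of j "count_space UNIV" borel] A] by simp
    have dec: "A = (\<Union>j. ((\<lambda>x. (x, j)) -` A) \<times> {j})" by auto
    have em: "emeasure K A = (\<Sum>j\<in>UNIV. emeasure K (((\<lambda>x. (x, j)) -` A) \<times> {j}))"
      if "sets K = sets state_space" for K :: "(real \<times> 'n) measure"
      by (subst dec, rule sum_emeasure[symmetric])
         (use sec in \<open>auto simp: that disjoint_family_on_def\<close>)
    show "emeasure M A = emeasure N A"
      unfolding em[OF MN(1)] em[OF MN(2)]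
      using S_em[OF MN(1) sp(1) sec] S_em[OF MN(2) sp(2) sec] S_eq by simp
  qed (simp add: MN)
  with g M N show ?thesis by simp
qed

section \<open>Paths of a finite-state jump process\<close>

context
  fixes K :: "real \<Rightarrow> 'v \<Rightarrow> 'n" and \<omega> :: 'v
  assumes k: "cadlag_discrete (\<lambda>t. K t \<omega>)"
begin

text \<open>
  Jump times cannot accumulate: left and right limits make the path locally constant on either side of
  every point, and the interval is compact.
\<close>

lemma finite_jump_set:
  shows "finite (jump_set K \<omega> \<inter> {..t})"
proof (rule ccontr)
  let ?J = "jump_set K \<omega> \<inter> {..t}"
  assume inf: "infinite ?J"
  have sub: "?J \<subseteq> {0..t}" by (auto simp: jump_set_def)
  obtain u where u: "u \<in> {0..t}" "u islimpt ?J"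
    using Heine_Borel_imp_Bolzano_Weierstrass[OF compact_Icc inf sub] by blast
  have const_no_jump: "s \<notin> jump_set K \<omega>" if "a < s" "s < b" "\<And>v. a < v \<Longrightarrow> v < b \<Longrightarrow> K v \<omega> = c" for a b s c
  proof -
    have "\<forall>\<^sub>F v in at_left s. K v \<omega> = K s \<omega>"
      using that unfolding eventually_at_left[OF that(1)] by (intro exI[of _ a]) auto
    then show ?thesis by (auto simp: jump_set_def)
  qed
  have right: "\<exists>b>u. \<forall>s. u < s \<and> s < b \<longrightarrow> s \<notin> ?J"
  proof -
    have "\<forall>\<^sub>F s in at_right u. K s \<omega> = K u \<omega>" using k u by (auto simp: cadlag_discrete_def)
    then obtain b where "b > u" "\<And>s. u < s \<Longrightarrow> s < b \<Longrightarrow> K s \<omega> = K u \<omega>"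
      by (auto simp: eventually_at_right_field)
    then show ?thesis using const_no_jump[of u _ b "K u \<omega>"] by blast
  qed
  have left: "\<exists>a<u. \<forall>s. a < s \<and> s < u \<longrightarrow> s \<notin> ?J"
  proof (cases "u = 0")
    case True
    then show ?thesis by (intro exI[of _ "-1"]) (auto simp: jump_set_def)
  next
    case False
    then have "u > 0" using u by auto
    then obtain c where "\<forall>\<^sub>F s in at_left u. K s \<omega> = c" using k by (auto simp: cadlag_discrete_def)
    then obtain a where "a < u" "\<And>s. a < s \<Longrightarrow> s < u \<Longrightarrow> K s \<omega> = c"
      by (auto simp: eventually_at_left_field)
    then show ?thesis using const_no_jump[of a _ u c] by blast
  qed
  obtain a b where "a < u" "u < b" "\<And>s. a < s \<Longrightarrow> s < b \<Longrightarrow> s \<noteq> u \<Longrightarrow> s \<notin> ?J"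
    using left right by (metis linorder_neqE_linordered_idom)
  then show False
    using u(2)[unfolded islimpt_def, rule_format, of "{a<..<b}"] by auto
qed

lemma constant_if_no_jump:
  assumes a: "0 \<le> a" "a \<le> b"
    and nj: "jump_set K \<omega> \<inter> {a<..b} = {}"
  shows "K b \<omega> = K a \<omega>"
proof (rule connected_local_const[of "{a..b}" b a "\<lambda>t. K t \<omega>"])
  show "\<forall>s\<in>{a..b}. \<forall>\<^sub>F u in at s within {a..b}. K s \<omega> = K u \<omega>"
  proof
    fix s assume s: "s \<in> {a..b}"
    have "\<forall>\<^sub>F u in at_right s. K u \<omega> = K s \<omega>" using k s a by (auto simp: cadlag_discrete_def)
    then obtain c where c: "c > s" "\<And>u. s < u \<Longrightarrow> u < c \<Longrightarrow> K u \<omega> = K s \<omega>"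
      by (auto simp: eventually_at_right_field)
    have "\<exists>d<s. \<forall>u\<in>{a..b}. d < u \<and> u < s \<longrightarrow> K u \<omega> = K s \<omega>"
    proof (cases "s = a")
      case True
      then show ?thesis by (intro exI[of _ "a - 1"]) auto
    next
      case False
      then have "s \<notin> jump_set K \<omega>" using nj s by auto
      then have "\<forall>\<^sub>F u in at_left s. K u \<omega> = K s \<omega>" using False s a by (auto simp: jump_set_def)
      then show ?thesis by (auto simp: eventually_at_left_field)
    qed
    then obtain d where d: "d < s" "\<And>u. u \<in> {a..b} \<Longrightarrow> d < u \<Longrightarrow> u < s \<Longrightarrow> K u \<omega> = K s \<omega>" by blast
    show "\<forall>\<^sub>F u in at s within {a..b}. K s \<omega> = K u \<omega>"
      unfolding eventually_at_topological
      by (intro exI[of _ "{d<..<c}"]) (use c d in \<open>auto, metis atLeastAtMost_iff linorder_neqE_linordered_idom\<close>)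
  qed
qed (use a in auto)

lemma jump_changes_value:
  assumes a: "0 \<le> a" "a < s"
    and s: "s \<in> jump_set K \<omega>" and nj: "jump_set K \<omega> \<inter> {a<..<s} = {}"
  shows "K s \<omega> \<noteq> K a \<omega>"
proof
  assume eq: "K s \<omega> = K a \<omega>"
  have "K u \<omega> = K s \<omega>" if "a < u" "u < s" for u
    unfolding eq using that a by (intro constant_if_no_jump) (use nj in auto)
  then have "\<forall>\<^sub>F u in at_left s. K u \<omega> = K s \<omega>"
    unfolding eventually_at_left[OF a(2)] using a by auto
  with s show False by (auto simp: jump_set_def)
qed

text \<open>
  As long as fewer than \<open>jump_count\<close> jumps have occurred the infimum defining the next jump time is a
  minimum of a finite set.
\<close>

lemma jump_time_step:
  assumes r: "card (jump_set K \<omega> \<inter> {..jump_time K \<omega> m}) = m" and m: "m < jump_count K t \<omega>"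
  shows "jump_time K \<omega> (Suc m) \<in> jump_set K \<omega>" "jump_time K \<omega> m < jump_time K \<omega> (Suc m)"
    "jump_time K \<omega> (Suc m) \<le> t" "jump_set K \<omega> \<inter> {jump_time K \<omega> m<..<jump_time K \<omega> (Suc m)} = {}"
    "card (jump_set K \<omega> \<inter> {..jump_time K \<omega> (Suc m)}) = Suc m"
proof -
  let ?r = "jump_time K \<omega> m" and ?J = "jump_set K \<omega>"
  define S where "S = ?J \<inter> {?r<..t}"
  have fin: "finite S" using finite_jump_set[of t] by (rule finite_subset[rotated]) (auto simp: S_def)
  have ne: "S \<noteq> {}"
  proof
    assume "S = {}"
    then have "?J \<inter> {..t} \<subseteq> ?J \<inter> {..?r}" by (auto simp: S_def)
    then have "card (?J \<inter> {..t}) \<le> card (?J \<inter> {..?r})" by (intro card_mono finite_jump_set)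
    with r m show False by (simp add: jump_count_def)
  qed
  have "jump_time K \<omega> (Suc m) = Inf (?J \<inter> {?r<..})" by simp
  also have "\<dots> = Min S"
  proof (rule cInf_eq_minimum)
    show "Min S \<in> ?J \<inter> {?r<..}" using Min_in[OF fin ne] by (auto simp: S_def)
    show "Min S \<le> x" if "x \<in> ?J \<inter> {?r<..}" for x
      using that Min_le[OF fin, of x] Min_in[OF fin ne] by (cases "x \<le> t") (auto simp: S_def)
  qed
  finally have eq: "jump_time K \<omega> (Suc m) = Min S" .
  have in_S: "Min S \<in> S" by (rule Min_in[OF fin ne])
  then show "jump_time K \<omega> (Suc m) \<in> ?J" "?r < jump_time K \<omega> (Suc m)" "jump_time K \<omega> (Suc m) \<le> t"
    unfolding eq by (auto simp: S_def)
  show nj: "?J \<inter> {?r<..<jump_time K \<omega> (Suc m)} = {}"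
    unfolding eq using Min_le[OF fin] in_S by (fastforce simp: S_def)
  have "?J \<inter> {..Min S} = insert (Min S) (?J \<inter> {..?r})"
    using nj in_S unfolding eq by (auto simp: S_def intro: le_less_trans)
  then show "card (?J \<inter> {..jump_time K \<omega> (Suc m)}) = Suc m"
    unfolding eq using in_S r finite_jump_set[of ?r] by (simp add: S_def)
qed

lemma card_jumps_up_to_jump_time:
  shows "m \<le> jump_count K t \<omega> \<Longrightarrow> card (jump_set K \<omega> \<inter> {..jump_time K \<omega> m}) = m"
proof (induction m)
  case 0
  have "jump_set K \<omega> \<inter> {..0} = {}" by (auto simp: jump_set_def)
  then show ?case by simp
next
  case (Suc m)
  then show ?case using jump_time_step(5)[of m t] by simp
qed

lemma jump_time_bounds:
  assumes t: "0 \<le> t"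
  shows "m \<le> jump_count K t \<omega> \<Longrightarrow> 0 \<le> jump_time K \<omega> m \<and> jump_time K \<omega> m \<le> t"
proof (induction m)
  case 0
  with t show ?case by simp
next
  case (Suc m)
  then have "m < jump_count K t \<omega>" by simp
  from jump_time_step(2,3)[OF card_jumps_up_to_jump_time[OF less_imp_le[OF this]] this] Suc show ?case
    by (simp del: jump_time.simps)
qed

lemma no_jump_after_last:
  assumes t: "0 \<le> t"
  shows "jump_set K \<omega> \<inter> {jump_time K \<omega> (jump_count K t \<omega>)<..t} = {}"
proof -
  let ?r = "jump_time K \<omega> (jump_count K t \<omega>)" and ?J = "jump_set K \<omega>"
  have "?J \<inter> {..?r} = ?J \<inter> {..t}"
    using jump_time_bounds[OF t order_refl] card_jumps_up_to_jump_time[OF order_refl, of t]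
    by (intro card_subset_eq finite_jump_set) (auto simp: jump_count_def)
  then have "x \<le> ?r" if "x \<in> ?J" "x \<le> t" for x using that by blast
  then show ?thesis by (auto simp: not_le[symmetric])
qed

end

section \<open>Reading the path on a grid\<close>

primrec last_change :: "(nat \<Rightarrow> 'n) \<Rightarrow> nat \<Rightarrow> nat" where
  "last_change \<kappa> 0 = 0"
| "last_change \<kappa> (Suc b) = (if \<kappa> (Suc b) = \<kappa> b then last_change \<kappa> b else Suc b)"

primrec change_count :: "(nat \<Rightarrow> 'n) \<Rightarrow> nat \<Rightarrow> nat" where
  "change_count \<kappa> 0 = 0"
| "change_count \<kappa> (Suc b) = (if \<kappa> (Suc b) = \<kappa> b then change_count \<kappa> b else Suc (change_count \<kappa> b))"

text \<open>
  The analogue for a discrete-time path \<open>\<kappa>\<close> with step \<open>h\<close> of the value of the construction at its last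
  jump. Every holding time is lengthened by one step: the elapsed time on the grid may fall short of
  the true one by less than \<open>h\<close>, and right-continuity of the Levy paths needs approximation from
  above.
\<close>

primrec change_value ::
  "(nat \<Rightarrow> 'n \<Rightarrow> real \<Rightarrow> real) \<Rightarrow> (nat \<Rightarrow> 'n \<Rightarrow> 'n \<Rightarrow> real) \<Rightarrow> real \<Rightarrow> (nat \<Rightarrow> 'n) \<Rightarrow> nat \<Rightarrow> real" where
  "change_value y u h \<kappa> 0 = 0"
| "change_value y u h \<kappa> (Suc b) = (if \<kappa> (Suc b) = \<kappa> b then change_value y u h \<kappa> b
     else change_value y u h \<kappa> b
       + y (change_count \<kappa> b) (\<kappa> b) (real (Suc b - last_change \<kappa> b) * h + h)
       + u (change_count \<kappa> b) (\<kappa> b) (\<kappa> (Suc b)))"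

definition grid_value ::
  "(nat \<Rightarrow> 'n \<Rightarrow> real \<Rightarrow> real) \<Rightarrow> (nat \<Rightarrow> 'n \<Rightarrow> 'n \<Rightarrow> real) \<Rightarrow> real \<Rightarrow> (nat \<Rightarrow> 'n) \<Rightarrow> nat \<Rightarrow> real" where
  "grid_value y u h \<kappa> b = change_value y u h \<kappa> b
     + y (change_count \<kappa> b) (\<kappa> b) (real (b - last_change \<kappa> b) * h + h)"

lemma last_change_le: "last_change \<kappa> b \<le> b"
  by (induction b) auto

lemma grid_constant:
  assumes "\<And>b'. b \<le> b' \<Longrightarrow> b' \<le> b + d \<Longrightarrow> \<kappa> b' = \<kappa> b"
  shows "change_count \<kappa> (b + d) = change_count \<kappa> b" "last_change \<kappa> (b + d) = last_change \<kappa> b"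
    "change_value y u h \<kappa> (b + d) = change_value y u h \<kappa> b"
proof -
  have "change_count \<kappa> (b + d) = change_count \<kappa> b \<and> last_change \<kappa> (b + d) = last_change \<kappa> b
      \<and> change_value y u h \<kappa> (b + d) = change_value y u h \<kappa> b"
    using assms
  proof (induction d)
    case (Suc d)
    have "\<kappa> (b + d) = \<kappa> b" "\<kappa> (Suc (b + d)) = \<kappa> b" by (rule Suc.prems; simp)+
    then have eq: "\<kappa> (Suc (b + d)) = \<kappa> (b + d)" by metis
    have "change_count \<kappa> (b + d) = change_count \<kappa> b \<and> last_change \<kappa> (b + d) = last_change \<kappa> b
      \<and> change_value y u h \<kappa> (b + d) = change_value y u h \<kappa> b"
      by (rule Suc.IH, rule Suc.prems) auto
    with eq show ?case by (simp only: add_Suc_right change_count.simps last_change.simps change_value.simps if_True simp_thms)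
  qed simp
  then show "change_count \<kappa> (b + d) = change_count \<kappa> b" "last_change \<kappa> (b + d) = last_change \<kappa> b"
    "change_value y u h \<kappa> (b + d) = change_value y u h \<kappa> b" by auto
qed

lemma grid_ceiling:
  assumes h: "0 < h" and r: "0 \<le> r"
  shows "r \<le> real (nat \<lceil>r / h\<rceil>) * h" "real (nat \<lceil>r / h\<rceil>) * h < r + h"
proof -
  have nn: "0 \<le> \<lceil>r / h\<rceil>" using h r by (metis ceiling_mono ceiling_zero divide_nonneg_pos)
  then have e: "real (nat \<lceil>r / h\<rceil>) = of_int \<lceil>r / h\<rceil>" by simp
  have "r / h \<le> of_int \<lceil>r / h\<rceil>" "of_int \<lceil>r / h\<rceil> < r / h + 1" by linarith+
  then have "r \<le> of_int \<lceil>r / h\<rceil> * h" "of_int \<lceil>r / h\<rceil> * h < (r / h + 1) * h"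
    using h by (simp_all only: pos_divide_le_eq mult_strict_right_mono)
  then show "r \<le> real (nat \<lceil>r / h\<rceil>) * h" "real (nat \<lceil>r / h\<rceil>) * h < r + h"
    using h unfolding e by (simp_all add: algebra_simps)
qed

lemma grid_ceiling_least:
  assumes h: "0 < h" and r: "0 \<le> r" and b: "r \<le> real b * h"
  shows "nat \<lceil>r / h\<rceil> \<le> b"
proof -
  have "r / h \<le> real b" using h b by (simp add: field_simps)
  then show ?thesis by linarith
qed

lemma tendsto_grid_ceiling:
  assumes h: "\<And>p. 0 < h p" "h \<longlonglongrightarrow> 0" and r: "0 \<le> r"
  shows "(\<lambda>p. real (nat \<lceil>r / h p\<rceil>) * h p) \<longlonglongrightarrow> r"
proof (rule tendsto_sandwich[of "\<lambda>_. r" _ _ "\<lambda>p. r + h p"])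
  show "(\<lambda>p. r + h p) \<longlonglongrightarrow> r" using tendsto_add[OF tendsto_const[of r] h(2)] by simp
qed (use grid_ceiling[OF h(1) r] in \<open>auto intro!: always_eventually less_imp_le\<close>)

lemma tendsto_from_right:
  fixes g :: "real \<Rightarrow> 'a::topological_space"
  assumes g: "(g \<longlongrightarrow> l) (at_right a)" and s: "s \<longlonglongrightarrow> a" "\<And>p. a < s p"
  shows "(\<lambda>p. g (s p)) \<longlonglongrightarrow> l"
  by (rule filterlim_compose[OF g]) (use s in \<open>auto simp: filterlim_at intro!: always_eventually\<close>)

text \<open>
  On a grid finer than all gaps between jumps the discrete path changes exactly once for each jump, at the
  next grid point. The lengthened holding times then decrease to the true ones up to a vanishing error
  from the right.
\<close>

lemma grid_value_tendsto_ma_path: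
  fixes K :: "real \<Rightarrow> 'v \<Rightarrow> 'n"
  assumes k: "cadlag_discrete (\<lambda>t. K t \<omega>)"
    and Y: "\<And>m i a. 0 \<le> a \<Longrightarrow> ((\<lambda>s. Y m i s \<omega>) \<longlongrightarrow> Y m i a \<omega>) (at_right a)"
    and t: "0 \<le> t" and h: "\<And>p. 0 < h p" "h \<longlonglongrightarrow> 0" and b: "\<And>p. real (b p) * h p = t"
  shows "(\<lambda>p. grid_value (\<lambda>m i s. Y m i s \<omega>) (\<lambda>m i j. U m i j \<omega>) (h p) (\<lambda>c. K (real c * h p) \<omega>) (b p))
    \<longlonglongrightarrow> fst (ma_path K Y U t \<omega>)"
proof -
  note jb = jump_time_bounds[where K=K and \<omega>=\<omega>, OF k t]
    and js = jump_time_step[where K=K and \<omega>=\<omega>, OF k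
      card_jumps_up_to_jump_time[where K=K and \<omega>=\<omega>, OF k less_imp_le]]
    and cinj = constant_if_no_jump[where K=K and \<omega>=\<omega>, OF k]
  define M where "M = jump_count K t \<omega>"
  define r where "r m = jump_time K \<omega> m" for m
  define \<kappa> where "\<kappa> p c = K (real c * h p) \<omega>" for p c
  define y where "y m i s = Y m i s \<omega>" for m i s
  define u where "u m i j = U m i j \<omega>" for m i j
  define c where "c p m = nat \<lceil>r m / h p\<rceil>" for p m
  define v where "v m = value_at_jump K Y U \<omega> m" for m
  have r0: "r 0 = 0" by (simp add: r_def)
  have r_bd: "0 \<le> r m" "r m \<le> t" if "m \<le> M" for m using jb[of m] that by (auto simp: r_def M_def)
  have r_step: "r m < r (Suc m)" "r (Suc m) \<le> t" "jump_set K \<omega> \<inter> {r m<..<r (Suc m)} = {}" "r (Suc m) \<in> jump_set K \<omega>"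
    if "m < M" for m
    using js[of m t] that unfolding r_def M_def by blast+
  have last: "jump_set K \<omega> \<inter> {r M<..t} = {}"
    using no_jump_after_last[where K=K and \<omega>=\<omega>, OF k t] by (simp add: r_def M_def)
  have v_Suc: "v (Suc m) = v m + y m (K (r m) \<omega>) (r (Suc m) - r m) + u m (K (r m) \<omega>) (K (r (Suc m)) \<omega>)" for m
    by (simp add: v_def y_def u_def r_def Let_def)
  define rng where "rng m p b \<longleftrightarrow> r m \<le> real b * h p \<and> real b * h p \<le> t \<and> (m < M \<longrightarrow> real b * h p < r (Suc m))"
    for m p b
  have rng_const: "K (real b * h p) \<omega> = K (r m) \<omega>" if "m \<le> M" "rng m p b" for m p b
  proof (rule cinj)
    show "0 \<le> r m" "r m \<le> real b * h p" using r_bd that by (auto simp: rng_def)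
    show "jump_set K \<omega> \<inter> {r m<..real b * h p} = {}"
      using that r_step(3)[of m] last by (cases "m = M") (auto simp: rng_def)
  qed
  have rng_mono: "rng m p b'" if "m \<le> M" "r m \<le> real b' * h p" "b' \<le> b" "rng m p b" for m p b b'
  proof -
    have "real b' * h p \<le> real b * h p" using that(3) h(1)[of p] by (intro mult_right_mono) auto
    with that show ?thesis by (auto simp: rng_def)
  qed
  have claim: "\<exists>w. w \<longlonglongrightarrow> v m \<and> (\<forall>\<^sub>F p in sequentially. \<forall>b. rng m p b \<longrightarrow>
      change_count (\<kappa> p) b = m \<and> last_change (\<kappa> p) b = c p m \<and> change_value y u (h p) (\<kappa> p) b = w p)"
    if "m \<le> M" for m
    using that
  proof (induction m)
    case 0
    have "change_count (\<kappa> p) b = 0 \<and> last_change (\<kappa> p) b = c p 0 \<and> change_value y u (h p) (\<kappa> p) b = 0"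
      if b: "rng 0 p b" for p b
    proof -
      have *: "\<kappa> p b' = \<kappa> p 0" if "b' \<le> 0 + b" for b'
      proof -
        have "rng 0 p b'" by (rule rng_mono[OF _ _ _ b]) (use that r0 h(1)[of p] in auto)
        then have "K (real b' * h p) \<omega> = K (r 0) \<omega>" by (rule rng_const[OF le0])
        then show ?thesis by (simp add: \<kappa>_def r0)
      qed
      have "change_count (\<kappa> p) (0 + b) = change_count (\<kappa> p) 0" by (rule grid_constant(1), rule *)
      moreover have "last_change (\<kappa> p) (0 + b) = last_change (\<kappa> p) 0" by (rule grid_constant(2), rule *)
      moreover have "change_value y u (h p) (\<kappa> p) (0 + b) = change_value y u (h p) (\<kappa> p) 0"
        by (rule grid_constant(3), rule *)
      moreover have "c p 0 = 0" by (simp add: c_def r0)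
      ultimately show ?thesis by (simp only: add_0_left change_count.simps last_change.simps change_value.simps simp_thms)
    qed
    then show ?case by (intro exI[of _ "\<lambda>_. 0"]) (auto simp: v_def)
  next
    case (Suc m)
    then obtain w where w: "w \<longlonglongrightarrow> v m" and ev: "\<forall>\<^sub>F p in sequentially. \<forall>b. rng m p b \<longrightarrow>
      change_count (\<kappa> p) b = m \<and> last_change (\<kappa> p) b = c p m \<and> change_value y u (h p) (\<kappa> p) b = w p"
      by auto
    have mM: "m < M" "m \<le> M" using Suc.prems by auto
    note st = r_step[OF mM(1)]
    define w' where "w' p = w p + y m (K (r m) \<omega>) (real (c p (Suc m) - c p m) * h p + h p)
        + u m (K (r m) \<omega>) (K (r (Suc m)) \<omega>)" for p
    have cm: "c p m \<le> c p (Suc m)" for p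
      unfolding c_def using st(1) h(1)[of p] by (intro nat_mono ceiling_mono divide_right_mono) auto
    have c_bd: "r m' \<le> real (c p m') * h p" "real (c p m') * h p < r m' + h p" if "m' \<le> M" for m' p
      unfolding c_def using grid_ceiling[OF h(1) r_bd(1)[OF that]] by auto
    have arg: "real (c p (Suc m) - c p m) * h p + h p = real (c p (Suc m)) * h p - real (c p m) * h p + h p" for p
      using cm[of p] by (simp add: of_nat_diff algebra_simps)
    have "w' \<longlonglongrightarrow> v (Suc m)"
      unfolding w'_def v_Suc
    proof (intro tendsto_add w tendsto_const,
        rule tendsto_from_right[where g="y m (K (r m) \<omega>)" and a="r (Suc m) - r m"])
      show "(y m (K (r m) \<omega>) \<longlongrightarrow> y m (K (r m) \<omega>) (r (Suc m) - r m)) (at_right (r (Suc m) - r m))"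
        unfolding y_def using st(1) by (intro Y) auto
      have "(\<lambda>p. real (c p (Suc m)) * h p - real (c p m) * h p + h p) \<longlonglongrightarrow> r (Suc m) - r m + 0"
        unfolding c_def using r_bd(1)[of "Suc m"] r_bd(1)[of m] Suc.prems
        by (intro tendsto_add tendsto_diff tendsto_grid_ceiling h) auto
      then show "(\<lambda>p. real (c p (Suc m) - c p m) * h p + h p) \<longlonglongrightarrow> r (Suc m) - r m" by (simp add: arg)
      show "r (Suc m) - r m < real (c p (Suc m) - c p m) * h p + h p" for p
        unfolding arg using c_bd(1)[of "Suc m" p] c_bd(2)[of m p] Suc.prems by linarith
    qed
    moreover
    have "\<forall>\<^sub>F p in sequentially. h p < r (Suc m) - r m"
      using st(1) h(2) by (intro order_tendstoD) auto
    with ev have "\<forall>\<^sub>F p in sequentially. \<forall>b. rng (Suc m) p b \<longrightarrow>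
      change_count (\<kappa> p) b = Suc m \<and> last_change (\<kappa> p) b = c p (Suc m) \<and> change_value y u (h p) (\<kappa> p) b = w' p"
    proof eventually_elim
      case (elim p)
      show ?case
      proof (intro allI impI)
        fix b assume b: "rng (Suc m) p b"
        have pos: "c p (Suc m) > 0"
          using c_bd(1)[of "Suc m" p] Suc.prems st(1) r_bd(1)[OF mM(2)] by (cases "c p (Suc m)") auto
        then obtain c' where c': "c p (Suc m) = Suc c'" by (cases "c p (Suc m)") auto
        have c'h: "real c' * h p = real (c p (Suc m)) * h p - h p" by (simp add: c' algebra_simps)
        have cb: "c p (Suc m) \<le> b"
          unfolding c_def using b r_bd(1)[OF Suc.prems] by (intro grid_ceiling_least h) (auto simp: rng_def)
        have "rng m p c'"
          unfolding rng_def using c'h c_bd[OF Suc.prems, of p] elim(2) st by auto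
        then have prev: "change_count (\<kappa> p) c' = m" "last_change (\<kappa> p) c' = c p m" "change_value y u (h p) (\<kappa> p) c' = w p"
          and kc': "\<kappa> p c' = K (r m) \<omega>"
          using elim(1) rng_const[OF mM(2)] by (auto simp: \<kappa>_def)
        have rc: "rng (Suc m) p b'" if "c p (Suc m) \<le> b'" "b' \<le> b" for b'
        proof (rule rng_mono[OF Suc.prems _ that(2) b])
          have "real (c p (Suc m)) * h p \<le> real b' * h p" using that(1) h(1)[of p] by (intro mult_right_mono) auto
          with c_bd(1)[OF Suc.prems, of p] show "r (Suc m) \<le> real b' * h p" by linarith
        qed
        then have kc: "\<kappa> p b' = K (r (Suc m)) \<omega>" if "c p (Suc m) \<le> b'" "b' \<le> b" for b'
          using rng_const[OF Suc.prems] that by (auto simp: \<kappa>_def)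
        have ne: "\<kappa> p (Suc c') \<noteq> \<kappa> p c'"
          using kc[of "Suc c'"] cb c' kc'
            jump_changes_value[where K=K and \<omega>=\<omega>, OF k r_bd(1)[OF mM(2)] st(1) st(4) st(3)] by simp
        have at_c: "change_count (\<kappa> p) (Suc c') = Suc m" "last_change (\<kappa> p) (Suc c') = c p (Suc m)"
          "change_value y u (h p) (\<kappa> p) (Suc c') = w' p"
          using ne prev kc' kc[of "Suc c'"] cb c' by (simp_all add: w'_def)
        have *: "\<kappa> p b' = \<kappa> p (Suc c')" if "Suc c' \<le> b'" "b' \<le> Suc c' + (b - Suc c')" for b'
          using kc[of b'] kc[of "Suc c'"] that cb c' by simp
        have "change_count (\<kappa> p) (Suc c' + (b - Suc c')) = change_count (\<kappa> p) (Suc c')"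
          by (rule grid_constant(1), rule *)
        moreover have "last_change (\<kappa> p) (Suc c' + (b - Suc c')) = last_change (\<kappa> p) (Suc c')"
          by (rule grid_constant(2), rule *)
        moreover have "change_value y u (h p) (\<kappa> p) (Suc c' + (b - Suc c')) = change_value y u (h p) (\<kappa> p) (Suc c')"
          by (rule grid_constant(3), rule *)
        moreover have "Suc c' + (b - Suc c') = b" using cb c' by simp
        ultimately show "change_count (\<kappa> p) b = Suc m \<and> last_change (\<kappa> p) b = c p (Suc m) \<and> change_value y u (h p) (\<kappa> p) b = w' p"
          by (simp only: at_c simp_thms)
      qed
    qed
    ultimately show ?case by blast
  qed
  from claim[OF order_refl] obtain w where w: "w \<longlonglongrightarrow> v M" and ev: "\<forall>\<^sub>F p in sequentially. \<forall>b. rng M p b \<longrightarrow>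
      change_count (\<kappa> p) b = M \<and> last_change (\<kappa> p) b = c p M \<and> change_value y u (h p) (\<kappa> p) b = w p"
    by auto
  have c_bd: "real (c p M) * h p < r M + h p" for p
    unfolding c_def using grid_ceiling[OF h(1) r_bd(1)[OF order_refl]] by auto
  have cb: "c p M \<le> b p" for p
    unfolding c_def using b[of p] r_bd[OF order_refl] by (intro grid_ceiling_least h) auto
  have arg: "real (b p - c p M) * h p + h p = t - real (c p M) * h p + h p" for p
    using cb[of p] b[of p] by (simp add: of_nat_diff algebra_simps)
  have "(\<lambda>p. w p + y M (K (r M) \<omega>) (real (b p - c p M) * h p + h p)) \<longlonglongrightarrow> v M + y M (K (r M) \<omega>) (t - r M)"
  proof (intro tendsto_add w, rule tendsto_from_right[where g="y M (K (r M) \<omega>)" and a="t - r M"])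
    show "(y M (K (r M) \<omega>) \<longlongrightarrow> y M (K (r M) \<omega>) (t - r M)) (at_right (t - r M))"
      unfolding y_def using r_bd[OF order_refl] by (intro Y) auto
    have "(\<lambda>p. t - real (c p M) * h p + h p) \<longlonglongrightarrow> t - r M + 0"
      unfolding c_def using r_bd(1)[OF order_refl]
      by (intro tendsto_add tendsto_diff tendsto_const tendsto_grid_ceiling h)
    then show "(\<lambda>p. real (b p - c p M) * h p + h p) \<longlonglongrightarrow> t - r M" by (simp add: arg)
    show "t - r M < real (b p - c p M) * h p + h p" for p
      unfolding arg using c_bd[of p] by linarith
  qed
  moreover from ev have "\<forall>\<^sub>F p in sequentially. w p + y M (K (r M) \<omega>) (real (b p - c p M) * h p + h p)
      = grid_value y u (h p) (\<kappa> p) (b p)"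
  proof eventually_elim
    case (elim p)
    have "rng M p (b p)" using b[of p] r_bd[OF order_refl] by (auto simp: rng_def)
    with elim show ?case
      using rng_const[OF order_refl, of p "b p"] by (simp add: grid_value_def \<kappa>_def)
  qed
  ultimately have "(\<lambda>p. grid_value y u (h p) (\<kappa> p) (b p)) \<longlonglongrightarrow> v M + y M (K (r M) \<omega>) (t - r M)"
    by (rule Lim_transform_eventually)
  then show ?thesis
    by (simp add: ma_path_def Let_def M_def r_def v_def y_def[abs_def] u_def[abs_def] \<kappa>_def[abs_def])
qed

section \<open>Laplace transforms of Markov additive subordinators\<close>

definition process_algebra :: "'v set \<Rightarrow> real set \<Rightarrow> 's measure \<Rightarrow> (real \<Rightarrow> 'v \<Rightarrow> 's) \<Rightarrow> 'v measure" where
  "process_algebra \<Omega> T S X = vimage_algebra \<Omega> (\<lambda>\<omega>. \<lambda>t\<in>T. X t \<omega>) (\<Pi>\<^sub>M t\<in>T. S)"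

lemma space_process_algebra [simp]: "space (process_algebra \<Omega> T S X) = \<Omega>"
  by (simp add: process_algebra_def)

lemma measurable_process_algebra:
  assumes "t \<in> T" "\<And>\<omega> u. \<omega> \<in> \<Omega> \<Longrightarrow> u \<in> T \<Longrightarrow> X u \<omega> \<in> space S"
  shows "X t \<in> process_algebra \<Omega> T S X \<rightarrow>\<^sub>M S"
proof -
  have "(\<lambda>\<omega>. \<lambda>u\<in>T. X u \<omega>) \<in> process_algebra \<Omega> T S X \<rightarrow>\<^sub>M (\<Pi>\<^sub>M t\<in>T. S)"
    unfolding process_algebra_def using assms by (intro measurable_vimage_algebra1) (auto simp: space_PiM PiE_iff)
  from measurable_compose[OF this measurable_component_singleton[OF assms(1)]] assms(1)
  show ?thesis by simp
qed

lemma measurable_process_algebra_mono: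
  assumes f: "f \<in> process_algebra \<Omega> T S X \<rightarrow>\<^sub>M B" and T: "T \<subseteq> T'"
    and X: "\<And>\<omega> u. \<omega> \<in> \<Omega> \<Longrightarrow> u \<in> T' \<Longrightarrow> X u \<omega> \<in> space S"
  shows "f \<in> process_algebra \<Omega> T' S X \<rightarrow>\<^sub>M B"
proof (rule measurable_compose[of "\<lambda>\<omega>. \<omega>" _ "process_algebra \<Omega> T S X", OF _ f])
  show "(\<lambda>\<omega>. \<omega>) \<in> process_algebra \<Omega> T' S X \<rightarrow>\<^sub>M process_algebra \<Omega> T S X"
    unfolding process_algebra_def[of \<Omega> T]
  proof (rule measurable_vimage_algebra2)
    show "(\<lambda>\<omega>. \<lambda>t\<in>T. X t \<omega>) \<in> process_algebra \<Omega> T' S X \<rightarrow>\<^sub>M (\<Pi>\<^sub>M t\<in>T. S)"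
      using T X by (intro measurable_restrict measurable_process_algebra) auto
  qed simp
qed

lemma (in prob_space) indep_set_integral_mult:
  fixes X Z :: "'a \<Rightarrow> real"
  assumes ind: "indep_set (sets A) (sets B)" and sp: "space A = space M" "space B = space M"
    and X: "X \<in> borel_measurable A" "integrable M X" and Z: "Z \<in> borel_measurable B" "integrable M Z"
  shows "(\<integral>\<omega>. X \<omega> * Z \<omega> \<partial>M) = (\<integral>\<omega>. X \<omega> \<partial>M) * (\<integral>\<omega>. Z \<omega> \<partial>M)"
proof (rule indep_var_lebesgue_integral)
  have sub: "sigma_sets (space M) {V -` C \<inter> space M |C. C \<in> sets borel} \<subseteq> sets D"
    if "V \<in> borel_measurable D" "space D = space M" for V :: "'a \<Rightarrow> real" and D
    unfolding that(2)[symmetric] using that(1) by (intro sets.sigma_sets_subset) (auto intro: measurable_sets)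
  show "indep_var borel X borel Z"
    unfolding indep_var_eq
  proof (intro conjI)
    have sX: "sigma_sets (space M) {X -` C \<inter> space M |C. C \<in> sets borel} \<subseteq> sets A" by (rule sub[OF X(1) sp(1)])
    have sZ: "sigma_sets (space M) {Z -` C \<inter> space M |C. C \<in> sets borel} \<subseteq> sets B" by (rule sub[OF Z(1) sp(2)])
    show "random_variable borel X" by (rule borel_measurable_integrable[OF X(2)])
    show "random_variable borel Z" by (rule borel_measurable_integrable[OF Z(2)])
    show "indep_set (sigma_sets (space M) {X -` C \<inter> space M |C. C \<in> sets borel})
        (sigma_sets (space M) {Z -` C \<inter> space M |C. C \<in> sets borel})"
    proof (rule indep_setI)
      show "prob (a \<inter> b) = prob a * prob b"
        if "a \<in> sigma_sets (space M) {X -` C \<inter> space M |C. C \<in> sets borel}"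
          "b \<in> sigma_sets (space M) {Z -` C \<inter> space M |C. C \<in> sets borel}" for a b
        by (rule indep_setD[OF ind]) (use that sX sZ in blast)+
    qed (rule order_trans[OF sX indep_setD_ev1[OF ind]], rule order_trans[OF sZ indep_setD_ev2[OF ind]])
  qed
qed (rule X(2), rule Z(2))

context
  fixes N :: "'v measure" and Y :: "real \<Rightarrow> 'v \<Rightarrow> real" and d :: real and \<nu> :: "real measure"
  assumes N: "prob_space N" and levy: "levy_subordinator N Y d \<nu>"
begin

interpretation prob_space N by fact

lemma levy_measurable: "0 \<le> t \<Longrightarrow> Y t \<in> borel_measurable N"
  and levy_zero: "\<omega> \<in> space N \<Longrightarrow> Y 0 \<omega> = 0"
  and levy_right_continuous: "\<omega> \<in> space N \<Longrightarrow> 0 \<le> t \<Longrightarrow> ((\<lambda>s. Y s \<omega>) \<longlongrightarrow> Y t \<omega>) (at_right t)"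
  and levy_mono: "\<omega> \<in> space N \<Longrightarrow> 0 \<le> s \<Longrightarrow> s \<le> t \<Longrightarrow> Y s \<omega> \<le> Y t \<omega>"
  and levy_laplace_1: "0 \<le> \<theta> \<Longrightarrow> (\<integral>\<omega>. exp (- \<theta> * Y 1 \<omega>) \<partial>N) = exp (- laplace_exponent d \<nu> \<theta>)"
proof -
  have 1: "\<forall>t\<ge>0. Y t \<in> borel_measurable N"
    and 2: "\<forall>\<omega>\<in>space N. Y 0 \<omega> = 0 \<and> cadlag (\<lambda>t. Y t \<omega>) \<and> mono_on {0..} (\<lambda>t. Y t \<omega>)"
    and 3: "\<forall>\<theta>\<ge>0. (\<integral>\<omega>. exp (- \<theta> * Y 1 \<omega>) \<partial>N) = exp (- laplace_exponent d \<nu> \<theta>)"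
    using levy unfolding levy_subordinator_def by blast+
  show "0 \<le> t \<Longrightarrow> Y t \<in> borel_measurable N" using 1 by blast
  show "\<omega> \<in> space N \<Longrightarrow> Y 0 \<omega> = 0" using 2 by blast
  show "\<omega> \<in> space N \<Longrightarrow> 0 \<le> t \<Longrightarrow> ((\<lambda>s. Y s \<omega>) \<longlongrightarrow> Y t \<omega>) (at_right t)"
    using 2 by (simp add: cadlag_def)
  show "\<omega> \<in> space N \<Longrightarrow> 0 \<le> s \<Longrightarrow> s \<le> t \<Longrightarrow> Y s \<omega> \<le> Y t \<omega>"
    using 2 by (auto dest!: bspec[of _ _ \<omega>] mono_onD[where r=s and s=t])
  show "0 \<le> \<theta> \<Longrightarrow> (\<integral>\<omega>. exp (- \<theta> * Y 1 \<omega>) \<partial>N) = exp (- laplace_exponent d \<nu> \<theta>)"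
    using 3 by blast
qed

text \<open>Independence of the increment from the past, in the form used along the grid.\<close>

lemma levy_increment:
  assumes s: "0 \<le> s" "s \<le> t" and X: "X \<in> borel_measurable (process_algebra (space N) {0..s} borel Y)"
    and bd: "AE \<omega> in N. \<bar>X \<omega>\<bar> \<le> 1" and Xm: "X \<in> borel_measurable N" and \<theta>: "0 \<le> \<theta>"
  shows "(\<integral>\<omega>. X \<omega> * exp (- \<theta> * (Y t \<omega> - Y s \<omega>)) \<partial>N) = (\<integral>\<omega>. X \<omega> \<partial>N) * (\<integral>\<omega>. exp (- \<theta> * Y (t - s) \<omega>) \<partial>N)"
proof -
  note [measurable] = levy_measurable
  have m: "Y t \<in> borel_measurable N" "Y s \<in> borel_measurable N" "Y (t - s) \<in> borel_measurable N"
    using s by (auto intro!: levy_measurable)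
  have ind: "indep_set (sets (process_algebra (space N) {0..s} borel Y))
      (sets (vimage_algebra (space N) (\<lambda>\<omega>. Y t \<omega> - Y s \<omega>) borel))"
    and eq: "distr N borel (\<lambda>\<omega>. Y t \<omega> - Y s \<omega>) = distr N borel (Y (t - s))"
    using levy s unfolding levy_subordinator_def process_algebra_def by blast+
  have le: "exp (- \<theta> * (Y t \<omega> - Y s \<omega>)) \<le> 1" if "\<omega> \<in> space N" for \<omega>
    using \<theta> levy_mono[OF that s] by auto
  have "(\<integral>\<omega>. X \<omega> * exp (- \<theta> * (Y t \<omega> - Y s \<omega>)) \<partial>N) =
      (\<integral>\<omega>. X \<omega> \<partial>N) * (\<integral>\<omega>. exp (- \<theta> * (Y t \<omega> - Y s \<omega>)) \<partial>N)"
  proof (rule indep_set_integral_mult[OF ind _ _ X])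
    show "integrable N X" using bd Xm by (intro integrable_const_bound[of _ 1]) auto
    show "integrable N (\<lambda>\<omega>. exp (- \<theta> * (Y t \<omega> - Y s \<omega>)))"
      using m le by (intro integrable_const_bound[of _ 1] AE_I2) auto
    have "(\<lambda>\<omega>. Y t \<omega> - Y s \<omega>) \<in> vimage_algebra (space N) (\<lambda>\<omega>. Y t \<omega> - Y s \<omega>) borel \<rightarrow>\<^sub>M borel"
      by (rule measurable_vimage_algebra1) simp
    then show "(\<lambda>\<omega>. exp (- \<theta> * (Y t \<omega> - Y s \<omega>))) \<in> borel_measurable (vimage_algebra (space N) (\<lambda>\<omega>. Y t \<omega> - Y s \<omega>) borel)"
      by simp
  qed simp_all
  also have "(\<integral>\<omega>. exp (- \<theta> * (Y t \<omega> - Y s \<omega>)) \<partial>N) = (\<integral>y. exp (- \<theta> * y) \<partial>distr N borel (\<lambda>\<omega>. Y t \<omega> - Y s \<omega>))"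
    using m by (subst integral_distr) auto
  also have "\<dots> = (\<integral>\<omega>. exp (- \<theta> * Y (t - s) \<omega>) \<partial>N)"
    unfolding eq using m by (subst integral_distr) auto
  finally show ?thesis .
qed

text \<open>
  The exponent at time 1 is given; stationarity and independence make the transform at time \<open>1 / q\<close> a
  positive \<open>q\<close>-th root of it.
\<close>

lemma levy_laplace:
  assumes q: "0 < (q::nat)" and \<theta>: "0 \<le> \<theta>"
  shows "(\<integral>\<omega>. exp (- \<theta> * Y (1 / real q) \<omega>) \<partial>N) = exp (- (1 / real q * laplace_exponent d \<nu> \<theta>))"
proof -
  define h where "h = 1 / real q"
  have h: "0 < h" using q by (simp add: h_def)
  define e where "e s = (\<integral>\<omega>. exp (- \<theta> * Y s \<omega>) \<partial>N)" for s
  have step: "e (s + h) = e s * e h" if s: "0 \<le> s" for s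
  proof -
    have "e (s + h) = (\<integral>\<omega>. exp (- \<theta> * Y s \<omega>) * exp (- \<theta> * (Y (s + h) \<omega> - Y s \<omega>)) \<partial>N)"
      unfolding e_def by (simp add: exp_add[symmetric] algebra_simps)
    also have "\<dots> = e s * e (s + h - s)"
      unfolding e_def
    proof (rule levy_increment)
      have [measurable]: "Y s \<in> borel_measurable (process_algebra (space N) {0..s} borel Y)"
        using s by (intro measurable_process_algebra) auto
      show "(\<lambda>\<omega>. exp (- \<theta> * Y s \<omega>)) \<in> borel_measurable (process_algebra (space N) {0..s} borel Y)" by measurable
      show "AE \<omega> in N. \<bar>exp (- \<theta> * Y s \<omega>)\<bar> \<le> 1"
        using \<theta> levy_mono[of _ 0 s] s by (auto simp: levy_zero)
      show "(\<lambda>\<omega>. exp (- \<theta> * Y s \<omega>)) \<in> borel_measurable N"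
        using levy_measurable[OF s] by measurable
    qed (use s h \<theta> in auto)
    finally show ?thesis by simp
  qed
  have e0: "e 0 = 1"
  proof -
    have "e 0 = (\<integral>\<omega>. 1 \<partial>N)" unfolding e_def by (intro Bochner_Integration.integral_cong) (auto simp: levy_zero)
    then show ?thesis by (simp add: prob_space)
  qed
  have "e (real n * h) = e h ^ n" for n
  proof (induction n)
    case (Suc n)
    then show ?case using step[of "real n * h"] h by (simp add: algebra_simps)
  qed (simp add: e0)
  from this[of q] have "e h ^ q = exp (- (h * laplace_exponent d \<nu> \<theta>)) ^ q"
    using q levy_laplace_1[OF \<theta>] by (simp add: e_def h_def exp_of_nat_mult[symmetric])
  then have "e h = exp (- (h * laplace_exponent d \<nu> \<theta>))"
    by (rule power_eq_imp_eq_base) (use q in \<open>simp_all add: e_def\<close>)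
  then show ?thesis by (simp add: e_def h_def)
qed

end

section \<open>The skeleton of the construction\<close>

text \<open>
  The sigma-algebras whose events are the \<open>ingredient_events\<close>; independence of the latter is used through
  measurability with respect to the former.
\<close>

primrec ingredient_algebra ::
  "'v measure \<Rightarrow> (real \<Rightarrow> 'v \<Rightarrow> 'n) \<Rightarrow> (nat \<Rightarrow> 'n \<Rightarrow> real \<Rightarrow> 'v \<Rightarrow> real) \<Rightarrow>
   (nat \<Rightarrow> 'n \<Rightarrow> 'n \<Rightarrow> 'v \<Rightarrow> real) \<Rightarrow> 'n ingredient \<Rightarrow> 'v measure" where
  "ingredient_algebra N K Y U Chain = process_algebra (space N) {0..} (count_space UNIV) K"
| "ingredient_algebra N K Y U (Levy m i) = process_algebra (space N) {0..} borel (Y m i)"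
| "ingredient_algebra N K Y U (Jump m i j) = vimage_algebra (space N) (U m i j) borel"

lemma ingredient_events_eq: "ingredient_events N K Y U g = sets (ingredient_algebra N K Y U g)"
  by (cases g) (simp_all add: process_algebra_def)

lemma space_ingredient_algebra [simp]: "space (ingredient_algebra N K Y U g) = space N"
  by (cases g) simp_all

text \<open>
  One step of the discrete path changes its value by an increment of the current Levy process, and, if the
  state changes, also by a jump variable and by the initial piece of the next Levy process (of length
  \<open>h\<close> because of the lengthened holding times). The three factors are the corresponding exponentials.
\<close>

definition stay_factor where
  "stay_factor Y h th \<kappa> b \<omega> = exp (- th (Suc b) *
     (Y (change_count \<kappa> b) (\<kappa> b) (real (Suc b - last_change \<kappa> b) * h + h) \<omega>
      - Y (change_count \<kappa> b) (\<kappa> b) (real (b - last_change \<kappa> b) * h + h) \<omega> :: real))"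

definition enter_factor where
  "enter_factor Y h th \<kappa> b \<omega> = exp (- th (Suc b) * (Y (Suc (change_count \<kappa> b)) (\<kappa> (Suc b)) h \<omega> :: real))"

definition jump_factor where
  "jump_factor U th \<kappa> b \<omega> = exp (- th (Suc b) * (U (change_count \<kappa> b) (\<kappa> b) (\<kappa> (Suc b)) \<omega> :: real))"

definition step_factor ::
  "(nat \<Rightarrow> 'n \<Rightarrow> real \<Rightarrow> 'v \<Rightarrow> real) \<Rightarrow> (nat \<Rightarrow> 'n \<Rightarrow> 'n \<Rightarrow> 'v \<Rightarrow> real) \<Rightarrow> real \<Rightarrow> (nat \<Rightarrow> real) \<Rightarrow>
   (nat \<Rightarrow> 'n) \<Rightarrow> nat \<Rightarrow> 'n ingredient \<Rightarrow> 'v \<Rightarrow> real" where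
  "step_factor Y U h th \<kappa> b g \<omega> =
     (if g = Levy (change_count \<kappa> b) (\<kappa> b) then stay_factor Y h th \<kappa> b \<omega> else 1) *
     (if \<kappa> (Suc b) = \<kappa> b then 1
      else (if g = Levy (Suc (change_count \<kappa> b)) (\<kappa> (Suc b)) then enter_factor Y h th \<kappa> b \<omega> else 1) *
           (if g = Jump (change_count \<kappa> b) (\<kappa> b) (\<kappa> (Suc b)) then jump_factor U th \<kappa> b \<omega> else 1))"

text \<open>
  The exponential of the weighted increments up to step \<open>b\<close>, split into one factor for each ingredient, so that
  independence of the ingredients can be applied for a fixed discrete path.
\<close>

primrec path_factor ::
  "(nat \<Rightarrow> 'n \<Rightarrow> real \<Rightarrow> 'v \<Rightarrow> real) \<Rightarrow> (nat \<Rightarrow> 'n \<Rightarrow> 'n \<Rightarrow> 'v \<Rightarrow> real) \<Rightarrow> real \<Rightarrow> (nat \<Rightarrow> real) \<Rightarrow>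
   (nat \<Rightarrow> 'n) \<Rightarrow> nat \<Rightarrow> 'n ingredient \<Rightarrow> 'v \<Rightarrow> real" where
  "path_factor Y U h th \<kappa> 0 g \<omega> = (if g = Levy 0 (\<kappa> 0) then exp (- th 0 * Y 0 (\<kappa> 0) h \<omega>) else 1)"
| "path_factor Y U h th \<kappa> (Suc b) g \<omega> = path_factor Y U h th \<kappa> b g \<omega> * step_factor Y U h th \<kappa> b g \<omega>"

abbreviation path_grid_value where
  "path_grid_value Y U h \<kappa> b \<omega> \<equiv> grid_value (\<lambda>m i s. Y m i s \<omega>) (\<lambda>m i j. U m i j \<omega>) h \<kappa> b"

text \<open>
  Weights may change from step to step, so that joint Laplace transforms at several times are covered.
\<close>

definition weighted_value where
  "weighted_value Y U h th \<kappa> n \<omega> = th 0 * path_grid_value Y U h \<kappa> 0 \<omega>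
     + (\<Sum>b<n. th (Suc b) * (path_grid_value Y U h \<kappa> (Suc b) \<omega> - path_grid_value Y U h \<kappa> b \<omega>))"

definition used_ingredients :: "nat \<Rightarrow> 'n::finite ingredient set" where
  "used_ingredients n = (\<lambda>(m, i). Levy m i) ` ({..n} \<times> UNIV) \<union> (\<lambda>(m, i, j). Jump m i j) ` ({..n} \<times> UNIV)"

lemma finite_used_ingredients [simp]: "finite (used_ingredients n)"
  by (simp add: used_ingredients_def)

lemma used_ingredients_iff [simp]:
  "Levy m i \<in> used_ingredients n \<longleftrightarrow> m \<le> n" "Jump m i j \<in> used_ingredients n \<longleftrightarrow> m \<le> n"
  "Chain \<notin> used_ingredients n"
  by (auto simp: used_ingredients_def image_iff)

lemma change_count_le: "change_count \<kappa> b \<le> b"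
  by (induction b) auto

lemma prod_step_factor:
  assumes "b < n"
  shows "(\<Prod>g\<in>used_ingredients n. step_factor Y U h th \<kappa> b g \<omega>) =
    exp (- (th (Suc b) * (path_grid_value Y U h \<kappa> (Suc b) \<omega> - path_grid_value Y U h \<kappa> b \<omega>)))"
proof -
  have cc: "change_count \<kappa> b \<le> n" "Suc (change_count \<kappa> b) \<le> n"
    using change_count_le[of \<kappa> b] assms by auto
  have delta: "(\<Prod>g\<in>used_ingredients n. if g = a then v else 1) = v" if "a \<in> used_ingredients n" for a v
    using that by (simp add: prod.delta)
  show ?thesis
  proof (cases "\<kappa> (Suc b) = \<kappa> b")
    case True
    then have "(\<Prod>g\<in>used_ingredients n. step_factor Y U h th \<kappa> b g \<omega>) = stay_factor Y h th \<kappa> b \<omega>"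
      using cc delta[of "Levy (change_count \<kappa> b) (\<kappa> b)"] by (simp add: step_factor_def)
    with True show ?thesis by (simp add: stay_factor_def grid_value_def algebra_simps)
  next
    case False
    then have "(\<Prod>g\<in>used_ingredients n. step_factor Y U h th \<kappa> b g \<omega>) =
        stay_factor Y h th \<kappa> b \<omega> * (enter_factor Y h th \<kappa> b \<omega> * jump_factor U th \<kappa> b \<omega>)"
      unfolding step_factor_def
      using cc by (simp only: if_False prod.distrib delta used_ingredients_iff)
    with False show ?thesis
      by (simp add: stay_factor_def enter_factor_def jump_factor_def grid_value_def exp_add[symmetric] algebra_simps)
  qed
qed

lemma prod_path_factor:
  "b \<le> n \<Longrightarrow> (\<Prod>g\<in>used_ingredients n. path_factor Y U h th \<kappa> b g \<omega>) = exp (- weighted_value Y U h th \<kappa> b \<omega>)"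
proof (induction b)
  case 0
  then show ?case by (simp add: prod.delta weighted_value_def grid_value_def)
next
  case (Suc b)
  then show ?case
    using prod_step_factor[of b n Y U h th \<kappa> \<omega>]
    by (simp add: prod.distrib weighted_value_def exp_add[symmetric])
qed

lemma path_factor_unused:
  "(\<And>m i. g = Levy m i \<Longrightarrow> change_count \<kappa> b < m) \<Longrightarrow> (\<And>m i j. g = Jump m i j \<Longrightarrow> change_count \<kappa> b \<le> m) \<Longrightarrow>
    path_factor Y U h th \<kappa> b g \<omega> = 1"
proof (induction b)
  case (Suc b)
  have "change_count \<kappa> b \<le> change_count \<kappa> (Suc b)" by simp
  with Suc show ?case
    by (cases g) (force simp: step_factor_def split: if_splits)+
qed auto

text \<open>
  Laplace transform of the increment during one step of length \<open>h\<close> from \<open>i\<close> to \<open>j\<close>. A change of state costs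
  two Levy pieces of length \<open>h\<close>, which is harmless since it has probability of order \<open>h\<close>.
\<close>

definition step_laplace ::
  "('n \<Rightarrow> real) \<Rightarrow> ('n \<Rightarrow> real measure) \<Rightarrow> ('n \<Rightarrow> 'n \<Rightarrow> real measure) \<Rightarrow> real \<Rightarrow> real \<Rightarrow> 'n \<Rightarrow> 'n \<Rightarrow> real" where
  "step_laplace d \<nu> G h \<theta> i j = exp (- (h * laplace_exponent (d i) (\<nu> i) \<theta>)) *
     (if i = j then 1 else (\<integral>y. exp (- \<theta> * y) \<partial>G i j) * exp (- (h * laplace_exponent (d j) (\<nu> j) \<theta>)))"

context
  fixes N :: "'v measure" and i0 :: "'n::finite" and Q :: "real^'n^'n" and d :: "'n \<Rightarrow> real"
    and \<nu> :: "'n \<Rightarrow> real measure" and G :: "'n \<Rightarrow> 'n \<Rightarrow> real measure"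
    and K :: "real \<Rightarrow> 'v \<Rightarrow> 'n" and Y :: "nat \<Rightarrow> 'n \<Rightarrow> real \<Rightarrow> 'v \<Rightarrow> real" and U :: "nat \<Rightarrow> 'n \<Rightarrow> 'n \<Rightarrow> 'v \<Rightarrow> real"
  assumes ing: "ma_ingredients N i0 Q d \<nu> G K Y U" and char: "ma_characteristics Q d \<nu> G"
begin

lemma ma_prob_space: "prob_space N"
  and ma_chain: "markov_chain N K i0 Q"
  and ma_levy: "levy_subordinator N (Y m i) (d i) (\<nu> i)"
  and ma_jump: "U m i j \<in> borel_measurable N" "distr N borel (U m i j) = G i j"
  and ma_indep: "prob_space.indep_sets N (ingredient_events N K Y U) UNIV"
  using ing unfolding ma_ingredients_def by blast+

interpretation prob_space N by (rule ma_prob_space)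

lemmas Y_measurable = levy_measurable[OF ma_prob_space ma_levy]
lemmas Y_zero = levy_zero[OF ma_prob_space ma_levy]
lemmas Y_right_continuous = levy_right_continuous[OF ma_prob_space ma_levy]
lemmas Y_mono = levy_mono[OF ma_prob_space ma_levy]

lemma Y_nonneg: "\<omega> \<in> space N \<Longrightarrow> 0 \<le> t \<Longrightarrow> 0 \<le> Y m i t \<omega>"
  using Y_mono[of \<omega> 0 t m i] by (simp add: Y_zero)

lemma U_nonneg: "AE \<omega> in N. \<forall>m i j. 0 \<le> U m i j \<omega>"
proof -
  have "AE \<omega> in N. 0 \<le> U m i j \<omega>" for m i j
  proof -
    have s: "sets (G i j) = sets borel" "emeasure (G i j) {..<0} = 0"
      using char unfolding ma_characteristics_def by blast+
    have "{..<0::real} \<in> null_sets (G i j)" using s by (auto simp: null_sets_def)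
    then have "AE y in G i j. 0 \<le> y" by (rule AE_I'[rotated 0]) auto
    then have "AE y in distr N borel (U m i j). 0 \<le> y" unfolding ma_jump(2) .
    then show ?thesis by (rule AE_distrD[OF ma_jump(1)])
  qed
  then show ?thesis by (simp add: AE_all_countable)
qed

lemma ingredient_expectation:
  fixes W :: "'n ingredient \<Rightarrow> 'v \<Rightarrow> real"
  assumes I: "finite I" and W: "\<And>g. g \<in> I \<Longrightarrow> W g \<in> borel_measurable (ingredient_algebra N K Y U g)"
    "\<And>g. g \<in> I \<Longrightarrow> integrable N (W g)"
  shows "(\<integral>\<omega>. (\<Prod>g\<in>I. W g \<omega>) \<partial>N) = (\<Prod>g\<in>I. \<integral>\<omega>. W g \<omega> \<partial>N)"
proof (rule indep_vars_lebesgue_integral[OF I _ W(2)])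
  show "indep_vars (\<lambda>_. borel) W I"
    unfolding indep_vars_def2
  proof (intro conjI ballI indep_sets_mono[OF ma_indep])
    fix g assume g: "g \<in> I"
    show "random_variable borel (W g)" by (rule borel_measurable_integrable[OF W(2)[OF g]])
    show "{W g -` A \<inter> space N |A. A \<in> sets borel} \<subseteq> ingredient_events N K Y U g"
      unfolding ingredient_events_eq using measurable_sets[OF W(1)[OF g]] by auto
  qed simp
qed

lemma K_measurable: "0 \<le> t \<Longrightarrow> K t \<in> N \<rightarrow>\<^sub>M count_space UNIV"
  and K_cadlag: "\<omega> \<in> space N \<Longrightarrow> cadlag_discrete (\<lambda>t. K t \<omega>)"
  and K_0: "AE \<omega> in N. K 0 \<omega> = i0"
  and K_markov: "0 \<le> s \<Longrightarrow> 0 \<le> t \<Longrightarrow> A \<in> sets (\<Pi>\<^sub>M u\<in>{0..s}. count_space UNIV) \<Longrightarrow>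
        prob {\<omega>\<in>space N. (\<lambda>u\<in>{0..s}. K u \<omega>) \<in> A \<and> K s \<omega> = i \<and> K (s + t) \<omega> = j} =
        prob {\<omega>\<in>space N. (\<lambda>u\<in>{0..s}. K u \<omega>) \<in> A \<and> K s \<omega> = i} * matrix_exp (t *\<^sub>R Q) $ i $ j"
  using ma_chain unfolding markov_chain_def by blast+

context
  fixes h :: real and q :: nat and th :: "nat \<Rightarrow> real" and \<kappa> :: "nat \<Rightarrow> 'n"
  assumes q: "0 < q" and h: "h = 1 / real q" and th: "\<And>b. 0 \<le> th b"
begin

lemma h_pos: "0 < h" using q h by simp

lemma factor_bounds:
  assumes "\<omega> \<in> space N" "\<forall>m i j. 0 \<le> U m i j \<omega>"
  shows "\<bar>stay_factor Y h th \<kappa> b \<omega>\<bar> \<le> 1" "\<bar>enter_factor Y h th \<kappa> b \<omega>\<bar> \<le> 1" "\<bar>jump_factor U th \<kappa> b \<omega>\<bar> \<le> 1"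
    "\<bar>step_factor Y U h th \<kappa> b g \<omega>\<bar> \<le> 1" "\<bar>path_factor Y U h th \<kappa> b g \<omega>\<bar> \<le> 1"
proof -
  have m: "Y m i (real (b - l) * h + h) \<omega> \<le> Y m i (real (Suc b - l) * h + h) \<omega>" for m i b l
    using h_pos by (intro Y_mono assms(1) add_mono mult_right_mono order_refl) auto
  show 1: "\<bar>stay_factor Y h th \<kappa> b \<omega>\<bar> \<le> 1" "\<bar>enter_factor Y h th \<kappa> b \<omega>\<bar> \<le> 1" "\<bar>jump_factor U th \<kappa> b \<omega>\<bar> \<le> 1" for b
    unfolding stay_factor_def enter_factor_def jump_factor_def
    using th[of "Suc b"] m Y_nonneg[OF assms(1) less_imp_le[OF h_pos]] assms(2) by (auto simp: mult_nonneg_nonneg)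
  show 2: "\<bar>step_factor Y U h th \<kappa> b g \<omega>\<bar> \<le> 1" for b
    unfolding step_factor_def using 1[of b]
    by (auto simp: abs_mult intro!: mult_le_one)
  show "\<bar>path_factor Y U h th \<kappa> b g \<omega>\<bar> \<le> 1"
  proof (induction b)
    case 0
    show ?case using th[of 0] Y_nonneg[OF assms(1) less_imp_le[OF h_pos]] by (auto simp: mult_nonneg_nonneg)
  next
    case (Suc b)
    then show ?case using 2[of b] by (auto simp: abs_mult intro!: mult_le_one)
  qed
qed

lemma Y_alg: "0 \<le> t \<Longrightarrow> Y m i t \<in> borel_measurable (ingredient_algebra N K Y U (Levy m i))"
  by (auto intro: measurable_process_algebra)

lemma U_alg: "U m i j \<in> borel_measurable (ingredient_algebra N K Y U (Jump m i j))"
  by (simp add: measurable_vimage_algebra1)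

lemma arg_nonneg: "0 \<le> real a * h + h" using h_pos by simp

lemma stay_factor_alg:
  "stay_factor Y h th \<kappa> b \<in> borel_measurable (ingredient_algebra N K Y U (Levy (change_count \<kappa> b) (\<kappa> b)))"
  unfolding stay_factor_def[abs_def]
  using Y_alg[OF arg_nonneg, of "change_count \<kappa> b" "\<kappa> b" "Suc b - last_change \<kappa> b"]
    Y_alg[OF arg_nonneg, of "change_count \<kappa> b" "\<kappa> b" "b - last_change \<kappa> b"] by simp

lemma enter_factor_alg:
  "enter_factor Y h th \<kappa> b \<in> borel_measurable (ingredient_algebra N K Y U (Levy (Suc (change_count \<kappa> b)) (\<kappa> (Suc b))))"
  unfolding enter_factor_def[abs_def]
  using Y_alg[OF less_imp_le[OF h_pos], of "Suc (change_count \<kappa> b)" "\<kappa> (Suc b)"] by simp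

lemma jump_factor_alg:
  "jump_factor U th \<kappa> b \<in> borel_measurable (ingredient_algebra N K Y U (Jump (change_count \<kappa> b) (\<kappa> b) (\<kappa> (Suc b))))"
  unfolding jump_factor_def[abs_def]
  using U_alg[of "change_count \<kappa> b" "\<kappa> b" "\<kappa> (Suc b)"] by simp

lemma step_factor_alg: "step_factor Y U h th \<kappa> b g \<in> borel_measurable (ingredient_algebra N K Y U g)"
proof -
  have if_const: "(\<lambda>\<omega>. if P then f \<omega> else 1) \<in> borel_measurable A" if "P \<Longrightarrow> f \<in> borel_measurable A"
    for P and f :: "'v \<Rightarrow> real" and A
    using that by (cases P) auto
  note m = stay_factor_alg[of b] enter_factor_alg[of b] jump_factor_alg[of b]
  show ?thesis
  proof (cases "\<kappa> (Suc b) = \<kappa> b")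
    case True
    then show ?thesis unfolding step_factor_def[abs_def] using m(1) by (simp add: if_const)
  next
    case False
    then show ?thesis
      unfolding step_factor_def[abs_def] if_not_P[OF False] using m by (intro borel_measurable_times if_const) simp_all
  qed
qed

lemma path_factor_alg: "path_factor Y U h th \<kappa> b g \<in> borel_measurable (ingredient_algebra N K Y U g)"
proof (induction b)
  case 0
  have [measurable]: "Y 0 (\<kappa> 0) h \<in> borel_measurable (ingredient_algebra N K Y U (Levy 0 (\<kappa> 0)))"
    using h_pos by (intro Y_alg) simp
  have "(\<lambda>\<omega>. exp (- th 0 * Y 0 (\<kappa> 0) h \<omega>)) \<in> borel_measurable (ingredient_algebra N K Y U (Levy 0 (\<kappa> 0)))"
    by measurable
  then show ?case by (cases "g = Levy 0 (\<kappa> 0)") simp_all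
next
  case (Suc b)
  then show ?case using borel_measurable_times[OF Suc step_factor_alg[of b g]] by simp
qed

lemma ingredient_algebra_measurable:
  assumes "f \<in> borel_measurable (ingredient_algebra N K Y U g)"
  shows "f \<in> borel_measurable N"
proof -
  have "sets (ingredient_algebra N K Y U g) \<subseteq> sets N"
    using ma_indep unfolding indep_sets_def ingredient_events_eq by blast
  then show ?thesis using measurable_sets[OF assms] by (auto simp: measurable_def)
qed

lemma path_factor_integrable: "integrable N (path_factor Y U h th \<kappa> b g)"
  using ingredient_algebra_measurable[OF path_factor_alg] U_nonneg factor_bounds(5)
  by (intro integrable_const_bound[of _ 1]) auto

text \<open>
  The factor of the current Levy process only looks at its past, so the increment in the next step is
  independent of it.
\<close>

lemma path_factor_past:
  "path_factor Y U h th \<kappa> b (Levy (change_count \<kappa> b) (\<kappa> b)) \<in>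
     borel_measurable (process_algebra (space N) {0..real (b - last_change \<kappa> b) * h + h} borel
        (Y (change_count \<kappa> b) (\<kappa> b)))"
proof (induction b)
  case 0
  have [measurable]: "Y 0 (\<kappa> 0) h \<in> borel_measurable (process_algebra (space N) {0..h} borel (Y 0 (\<kappa> 0)))"
    using h_pos by (intro measurable_process_algebra) auto
  show ?case by simp
next
  case (Suc b)
  let ?m = "change_count \<kappa> b" and ?i = "\<kappa> b"
  show ?case
  proof (cases "\<kappa> (Suc b) = \<kappa> b")
    case True
    let ?A = "process_algebra (space N) {0..real (Suc b - last_change \<kappa> b) * h + h} borel (Y ?m ?i)"
    have le: "real (b - last_change \<kappa> b) * h + h \<le> real (Suc b - last_change \<kappa> b) * h + h"
      using h_pos by (intro add_mono mult_right_mono order_refl) auto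
    have 1: "path_factor Y U h th \<kappa> b (Levy ?m ?i) \<in> borel_measurable ?A"
      by (rule measurable_process_algebra_mono[OF Suc]) (use le in auto)
    have [measurable]: "Y ?m ?i (real (Suc b - last_change \<kappa> b) * h + h) \<in> borel_measurable ?A"
      "Y ?m ?i (real (b - last_change \<kappa> b) * h + h) \<in> borel_measurable ?A"
      using le arg_nonneg by (auto intro!: measurable_process_algebra)
    have "stay_factor Y h th \<kappa> b \<in> borel_measurable ?A" unfolding stay_factor_def[abs_def] by measurable
    from borel_measurable_times[OF 1 this] show ?thesis
      using True by (simp add: step_factor_def)
  next
    case False
    let ?A = "process_algebra (space N) {0..h} borel (Y (Suc ?m) (\<kappa> (Suc b)))"
    have [measurable]: "Y (Suc ?m) (\<kappa> (Suc b)) h \<in> borel_measurable ?A"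
      using h_pos by (auto intro!: measurable_process_algebra)
    have "enter_factor Y h th \<kappa> b \<in> borel_measurable ?A" unfolding enter_factor_def[abs_def] by measurable
    then show ?thesis
      using False path_factor_unused[of "Levy (Suc ?m) (\<kappa> (Suc b))" \<kappa> b Y U h th]
      by (simp add: step_factor_def)
  qed
qed

definition expected_step :: "nat \<Rightarrow> 'n ingredient \<Rightarrow> real" where
  "expected_step b g =
     (if g = Levy (change_count \<kappa> b) (\<kappa> b)
      then exp (- (h * laplace_exponent (d (\<kappa> b)) (\<nu> (\<kappa> b)) (th (Suc b)))) else 1) *
     (if \<kappa> (Suc b) = \<kappa> b then 1
      else (if g = Levy (Suc (change_count \<kappa> b)) (\<kappa> (Suc b))
            then exp (- (h * laplace_exponent (d (\<kappa> (Suc b))) (\<nu> (\<kappa> (Suc b))) (th (Suc b)))) else 1) *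
           (if g = Jump (change_count \<kappa> b) (\<kappa> b) (\<kappa> (Suc b))
            then \<integral>y. exp (- th (Suc b) * y) \<partial>G (\<kappa> b) (\<kappa> (Suc b)) else 1))"

lemma expectation_stay:
  fixes b defines "g \<equiv> Levy (change_count \<kappa> b) (\<kappa> b)"
  shows "(\<integral>\<omega>. path_factor Y U h th \<kappa> b g \<omega> * stay_factor Y h th \<kappa> b \<omega> \<partial>N) =
    (\<integral>\<omega>. path_factor Y U h th \<kappa> b g \<omega> \<partial>N) * exp (- (h * laplace_exponent (d (\<kappa> b)) (\<nu> (\<kappa> b)) (th (Suc b))))"
proof -
  let ?s = "real (b - last_change \<kappa> b) * h + h" and ?t = "real (Suc b - last_change \<kappa> b) * h + h"
  have st: "?t - ?s = h"
    by (simp add: Suc_diff_le[OF last_change_le] algebra_simps)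
  have st': "?s \<le> ?t" using h_pos by (intro add_mono mult_right_mono order_refl) auto
  have "(\<integral>\<omega>. path_factor Y U h th \<kappa> b g \<omega> * stay_factor Y h th \<kappa> b \<omega> \<partial>N) =
      (\<integral>\<omega>. path_factor Y U h th \<kappa> b g \<omega> \<partial>N) *
      (\<integral>\<omega>. exp (- th (Suc b) * Y (change_count \<kappa> b) (\<kappa> b) (?t - ?s) \<omega>) \<partial>N)"
    unfolding stay_factor_def
  proof (rule levy_increment[OF ma_prob_space ma_levy arg_nonneg st'])
    show "path_factor Y U h th \<kappa> b g \<in> borel_measurable (process_algebra (space N) {0..?s} borel
        (Y (change_count \<kappa> b) (\<kappa> b)))"
      unfolding g_def by (rule path_factor_past)
    show "AE \<omega> in N. \<bar>path_factor Y U h th \<kappa> b g \<omega>\<bar> \<le> 1" using U_nonneg factor_bounds(5) by auto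
    show "random_variable borel (path_factor Y U h th \<kappa> b g)"
      by (rule ingredient_algebra_measurable[OF path_factor_alg])
  qed (rule th)
  then show ?thesis
    unfolding st levy_laplace[OF ma_prob_space ma_levy q th, folded h] .
qed

lemma expectation_path_factor_Suc:
  "(\<integral>\<omega>. path_factor Y U h th \<kappa> (Suc b) g \<omega> \<partial>N) = (\<integral>\<omega>. path_factor Y U h th \<kappa> b g \<omega> \<partial>N) * expected_step b g"
proof -
  have "g = Levy (change_count \<kappa> b) (\<kappa> b)
    \<or> \<kappa> (Suc b) \<noteq> \<kappa> b \<and> g = Levy (Suc (change_count \<kappa> b)) (\<kappa> (Suc b))
    \<or> \<kappa> (Suc b) \<noteq> \<kappa> b \<and> g = Jump (change_count \<kappa> b) (\<kappa> b) (\<kappa> (Suc b))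
    \<or> (\<forall>\<omega>. step_factor Y U h th \<kappa> b g \<omega> = 1) \<and> expected_step b g = 1"
    by (simp add: step_factor_def expected_step_def)
  then consider (stay) "g = Levy (change_count \<kappa> b) (\<kappa> b)"
    | (enter) "\<kappa> (Suc b) \<noteq> \<kappa> b" "g = Levy (Suc (change_count \<kappa> b)) (\<kappa> (Suc b))"
    | (jump) "\<kappa> (Suc b) \<noteq> \<kappa> b" "g = Jump (change_count \<kappa> b) (\<kappa> b) (\<kappa> (Suc b))"
    | (none) "\<And>\<omega>. step_factor Y U h th \<kappa> b g \<omega> = 1" "expected_step b g = 1"
    by blast
  then show ?thesis
  proof cases
    case stay
    then have "step_factor Y U h th \<kappa> b g \<omega> = stay_factor Y h th \<kappa> b \<omega>" for \<omega>
      by (auto simp: step_factor_def)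
    moreover have "expected_step b g = exp (- (h * laplace_exponent (d (\<kappa> b)) (\<nu> (\<kappa> b)) (th (Suc b))))"
      using stay by (auto simp: expected_step_def)
    ultimately show ?thesis using expectation_stay[of b] stay by simp
  next
    case enter
    then have "path_factor Y U h th \<kappa> b g \<omega> = 1" for \<omega> by (intro path_factor_unused) auto
    moreover have "step_factor Y U h th \<kappa> b g \<omega> = enter_factor Y h th \<kappa> b \<omega>" for \<omega>
      using enter by (auto simp: step_factor_def)
    moreover have "(\<integral>\<omega>. enter_factor Y h th \<kappa> b \<omega> \<partial>N) =
        exp (- (h * laplace_exponent (d (\<kappa> (Suc b))) (\<nu> (\<kappa> (Suc b))) (th (Suc b))))"
      unfolding enter_factor_def h by (rule levy_laplace[OF ma_prob_space ma_levy q th])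
    ultimately show ?thesis using enter by (simp add: expected_step_def prob_space)
  next
    case jump
    then have "path_factor Y U h th \<kappa> b g \<omega> = 1" for \<omega> by (intro path_factor_unused) auto
    moreover have "step_factor Y U h th \<kappa> b g \<omega> = jump_factor U th \<kappa> b \<omega>" for \<omega>
      using jump by (auto simp: step_factor_def)
    moreover have "(\<integral>\<omega>. jump_factor U th \<kappa> b \<omega> \<partial>N) = (\<integral>y. exp (- th (Suc b) * y) \<partial>G (\<kappa> b) (\<kappa> (Suc b)))"
      unfolding jump_factor_def ma_jump(2)[symmetric, where m="change_count \<kappa> b"] using ma_jump(1)
      by (subst integral_distr) auto
    ultimately show ?thesis using jump by (simp add: expected_step_def prob_space)
  next
    case none
    then show ?thesis by simp
  qed
qed

lemma prod_expected_step:
  assumes "b < n"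
  shows "(\<Prod>g\<in>used_ingredients n. expected_step b g) = step_laplace d \<nu> G h (th (Suc b)) (\<kappa> b) (\<kappa> (Suc b))"
proof -
  have cc: "change_count \<kappa> b \<le> n" "Suc (change_count \<kappa> b) \<le> n"
    using change_count_le[of \<kappa> b] assms by auto
  have delta: "(\<Prod>g\<in>used_ingredients n. if g = a then v else 1) = v" if "a \<in> used_ingredients n" for a and v :: real
    using that by (simp add: prod.delta)
  show ?thesis
  proof (cases "\<kappa> (Suc b) = \<kappa> b")
    case True
    then show ?thesis
      using cc delta[of "Levy (change_count \<kappa> b) (\<kappa> b)"] by (simp add: expected_step_def step_laplace_def)
  next
    case False
    then show ?thesis
      unfolding expected_step_def step_laplace_def
      using cc by (simp only: if_False prod.distrib delta used_ingredients_iff) simp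
  qed
qed

lemma expectation_path_factor_0:
  "(\<Prod>g\<in>used_ingredients n. \<integral>\<omega>. path_factor Y U h th \<kappa> 0 g \<omega> \<partial>N)
    = exp (- (h * laplace_exponent (d (\<kappa> 0)) (\<nu> (\<kappa> 0)) (th 0)))"
proof -
  have "(\<integral>\<omega>. path_factor Y U h th \<kappa> 0 g \<omega> \<partial>N) =
      (if g = Levy 0 (\<kappa> 0) then exp (- (h * laplace_exponent (d (\<kappa> 0)) (\<nu> (\<kappa> 0)) (th 0))) else 1)" for g
    using levy_laplace[OF ma_prob_space ma_levy[of 0 "\<kappa> 0"] q th[of 0]] by (simp add: h prob_space)
  then show ?thesis by (simp add: prod.delta)
qed

lemma expectation_path:
  "b \<le> n \<Longrightarrow> (\<Prod>g\<in>used_ingredients n. \<integral>\<omega>. path_factor Y U h th \<kappa> b g \<omega> \<partial>N)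
    = exp (- (h * laplace_exponent (d (\<kappa> 0)) (\<nu> (\<kappa> 0)) (th 0)))
      * (\<Prod>c<b. step_laplace d \<nu> G h (th (Suc c)) (\<kappa> c) (\<kappa> (Suc c)))"
proof (induction b)
  case 0
  show ?case using expectation_path_factor_0 by simp
next
  case (Suc b)
  then show ?case
    unfolding expectation_path_factor_Suc prod.distrib by (simp add: prod_expected_step)
qed

definition skeleton_event :: "nat \<Rightarrow> 'v set" where
  "skeleton_event n = {\<omega>\<in>space N. \<forall>b\<le>n. K (real b * h) \<omega> = \<kappa> b}"

lemma skeleton_event_alg: "skeleton_event n \<in> sets (ingredient_algebra N K Y U Chain)"
proof -
  have m: "K (real b * h) \<in> ingredient_algebra N K Y U Chain \<rightarrow>\<^sub>M count_space UNIV" for b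
    using h_pos by (auto intro!: measurable_process_algebra)
  then have "{\<omega>\<in>space (ingredient_algebra N K Y U Chain). \<forall>b\<in>{..n}. K (real b * h) \<omega> = \<kappa> b}
      \<in> sets (ingredient_algebra N K Y U Chain)"
  proof (intro sets.sets_Collect_finite_All)
    fix b
    have "K (real b * h) -` {\<kappa> b} \<inter> space (ingredient_algebra N K Y U Chain) \<in> sets (ingredient_algebra N K Y U Chain)"
      by (rule measurable_sets) (use m in auto)
    then show "{\<omega>\<in>space (ingredient_algebra N K Y U Chain). K (real b * h) \<omega> = \<kappa> b}
        \<in> sets (ingredient_algebra N K Y U Chain)"
      by (simp add: vimage_def Int_def conj_commute)
  qed simp
  moreover have "skeleton_event n = {\<omega>\<in>space (ingredient_algebra N K Y U Chain). \<forall>b\<in>{..n}. K (real b * h) \<omega> = \<kappa> b}"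
    unfolding skeleton_event_def space_ingredient_algebra by (intro Collect_cong) (auto simp only: Ball_def atMost_iff)
  ultimately show ?thesis by (simp only:)
qed

lemma prob_skeleton_event:
  "prob (skeleton_event n) = (if \<kappa> 0 = i0 then 1 else 0) * (\<Prod>b<n. matrix_exp (h *\<^sub>R Q) $ (\<kappa> b) $ (\<kappa> (Suc b)))"
proof (induction n)
  case 0
  have K0: "K 0 \<in> N \<rightarrow>\<^sub>M count_space UNIV" by (rule K_measurable) simp
  then have m: "{\<omega> \<in> space N. K 0 \<omega> = \<kappa> 0} \<in> events" by (auto simp: pred_def[symmetric])
  have "prob {\<omega> \<in> space N. K 0 \<omega> = \<kappa> 0} = (if \<kappa> 0 = i0 then 1 else 0)"
  proof (cases "\<kappa> 0 = i0")
    case True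
    then show ?thesis using K_0 m by (simp add: prob_Collect_eq_1)
  next
    case False
    then have "AE \<omega> in N. K 0 \<omega> \<noteq> \<kappa> 0" using K_0 by auto
    then show ?thesis using False m by (simp add: prob_Collect_eq_0)
  qed
  then show ?case by (simp add: skeleton_event_def)
next
  case (Suc n)
  define A where "A = {f \<in> space (\<Pi>\<^sub>M u\<in>{0..real n * h}. count_space UNIV). \<forall>b\<in>{..n}. f (real b * h) = \<kappa> b}"
  have A: "A \<in> sets (\<Pi>\<^sub>M u\<in>{0..real n * h}. count_space UNIV)"
    unfolding A_def
  proof (intro sets.sets_Collect_finite_All)
    fix b assume "b \<in> {..n}"
    then have "(\<lambda>f. f (real b * h)) \<in> (\<Pi>\<^sub>M u\<in>{0..real n * h}. count_space UNIV) \<rightarrow>\<^sub>M count_space (UNIV::'n set)"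
      using h_pos by (intro measurable_component_singleton) (auto intro!: mult_right_mono)
    then show "{f \<in> space (\<Pi>\<^sub>M u\<in>{0..real n * h}. count_space UNIV). f (real b * h) = \<kappa> b}
        \<in> sets (\<Pi>\<^sub>M u\<in>{0..real n * h}. count_space (UNIV::'n set))"
      by (auto simp: pred_def[symmetric])
  qed simp
  have inA: "(\<lambda>u\<in>{0..real n * h}. K u \<omega>) \<in> A \<longleftrightarrow> (\<forall>b\<le>n. K (real b * h) \<omega> = \<kappa> b)" for \<omega>
    using h_pos by (auto simp: A_def space_PiM intro!: mult_right_mono)
  have e1: "skeleton_event (Suc n) = {\<omega>\<in>space N. (\<lambda>u\<in>{0..real n * h}. K u \<omega>) \<in> A \<and> K (real n * h) \<omega> = \<kappa> n \<and>
      K (real n * h + h) \<omega> = \<kappa> (Suc n)}"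
    unfolding inA by (auto simp: skeleton_event_def le_Suc_eq algebra_simps)
  have e2: "skeleton_event n = {\<omega>\<in>space N. (\<lambda>u\<in>{0..real n * h}. K u \<omega>) \<in> A \<and> K (real n * h) \<omega> = \<kappa> n}"
    unfolding inA by (auto simp: skeleton_event_def)
  show ?case
    unfolding e1 using K_markov[OF _ _ A, of h "\<kappa> n" "\<kappa> (Suc n)"] h_pos Suc
    by (simp add: e2[symmetric])
qed

text \<open>
  The event concerns only the chain and the exponential, on this event, only the Levy and jump
  ingredients; both expectations are products over the steps.
\<close>

lemma expectation_skeleton_event:
  "(\<integral>\<omega>. indicator (skeleton_event n) \<omega> * exp (- weighted_value Y U h th \<kappa> n \<omega>) \<partial>N) =
    (if \<kappa> 0 = i0 then exp (- (h * laplace_exponent (d i0) (\<nu> i0) (th 0))) else 0) *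
    (\<Prod>b<n. matrix_exp (h *\<^sub>R Q) $ (\<kappa> b) $ (\<kappa> (Suc b)) * step_laplace d \<nu> G h (th (Suc b)) (\<kappa> b) (\<kappa> (Suc b)))"
proof -
  define W where "W g \<omega> = (if g = Chain then indicator (skeleton_event n) \<omega> else path_factor Y U h th \<kappa> n g \<omega>)" for g \<omega>
  have Wc: "W Chain = indicator (skeleton_event n)" by (simp add: W_def fun_eq_iff)
  have Wo: "W g = path_factor Y U h th \<kappa> n g" if "g \<noteq> Chain" for g using that by (simp add: W_def fun_eq_iff)
  have ev: "skeleton_event n \<in> events"
    using skeleton_event_alg ma_indep unfolding indep_sets_def ingredient_events_eq by blast
  have "(\<integral>\<omega>. (\<Prod>g\<in>insert Chain (used_ingredients n). W g \<omega>) \<partial>N) =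
      (\<Prod>g\<in>insert Chain (used_ingredients n). \<integral>\<omega>. W g \<omega> \<partial>N)"
  proof (rule ingredient_expectation)
    show "W g \<in> borel_measurable (ingredient_algebra N K Y U g)" for g
      using skeleton_event_alg path_factor_alg by (cases "g = Chain") (simp_all add: Wc Wo)
    show "integrable N (W g)" for g
      using ev path_factor_integrable by (cases "g = Chain") (simp_all add: Wc Wo emeasure_eq_measure)
  qed simp
  also have "(\<lambda>\<omega>. \<Prod>g\<in>insert Chain (used_ingredients n). W g \<omega>) =
      (\<lambda>\<omega>. indicator (skeleton_event n) \<omega> * exp (- weighted_value Y U h th \<kappa> n \<omega>))"
  proof
    fix \<omega>
    have "(\<Prod>g\<in>used_ingredients n. W g \<omega>) = (\<Prod>g\<in>used_ingredients n. path_factor Y U h th \<kappa> n g \<omega>)"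
      by (intro prod.cong refl) (metis Wo used_ingredients_iff(3))
    then show "(\<Prod>g\<in>insert Chain (used_ingredients n). W g \<omega>) =
        indicator (skeleton_event n) \<omega> * exp (- weighted_value Y U h th \<kappa> n \<omega>)"
      by (simp add: Wc prod_path_factor)
  qed
  also have "(\<Prod>g\<in>insert Chain (used_ingredients n). \<integral>\<omega>. W g \<omega> \<partial>N) =
      prob (skeleton_event n) * (\<Prod>g\<in>used_ingredients n. \<integral>\<omega>. path_factor Y U h th \<kappa> n g \<omega> \<partial>N)"
  proof -
    have "(\<Prod>g\<in>used_ingredients n. \<integral>\<omega>. W g \<omega> \<partial>N) = (\<Prod>g\<in>used_ingredients n. \<integral>\<omega>. path_factor Y U h th \<kappa> n g \<omega> \<partial>N)"
      by (intro prod.cong refl) (metis Wo used_ingredients_iff(3))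
    then show ?thesis using ev by (simp add: Wc)
  qed
  finally show ?thesis
    unfolding expectation_path[OF order_refl] prob_skeleton_event by (simp add: prod.distrib)
qed

end

end

lemma grid_value_cong:
  assumes "\<And>c. c \<le> b \<Longrightarrow> \<kappa> c = \<kappa>' c"
  shows "grid_value y u h \<kappa> b = grid_value y u h \<kappa>' b"
proof -
  have "change_count \<kappa> b = change_count \<kappa>' b \<and> last_change \<kappa> b = last_change \<kappa>' b
      \<and> change_value y u h \<kappa> b = change_value y u h \<kappa>' b"
    using assms by (induction b) auto
  with assms show ?thesis by (simp add: grid_value_def)
qed

lemma weighted_value_cong:
  assumes "\<And>c. c \<le> n \<Longrightarrow> \<kappa> c = \<kappa>' c"
  shows "weighted_value Y U h th \<kappa> n \<omega> = weighted_value Y U h th \<kappa>' n \<omega>"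
proof -
  have eq: "path_grid_value Y U h \<kappa> b \<omega> = path_grid_value Y U h \<kappa>' b \<omega>" if "b \<le> n" for b
    using that assms by (intro grid_value_cong) auto
  show ?thesis
    unfolding weighted_value_def by (intro arg_cong2[where f="(+)"] sum.cong) (auto simp: eq)
qed

lemma weighted_value_two_weights:
  assumes "a \<le> n"
  shows "weighted_value Y U h (\<lambda>c. if c \<le> a then l else \<theta>) \<kappa> n \<omega> =
    l * path_grid_value Y U h \<kappa> a \<omega> + \<theta> * (path_grid_value Y U h \<kappa> n \<omega> - path_grid_value Y U h \<kappa> a \<omega>)"
  using assms
proof (induction n rule: dec_induct)
  case base
  have "(\<Sum>b<a. (if Suc b \<le> a then l else \<theta>) * (path_grid_value Y U h \<kappa> (Suc b) \<omega> - path_grid_value Y U h \<kappa> b \<omega>))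
      = l * (\<Sum>b<a. path_grid_value Y U h \<kappa> (Suc b) \<omega> - path_grid_value Y U h \<kappa> b \<omega>)"
    by (simp add: sum_distrib_left)
  then show ?case by (simp add: weighted_value_def sum_lessThan_telescope algebra_simps)
next
  case (step n)
  then show ?case by (simp add: weighted_value_def algebra_simps)
qed

primrec matrix_path :: "(nat \<Rightarrow> real^'n^'n) \<Rightarrow> nat \<Rightarrow> real^'n^'n" where
  "matrix_path A 0 = mat 1"
| "matrix_path A (Suc n) = matrix_path A n ** A n"

lemma sum_PiE_insert:
  fixes F :: "('a \<Rightarrow> 'b::finite) \<Rightarrow> real"
  assumes x: "x \<notin> S"
  shows "(\<Sum>\<kappa>\<in>insert x S \<rightarrow>\<^sub>E UNIV. F \<kappa>) = (\<Sum>g\<in>S \<rightarrow>\<^sub>E UNIV. \<Sum>y\<in>UNIV. F (g(x := y)))"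
proof -
  have "(\<Sum>\<kappa>\<in>insert x S \<rightarrow>\<^sub>E UNIV. F \<kappa>) = (\<Sum>z\<in>UNIV \<times> (S \<rightarrow>\<^sub>E UNIV). F ((\<lambda>(y, g). g(x := y)) z))"
    unfolding PiE_insert_eq by (subst sum.reindex[OF inj_combinator[OF x]]) simp
  also have "\<dots> = (\<Sum>y\<in>UNIV. \<Sum>g\<in>S \<rightarrow>\<^sub>E UNIV. F (g(x := y)))"
    by (simp add: sum.cartesian_product case_prod_beta)
  also have "\<dots> = (\<Sum>g\<in>S \<rightarrow>\<^sub>E UNIV. \<Sum>y\<in>UNIV. F (g(x := y)))" by (rule sum.swap)
  finally show ?thesis .
qed

text \<open>A product of matrices as a sum over discrete paths.\<close>

lemma matrix_path_eq_sum:
  fixes A :: "nat \<Rightarrow> real^'n::finite^'n"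
  shows "(\<Sum>\<kappa>\<in>{..n} \<rightarrow>\<^sub>E UNIV. if \<kappa> n = k then (if \<kappa> 0 = i then 1 else 0) * (\<Prod>b<n. A b $ \<kappa> b $ \<kappa> (Suc b)) else 0)
    = matrix_path A n $ i $ k"
proof (induction n arbitrary: k)
  case 0
  have "{..0::nat} = insert 0 {}" by auto
  then show ?case by (simp only: sum_PiE_insert empty_iff not_False_eq_True) (simp add: mat_def)
next
  case (Suc n)
  let ?S = "{..n} \<rightarrow>\<^sub>E (UNIV::'n set)"
  let ?F = "\<lambda>\<kappa> n k. if \<kappa> n = k then (if \<kappa> 0 = i then 1 else 0) * (\<Prod>b<n. A b $ \<kappa> b $ \<kappa> (Suc b)) else (0::real)"
  have fin: "finite ?S" by (intro finite_PiE) auto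
  have upd: "?F (g(Suc n := y)) (Suc n) k =
      (if y = k then (if g 0 = i then 1 else 0) * (\<Prod>b<n. A b $ g b $ g (Suc b)) * (A n $ g n $ k) else 0)" for g y
  proof -
    have "(\<Prod>b<n. A b $ (g(Suc n := y)) b $ (g(Suc n := y)) (Suc b)) = (\<Prod>b<n. A b $ g b $ g (Suc b))"
      by (intro prod.cong) auto
    then show ?thesis by simp
  qed
  have "(\<Sum>\<kappa>\<in>{..Suc n} \<rightarrow>\<^sub>E UNIV. ?F \<kappa> (Suc n) k) = (\<Sum>g\<in>?S. \<Sum>y\<in>UNIV. ?F (g(Suc n := y)) (Suc n) k)"
    unfolding atMost_Suc by (rule sum_PiE_insert) simp
  also have "\<dots> = (\<Sum>g\<in>?S. (if g 0 = i then 1 else 0) * (\<Prod>b<n. A b $ g b $ g (Suc b)) * (A n $ g n $ k))"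
    unfolding upd by simp
  also have "\<dots> = (\<Sum>g\<in>?S. \<Sum>j\<in>UNIV. ?F g n j * A n $ j $ k)"
  proof (rule sum.cong[OF refl])
    fix g
    have "(\<Sum>j\<in>UNIV. ?F g n j * A n $ j $ k) =
        (\<Sum>j\<in>UNIV. if j = g n then (if g 0 = i then 1 else 0) * (\<Prod>b<n. A b $ g b $ g (Suc b)) * A n $ j $ k else 0)"
      by (intro sum.cong) auto
    then show "(if g 0 = i then 1 else 0) * (\<Prod>b<n. A b $ g b $ g (Suc b)) * (A n $ g n $ k) =
        (\<Sum>j\<in>UNIV. ?F g n j * A n $ j $ k)" by simp
  qed
  also have "\<dots> = (\<Sum>j\<in>UNIV. matrix_path A n $ i $ j * A n $ j $ k)"
    by (subst sum.swap) (simp add: sum_distrib_right[symmetric] Suc)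
  also have "\<dots> = matrix_path A (Suc n) $ i $ k" by (simp add: matrix_matrix_mult_def)
  finally show ?case .
qed

lemma matrix_path_two_weights:
  "matrix_path (\<lambda>b. if b < a then A else B) (a + n) = mat_pow A a ** mat_pow B n"
proof (induction n)
  case 0
  have "b \<le> a \<Longrightarrow> matrix_path (\<lambda>b. if b < a then A else B) b = mat_pow A b" for b
    by (induction b) (simp_all add: mat_pow_Suc2)
  then show ?case by simp
next
  case (Suc n)
  then show ?case by (simp add: mat_pow_Suc2 matrix_mul_assoc)
qed

definition skeleton_matrix ::
  "real^'n^'n \<Rightarrow> ('n::finite \<Rightarrow> real) \<Rightarrow> ('n \<Rightarrow> real measure) \<Rightarrow> ('n \<Rightarrow> 'n \<Rightarrow> real measure) \<Rightarrow> real \<Rightarrow> real \<Rightarrow> real^'n^'n" where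
  "skeleton_matrix Q d \<nu> G h \<theta> = (\<chi> i j. matrix_exp (h *\<^sub>R Q) $ i $ j * step_laplace d \<nu> G h \<theta> i j)"

context
  fixes N :: "'v measure" and i0 :: "'n::finite" and Q :: "real^'n^'n" and d :: "'n \<Rightarrow> real"
    and \<nu> :: "'n \<Rightarrow> real measure" and G :: "'n \<Rightarrow> 'n \<Rightarrow> real measure"
    and K :: "real \<Rightarrow> 'v \<Rightarrow> 'n" and Y :: "nat \<Rightarrow> 'n \<Rightarrow> real \<Rightarrow> 'v \<Rightarrow> real" and U :: "nat \<Rightarrow> 'n \<Rightarrow> 'n \<Rightarrow> 'v \<Rightarrow> real"
  assumes ing: "ma_ingredients N i0 Q d \<nu> G K Y U" and char: "ma_characteristics Q d \<nu> G"
begin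

interpretation prob_space N by (rule ma_prob_space[OF ing char])

lemmas Km = K_measurable[OF ing char] and Ym = Y_measurable[OF ing char] and Um = ma_jump(1)[OF ing char]

lemma path_grid_value_measurable:
  assumes h: "0 < h"
  shows "path_grid_value Y U h \<kappa> b \<in> borel_measurable N"
proof -
  have arg: "0 \<le> real a * h + h" for a using h by simp
  have "(\<lambda>\<omega>. change_value (\<lambda>m i s. Y m i s \<omega>) (\<lambda>m i j. U m i j \<omega>) h \<kappa> b) \<in> borel_measurable N"
  proof (induction b)
    case (Suc b)
    then show ?case
      using Um Ym[OF arg] by (cases "\<kappa> (Suc b) = \<kappa> b") (simp_all del: of_nat_Suc of_nat_diff)
  qed simp
  then show ?thesis unfolding grid_value_def using Ym[OF arg] by simp
qed

text \<open>Splitting according to the finitely many discrete paths that the chain can follow on the grid.\<close>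

lemma skeleton_decomposition:
  fixes f :: "(nat \<Rightarrow> 'n) \<Rightarrow> 'v \<Rightarrow> real"
  assumes cong: "\<And>\<kappa> \<kappa>' \<omega>. (\<And>c. c \<le> n \<Longrightarrow> \<kappa> c = \<kappa>' c) \<Longrightarrow> f \<kappa> \<omega> = f \<kappa>' \<omega>" and \<omega>: "\<omega> \<in> space N"
  shows "f (\<lambda>c. K (real c * h) \<omega>) \<omega> =
    (\<Sum>\<kappa>\<in>{..n} \<rightarrow>\<^sub>E UNIV. indicator {\<omega>\<in>space N. \<forall>b\<le>n. K (real b * h) \<omega> = \<kappa> b} \<omega> * f \<kappa> \<omega>)"
proof -
  define \<kappa>0 where "\<kappa>0 = restrict (\<lambda>c. K (real c * h) \<omega>) {..n}"
  have in_S: "\<kappa>0 \<in> {..n} \<rightarrow>\<^sub>E UNIV" by (simp add: \<kappa>0_def)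
  have fin: "finite ({..n} \<rightarrow>\<^sub>E (UNIV::'n set))" by (intro finite_PiE) auto
  have "(\<Sum>\<kappa>\<in>{..n} \<rightarrow>\<^sub>E UNIV. indicator {\<omega>\<in>space N. \<forall>b\<le>n. K (real b * h) \<omega> = \<kappa> b} \<omega> * f \<kappa> \<omega>)
      = (\<Sum>\<kappa>\<in>{..n} \<rightarrow>\<^sub>E UNIV. if \<kappa> = \<kappa>0 then f \<kappa> \<omega> else 0)"
  proof (rule sum.cong[OF refl])
    fix \<kappa> assume \<kappa>: "\<kappa> \<in> {..n} \<rightarrow>\<^sub>E (UNIV::'n set)"
    have "(\<forall>b\<le>n. K (real b * h) \<omega> = \<kappa> b) \<longleftrightarrow> \<kappa> = \<kappa>0"
      using \<kappa> in_S by (auto simp: \<kappa>0_def intro!: PiE_ext[OF \<kappa> in_S[unfolded \<kappa>0_def]])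
    then show "indicator {\<omega>\<in>space N. \<forall>b\<le>n. K (real b * h) \<omega> = \<kappa> b} \<omega> * f \<kappa> \<omega> = (if \<kappa> = \<kappa>0 then f \<kappa> \<omega> else 0)"
      using \<omega> by (auto simp: indicator_def)
  qed
  also have "\<dots> = f \<kappa>0 \<omega>" using fin in_S by simp
  also have "\<dots> = f (\<lambda>c. K (real c * h) \<omega>) \<omega>" by (rule cong) (simp add: \<kappa>0_def)
  finally show ?thesis by simp
qed

lemma skeleton_event_measurable:
  assumes "0 < h" shows "{\<omega>\<in>space N. \<forall>b\<le>n. K (real b * h) \<omega> = \<kappa> b} \<in> sets N"
proof -
  have "{\<omega>\<in>space N. \<forall>b\<in>{..n}. K (real b * h) \<omega> = \<kappa> b} \<in> sets N"
  proof (intro sets.sets_Collect_finite_All)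
    fix b
    have "K (real b * h) -` {\<kappa> b} \<inter> space N \<in> sets N"
      by (rule measurable_sets[OF Km]) (use assms in auto)
    then show "{\<omega>\<in>space N. K (real b * h) \<omega> = \<kappa> b} \<in> sets N" by (simp add: vimage_def Int_def conj_commute)
  qed simp
  then show ?thesis by (simp only: Ball_def atMost_iff)
qed

lemma skeleton_functional_measurable:
  fixes f :: "(nat \<Rightarrow> 'n) \<Rightarrow> 'v \<Rightarrow> real"
  assumes cong: "\<And>\<kappa> \<kappa>' \<omega>. (\<And>c. c \<le> n \<Longrightarrow> \<kappa> c = \<kappa>' c) \<Longrightarrow> f \<kappa> \<omega> = f \<kappa>' \<omega>" and h: "0 < h"
    and f: "\<And>\<kappa>. f \<kappa> \<in> borel_measurable N"
  shows "(\<lambda>\<omega>. f (\<lambda>c. K (real c * h) \<omega>) \<omega>) \<in> borel_measurable N"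
proof -
  let ?g = "\<lambda>\<omega>. \<Sum>\<kappa>\<in>{..n} \<rightarrow>\<^sub>E UNIV. indicator {\<omega>\<in>space N. \<forall>b\<le>n. K (real b * h) \<omega> = \<kappa> b} \<omega> * f \<kappa> \<omega>"
  have "?g \<in> borel_measurable N"
    using skeleton_event_measurable[OF h] f by (intro borel_measurable_sum borel_measurable_times borel_measurable_indicator)
  moreover have "f (\<lambda>c. K (real c * h) \<omega>) \<omega> = ?g \<omega>" if "\<omega> \<in> space N" for \<omega>
    by (rule skeleton_decomposition) (use cong that in blast)+
  ultimately show ?thesis using measurable_cong[of N "\<lambda>\<omega>. f (\<lambda>c. K (real c * h) \<omega>) \<omega>" ?g] by blast
qed

lemma ma_path_fst_measurable:
  assumes t: "0 \<le> t"
  shows "(\<lambda>\<omega>. fst (ma_path K Y U t \<omega>)) \<in> borel_measurable N"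
proof -
  define h where "h p = (if t = 0 then 1 else t) / 2 ^ p" for p :: nat
  define b where "b p = (if t = 0 then 0 else 2 ^ p :: nat)" for p :: nat
  have h: "0 < h p" for p using t by (simp add: h_def)
  have "(\<lambda>p. (if t = 0 then 1 else t) * (1 / 2) ^ p) \<longlonglongrightarrow> (if t = 0 then 1 else t) * 0"
    by (intro tendsto_mult tendsto_const LIMSEQ_realpow_zero) auto
  then have h0: "h \<longlonglongrightarrow> 0" by (simp add: h_def[abs_def] power_divide)
  have b: "real (b p) * h p = t" for p by (simp add: b_def h_def)
  show ?thesis
  proof (rule borel_measurable_LIMSEQ_real)
    show "(\<lambda>p. path_grid_value Y U (h p) (\<lambda>c. K (real c * h p) \<omega>) (b p) \<omega>) \<longlonglongrightarrow> fst (ma_path K Y U t \<omega>)"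
      if "\<omega> \<in> space N" for \<omega>
      by (rule grid_value_tendsto_ma_path[where K=K and Y=Y and U=U and \<omega>=\<omega>])
        (use that K_cadlag[OF ing char that] Y_right_continuous[OF ing char that] t h h0 b in auto)
    show "(\<lambda>\<omega>. path_grid_value Y U (h p) (\<lambda>c. K (real c * h p) \<omega>) (b p) \<omega>) \<in> borel_measurable N" for p
      by (rule skeleton_functional_measurable[where n="b p" and f="\<lambda>\<kappa> \<omega>. path_grid_value Y U (h p) \<kappa> (b p) \<omega>"])
        (use h path_grid_value_measurable in \<open>auto intro: grid_value_cong\<close>)
  qed
qed

lemma snd_ma_path: "snd (ma_path K Y U t \<omega>) = K t \<omega>"
  by (simp add: ma_path_def Let_def)

lemma ma_path_measurable:
  assumes "0 \<le> t"
  shows "ma_path K Y U t \<in> N \<rightarrow>\<^sub>M state_space"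
proof -
  have "(\<lambda>\<omega>. (fst (ma_path K Y U t \<omega>), K t \<omega>)) \<in> N \<rightarrow>\<^sub>M state_space"
    using ma_path_fst_measurable[OF assms] Km[OF assms] by (rule measurable_Pair)
  then show ?thesis by (simp add: snd_ma_path[symmetric])
qed

lemma ma_path_0: "\<omega> \<in> space N \<Longrightarrow> fst (ma_path K Y U 0 \<omega>) = 0"
proof -
  assume \<omega>: "\<omega> \<in> space N"
  have "jump_set K \<omega> \<inter> {..0} = {}" by (auto simp: jump_set_def)
  then show ?thesis using Y_zero[OF ing char \<omega>] by (simp add: ma_path_def jump_count_def Let_def)
qed

text \<open>Skeletons with step size \<open>1 / (q * 2 ^ p)\<close>.\<close>

context
  fixes q :: nat and h :: "nat \<Rightarrow> real"
  assumes q: "0 < q" and h: "\<And>p. h p = 1 / real (q * 2 ^ p)"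
begin

lemma hp: "0 < h p" "h \<longlonglongrightarrow> 0"
proof -
  show "0 < h p" using q by (simp add: h)
  have "(\<lambda>p. 1 / real q * (1 / 2) ^ p) \<longlonglongrightarrow> 1 / real q * 0"
    by (intro tendsto_mult tendsto_const LIMSEQ_realpow_zero) auto
  then show "h \<longlonglongrightarrow> 0" by (simp add: h[abs_def] power_divide)
qed

lemma skeleton_time: "real (m * 2 ^ p) * h p = real m / real q"
  using q by (simp add: h)

lemma skeleton_tendsto:
  "\<omega> \<in> space N \<Longrightarrow> (\<lambda>p. path_grid_value Y U (h p) (\<lambda>c. K (real c * h p) \<omega>) (m * 2 ^ p) \<omega>)
    \<longlonglongrightarrow> fst (ma_path K Y U (real m / real q) \<omega>)"
  by (rule grid_value_tendsto_ma_path[where K=K and Y=Y and U=U and \<omega>=\<omega>])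
    (use K_cadlag[OF ing char] Y_right_continuous[OF ing char] hp skeleton_time in auto)

lemma path_grid_value_mono:
  assumes \<omega>: "\<omega> \<in> space N" "\<forall>m i j. 0 \<le> U m i j \<omega>" and ab: "a \<le> b"
  shows "path_grid_value Y U (h p) \<kappa> a \<omega> \<le> path_grid_value Y U (h p) \<kappa> b \<omega>"
  using ab
proof (induction b rule: dec_induct)
  case (step b)
  have q2: "0 < q * 2 ^ p" using q by simp
  have "\<bar>\<Prod>g\<in>used_ingredients (Suc b). step_factor Y U (h p) (\<lambda>_. 1) \<kappa> b g \<omega>\<bar> \<le> 1"
    unfolding abs_prod
    by (intro prod_le_1 conjI abs_ge_zero factor_bounds(4)[OF ing char q2 h _ \<omega>]) auto
  then have "path_grid_value Y U (h p) \<kappa> b \<omega> \<le> path_grid_value Y U (h p) \<kappa> (Suc b) \<omega>"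
    by (simp add: prod_step_factor)
  with step show ?case by simp
qed simp

lemma ma_path_mono:
  "AE \<omega> in N. fst (ma_path K Y U (real m / real q) \<omega>) \<le> fst (ma_path K Y U (real (Suc m) / real q) \<omega>)"
  using U_nonneg[OF ing char] AE_space
proof eventually_elim
  case (elim \<omega>)
  show ?case
    by (rule LIMSEQ_le[OF skeleton_tendsto[OF elim(2)] skeleton_tendsto[OF elim(2)]])
      (use path_grid_value_mono[OF elim(2,1)] in auto)
qed

lemma exp_weighted_value_le_1:
  assumes \<omega>: "\<omega> \<in> space N" "\<forall>m i j. 0 \<le> U m i j \<omega>" and th: "\<And>b. 0 \<le> th b"
  shows "exp (- weighted_value Y U (h p) th \<kappa> n \<omega>) \<le> 1"
proof -
  have q2: "0 < q * 2 ^ p" using q by simp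
  have "\<bar>\<Prod>g\<in>used_ingredients n. path_factor Y U (h p) th \<kappa> n g \<omega>\<bar> \<le> 1"
    unfolding abs_prod
    by (intro prod_le_1 conjI abs_ge_zero factor_bounds(5)[OF ing char q2 h th \<omega>])
  then show ?thesis by (simp add: prod_path_factor)
qed

lemma weighted_value_measurable: "weighted_value Y U (h p) th \<kappa> n \<in> borel_measurable N"
  unfolding weighted_value_def[abs_def] using path_grid_value_measurable[OF hp(1)]
  by (intro borel_measurable_add borel_measurable_sum borel_measurable_times borel_measurable_diff) auto

text \<open>Summing the expectations over all discrete paths turns them into entries of a matrix product.\<close>

lemma skeleton_laplace:
  assumes th: "\<And>b. 0 \<le> th b"
  shows "(\<integral>\<omega>. (if K (real n * h p) \<omega> = k then 1 else 0) * exp (- weighted_value Y U (h p) th (\<lambda>c. K (real c * h p) \<omega>) n \<omega>) \<partial>N)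
    = exp (- (h p * laplace_exponent (d i0) (\<nu> i0) (th 0))) *
      matrix_path (\<lambda>b. skeleton_matrix Q d \<nu> G (h p) (th (Suc b))) n $ i0 $ k"
proof -
  have q2: "0 < q * 2 ^ p" using q by simp
  define E where "E \<kappa> = {\<omega>\<in>space N. \<forall>b\<le>n. K (real b * h p) \<omega> = \<kappa> b}" for \<kappa>
  define f where "f \<kappa> \<omega> = (if \<kappa> n = k then 1 else 0) * exp (- weighted_value Y U (h p) th \<kappa> n \<omega>)" for \<kappa> \<omega>
  have f_cong: "f \<kappa> \<omega> = f \<kappa>' \<omega>" if "\<And>c. c \<le> n \<Longrightarrow> \<kappa> c = \<kappa>' c" for \<kappa> \<kappa>' \<omega>
  proof -
    have "weighted_value Y U (h p) th \<kappa> n \<omega> = weighted_value Y U (h p) th \<kappa>' n \<omega>"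
      by (rule weighted_value_cong) (rule that)
    then show ?thesis using that[of n] by (simp add: f_def)
  qed
  have fm: "f \<kappa> \<in> borel_measurable N" for \<kappa>
    unfolding f_def[abs_def] using weighted_value_measurable by (intro borel_measurable_times) auto
  have Em: "E \<kappa> \<in> sets N" for \<kappa> unfolding E_def by (rule skeleton_event_measurable[OF hp(1)])
  have int: "integrable N (\<lambda>\<omega>. indicator (E \<kappa>) \<omega> * f \<kappa> \<omega>)" for \<kappa>
  proof (rule integrable_const_bound[of _ 1])
    show "AE \<omega> in N. norm (indicator (E \<kappa>) \<omega> * f \<kappa> \<omega>) \<le> 1"
      using U_nonneg[OF ing char] AE_space
    proof eventually_elim
      case (elim \<omega>)
      then show ?case using exp_weighted_value_le_1[where p=p and \<kappa>=\<kappa> and n=n, OF elim(2,1) th]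
        by (auto simp: f_def indicator_def)
    qed
    show "(\<lambda>\<omega>. indicator (E \<kappa>) \<omega> * f \<kappa> \<omega>) \<in> borel_measurable N" using Em fm by simp
  qed
  have "(\<integral>\<omega>. f (\<lambda>c. K (real c * h p) \<omega>) \<omega> \<partial>N) =
      (\<integral>\<omega>. (\<Sum>\<kappa>\<in>{..n} \<rightarrow>\<^sub>E UNIV. indicator (E \<kappa>) \<omega> * f \<kappa> \<omega>) \<partial>N)"
    unfolding E_def
    by (rule Bochner_Integration.integral_cong[OF refl]) (rule skeleton_decomposition, rule f_cong)
  also have "\<dots> = (\<Sum>\<kappa>\<in>{..n} \<rightarrow>\<^sub>E UNIV. \<integral>\<omega>. indicator (E \<kappa>) \<omega> * f \<kappa> \<omega> \<partial>N)"
    using int by (rule Bochner_Integration.integral_sum)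
  also have "\<dots> = (\<Sum>\<kappa>\<in>{..n} \<rightarrow>\<^sub>E UNIV. exp (- (h p * laplace_exponent (d i0) (\<nu> i0) (th 0))) *
      (if \<kappa> n = k then (if \<kappa> 0 = i0 then 1 else 0) *
        (\<Prod>b<n. skeleton_matrix Q d \<nu> G (h p) (th (Suc b)) $ \<kappa> b $ \<kappa> (Suc b)) else 0))"
  proof (rule sum.cong[OF refl])
    fix \<kappa> assume "\<kappa> \<in> {..n} \<rightarrow>\<^sub>E (UNIV::'n set)"
    have "(\<integral>\<omega>. indicator (E \<kappa>) \<omega> * exp (- weighted_value Y U (h p) th \<kappa> n \<omega>) \<partial>N) =
      (if \<kappa> 0 = i0 then exp (- (h p * laplace_exponent (d i0) (\<nu> i0) (th 0))) else 0) *
      (\<Prod>b<n. skeleton_matrix Q d \<nu> G (h p) (th (Suc b)) $ \<kappa> b $ \<kappa> (Suc b))"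
      using expectation_skeleton_event[where n=n and \<kappa>=\<kappa>, OF ing char q2 h[of p] th]
      by (simp add: skeleton_event_def[OF ing char q2 h th] E_def skeleton_matrix_def)
    then show "(\<integral>\<omega>. indicator (E \<kappa>) \<omega> * f \<kappa> \<omega> \<partial>N) =
      exp (- (h p * laplace_exponent (d i0) (\<nu> i0) (th 0))) *
      (if \<kappa> n = k then (if \<kappa> 0 = i0 then 1 else 0) *
        (\<Prod>b<n. skeleton_matrix Q d \<nu> G (h p) (th (Suc b)) $ \<kappa> b $ \<kappa> (Suc b)) else 0)"
      by (simp add: f_def)
  qed
  also have "\<dots> = exp (- (h p * laplace_exponent (d i0) (\<nu> i0) (th 0))) *
      matrix_path (\<lambda>b. skeleton_matrix Q d \<nu> G (h p) (th (Suc b))) n $ i0 $ k"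
    by (simp only: sum_distrib_left[symmetric] matrix_path_eq_sum)
  finally show ?thesis by (simp add: f_def)
qed

text \<open>
  Dominated convergence along refined grids, with weight \<open>l\<close> up to time \<open>m / q\<close> and \<open>\<theta>\<close> in the next interval.
\<close>

lemma ma_two_time_laplace_limit:
  assumes l: "0 \<le> l" and \<theta>: "0 \<le> \<theta>"
  shows "(\<lambda>p. exp (- (h p * laplace_exponent (d i0) (\<nu> i0) l)) *
      (mat_pow (skeleton_matrix Q d \<nu> G (h p) l) (m * 2 ^ p) ** mat_pow (skeleton_matrix Q d \<nu> G (h p) \<theta>) (2 ^ p)) $ i0 $ k)
    \<longlonglongrightarrow> (\<integral>\<omega>. (if snd (ma_path K Y U (real (Suc m) / real q) \<omega>) = k then 1 else 0) *
        exp (- (l * fst (ma_path K Y U (real m / real q) \<omega>) +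
          \<theta> * (fst (ma_path K Y U (real (Suc m) / real q) \<omega>) - fst (ma_path K Y U (real m / real q) \<omega>)))) \<partial>N)"
proof -
  define th where "th p c = (if c \<le> m * 2 ^ p then l else \<theta>)" for p c
  have th: "0 \<le> th p c" for p c using l \<theta> by (simp add: th_def)
  define W where "W p \<omega> = weighted_value Y U (h p) (th p) (\<lambda>c. K (real c * h p) \<omega>) (Suc m * 2 ^ p) \<omega>" for p \<omega>
  define H where "H j \<omega> = fst (ma_path K Y U (real j / real q) \<omega>)" for j \<omega>
  have K_meas: "K (real (Suc m) / real q) \<in> N \<rightarrow>\<^sub>M count_space UNIV" by (rule Km) simp
  have ind: "(\<lambda>\<omega>. if K (real (Suc m) / real q) \<omega> = k then 1 else 0 :: real) \<in> borel_measurable N"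
    by (rule measurable_compose[OF K_meas]) simp
  have lim: "(\<lambda>p. \<integral>\<omega>. (if K (real (Suc m) / real q) \<omega> = k then 1 else 0) * exp (- W p \<omega>) \<partial>N) \<longlonglongrightarrow>
     (\<integral>\<omega>. (if K (real (Suc m) / real q) \<omega> = k then 1 else 0) * exp (- (l * H m \<omega> + \<theta> * (H (Suc m) \<omega> - H m \<omega>))) \<partial>N)"
  proof (rule integral_dominated_convergence[where w="\<lambda>_. 1"])
    show "(\<lambda>\<omega>. (if K (real (Suc m) / real q) \<omega> = k then 1 else 0) * exp (- (l * H m \<omega> + \<theta> * (H (Suc m) \<omega> - H m \<omega>))))
        \<in> borel_measurable N"
      using ind ma_path_fst_measurable[of "real m / real q"] ma_path_fst_measurable[of "real (Suc m) / real q"]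
      by (simp add: H_def)
    have "W p \<in> borel_measurable N" for p
      unfolding W_def[abs_def]
      by (rule skeleton_functional_measurable[where n="Suc m * 2 ^ p" and
            f="\<lambda>\<kappa> \<omega>. weighted_value Y U (h p) (th p) \<kappa> (Suc m * 2 ^ p) \<omega>"])
        (use hp weighted_value_measurable in \<open>auto intro: weighted_value_cong\<close>)
    then show "(\<lambda>\<omega>. (if K (real (Suc m) / real q) \<omega> = k then 1 else 0) * exp (- W p \<omega>)) \<in> borel_measurable N" for p
      using ind by simp
    show "AE \<omega> in N. norm ((if K (real (Suc m) / real q) \<omega> = k then 1 else 0) * exp (- W p \<omega>)) \<le> 1" for p
      using U_nonneg[OF ing char] AE_space
    proof eventually_elim
      case (elim \<omega>)
      then show ?case using exp_weighted_value_le_1[OF elim(2,1) th] by (auto simp: W_def)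
    qed
    show "AE \<omega> in N. (\<lambda>p. (if K (real (Suc m) / real q) \<omega> = k then 1 else 0) * exp (- W p \<omega>)) \<longlonglongrightarrow>
        (if K (real (Suc m) / real q) \<omega> = k then 1 else 0) * exp (- (l * H m \<omega> + \<theta> * (H (Suc m) \<omega> - H m \<omega>)))"
    proof (intro AE_I2 tendsto_mult tendsto_const tendsto_exp tendsto_minus)
      fix \<omega> assume \<omega>: "\<omega> \<in> space N"
      have W: "W p \<omega> = l * path_grid_value Y U (h p) (\<lambda>c. K (real c * h p) \<omega>) (m * 2 ^ p) \<omega> +
          \<theta> * (path_grid_value Y U (h p) (\<lambda>c. K (real c * h p) \<omega>) (Suc m * 2 ^ p) \<omega>
            - path_grid_value Y U (h p) (\<lambda>c. K (real c * h p) \<omega>) (m * 2 ^ p) \<omega>)" for p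
        unfolding W_def th_def by (rule weighted_value_two_weights) simp
      show "(\<lambda>p. W p \<omega>) \<longlonglongrightarrow> l * H m \<omega> + \<theta> * (H (Suc m) \<omega> - H m \<omega>)"
        unfolding W H_def by (intro tendsto_intros skeleton_tendsto \<omega>)
    qed
  qed simp
  have "(\<integral>\<omega>. (if K (real (Suc m) / real q) \<omega> = k then 1 else 0) * exp (- W p \<omega>) \<partial>N) =
      exp (- (h p * laplace_exponent (d i0) (\<nu> i0) l)) *
      (mat_pow (skeleton_matrix Q d \<nu> G (h p) l) (m * 2 ^ p) ** mat_pow (skeleton_matrix Q d \<nu> G (h p) \<theta>) (2 ^ p)) $ i0 $ k" for p
  proof -
    have eq: "(\<lambda>b. skeleton_matrix Q d \<nu> G (h p) (th p (Suc b))) =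
        (\<lambda>b. if b < m * 2 ^ p then skeleton_matrix Q d \<nu> G (h p) l else skeleton_matrix Q d \<nu> G (h p) \<theta>)"
      by (auto simp: th_def)
    have n: "Suc m * 2 ^ p = m * 2 ^ p + 2 ^ p" by simp
    have t: "real (Suc m) / real q = real (Suc m * 2 ^ p) * h p" by (rule skeleton_time[symmetric])
    show ?thesis
      unfolding W_def t using skeleton_laplace[where th="th p" and n="Suc m * 2 ^ p" and p=p and k=k, OF th]
      unfolding eq unfolding n matrix_path_two_weights by (simp add: th_def)
  qed
  then show ?thesis using lim by (simp add: H_def snd_ma_path)
qed

end

end

section \<open>The generator of the Laplace matrices\<close>

lemma tendsto_matrix_mult:
  fixes A B :: "nat \<Rightarrow> real^'n::finite^'n"
  assumes "\<And>i k. (\<lambda>p. A p $ i $ k) \<longlonglongrightarrow> A' $ i $ k" "\<And>i k. (\<lambda>p. B p $ i $ k) \<longlonglongrightarrow> B' $ i $ k"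
  shows "(\<lambda>p. (A p ** B p) $ i $ k) \<longlonglongrightarrow> (A' ** B') $ i $ k"
  unfolding matrix_matrix_mult_def vec_lambda_beta by (intro tendsto_sum tendsto_mult assms)

lemma tendsto_mat_pow:
  fixes A :: "nat \<Rightarrow> real^'n::finite^'n"
  assumes "\<And>i k. (\<lambda>p. A p $ i $ k) \<longlonglongrightarrow> A' $ i $ k"
  shows "(\<lambda>p. mat_pow (A p) m $ i $ k) \<longlonglongrightarrow> mat_pow A' m $ i $ k"
proof (induction m arbitrary: i k)
  case (Suc m)
  show ?case unfolding mat_pow_Suc by (rule tendsto_matrix_mult[OF assms Suc])
qed simp

lemma tendsto_entry_norm:
  assumes "\<And>i k. (\<lambda>p. A p $ i $ k) \<longlonglongrightarrow> A' $ i $ k"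
  shows "(\<lambda>p. entry_norm (A p)) \<longlonglongrightarrow> entry_norm A'"
  unfolding entry_norm_def using assms by (intro tendsto_sum tendsto_rabs)

lemma matrix_exp_0: "matrix_exp (0 :: real^'n::finite^'n) = mat 1"
proof -
  have "matrix_exp (0 :: real^'n^'n) $ i $ j = mat 1 $ i $ j" for i j
  proof -
    have "(1 / fact k) * mat_pow (0 :: real^'n^'n) k $ i $ j = (if k = 0 then mat 1 $ i $ j else 0)" for k
      by (cases k) (simp_all add: mat_pow_Suc)
    then have "(\<lambda>k. if k = 0 then mat 1 $ i $ j else 0) sums (matrix_exp (0 :: real^'n^'n) $ i $ j)"
      using matrix_exp_entry_sums[of "0 :: real^'n^'n" i j] by simp
    moreover have "(\<lambda>k. if k = 0 then mat 1 $ i $ j else 0) sums (mat 1 :: real^'n^'n) $ i $ j"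
      using sums_single[of 0 "\<lambda>_. mat 1 $ i $ j :: real"] by simp
    ultimately show ?thesis by (rule sums_unique2)
  qed
  then show ?thesis by (simp add: vec_eq_iff)
qed

text \<open>
  The transition matrix has derivative \<open>Q\<close>, and the one-step transforms contribute the Laplace exponents on the
  diagonal and the factors of the jumps off it.
\<close>

lemma skeleton_matrix_derivative:
  assumes char: "ma_characteristics Q d \<nu> G"
  shows "((\<lambda>h. skeleton_matrix Q d \<nu> G h \<theta> $ i $ j) has_real_derivative - matrix_exponent Q d \<nu> G \<theta> $ i $ j) (at 0)"
    and "skeleton_matrix Q d \<nu> G 0 \<theta> = mat 1"
proof -
  note E = matrix_exp_entry_derivative[of Q i j]
  have E0: "matrix_exp (0 *\<^sub>R Q) = mat 1" by (simp add: matrix_exp_0)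
  have L: "((\<lambda>h. exp (- (h * c))) has_real_derivative - c) (at 0)" for c :: real
    by (auto intro!: derivative_eq_intros)
  show "((\<lambda>h. skeleton_matrix Q d \<nu> G h \<theta> $ i $ j) has_real_derivative - matrix_exponent Q d \<nu> G \<theta> $ i $ j) (at 0)"
  proof (cases "i = j")
    case True
    have "G i i = return borel 0" using char by (auto simp: ma_characteristics_def)
    then have "matrix_exponent Q d \<nu> G \<theta> $ i $ j = laplace_exponent (d i) (\<nu> i) \<theta> - Q $ i $ j"
      using True by (simp add: matrix_exponent_def integral_return)
    then show ?thesis
      using DERIV_mult[OF E L[of "laplace_exponent (d i) (\<nu> i) \<theta>"]] True E0
      by (simp add: skeleton_matrix_def step_laplace_def mat_def)
  next
    case False
    define g where "g = (\<integral>y. exp (- \<theta> * y) \<partial>G i j)"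
    have "((\<lambda>h. step_laplace d \<nu> G h \<theta> i j) has_real_derivative
        - (g * laplace_exponent (d i) (\<nu> i) \<theta>) - g * laplace_exponent (d j) (\<nu> j) \<theta>) (at 0)"
      unfolding step_laplace_def g_def[symmetric] using False
      by (auto intro!: derivative_eq_intros L simp: algebra_simps)
    from DERIV_mult[OF E this] show ?thesis
      using False E0 by (simp add: skeleton_matrix_def step_laplace_def mat_def matrix_exponent_def g_def)
  qed
  show "skeleton_matrix Q d \<nu> G 0 \<theta> = mat 1"
    by (simp add: skeleton_matrix_def vec_eq_iff matrix_exp_0 step_laplace_def mat_def)
qed

definition laplace_matrix ::
  "('n::finite \<Rightarrow> 'v measure) \<Rightarrow> ('n \<Rightarrow> real \<Rightarrow> 'v \<Rightarrow> real \<times> 'n) \<Rightarrow> real \<Rightarrow> real \<Rightarrow> real^'n^'n" where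
  "laplace_matrix N X t \<theta> = (\<chi> i k. \<integral>\<omega>. (if snd (X i t \<omega>) = k then 1 else 0) * exp (- (\<theta> * fst (X i t \<omega>))) \<partial>N i)"

context
  fixes N :: "'n::finite \<Rightarrow> 'v measure" and Q :: "real^'n^'n" and d :: "'n \<Rightarrow> real"
    and \<nu> :: "'n \<Rightarrow> real measure" and G :: "'n \<Rightarrow> 'n \<Rightarrow> real measure"
    and K :: "'n \<Rightarrow> real \<Rightarrow> 'v \<Rightarrow> 'n" and Y :: "'n \<Rightarrow> nat \<Rightarrow> 'n \<Rightarrow> real \<Rightarrow> 'v \<Rightarrow> real"
    and U :: "'n \<Rightarrow> nat \<Rightarrow> 'n \<Rightarrow> 'n \<Rightarrow> 'v \<Rightarrow> real"
  assumes char: "ma_characteristics Q d \<nu> G" and ing: "\<And>i. ma_ingredients (N i) i Q d \<nu> G (K i) (Y i) (U i)"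
begin

abbreviation H where "H i \<equiv> ma_path (K i) (Y i) (U i)"

lemma laplace_matrix_limit:
  assumes q: "0 < q" and \<theta>: "0 \<le> \<theta>"
  shows "(\<lambda>p. mat_pow (skeleton_matrix Q d \<nu> G (1 / real (q * 2 ^ p)) \<theta>) (2 ^ p) $ i $ k)
    \<longlonglongrightarrow> laplace_matrix N H (1 / real q) \<theta> $ i $ k"
proof -
  define h where "h p = 1 / real (q * 2 ^ p)" for p :: nat
  define c where "c = laplace_exponent (d i) (\<nu> i) \<theta>"
  have h0: "h \<longlonglongrightarrow> 0" by (rule hp(2)[OF ing char q]) (simp add: h_def)
  have "(\<lambda>p. exp (h p * c)) \<longlonglongrightarrow> exp (0 * c)" by (intro tendsto_exp tendsto_mult h0 tendsto_const)
  moreover have "(\<lambda>p. exp (- (h p * c)) * (mat_pow (skeleton_matrix Q d \<nu> G (h p) \<theta>) (2 ^ p)) $ i $ k)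
      \<longlonglongrightarrow> laplace_matrix N H (1 / real q) \<theta> $ i $ k"
  proof -
    have "(\<integral>\<omega>. (if snd (H i (real (Suc 0) / real q) \<omega>) = k then 1 else 0) *
        exp (- (\<theta> * fst (H i (real 0 / real q) \<omega>) +
          \<theta> * (fst (H i (real (Suc 0) / real q) \<omega>) - fst (H i (real 0 / real q) \<omega>)))) \<partial>N i)
      = laplace_matrix N H (1 / real q) \<theta> $ i $ k"
      unfolding laplace_matrix_def by (simp add: algebra_simps)
    with ma_two_time_laplace_limit[where h=h and m=0 and k=k, OF ing[of i] char q _ \<theta> \<theta>] show ?thesis
      by (simp add: h_def c_def)
  qed
  ultimately have "(\<lambda>p. exp (h p * c) * (exp (- (h p * c)) * (mat_pow (skeleton_matrix Q d \<nu> G (h p) \<theta>) (2 ^ p)) $ i $ k))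
      \<longlonglongrightarrow> exp (0 * c) * laplace_matrix N H (1 / real q) \<theta> $ i $ k" by (rule tendsto_mult)
  then show ?thesis
    by (simp add: h_def mult.assoc[symmetric] exp_add[symmetric])
qed

text \<open>The Markov property of the subordinator at grid times, as a product of matrices.\<close>

lemma two_time_laplace:
  assumes q: "0 < q" and l: "0 \<le> l" and \<theta>: "0 \<le> \<theta>"
  shows "(\<integral>\<omega>. (if snd (H i (real (Suc m) / real q) \<omega>) = k then 1 else 0) *
        exp (- (l * fst (H i (real m / real q) \<omega>) +
          \<theta> * (fst (H i (real (Suc m) / real q) \<omega>) - fst (H i (real m / real q) \<omega>)))) \<partial>N i)
    = (mat_pow (laplace_matrix N H (1 / real q) l) m ** laplace_matrix N H (1 / real q) \<theta>) $ i $ k"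
proof (rule LIMSEQ_unique)
  define h where "h p = 1 / real (q * 2 ^ p)" for p :: nat
  have h0: "h \<longlonglongrightarrow> 0" by (rule hp(2)[OF ing char q]) (simp add: h_def)
  show "(\<lambda>p. exp (- (h p * laplace_exponent (d i) (\<nu> i) l)) *
      (mat_pow (skeleton_matrix Q d \<nu> G (h p) l) (m * 2 ^ p) ** mat_pow (skeleton_matrix Q d \<nu> G (h p) \<theta>) (2 ^ p)) $ i $ k)
    \<longlonglongrightarrow> (\<integral>\<omega>. (if snd (H i (real (Suc m) / real q) \<omega>) = k then 1 else 0) *
        exp (- (l * fst (H i (real m / real q) \<omega>) +
          \<theta> * (fst (H i (real (Suc m) / real q) \<omega>) - fst (H i (real m / real q) \<omega>)))) \<partial>N i)"
    by (rule ma_two_time_laplace_limit[OF ing char q _ l \<theta>]) (simp add: h_def)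
  have "(\<lambda>p. exp (- (h p * laplace_exponent (d i) (\<nu> i) l)) *
      (mat_pow (mat_pow (skeleton_matrix Q d \<nu> G (h p) l) (2 ^ p)) m ** mat_pow (skeleton_matrix Q d \<nu> G (h p) \<theta>) (2 ^ p)) $ i $ k)
    \<longlonglongrightarrow> exp (- (0 * laplace_exponent (d i) (\<nu> i) l)) *
      (mat_pow (laplace_matrix N H (1 / real q) l) m ** laplace_matrix N H (1 / real q) \<theta>) $ i $ k"
    unfolding h_def
    by (intro tendsto_mult tendsto_exp tendsto_minus tendsto_const h0[unfolded h_def] tendsto_matrix_mult
        tendsto_mat_pow laplace_matrix_limit q l \<theta>)
  then show "(\<lambda>p. exp (- (h p * laplace_exponent (d i) (\<nu> i) l)) *
      (mat_pow (skeleton_matrix Q d \<nu> G (h p) l) (m * 2 ^ p) ** mat_pow (skeleton_matrix Q d \<nu> G (h p) \<theta>) (2 ^ p)) $ i $ k)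
    \<longlonglongrightarrow> (mat_pow (laplace_matrix N H (1 / real q) l) m ** laplace_matrix N H (1 / real q) \<theta>) $ i $ k"
    by (simp add: mat_pow_mult)
qed

text \<open>
  The skeleton matrix with step \<open>1 / (q 2\<^sup>p)\<close> is \<open>1 - \<Phi> / (q 2\<^sup>p)\<close> up to a smaller error, so the remainder bound for
  powers applies before the limit \<open>p \<rightarrow> \<infinity>\<close> is taken, uniformly in \<open>q\<close>.
\<close>

lemma laplace_matrix_remainder:
  assumes q: "0 < q" and \<theta>: "0 \<le> \<theta>"
  defines "\<Phi> \<equiv> matrix_exponent Q d \<nu> G \<theta>"
  shows "\<bar>(mat 1 - laplace_matrix N H (1 / real q) \<theta>) $ i $ k - 1 / real q * \<Phi> $ i $ k\<bar>
    \<le> (1 / real q * entry_norm \<Phi>)\<^sup>2 * exp (1 / real q * entry_norm \<Phi>)"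
proof -
  define \<epsilon> where "\<epsilon> = 1 / real q"
  define h where "h p = 1 / real (q * 2 ^ p)" for p :: nat
  have hpos: "0 < h p" for p using q by (simp add: h_def)
  have h0: "h \<longlonglongrightarrow> 0" by (rule hp(2)[OF ing char q]) (simp add: h_def)
  have \<epsilon>: "0 < \<epsilon>" using q by (simp add: \<epsilon>_def)
  (* 2 ^ p steps of size h p make up one interval of length 1 / q *)
  have hp2: "2 ^ p = \<epsilon> / h p" for p using q by (simp add: \<epsilon>_def h_def)
  define S where "S p = skeleton_matrix Q d \<nu> G (h p) \<theta>" for p
  define E where "E p = S p - mat 1" for p
  define B where "B = laplace_matrix N H (1 / real q) \<theta>"
  have SB: "(\<lambda>p. mat_pow (S p) (2 ^ p) $ i $ k) \<longlonglongrightarrow> B $ i $ k" for i k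
    using laplace_matrix_limit[OF q \<theta>] by (simp add: S_def B_def h_def)
  have E_lim: "(\<lambda>p. (2 ^ p *\<^sub>R E p) $ i $ k) \<longlonglongrightarrow> (- \<epsilon> *\<^sub>R \<Phi>) $ i $ k" for i k
  proof -
    have "((\<lambda>h. (skeleton_matrix Q d \<nu> G h \<theta> $ i $ k - mat 1 $ i $ k) / h) \<longlongrightarrow> - \<Phi> $ i $ k) (at 0)"
      using skeleton_matrix_derivative(1)[OF char, of \<theta> i k] skeleton_matrix_derivative(2)[OF char, of \<theta>] unfolding has_field_derivative_iff \<Phi>_def by simp
    moreover have "filterlim h (at 0) sequentially"
      using h0 hpos by (auto simp: filterlim_at intro!: always_eventually less_imp_neq[symmetric])
    ultimately have "(\<lambda>p. (S p $ i $ k - mat 1 $ i $ k) / h p) \<longlonglongrightarrow> - \<Phi> $ i $ k"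
      unfolding S_def by (rule filterlim_compose)
    from tendsto_mult[OF tendsto_const[of \<epsilon>] this] show ?thesis
      by (simp add: E_def hp2 mult.commute)
  qed
  have en: "(\<lambda>p. entry_norm (2 ^ p *\<^sub>R E p)) \<longlonglongrightarrow> \<epsilon> * entry_norm \<Phi>"
  proof -
    have "entry_norm (- \<epsilon> *\<^sub>R \<Phi>) = \<epsilon> * entry_norm \<Phi>" unfolding entry_norm_scaleR using \<epsilon> by simp
    then show ?thesis using tendsto_entry_norm[OF E_lim] by simp
  qed
  have le: "\<bar>(mat_pow (S p) (2 ^ p) $ i $ k - mat 1 $ i $ k) - (2 ^ p *\<^sub>R E p) $ i $ k\<bar>
      \<le> (entry_norm (2 ^ p *\<^sub>R E p))\<^sup>2 * exp (entry_norm (2 ^ p *\<^sub>R E p))" for p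
  proof -
    have "\<bar>(mat_pow (mat 1 + E p) (2 ^ p) - mat 1 - real (2 ^ p) *\<^sub>R E p) $ i $ k\<bar>
        \<le> (real (2 ^ p) * entry_norm (E p))\<^sup>2 * exp (real (2 ^ p) * entry_norm (E p))"
      by (rule order_trans[OF entry_le_entry_norm mat_pow_linear_remainder])
    then show ?thesis by (simp add: entry_norm_scaleR E_def)
  qed
  have "\<bar>(B $ i $ k - mat 1 $ i $ k) - (- \<epsilon> *\<^sub>R \<Phi>) $ i $ k\<bar> \<le> (\<epsilon> * entry_norm \<Phi>)\<^sup>2 * exp (\<epsilon> * entry_norm \<Phi>)"
  proof (rule LIMSEQ_le)
    show "(\<lambda>p. \<bar>(mat_pow (S p) (2 ^ p) $ i $ k - mat 1 $ i $ k) - (2 ^ p *\<^sub>R E p) $ i $ k\<bar>)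
        \<longlonglongrightarrow> \<bar>(B $ i $ k - mat 1 $ i $ k) - (- \<epsilon> *\<^sub>R \<Phi>) $ i $ k\<bar>"
      by (intro tendsto_rabs tendsto_diff SB E_lim tendsto_const)
    show "(\<lambda>p. (entry_norm (2 ^ p *\<^sub>R E p))\<^sup>2 * exp (entry_norm (2 ^ p *\<^sub>R E p)))
        \<longlonglongrightarrow> (\<epsilon> * entry_norm \<Phi>)\<^sup>2 * exp (\<epsilon> * entry_norm \<Phi>)"
      by (intro tendsto_mult tendsto_power tendsto_exp en)
  qed (use le in auto)
  then show ?thesis by (simp add: \<epsilon>_def B_def abs_le_iff algebra_simps)
qed

lemma laplace_matrix_generator:
  assumes \<theta>: "0 \<le> \<theta>"
  shows "(\<lambda>r. 2 ^ r * (mat 1 - laplace_matrix N H (1 / 2 ^ r) \<theta>) $ i $ k) \<longlonglongrightarrow> matrix_exponent Q d \<nu> G \<theta> $ i $ k"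
proof -
  define \<Phi> where "\<Phi> = matrix_exponent Q d \<nu> G \<theta>"
  define c where "c = entry_norm \<Phi>"
  have half: "(\<lambda>r. (1 / 2) ^ r :: real) \<longlonglongrightarrow> 0" by (rule LIMSEQ_realpow_zero) auto
  have "(\<lambda>r. (1 / 2) ^ r * c\<^sup>2 * exp ((1 / 2) ^ r * c)) \<longlonglongrightarrow> 0 * c\<^sup>2 * exp (0 * c)"
    by (intro tendsto_mult tendsto_exp tendsto_const half)
  then have 0: "(\<lambda>r. (1 / 2) ^ r * c\<^sup>2 * exp ((1 / 2) ^ r * c)) \<longlonglongrightarrow> 0" by simp
  define D where "D r = (mat 1 - laplace_matrix N H (1 / 2 ^ r) \<theta>) $ i $ k" for r :: nat
  have bound: "norm (2 ^ r * D r - \<Phi> $ i $ k) \<le> (1 / 2) ^ r * c\<^sup>2 * exp ((1 / 2) ^ r * c)" for r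
  proof -
    have "\<bar>D r - (1 / 2) ^ r * \<Phi> $ i $ k\<bar> \<le> ((1 / 2) ^ r * c)\<^sup>2 * exp ((1 / 2) ^ r * c)"
      using laplace_matrix_remainder[of "2 ^ r" \<theta> i k] \<theta> by (simp add: D_def \<Phi>_def c_def power_one_over)
    then have "2 ^ r * \<bar>D r - (1 / 2) ^ r * \<Phi> $ i $ k\<bar> \<le> 2 ^ r * (((1 / 2) ^ r * c)\<^sup>2 * exp ((1 / 2) ^ r * c))"
      by (intro mult_left_mono) auto
    moreover have "2 ^ r * (((1 / 2) ^ r * c)\<^sup>2 * exp ((1 / 2) ^ r * c)) = (1 / 2) ^ r * c\<^sup>2 * exp ((1 / 2) ^ r * c)"
      by (simp add: power_mult_distrib power2_eq_square power_one_over)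
    moreover have "2 ^ r * D r - \<Phi> $ i $ k = 2 ^ r * (D r - (1 / 2) ^ r * \<Phi> $ i $ k)"
      by (simp add: right_diff_distrib power_one_over)
    ultimately show ?thesis by (simp add: abs_mult)
  qed
  have "(\<lambda>r. 2 ^ r * D r - \<Phi> $ i $ k) \<longlonglongrightarrow> 0"
    by (rule Lim_null_comparison[OF _ 0]) (use bound in auto)
  then have "(\<lambda>r. 2 ^ r * D r) \<longlonglongrightarrow> \<Phi> $ i $ k" by (rule LIM_zero_cancel)
  then show ?thesis by (simp only: D_def \<Phi>_def)
qed

end

section \<open>Passage times of right-continuous processes\<close>

lemma dyadic_from_right:
  fixes a :: real
  defines "s p \<equiv> (real (nat \<lfloor>a * 2 ^ p\<rfloor>) + 1) / 2 ^ p"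
  assumes a: "0 \<le> a"
  shows "s \<longlonglongrightarrow> a" "\<And>p. a < s p"
proof -
  have nn: "0 \<le> a * 2 ^ p" for p using a by simp
  have b: "a * 2 ^ p < real (nat \<lfloor>a * 2 ^ p\<rfloor>) + 1" "real (nat \<lfloor>a * 2 ^ p\<rfloor>) \<le> a * 2 ^ p" for p
    using nn[of p] by linarith+
  show lt: "a < s p" for p using b(1)[of p] by (simp add: s_def pos_less_divide_eq)
  have up: "s p \<le> a + (1 / 2) ^ p" for p
    using b(2)[of p] by (simp add: s_def divide_le_eq algebra_simps power_one_over)
  have "(\<lambda>p. a + (1 / 2) ^ p) \<longlonglongrightarrow> a + 0" by (intro tendsto_add tendsto_const LIMSEQ_realpow_zero) auto
  then show "s \<longlonglongrightarrow> a"
    by (intro tendsto_sandwich[of "\<lambda>_. a" s _ "\<lambda>p. a + (1 / 2) ^ p"])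
      (use lt up in \<open>auto intro!: always_eventually less_imp_le\<close>)
qed

text \<open>Evaluation at dyadic times approaching from the right takes countably many values.\<close>

lemma jointly_measurable_right_continuous:
  fixes g :: "real \<Rightarrow> 'w \<Rightarrow> real"
  assumes m: "\<And>t. 0 \<le> t \<Longrightarrow> g t \<in> borel_measurable M"
    and rc: "\<And>t \<omega>. 0 \<le> t \<Longrightarrow> \<omega> \<in> space M \<Longrightarrow> ((\<lambda>s. g s \<omega>) \<longlongrightarrow> g t \<omega>) (at_right t)"
  shows "(\<lambda>(t, \<omega>). g (max 0 t) \<omega>) \<in> borel_measurable (borel \<Otimes>\<^sub>M M)"
proof -
  define s where "s p t = (real (nat \<lfloor>max 0 t * 2 ^ p\<rfloor>) + 1) / 2 ^ p" for p :: nat and t :: real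
  have "(\<lambda>z. g (max 0 (fst z)) (snd z)) \<in> borel_measurable (borel \<Otimes>\<^sub>M M)"
  proof (rule borel_measurable_LIMSEQ_real[where u="\<lambda>p z. g (s p (fst z)) (snd z)"])
    fix z assume "z \<in> space ((borel :: real measure) \<Otimes>\<^sub>M M)"
    then have z: "snd z \<in> space M" by (auto simp: space_pair_measure)
    show "(\<lambda>p. g (s p (fst z)) (snd z)) \<longlonglongrightarrow> g (max 0 (fst z)) (snd z)"
      unfolding s_def
      by (rule tendsto_from_right[where g="\<lambda>u. g u (snd z)" and a="max 0 (fst z)", OF rc[OF _ z] dyadic_from_right]) auto
  next
    fix p
    have "(\<lambda>z. (\<lambda>n z. g ((real n + 1) / 2 ^ p) (snd z)) (nat \<lfloor>max 0 (fst z) * 2 ^ p\<rfloor>) z)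
        \<in> borel_measurable ((borel :: real measure) \<Otimes>\<^sub>M M)"
    proof (rule measurable_compose_countable[where g="\<lambda>z. nat \<lfloor>max 0 (fst z) * 2 ^ p\<rfloor>" and
          f="\<lambda>n z. g ((real n + 1) / 2 ^ p) (snd z)"])
      show "(\<lambda>z. g ((real n + 1) / 2 ^ p) (snd z)) \<in> borel_measurable (borel \<Otimes>\<^sub>M M)" for n
        by (rule measurable_compose[OF measurable_snd m]) simp
      show "(\<lambda>z. nat \<lfloor>max 0 (fst z) * 2 ^ p\<rfloor>) \<in> (borel :: real measure) \<Otimes>\<^sub>M M \<rightarrow>\<^sub>M count_space UNIV"
        by measurable
    qed
    then show "(\<lambda>z. g (s p (fst z)) (snd z)) \<in> borel_measurable (borel \<Otimes>\<^sub>M M)" by (simp add: s_def)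
  qed
  then show ?thesis by (simp add: case_prod_beta)
qed

lemma jointly_measurable_right_continuous_discrete:
  fixes g :: "real \<Rightarrow> 'w \<Rightarrow> 'n::finite"
  assumes m: "\<And>t. 0 \<le> t \<Longrightarrow> g t \<in> M \<rightarrow>\<^sub>M count_space UNIV"
    and rc: "\<And>t \<omega>. 0 \<le> t \<Longrightarrow> \<omega> \<in> space M \<Longrightarrow> \<forall>\<^sub>F s in at_right t. g s \<omega> = g t \<omega>"
  shows "(\<lambda>(t, \<omega>). g (max 0 t) \<omega>) \<in> borel \<Otimes>\<^sub>M M \<rightarrow>\<^sub>M count_space UNIV"
proof -
  have "(\<lambda>z. case z of (t, \<omega>) \<Rightarrow> g (max 0 t) \<omega>) -` {k} \<inter> space (borel \<Otimes>\<^sub>M M) \<in> sets (borel \<Otimes>\<^sub>M M)" for k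
  proof -
    have "(\<lambda>(t, \<omega>). (\<lambda>t \<omega>. if g t \<omega> = k then 1 else 0 :: real) (max 0 t) \<omega>) \<in> borel_measurable (borel \<Otimes>\<^sub>M M)"
    proof (rule jointly_measurable_right_continuous)
      show "(\<lambda>\<omega>. if g t \<omega> = k then 1 else 0 :: real) \<in> borel_measurable M" if "0 \<le> t" for t
        by (rule measurable_compose[OF m[OF that]]) simp
      show "((\<lambda>s. if g s \<omega> = k then 1 else 0 :: real) \<longlongrightarrow> (if g t \<omega> = k then 1 else 0)) (at_right t)"
        if "0 \<le> t" "\<omega> \<in> space M" for t \<omega>
        by (rule tendsto_eventually) (use rc[OF that] in eventually_elim, simp)
    qed
    then have "(\<lambda>(t, \<omega>). if g (max 0 t) \<omega> = k then 1 else 0 :: real) -` {1} \<inter> space (borel \<Otimes>\<^sub>M M) \<in> sets (borel \<Otimes>\<^sub>M M)"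
      by (rule measurable_sets) simp
    also have "(\<lambda>(t, \<omega>). if g (max 0 t) \<omega> = k then 1 else 0 :: real) -` {1} \<inter> space (borel \<Otimes>\<^sub>M M) =
        (\<lambda>z. case z of (t, \<omega>) \<Rightarrow> g (max 0 t) \<omega>) -` {k} \<inter> space (borel \<Otimes>\<^sub>M M)"
      by (auto split: if_splits)
    finally show ?thesis .
  qed
  then show ?thesis by (intro measurable_count_space_eq2[THEN iffD2]) auto
qed

text \<open>The inverse local time is a passage time of the local time, so one theory serves both.\<close>

lemma inverse_time_eq_passage_time: "inverse_time Z t \<omega> = passage_time Z t \<omega>"
  by (simp add: inverse_time_def passage_time_def)

abbreviation first_passage :: "(real \<Rightarrow> 'w \<Rightarrow> real) \<Rightarrow> real \<Rightarrow> 'w \<Rightarrow> real" where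
  "first_passage Z t \<omega> \<equiv> real_of_ereal (passage_time Z t \<omega>)"

lemma passage_time_nonneg: "0 \<le> passage_time Z t \<omega>"
  unfolding passage_time_def by (rule Inf_greatest) auto

lemma first_passage_nonneg [simp]: "0 \<le> first_passage Z t \<omega>"
  by (simp add: passage_time_nonneg real_of_ereal_pos)

lemma passage_time_less_iff: "passage_time Z t \<omega> < a \<longleftrightarrow> (\<exists>s\<ge>0. t < Z s \<omega> \<and> ereal s < a)"
  unfolding passage_time_def Inf_less_iff by auto

lemma passage_time_less_iff_rat:
  assumes rc: "\<And>s. 0 \<le> s \<Longrightarrow> ((\<lambda>u. Z u \<omega>) \<longlongrightarrow> Z s \<omega>) (at_right s)"
  shows "passage_time Z t \<omega> < a \<longleftrightarrow> (\<exists>r::rat. 0 \<le> r \<and> t < Z (of_rat r) \<omega> \<and> ereal (of_rat r) < a)"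
proof
  assume "passage_time Z t \<omega> < a"
  then obtain s where s: "0 \<le> s" "t < Z s \<omega>" "ereal s < a" by (auto simp: passage_time_less_iff)
  have "\<forall>\<^sub>F u in at_right s. t < Z u \<omega>" using order_tendstoD(1)[OF rc[OF s(1)] s(2)] .
  then obtain b where b: "s < b" "\<And>u. s < u \<Longrightarrow> u < b \<Longrightarrow> t < Z u \<omega>" by (auto simp: eventually_at_right_field)
  obtain c where "ereal s < ereal c" and ca: "ereal c < a" using ereal_dense2[OF s(3)] by blast
  then have c: "s < c" by simp
  obtain r where r: "s < of_rat r" "of_rat r < min b c" using of_rat_dense[of s "min b c"] b c by auto
  then have "(0::real) \<le> of_rat r" using s(1) by linarith
  then have "0 \<le> r" by simp
  moreover have "ereal (of_rat r) < ereal c" using r by simp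
  then have "ereal (of_rat r) < a" using ca by (rule less_trans)
  ultimately show "\<exists>r::rat. 0 \<le> r \<and> t < Z (of_rat r) \<omega> \<and> ereal (of_rat r) < a" using b(2) r by auto
next
  assume "\<exists>r::rat. 0 \<le> r \<and> t < Z (of_rat r) \<omega> \<and> ereal (of_rat r) < a"
  then obtain r :: rat where "0 \<le> r" "t < Z (of_rat r) \<omega>" "ereal (of_rat r) < a" by blast
  then show "passage_time Z t \<omega> < a" unfolding passage_time_less_iff by (intro exI[of _ "of_rat r"]) auto
qed

lemma first_passage_properties:
  assumes ex: "\<exists>s\<ge>0. t < Z s \<omega>"
  shows "passage_time Z t \<omega> = ereal (first_passage Z t \<omega>)"
    "\<And>s. 0 \<le> s \<Longrightarrow> s < first_passage Z t \<omega> \<Longrightarrow> Z s \<omega> \<le> t"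
    "\<And>s. 0 \<le> s \<Longrightarrow> t < Z s \<omega> \<Longrightarrow> first_passage Z t \<omega> \<le> s"
    "\<And>e. 0 < e \<Longrightarrow> \<exists>s\<ge>first_passage Z t \<omega>. s < first_passage Z t \<omega> + e \<and> t < Z s \<omega>"
proof -
  obtain s0 where s0: "0 \<le> s0" "t < Z s0 \<omega>" using ex by blast
  have lt: "passage_time Z t \<omega> < ereal (s0 + 1)"
    unfolding passage_time_less_iff by (intro exI[of _ s0]) (use s0 in simp)
  have fin: "\<bar>v\<bar> \<noteq> \<infinity>" if "0 \<le> v" "v < ereal c" for v c using that by (cases v) auto
  have "\<bar>passage_time Z t \<omega>\<bar> \<noteq> \<infinity>" by (rule fin[OF passage_time_nonneg lt])
  then show eq: "passage_time Z t \<omega> = ereal (first_passage Z t \<omega>)" by (simp add: ereal_real)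
  show le: "first_passage Z t \<omega> \<le> s" if "0 \<le> s" "t < Z s \<omega>" for s
  proof -
    have "passage_time Z t \<omega> \<le> ereal s" unfolding passage_time_def by (rule Inf_lower) (use that in auto)
    then have "ereal (first_passage Z t \<omega>) \<le> ereal s" by (rule order_trans[OF eq_refl[OF eq[symmetric]]])
    then show ?thesis by simp
  qed
  show "Z s \<omega> \<le> t" if "0 \<le> s" "s < first_passage Z t \<omega>" for s
    using le[OF that(1)] that(2) by (meson not_le)
  show "\<exists>s\<ge>first_passage Z t \<omega>. s < first_passage Z t \<omega> + e \<and> t < Z s \<omega>" if "0 < e" for e
  proof -
    have "passage_time Z t \<omega> < ereal (first_passage Z t \<omega> + e)" 
      by (rule le_less_trans[OF eq_refl[OF eq]]) (use that in simp)
    then obtain s where s: "0 \<le> s" "t < Z s \<omega>" "ereal s < ereal (first_passage Z t \<omega> + e)"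
      unfolding passage_time_less_iff by blast
    have "s < first_passage Z t \<omega> + e" using s(3) by (simp only: less_ereal.simps(1))
    with s le show ?thesis by blast
  qed
qed

lemma at_first_passage:
  assumes ex: "\<exists>s\<ge>0. t < Z s \<omega>" and rc: "\<And>s. 0 \<le> s \<Longrightarrow> ((\<lambda>u. Z u \<omega>) \<longlongrightarrow> Z s \<omega>) (at_right s)"
  shows "t \<le> Z (first_passage Z t \<omega>) \<omega>"
proof (rule ccontr)
  let ?T = "first_passage Z t \<omega>"
  assume "\<not> t \<le> Z ?T \<omega>"
  then have lt: "Z ?T \<omega> < t" by simp
  have "\<forall>\<^sub>F u in at_right ?T. Z u \<omega> < t" using order_tendstoD(2)[OF rc lt] by simp
  then obtain b where b: "?T < b" "\<And>u. ?T < u \<Longrightarrow> u < b \<Longrightarrow> Z u \<omega> < t" by (auto simp: eventually_at_right_field)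
  obtain s where "?T \<le> s" "s < ?T + (b - ?T)" "t < Z s \<omega>"
    using first_passage_properties(4)[where Z=Z and t=t and \<omega>=\<omega>, OF ex, of "b - ?T"] b(1) by auto
  with b(2)[of s] lt show False by (cases "s = ?T") auto
qed

text \<open>
  By right-continuity the level is exceeded before time \<open>a\<close> iff it is exceeded at a rational time before \<open>a\<close>.
\<close>

lemma passage_time_jointly_measurable:
  assumes m: "\<And>s. 0 \<le> s \<Longrightarrow> Z s \<in> borel_measurable M"
    and rc: "\<And>s \<omega>. 0 \<le> s \<Longrightarrow> \<omega> \<in> space M \<Longrightarrow> ((\<lambda>u. Z u \<omega>) \<longlongrightarrow> Z s \<omega>) (at_right s)"
  shows "(\<lambda>(t, \<omega>). passage_time Z t \<omega>) \<in> borel_measurable (borel \<Otimes>\<^sub>M M)"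
proof (rule borel_measurableI_less)
  fix a :: ereal
  have Zm: "(\<lambda>z. Z (of_rat r) (snd z)) \<in> borel_measurable ((borel :: real measure) \<Otimes>\<^sub>M M)" if "0 \<le> r" for r :: rat
    using that by (intro measurable_compose[OF measurable_snd m]) simp
  have "{z \<in> space (borel \<Otimes>\<^sub>M M). (case z of (t, \<omega>) \<Rightarrow> passage_time Z t \<omega>) < a} =
      (\<Union>r\<in>{r::rat. 0 \<le> r \<and> ereal (of_rat r) < a}. {z \<in> space (borel \<Otimes>\<^sub>M M). fst z < Z (of_rat r) (snd z)})"
    using passage_time_less_iff_rat[where Z=Z, OF rc] by (auto simp: space_pair_measure)
  also have "\<dots> \<in> sets (borel \<Otimes>\<^sub>M M)"
    using Zm by (intro sets.countable_UN' countableI_type) (auto intro!: borel_measurable_less)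
  finally show "{z \<in> space (borel \<Otimes>\<^sub>M M). (case z of (t, \<omega>) \<Rightarrow> passage_time Z t \<omega>) < a} \<in> sets (borel \<Otimes>\<^sub>M M)" .
qed

section \<open>Markov additive processes at passage times\<close>

context markov_additive_process
begin

lemma space_P [simp]: "space (P x i) = space M"
  using sets_eq_imp_space_eq[OF sets_P] .

lemma F_measurable_M: "f \<in> F t \<rightarrow>\<^sub>M B \<Longrightarrow> f \<in> M \<rightarrow>\<^sub>M B"
  using filtration_sub[of t] by (auto simp: measurable_def space_F)

lemma F_mono_measurable: "f \<in> F s \<rightarrow>\<^sub>M B \<Longrightarrow> s \<le> t \<Longrightarrow> f \<in> F t \<rightarrow>\<^sub>M B"
  using sets_F_mono[of s t] by (auto simp: measurable_def space_F)

lemma xi_measurable: "0 \<le> t \<Longrightarrow> \<xi> t \<in> borel_measurable M"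
  and J_measurable: "0 \<le> t \<Longrightarrow> J t \<in> M \<rightarrow>\<^sub>M count_space UNIV"
  using adapted_xi adapted_J by (auto intro: F_measurable_M)

lemma measurable_P: "f \<in> M \<rightarrow>\<^sub>M B \<Longrightarrow> f \<in> P x i \<rightarrow>\<^sub>M B"
  using measurable_cong_sets[OF sets_P refl] by blast

lemma xi_right_continuous: "\<omega> \<in> space M \<Longrightarrow> 0 \<le> t \<Longrightarrow> ((\<lambda>s. \<xi> s \<omega>) \<longlongrightarrow> \<xi> t \<omega>) (at_right t)"
  using cadlag_xi by (auto simp: cadlag_def)

lemma J_right_continuous: "\<omega> \<in> space M \<Longrightarrow> 0 \<le> t \<Longrightarrow> \<forall>\<^sub>F s in at_right t. J s \<omega> = J t \<omega>"
  using cadlag_J by (auto simp: cadlag_discrete_def)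

lemma process_at_measurable:
  assumes T: "T \<in> borel_measurable A" "\<And>z. z \<in> space A \<Longrightarrow> 0 \<le> T z" and w: "w \<in> A \<rightarrow>\<^sub>M M"
  shows "(\<lambda>z. \<xi> (T z) (w z)) \<in> borel_measurable A" "(\<lambda>z. J (T z) (w z)) \<in> A \<rightarrow>\<^sub>M count_space UNIV"
proof -
  have p: "(\<lambda>z. (T z, w z)) \<in> A \<rightarrow>\<^sub>M borel \<Otimes>\<^sub>M M" using T(1) w by simp
  have "(\<lambda>z. \<xi> (max 0 (T z)) (w z)) \<in> borel_measurable A"
    using measurable_compose[OF p jointly_measurable_right_continuous[OF xi_measurable xi_right_continuous]] by simp
  then show "(\<lambda>z. \<xi> (T z) (w z)) \<in> borel_measurable A"
    by (rule measurable_cong[THEN iffD1, rotated]) (use T(2) in \<open>simp add: max_absorb2\<close>)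
  have "(\<lambda>z. J (max 0 (T z)) (w z)) \<in> A \<rightarrow>\<^sub>M count_space UNIV"
    using measurable_compose[OF p jointly_measurable_right_continuous_discrete[OF J_measurable J_right_continuous]] by simp
  then show "(\<lambda>z. J (T z) (w z)) \<in> A \<rightarrow>\<^sub>M count_space UNIV"
    by (rule measurable_cong[THEN iffD1, rotated]) (use T(2) in \<open>simp add: max_absorb2\<close>)
qed

lemma first_passage_xi_jointly_measurable:
  "(\<lambda>z. first_passage \<xi> (fst z) (snd z)) \<in> borel_measurable (borel \<Otimes>\<^sub>M M)"
  using passage_time_jointly_measurable[OF xi_measurable xi_right_continuous]
  by (intro borel_measurable_real_of_ereal) (simp add: case_prod_beta)

lemma overshoot_jointly_measurable:
  "(\<lambda>z. overshoot \<xi> J (fst z) (snd z)) \<in> borel \<Otimes>\<^sub>M M \<rightarrow>\<^sub>M state_space"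
  unfolding overshoot_def Let_def
  using process_at_measurable[OF first_passage_xi_jointly_measurable _ measurable_snd] by simp

lemma overshoot_measurable: "overshoot \<xi> J t \<in> M \<rightarrow>\<^sub>M state_space"
  using measurable_compose[OF measurable_Pair1'[of t borel M] overshoot_jointly_measurable] by simp

text \<open>
  On these paths all passage times are finite and right-continuity controls the overshoots; they carry all
  the laws.
\<close>

definition unbounded_paths :: "'w set" where
  "unbounded_paths = {\<omega> \<in> space M. \<forall>t. \<exists>s\<ge>0. t < \<xi> s \<omega>}"

lemma unbounded_pathsD: "\<omega> \<in> unbounded_paths \<Longrightarrow> \<exists>s\<ge>0. t < \<xi> s \<omega>" "\<omega> \<in> unbounded_paths \<Longrightarrow> \<omega> \<in> space M"
  by (auto simp: unbounded_paths_def)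

lemma overshoot_nonneg: "\<omega> \<in> unbounded_paths \<Longrightarrow> 0 \<le> fst (overshoot \<xi> J t \<omega>)"
  using at_first_passage[where Z=\<xi> and t=t and \<omega>=\<omega>] xi_right_continuous unbounded_pathsD
  by (simp add: overshoot_def Let_def)

lemma limsup_imp_unbounded:
  assumes "\<omega> \<in> space M" "Limsup at_top (\<lambda>t. ereal (\<xi> t \<omega>)) = \<infinity>"
  shows "\<omega> \<in> unbounded_paths"
  unfolding unbounded_paths_def
proof (intro CollectI conjI allI, fact)
  fix t
  show "\<exists>s\<ge>0. t < \<xi> s \<omega>"
  proof (rule ccontr)
    assume "\<not> (\<exists>s\<ge>0. t < \<xi> s \<omega>)"
    then have "\<forall>\<^sub>F s in at_top. ereal (\<xi> s \<omega>) \<le> ereal t"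
      by (intro eventually_at_top_linorderI[of 0]) (auto simp: not_less)
    then have "Limsup at_top (\<lambda>t. ereal (\<xi> t \<omega>)) \<le> ereal t" by (rule Limsup_bounded)
    with assms show False by simp
  qed
qed

end

context markov_additive_process
begin

text \<open>By right-continuity of the filtration, an event seen immediately after time \<open>s\<close> is seen at time \<open>s\<close>.\<close>

lemma in_F_if_in_later_F:
  assumes "0 \<le> s" "\<And>s'. s < s' \<Longrightarrow> A \<in> sets (F s')"
  shows "A \<in> sets (F s)"
  unfolding filtration_right_cont[OF assms(1)] using assms(2) by auto

text \<open>
  Local times regenerate at real-valued stopping times; passage times enter through their minimum with a
  constant \<open>m\<close>, on the event that the minimum is below \<open>m\<close>.
\<close>

definition capped_passage :: "real \<Rightarrow> real \<Rightarrow> 'w \<Rightarrow> real" where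
  "capped_passage t m \<omega> = real_of_ereal (min (passage_time \<xi> t \<omega>) (ereal m))"

lemma capped_passage_cases:
  assumes m: "0 \<le> m"
  shows "0 \<le> capped_passage t m \<omega>" "capped_passage t m \<omega> \<le> m"
    "capped_passage t m \<omega> < m \<Longrightarrow> passage_time \<xi> t \<omega> = ereal (capped_passage t m \<omega>)"
    "passage_time \<xi> t \<omega> = ereal u \<Longrightarrow> capped_passage t m \<omega> = min u m"
    "passage_time \<xi> t \<omega> = \<infinity> \<Longrightarrow> capped_passage t m \<omega> = m"
  using passage_time_nonneg[of \<xi> t \<omega>] m
  by (cases "passage_time \<xi> t \<omega>"; auto simp: capped_passage_def min_def split: if_splits)+

lemma capped_passage_eq:
  assumes "0 \<le> m" "0 \<le> m'" "capped_passage t m \<omega> < m" "capped_passage t m \<omega> < m'"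
  shows "capped_passage t m' \<omega> = capped_passage t m \<omega>"
  using capped_passage_cases(3)[OF assms(1,3)] capped_passage_cases(4)[OF assms(2), of t \<omega>] assms(4) by auto

lemma capped_passage_measurable:
  assumes m: "0 \<le> m"
  shows "capped_passage t m \<in> borel_measurable (F m)"
proof (rule borel_measurableI_less)
  fix a :: real
  show "{\<omega> \<in> space (F m). capped_passage t m \<omega> < a} \<in> sets (F m)"
  proof (cases "m < a")
    case True
    then have "{\<omega> \<in> space (F m). capped_passage t m \<omega> < a} = space (F m)"
      using capped_passage_cases(2)[OF m] by (auto intro: le_less_trans)
    then show ?thesis by simp
  next
    case False
    have "capped_passage t m \<omega> < a \<longleftrightarrow> passage_time \<xi> t \<omega> < ereal a" for \<omega>
      using False passage_time_nonneg[of \<xi> t \<omega>] m capped_passage_cases(4,5)[OF m, of t \<omega>]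
      by (cases "passage_time \<xi> t \<omega>") (auto simp: min_def)
    then have "{\<omega> \<in> space (F m). capped_passage t m \<omega> < a} =
        (\<Union>r\<in>{r::rat. 0 \<le> r \<and> ereal (of_rat r) < ereal a}. {\<omega> \<in> space (F m). t < \<xi> (of_rat r) \<omega>})"
      using passage_time_less_iff_rat[where Z=\<xi>, OF xi_right_continuous] by (auto simp: space_F)
    also have "\<dots> \<in> sets (F m)"
    proof (intro sets.countable_UN' countableI_type image_subsetI)
      fix r :: rat assume "r \<in> {r. 0 \<le> r \<and> ereal (of_rat r) < ereal a}"
      then have "\<xi> (of_rat r) \<in> borel_measurable (F m)"
        using False by (intro F_mono_measurable[OF adapted_xi]) auto
      then show "{\<omega> \<in> space (F m). t < \<xi> (of_rat r) \<omega>} \<in> sets (F m)" by (intro borel_measurable_less) auto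
    qed
    finally show ?thesis .
  qed
qed

lemma J_at_capped_passage_measurable:
  assumes m: "0 \<le> m"
  shows "(\<lambda>\<omega>. J (capped_passage t m \<omega>) \<omega>) \<in> F m \<rightarrow>\<^sub>M count_space UNIV"
proof -
  have "(\<lambda>(u, \<omega>). (\<lambda>u \<omega>. J (min u m) \<omega>) (max 0 u) \<omega>) \<in> borel \<Otimes>\<^sub>M F m \<rightarrow>\<^sub>M count_space UNIV"
  proof (rule jointly_measurable_right_continuous_discrete)
    show "J (min u m) \<in> F m \<rightarrow>\<^sub>M count_space UNIV" if "0 \<le> u" for u
      using that m by (intro F_mono_measurable[OF adapted_J]) auto
    show "\<forall>\<^sub>F s in at_right u. J (min s m) \<omega> = J (min u m) \<omega>" if u: "0 \<le> u" and \<omega>: "\<omega> \<in> space (F m)" for u \<omega>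
    proof (cases "u < m")
      case True
      then have "\<forall>\<^sub>F s in at_right u. s < m" by (intro order_tendstoD(2)[OF tendsto_ident_at])
      with J_right_continuous[OF _ u, of \<omega>] \<omega> show ?thesis
        unfolding space_F by (auto elim: eventually_elim2 simp: True min_absorb1 less_imp_le)
    next
      case False
      have "\<forall>\<^sub>F s in at_right u. u < s" by (simp add: eventually_at_right_less)
      then show ?thesis by eventually_elim (use False in \<open>simp add: min_absorb2\<close>)
    qed
  qed
  from measurable_compose[OF measurable_Pair[OF capped_passage_measurable[OF m] measurable_ident] this]
  have "(\<lambda>\<omega>. J (min (max 0 (capped_passage t m \<omega>)) m) \<omega>) \<in> F m \<rightarrow>\<^sub>M count_space UNIV" by simp
  then show ?thesis
    using capped_passage_cases(1,2)[OF m] by (simp add: max_absorb2 min_absorb1)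
qed

lemma capped_passage_event:
  assumes m: "0 < m" and s: "0 \<le> s" "s < s'"
  shows "{\<omega>\<in>space M. capped_passage t m \<omega> < m \<and> J (capped_passage t m \<omega>) \<omega> = j \<and> capped_passage t m \<omega> \<le> s} \<in> sets (F s')"
    and "s < m \<Longrightarrow> {\<omega>\<in>space M. capped_passage t m \<omega> \<le> s} \<in> sets (F s')"
proof -
  have s'0: "0 \<le> s'" using s by simp
  have m0: "0 \<le> m" using m by simp
  have iff: "capped_passage t m \<omega> < m \<and> capped_passage t m \<omega> \<le> s \<longleftrightarrow> capped_passage t s' \<omega> \<le> s \<and> capped_passage t s' \<omega> < m" for \<omega>
    using capped_passage_eq[OF m0 s'0, of t \<omega>] capped_passage_eq[OF s'0 m0, of t \<omega>] s by force
  have same: "capped_passage t m \<omega> = capped_passage t s' \<omega>" if "capped_passage t s' \<omega> \<le> s" "capped_passage t s' \<omega> < m" for \<omega>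
    using capped_passage_eq[OF s'0 m0, of t \<omega>] s that by force
  note cm = capped_passage_measurable[OF s'0, of t]
  have "{\<omega>\<in>space (F s'). capped_passage t s' \<omega> \<le> s} \<inter> {\<omega>\<in>space (F s'). capped_passage t s' \<omega> < m}
      \<inter> ((\<lambda>\<omega>. J (capped_passage t s' \<omega>) \<omega>) -` {j} \<inter> space (F s')) \<in> sets (F s')"
  proof (rule sets.Int[OF sets.Int])
    show "{\<omega>\<in>space (F s'). capped_passage t s' \<omega> \<le> s} \<in> sets (F s')" using cm by (intro borel_measurable_le) auto
    show "{\<omega>\<in>space (F s'). capped_passage t s' \<omega> < m} \<in> sets (F s')" using cm by (intro borel_measurable_less) auto
    show "(\<lambda>\<omega>. J (capped_passage t s' \<omega>) \<omega>) -` {j} \<inter> space (F s') \<in> sets (F s')"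
      by (rule measurable_sets[OF J_at_capped_passage_measurable[OF s'0]]) simp
  qed
  also have "{\<omega>\<in>space (F s'). capped_passage t s' \<omega> \<le> s} \<inter> {\<omega>\<in>space (F s'). capped_passage t s' \<omega> < m}
      \<inter> ((\<lambda>\<omega>. J (capped_passage t s' \<omega>) \<omega>) -` {j} \<inter> space (F s')) =
    {\<omega>\<in>space M. capped_passage t m \<omega> < m \<and> J (capped_passage t m \<omega>) \<omega> = j \<and> capped_passage t m \<omega> \<le> s}"
  proof -
    have "capped_passage t s' \<omega> \<le> s \<and> capped_passage t s' \<omega> < m \<and> J (capped_passage t s' \<omega>) \<omega> = j \<longleftrightarrow>
        capped_passage t m \<omega> < m \<and> J (capped_passage t m \<omega>) \<omega> = j \<and> capped_passage t m \<omega> \<le> s" for \<omega>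
      using iff[of \<omega>] same[of \<omega>] by metis
    then show ?thesis unfolding space_F by blast
  qed
  finally show "{\<omega>\<in>space M. capped_passage t m \<omega> < m \<and> J (capped_passage t m \<omega>) \<omega> = j \<and> capped_passage t m \<omega> \<le> s} \<in> sets (F s')" .
  assume sm: "s < m"
  have "{\<omega>\<in>space (F s'). capped_passage t s' \<omega> \<le> s} \<in> sets (F s')" using cm by (intro borel_measurable_le) auto
  also have "{\<omega>\<in>space (F s'). capped_passage t s' \<omega> \<le> s} = {\<omega>\<in>space M. capped_passage t m \<omega> \<le> s}"
    unfolding space_F using iff sm by (auto intro: le_less_trans)
  finally show "{\<omega>\<in>space M. capped_passage t m \<omega> \<le> s} \<in> sets (F s')" .
qed

lemma stopping_time_capped_passage:
  assumes m: "0 < m"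
  shows "stopping_time F (capped_passage t m)"
proof (rule stopping_timeI)
  fix s
  consider "s < 0" | "m \<le> s" | "0 \<le> s" "s < m" by linarith
  then have "{\<omega>\<in>space M. capped_passage t m \<omega> \<le> s} \<in> sets (F s)"
  proof cases
    case 1
    then have "{\<omega>\<in>space M. capped_passage t m \<omega> \<le> s} = {}"
      using capped_passage_cases(1)[OF less_imp_le[OF m], of t] by (auto simp: not_le intro: less_le_trans)
    then show ?thesis by (simp only: sets.empty_sets)
  next
    case 2
    then have "{\<omega>\<in>space M. capped_passage t m \<omega> \<le> s} = space (F s)"
      using capped_passage_cases(2)[OF less_imp_le[OF m], of t] by (auto simp: space_F intro: order_trans)
    then show ?thesis by (simp only: sets.top)
  next
    case 3
    show ?thesis by (rule in_F_if_in_later_F[OF 3(1)], rule capped_passage_event(2)[OF m 3(1) _ 3(2)])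
  qed
  then show "Measurable.pred (F s) (\<lambda>\<omega>. capped_passage t m \<omega> \<le> s)" by (simp add: pred_def space_F)
qed

lemma passage_in_state_pre_sigma:
  assumes m: "0 < m"
  shows "{\<omega>\<in>space M. capped_passage t m \<omega> < m \<and> J (capped_passage t m \<omega>) \<omega> = j} \<in> sets (pre_sigma (capped_passage t m))"
proof (rule sets_pre_sigmaI[OF stopping_time_capped_passage[OF m]])
  fix s
  have eq: "{\<omega>\<in>{\<omega>\<in>space M. capped_passage t m \<omega> < m \<and> J (capped_passage t m \<omega>) \<omega> = j}. capped_passage t m \<omega> \<le> s} =
    {\<omega>\<in>space M. capped_passage t m \<omega> < m \<and> J (capped_passage t m \<omega>) \<omega> = j \<and> capped_passage t m \<omega> \<le> s}" by auto
  show "{\<omega>\<in>{\<omega>\<in>space M. capped_passage t m \<omega> < m \<and> J (capped_passage t m \<omega>) \<omega> = j}. capped_passage t m \<omega> \<le> s} \<in> sets (F s)"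
  proof (cases "s < 0")
    case True
    then have "{\<omega>\<in>space M. capped_passage t m \<omega> < m \<and> J (capped_passage t m \<omega>) \<omega> = j \<and> capped_passage t m \<omega> \<le> s} = {}"
      using capped_passage_cases(1)[OF less_imp_le[OF m], of t] by (auto simp: not_le intro: less_le_trans)
    then show ?thesis unfolding eq by (simp only: sets.empty_sets)
  next
    case False
    then have s0: "0 \<le> s" by simp
    show ?thesis unfolding eq by (rule in_F_if_in_later_F[OF s0], rule capped_passage_event(1)[OF m s0])
  qed
qed

text \<open>
  Before the passage time the path is at most \<open>t\<close>, at the passage time it is at least \<open>t\<close>: a new maximum.
\<close>

lemma reflected_at_passage:
  assumes m: "0 < m" and \<omega>: "\<omega> \<in> space M" and T: "capped_passage t m \<omega> < m" and t: "0 \<le> t" 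
  shows "reflected \<xi> J (capped_passage t m \<omega>) \<omega> = (0, J (capped_passage t m \<omega>) \<omega>)"
proof -
  let ?T = "capped_passage t m \<omega>"
  have p: "passage_time \<xi> t \<omega> = ereal ?T" using capped_passage_cases(3)[OF less_imp_le[OF m] T] .
  then have "passage_time \<xi> t \<omega> < \<infinity>" by simp
  then have ex: "\<exists>s\<ge>0. t < \<xi> s \<omega>" unfolding passage_time_less_iff by blast
  have fp: "first_passage \<xi> t \<omega> = ?T" using p by simp
  have le: "\<xi> s \<omega> \<le> t" if "0 \<le> s" "s < ?T" for s
    using first_passage_properties(2)[where Z=\<xi> and t=t and \<omega>=\<omega>, OF ex that(1)] that(2) fp by simp
  have ge: "t \<le> \<xi> ?T \<omega>"
    using at_first_passage[where Z=\<xi> and t=t and \<omega>=\<omega>, OF ex xi_right_continuous[OF \<omega>]] fp by simp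
  have T0: "0 \<le> ?T" using capped_passage_cases(1)[OF less_imp_le[OF m]] .
  have "(SUP s\<in>{0..?T}. \<xi> s \<omega>) = \<xi> ?T \<omega>"
  proof (rule cSup_eq_maximum)
    show "\<xi> ?T \<omega> \<in> (\<lambda>s. \<xi> s \<omega>) ` {0..?T}" using T0 by auto
    show "y \<le> \<xi> ?T \<omega>" if y: "y \<in> (\<lambda>s. \<xi> s \<omega>) ` {0..?T}" for y
    proof -
      obtain s where s: "0 \<le> s" "s \<le> ?T" "y = \<xi> s \<omega>" using y by auto
      then show ?thesis using le[of s] ge by (cases "s = ?T") auto
    qed
  qed
  then show ?thesis by (simp add: reflected_def)
qed

section \<open>Regeneration of the local times\<close>

context
  fixes L :: "'n \<Rightarrow> real \<Rightarrow> 'w \<Rightarrow> real"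
  assumes lt: "\<And>i. local_time (space M) F {P x k | x k. True} state_space (reflected \<xi> J) (0, i) (P 0 i) (L i)"
begin

lemma L_adapted: "0 \<le> t \<Longrightarrow> L i t \<in> borel_measurable (F t)"
  and L_0: "\<omega> \<in> space M \<Longrightarrow> L i 0 \<omega> = 0"
  and L_continuous: "\<omega> \<in> space M \<Longrightarrow> continuous_on {0..} (\<lambda>t. L i t \<omega>)"
  and L_mono: "\<omega> \<in> space M \<Longrightarrow> 0 \<le> s \<Longrightarrow> s \<le> t \<Longrightarrow> L i s \<omega> \<le> L i t \<omega>"
  and L_increase: "AE \<omega> in P x k.
    {t. 0 \<le> t \<and> (\<forall>e>0. L i (max 0 (t - e)) \<omega> < L i (t + e) \<omega>)} = closure {t. 0 \<le> t \<and> reflected \<xi> J t \<omega> = (0, i)}"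
  and L_regeneration: "stopping_time F T \<Longrightarrow> (\<And>\<omega>. \<omega> \<in> space M \<Longrightarrow> 0 \<le> T \<omega>) \<Longrightarrow> A \<in> sets (pre_sigma T) \<Longrightarrow>
    (\<And>\<omega>. \<omega> \<in> A \<Longrightarrow> reflected \<xi> J (T \<omega>) \<omega> = (0, i)) \<Longrightarrow> B \<in> sets (\<Pi>\<^sub>M s\<in>{0..}. state_space \<Otimes>\<^sub>M borel) \<Longrightarrow>
    measure (P x k) {\<omega>\<in>A. (\<lambda>s\<in>{0..}. (reflected \<xi> J (T \<omega> + s) \<omega>, L i (T \<omega> + s) \<omega> - L i (T \<omega>) \<omega>)) \<in> B} =
      measure (P x k) A * measure (P 0 i) {\<omega>\<in>space M. (\<lambda>s\<in>{0..}. (reflected \<xi> J s \<omega>, L i s \<omega>)) \<in> B}"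
proof -
  note l = lt[of i, unfolded local_time_def]
  show "0 \<le> t \<Longrightarrow> L i t \<in> borel_measurable (F t)" using l by blast
  show "\<omega> \<in> space M \<Longrightarrow> L i 0 \<omega> = 0" "\<omega> \<in> space M \<Longrightarrow> continuous_on {0..} (\<lambda>t. L i t \<omega>)" using l by blast+
  have "\<omega> \<in> space M \<Longrightarrow> mono_on {0..} (\<lambda>t. L i t \<omega>)" using l by blast
  then show "\<omega> \<in> space M \<Longrightarrow> 0 \<le> s \<Longrightarrow> s \<le> t \<Longrightarrow> L i s \<omega> \<le> L i t \<omega>" by (auto simp: mono_on_def)
  have "P x k \<in> {P x k | x k. True}" by blast
  then show "AE \<omega> in P x k.
    {t. 0 \<le> t \<and> (\<forall>e>0. L i (max 0 (t - e)) \<omega> < L i (t + e) \<omega>)} = closure {t. 0 \<le> t \<and> reflected \<xi> J t \<omega> = (0, i)}"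
    using l by blast
  show "measure (P x k) {\<omega>\<in>A. (\<lambda>s\<in>{0..}. (reflected \<xi> J (T \<omega> + s) \<omega>, L i (T \<omega> + s) \<omega> - L i (T \<omega>) \<omega>)) \<in> B} =
      measure (P x k) A * measure (P 0 i) {\<omega>\<in>space M. (\<lambda>s\<in>{0..}. (reflected \<xi> J s \<omega>, L i s \<omega>)) \<in> B}"
    if "stopping_time F T" "\<And>\<omega>. \<omega> \<in> space M \<Longrightarrow> 0 \<le> T \<omega>" "A \<in> sets (pre_sigma T)"
      "\<And>\<omega>. \<omega> \<in> A \<Longrightarrow> reflected \<xi> J (T \<omega>) \<omega> = (0, i)" "B \<in> sets (\<Pi>\<^sub>M s\<in>{0..}. state_space \<Otimes>\<^sub>M borel)"
  proof -
    have "\<forall>\<mu>\<in>{P x k | x k. True}. \<forall>T. stopping_time F T \<and> (\<forall>\<omega>\<in>space M. 0 \<le> T \<omega>) \<longrightarrow>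
        (\<forall>A\<in>sets (pre_sigma T). (\<forall>\<omega>\<in>A. reflected \<xi> J (T \<omega>) \<omega> = (0, i)) \<longrightarrow>
          (\<forall>B\<in>sets (\<Pi>\<^sub>M s\<in>{0..}. state_space \<Otimes>\<^sub>M borel).
             measure \<mu> {\<omega>\<in>A. (\<lambda>s\<in>{0..}. (reflected \<xi> J (T \<omega> + s) \<omega>, L i (T \<omega> + s) \<omega> - L i (T \<omega>) \<omega>)) \<in> B} =
             measure \<mu> A * measure (P 0 i) {\<omega>\<in>space M. (\<lambda>s\<in>{0..}. (reflected \<xi> J s \<omega>, L i s \<omega>)) \<in> B}))"
      using l by blast
    with \<open>P x k \<in> _\<close> that show ?thesis by blast
  qed
qed

lemma L_right_continuous: "\<omega> \<in> space M \<Longrightarrow> 0 \<le> t \<Longrightarrow> ((\<lambda>s. L i s \<omega>) \<longlongrightarrow> L i t \<omega>) (at_right t)"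
proof -
  assume \<omega>: "\<omega> \<in> space M" and t: "0 \<le> t"
  have "((\<lambda>s. L i s \<omega>) \<longlongrightarrow> L i t \<omega>) (at t within {0..})"
    using L_continuous[OF \<omega>, of i] t by (auto simp: continuous_on_def)
  then show ?thesis by (rule tendsto_within_subset) (use t in auto)
qed

lemma L_measurable: "0 \<le> t \<Longrightarrow> L i t \<in> borel_measurable M"
  using L_adapted F_measurable_M by blast

lemma reflected_0: "reflected \<xi> J 0 \<omega> = (0, J 0 \<omega>)"
  by (simp add: reflected_def)

text \<open>
  Zero is a point of increase of the local time at the starting state, since the reflected process starts there.
\<close>

lemma local_time_positive:
  assumes e: "0 < e"
  shows "AE \<omega> in P 0 j. 0 < L j e \<omega>"
  using L_increase[where x=0 and k=j and i=j] initial[of 0 j] AE_space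
proof eventually_elim
  case (elim \<omega>)
  then have "0 \<in> closure {t. 0 \<le> t \<and> reflected \<xi> J t \<omega> = (0, j)}"
    by (intro closure_subset[THEN subsetD]) (auto simp: reflected_0)
  then have "0 \<in> {t. 0 \<le> t \<and> (\<forall>e>0. L j (max 0 (t - e)) \<omega> < L j (t + e) \<omega>)}" using elim(1) by blast
  then have "L j (max 0 (0 - e)) \<omega> < L j (0 + e) \<omega>" using e by blast
  then show ?case using e L_0 elim(3) by (simp add: max_absorb1)
qed

text \<open>
  Regeneration at the passage time: the growth of the local time after it has the law of the local time from
  zero, which is positive at all positive times.
\<close>

lemma local_time_increases_at_passage_in_state:
  assumes m: "0 < m" and t: "0 \<le> t" and e: "0 < e"
  shows "AE \<omega> in P x k. capped_passage t m \<omega> < m \<and> J (capped_passage t m \<omega>) \<omega> = j \<longrightarrow>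
    L j (capped_passage t m \<omega>) \<omega> < L j (capped_passage t m \<omega> + e) \<omega>"
proof -
  interpret prob_space "P x k" by (rule prob_space_P)
  interpret P0: prob_space "P 0 j" by (rule prob_space_P)
  let ?T = "capped_passage t m"
  define A where "A = {\<omega>\<in>space M. ?T \<omega> < m \<and> J (?T \<omega>) \<omega> = j}"
  define B where "B = {g \<in> space (\<Pi>\<^sub>M s\<in>{0..}. (state_space :: (real \<times> 'n) measure) \<Otimes>\<^sub>M (borel :: real measure)). 0 < snd (g e)}"
  have e0: "e \<in> {0..}" using e by simp
  have m_e: "(\<lambda>g. snd (g e) :: real) \<in> borel_measurable (\<Pi>\<^sub>M s\<in>{0..}. (state_space :: (real \<times> 'n) measure) \<Otimes>\<^sub>M borel)"
    by (rule measurable_compose[OF measurable_component_singleton[OF e0] measurable_snd])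
  have B: "B \<in> sets (\<Pi>\<^sub>M s\<in>{0..}. state_space \<Otimes>\<^sub>M borel)"
  proof -
    have "(\<lambda>g. snd (g e)) -` {0<..} \<inter> space (\<Pi>\<^sub>M s\<in>{0..}. (state_space :: (real \<times> 'n) measure) \<Otimes>\<^sub>M (borel :: real measure))
        \<in> sets (\<Pi>\<^sub>M s\<in>{0..}. (state_space :: (real \<times> 'n) measure) \<Otimes>\<^sub>M (borel :: real measure))"
      by (rule measurable_sets[OF m_e]) simp
    also have "(\<lambda>g. snd (g e)) -` {0<..} \<inter> space (\<Pi>\<^sub>M s\<in>{0..}. (state_space :: (real \<times> 'n) measure) \<Otimes>\<^sub>M (borel :: real measure)) = B"
      by (auto simp: B_def)
    finally show ?thesis .
  qed
  have inB: "(\<lambda>s\<in>{0..}. (a s, b s)) \<in> B \<longleftrightarrow> 0 < b e" for a :: "real \<Rightarrow> real \<times> 'n" and b :: "real \<Rightarrow> real"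
    using e by (auto simp: B_def space_PiM space_pair_measure)
  have T0: "0 \<le> ?T \<omega>" for \<omega> using capped_passage_cases(1)[OF less_imp_le[OF m]] .
  have reg: "measure (P x k) {\<omega>\<in>A. 0 < L j (?T \<omega> + e) \<omega> - L j (?T \<omega>) \<omega>} =
      measure (P x k) A * measure (P 0 j) {\<omega>\<in>space M. 0 < L j e \<omega>}"
  proof -
    have A: "A \<in> sets (pre_sigma ?T)" unfolding A_def by (rule passage_in_state_pre_sigma[OF m])
    have "reflected \<xi> J (?T \<omega>) \<omega> = (0, j)" if "\<omega> \<in> A" for \<omega>
      using reflected_at_passage[OF m _ _ t, of \<omega>] that by (auto simp: A_def)
    from L_regeneration[where i=j and x=x and k=k, OF stopping_time_capped_passage[OF m] T0 A this B]
    show ?thesis unfolding inB .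
  qed
  have Lm: "{\<omega>\<in>space (P 0 j). 0 < L j e \<omega>} \<in> sets (P 0 j)"
    using L_measurable[of e j] e by (intro borel_measurable_less measurable_P) auto
  have one: "measure (P 0 j) {\<omega>\<in>space M. 0 < L j e \<omega>} = 1"
    using P0.prob_Collect_eq_1[OF Lm] local_time_positive[OF e, of j] by simp
  have Tm: "?T \<in> borel_measurable M" by (rule F_measurable_M[OF capped_passage_measurable]) (use m in simp)
  have "A \<in> sets (P x k)"
  proof -
    have "A = {\<omega>\<in>space M. ?T \<omega> < m} \<inter> ((\<lambda>\<omega>. J (?T \<omega>) \<omega>) -` {j} \<inter> space M)" by (auto simp: A_def)
    moreover have "(\<lambda>\<omega>. J (?T \<omega>) \<omega>) -` {j} \<inter> space M \<in> sets M"
    proof (rule measurable_sets)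
      show "(\<lambda>\<omega>. J (?T \<omega>) \<omega>) \<in> M \<rightarrow>\<^sub>M count_space UNIV"
        by (rule process_at_measurable(2)[where w="\<lambda>\<omega>. \<omega>"]) (use Tm T0 in auto)
    qed simp
    moreover have "{\<omega>\<in>space M. ?T \<omega> < m} \<in> sets M" using Tm by (intro borel_measurable_less) auto
    ultimately show ?thesis by (simp add: sets_P)
  qed
  moreover have "{\<omega>\<in>A. 0 < L j (?T \<omega> + e) \<omega> - L j (?T \<omega>) \<omega>} \<in> sets (P x k)"
  proof -
    have jm: "(\<lambda>\<omega>. L j (S \<omega>) \<omega>) \<in> borel_measurable M" if "S \<in> borel_measurable M" "\<And>\<omega>. 0 \<le> S \<omega>" for S
    proof -
      have "(\<lambda>\<omega>. (S \<omega>, \<omega>)) \<in> M \<rightarrow>\<^sub>M borel \<Otimes>\<^sub>M M" using that(1) by simp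
      from measurable_compose[OF this jointly_measurable_right_continuous[OF L_measurable L_right_continuous]]
      show ?thesis using that(2) by (simp add: max_absorb2)
    qed
    have "(\<lambda>\<omega>. L j (?T \<omega> + e) \<omega> - L j (?T \<omega>) \<omega>) \<in> borel_measurable M"
      using Tm T0 e by (intro borel_measurable_diff jm) auto
    then have "{\<omega>\<in>space M. 0 < L j (?T \<omega> + e) \<omega> - L j (?T \<omega>) \<omega>} \<in> sets M" by (intro borel_measurable_less) auto
    moreover have "{\<omega>\<in>A. 0 < L j (?T \<omega> + e) \<omega> - L j (?T \<omega>) \<omega>} = A \<inter> {\<omega>\<in>space M. 0 < L j (?T \<omega> + e) \<omega> - L j (?T \<omega>) \<omega>}"
      by (auto simp: A_def)
    ultimately show ?thesis using \<open>A \<in> sets (P x k)\<close> by (simp add: sets_P)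
  qed
  ultimately have D: "A - {\<omega>\<in>A. 0 < L j (?T \<omega> + e) \<omega> - L j (?T \<omega>) \<omega>} \<in> null_sets (P x k)"
    using reg one finite_measure_Diff[of A "{\<omega>\<in>A. 0 < L j (?T \<omega> + e) \<omega> - L j (?T \<omega>) \<omega>}"]
    by (auto simp: null_sets_def emeasure_eq_measure)
  show ?thesis by (rule AE_I'[OF D]) (auto simp: A_def)
qed

definition total_local_time :: "real \<Rightarrow> 'w \<Rightarrow> real" where
  "total_local_time s \<omega> = (\<Sum>i\<in>UNIV. L i s \<omega>)"

lemma total_mono: "\<omega> \<in> space M \<Longrightarrow> 0 \<le> s \<Longrightarrow> s \<le> t \<Longrightarrow> total_local_time s \<omega> \<le> total_local_time t \<omega>"
  unfolding total_local_time_def by (intro sum_mono L_mono)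

lemma total_0: "\<omega> \<in> space M \<Longrightarrow> total_local_time 0 \<omega> = 0"
  unfolding total_local_time_def by (simp add: L_0)

lemma total_continuous: "\<omega> \<in> space M \<Longrightarrow> continuous_on {0..} (\<lambda>t. total_local_time t \<omega>)"
  unfolding total_local_time_def by (intro continuous_on_sum L_continuous)

lemma total_measurable: "0 \<le> t \<Longrightarrow> total_local_time t \<in> borel_measurable M"
  unfolding total_local_time_def[abs_def] by (intro borel_measurable_sum L_measurable)

lemma total_right_continuous:
  "\<omega> \<in> space M \<Longrightarrow> 0 \<le> t \<Longrightarrow> ((\<lambda>s. total_local_time s \<omega>) \<longlongrightarrow> total_local_time t \<omega>) (at_right t)"
  unfolding total_local_time_def by (intro tendsto_sum L_right_continuous)

lemma total_local_time_increases_at_rational_levels: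
  "AE \<omega> in P x k. \<omega> \<in> unbounded_paths \<longrightarrow> (\<forall>r::rat. 0 \<le> r \<longrightarrow> (\<forall>e>0.
     total_local_time (first_passage \<xi> (of_rat r) \<omega>) \<omega> < total_local_time (first_passage \<xi> (of_rat r) \<omega> + e) \<omega>))"
proof -
  have "AE \<omega> in P x k. \<forall>r::rat. \<forall>n m::nat. \<forall>j. 0 \<le> r \<longrightarrow>
     capped_passage (of_rat r) (real (Suc m)) \<omega> < real (Suc m) \<and> J (capped_passage (of_rat r) (real (Suc m)) \<omega>) \<omega> = j \<longrightarrow>
     L j (capped_passage (of_rat r) (real (Suc m)) \<omega>) \<omega> < L j (capped_passage (of_rat r) (real (Suc m)) \<omega> + 1 / real (Suc n)) \<omega>"
    unfolding AE_all_countable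
  proof (intro allI)
    fix r :: rat and n m :: nat and j
    show "AE \<omega> in P x k. 0 \<le> r \<longrightarrow>
     capped_passage (of_rat r) (real (Suc m)) \<omega> < real (Suc m) \<and> J (capped_passage (of_rat r) (real (Suc m)) \<omega>) \<omega> = j \<longrightarrow>
     L j (capped_passage (of_rat r) (real (Suc m)) \<omega>) \<omega> < L j (capped_passage (of_rat r) (real (Suc m)) \<omega> + 1 / real (Suc n)) \<omega>"
    proof (cases "0 \<le> r")
      case True
      then have "0 \<le> (of_rat r :: real)" by simp
      from local_time_increases_at_passage_in_state[where m="real (Suc m)" and e="1 / real (Suc n)" and x=x and k=k and j=j, OF _ this]
      show ?thesis by auto
    qed simp
  qed
  then show ?thesis using AE_space
  proof eventually_elim
    case (elim \<omega>)
    show ?case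
    proof (intro impI allI)
      fix r :: rat and e :: real assume ub: "\<omega> \<in> unbounded_paths" and r: "0 \<le> r" and e: "0 < e"
      let ?T = "first_passage \<xi> (of_rat r) \<omega>"
      have p: "passage_time \<xi> (of_rat r) \<omega> = ereal ?T"
        by (rule first_passage_properties(1)) (rule unbounded_pathsD(1)[OF ub])
      obtain m :: nat where m: "?T < real (Suc m)" by (metis reals_Archimedean2 less_trans lessI of_nat_less_iff)
      have c: "capped_passage (of_rat r) (real (Suc m)) \<omega> = ?T"
        using capped_passage_cases(4)[OF _ p, of "real (Suc m)"] m by simp
      obtain n :: nat where n: "1 / real (Suc n) < e" using e nat_approx_posE by blast
      let ?j = "J ?T \<omega>"
      have "0 \<le> r \<longrightarrow> capped_passage (of_rat r) (real (Suc m)) \<omega> < real (Suc m) \<and>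
          J (capped_passage (of_rat r) (real (Suc m)) \<omega>) \<omega> = ?j \<longrightarrow>
          L ?j (capped_passage (of_rat r) (real (Suc m)) \<omega>) \<omega> <
          L ?j (capped_passage (of_rat r) (real (Suc m)) \<omega> + 1 / real (Suc n)) \<omega>"
        using elim(1) by blast
      then have "L ?j ?T \<omega> < L ?j (?T + 1 / real (Suc n)) \<omega>" unfolding c using r m by blast
      also have "\<dots> \<le> L ?j (?T + e) \<omega>" using n elim(2) by (intro L_mono) auto
      finally have lt: "L ?j ?T \<omega> < L ?j (?T + e) \<omega>" .
      show "total_local_time ?T \<omega> < total_local_time (?T + e) \<omega>"
        unfolding total_local_time_def
        by (rule sum_strict_mono_ex1) (use lt e elim(2) in \<open>auto intro!: L_mono\<close>)
    qed
  qed
qed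

text \<open>
  The passage time is right-continuous in the level. If the local time were constant on an interval after
  the passage time of \<open>t\<close>, that interval would contain passage times of rational levels above \<open>t\<close>,
  at which it does increase.
\<close>

lemma total_local_time_increases_at_passage:
  "AE \<omega> in P x k. \<omega> \<in> unbounded_paths \<longrightarrow> (\<forall>t\<ge>0. \<forall>e>0.
     total_local_time (first_passage \<xi> t \<omega>) \<omega> < total_local_time (first_passage \<xi> t \<omega> + e) \<omega>)"
  using total_local_time_increases_at_rational_levels
proof eventually_elim
  case (elim \<omega>)
  show ?case
  proof (intro impI allI)
    fix t e :: real assume ub: "\<omega> \<in> unbounded_paths" and t: "0 \<le> t" and e: "0 < e"
    have \<omega>: "\<omega> \<in> space M" using unbounded_pathsD(2)[OF ub] .
    let ?T = "first_passage \<xi> t \<omega>"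
    (* the level is exceeded before ?T + e, hence so is some rational level above it *)
    obtain s where s: "?T \<le> s" "s < ?T + e" "t < \<xi> s \<omega>"
      using first_passage_properties(4)[where Z=\<xi> and t=t and \<omega>=\<omega>, OF unbounded_pathsD(1)[OF ub] e] by blast
    obtain r :: rat where r: "t < of_rat r" "of_rat r < \<xi> s \<omega>" using of_rat_dense[OF s(3)] by blast
    let ?S = "first_passage \<xi> (of_rat r) \<omega>"
    have "0 \<le> (of_rat r :: real)" using r(1) t by linarith
    then have r0: "0 \<le> r" by simp
    have Ss: "?S \<le> s"
      by (rule first_passage_properties(3)[where Z=\<xi> and t="of_rat r" and \<omega>=\<omega>, OF unbounded_pathsD(1)[OF ub] _ r(2)])
        (use s(1) first_passage_nonneg[of \<xi> t \<omega>] in linarith)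
    have TS: "?T \<le> ?S"
    proof (rule ccontr)
      assume "\<not> ?T \<le> ?S"
      then have lt: "?S < ?T" by simp
      have "of_rat r \<le> \<xi> ?S \<omega>"
        by (rule at_first_passage[where Z=\<xi>, OF unbounded_pathsD(1)[OF ub] xi_right_continuous[OF \<omega>]])
      moreover have "\<xi> ?S \<omega> \<le> t"
        by (rule first_passage_properties(2)[where Z=\<xi> and t=t and \<omega>=\<omega>, OF unbounded_pathsD(1)[OF ub] _ lt]) simp
      ultimately show False using r(1) by simp
    qed
    have "total_local_time ?T \<omega> \<le> total_local_time ?S \<omega>" using TS by (intro total_mono[OF \<omega>]) auto
    also have "\<dots> < total_local_time (?S + (?T + e - ?S)) \<omega>"
    proof -
      have "0 < ?T + e - ?S" using Ss s(2) by linarith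
      then show ?thesis using elim[rule_format, OF ub r0] by blast
    qed
    finally show "total_local_time ?T \<omega> < total_local_time (?T + e) \<omega>" by simp
  qed
qed

end

end

section \<open>Overshoots of ever finer skeletons\<close>

text \<open>
  The integral of \<open>exp (- l t) exp (- \<theta> (y - t))\<close> over \<open>0 \<le> t \<le> y\<close>.
\<close>

definition exp_quotient :: "real \<Rightarrow> real \<Rightarrow> real \<Rightarrow> real" where
  "exp_quotient l \<theta> y = (exp (- \<theta> * y) - exp (- l * y)) / (l - \<theta>)"

lemma exp_quotient_nonneg: "0 \<le> y \<Longrightarrow> 0 \<le> exp_quotient l \<theta> y"
proof -
  assume y: "0 \<le> y"
  consider "\<theta> < l" | "\<theta> = l" | "l < \<theta>" by linarith
  then show ?thesis
  proof cases
    case 1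
    then have "\<theta> * y \<le> l * y" using y by (simp add: mult_right_mono)
    with 1 show ?thesis by (simp add: exp_quotient_def)
  next
    case 3
    then have "l * y \<le> \<theta> * y" using y by (simp add: mult_right_mono)
    with 3 show ?thesis by (auto simp: exp_quotient_def intro!: divide_nonpos_nonpos)
  qed (simp add: exp_quotient_def)
qed

lemma nn_integral_exp_piece:
  assumes ab: "a \<le> b" and neq: "\<theta> \<noteq> l"
  shows "(\<integral>\<^sup>+t. ennreal (exp (- l * t) * exp (- \<theta> * (b - t))) * indicator {a..b} t \<partial>lborel)
    = ennreal (exp (- l * a) * exp_quotient l \<theta> (b - a))"
proof -
  define E where "E t = exp (- l * t) * exp (- \<theta> * (b - t))" for t
  have E': "(E has_real_derivative (\<theta> - l) * E t) (at t)" for t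
    unfolding E_def by (auto intro!: derivative_eq_intros simp: algebra_simps)
  have "(\<integral>\<^sup>+t. ennreal (E t) * indicator {a..b} t \<partial>lborel) = ennreal (E b / (\<theta> - l) - E a / (\<theta> - l))"
  proof (rule nn_integral_FTC_Icc)
    show "E \<in> borel_measurable borel" unfolding E_def[abs_def] by measurable
    show "((\<lambda>t. E t / (\<theta> - l)) has_real_derivative E t) (at t)" for t
      using DERIV_cdivide[OF E', of "\<theta> - l" t] neq by simp
    show "0 \<le> E t" for t by (simp add: E_def)
  qed (use ab in auto)
  also have "E b / (\<theta> - l) - E a / (\<theta> - l) = exp (- l * a) * exp_quotient l \<theta> (b - a)"
  proof -
    have "exp (- l * b) = exp (- l * a) * exp (- l * (b - a))" by (simp add: exp_add[symmetric] algebra_simps)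
    then have "E b / (\<theta> - l) - E a / (\<theta> - l)
        = exp (- l * a) * ((exp (- l * (b - a)) - exp (- \<theta> * (b - a))) / (\<theta> - l))"
      by (simp add: E_def diff_divide_distrib right_diff_distrib)
    also have "(exp (- l * (b - a)) - exp (- \<theta> * (b - a))) / (\<theta> - l) = exp_quotient l \<theta> (b - a)"
      unfolding exp_quotient_def by (metis minus_diff_eq minus_divide_divide)
    finally show ?thesis .
  qed
  finally show ?thesis by (simp only: E_def)
qed

lemma nn_integral_exp_half_line:
  assumes "0 < l"
  shows "(\<integral>\<^sup>+t. ennreal (exp (- l * t)) * indicator {0..} t \<partial>lborel) = ennreal (1 / l)"
proof -
  have lim: "((\<lambda>t. - exp (- l * t) / l) \<longlongrightarrow> 0) at_top"
  proof -
    have "filterlim (\<lambda>t. l * t) at_top at_top"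
      using assms by (intro filterlim_tendsto_pos_mult_at_top[OF tendsto_const]) (auto simp: filterlim_ident)
    then have "filterlim (\<lambda>t. - (l * t)) at_bot at_top" by (simp add: filterlim_uminus_at_bot)
    then have "((\<lambda>t. exp (- (l * t))) \<longlongrightarrow> 0) at_top" by (rule filterlim_compose[OF exp_at_bot])
    then have "((\<lambda>t. - exp (- (l * t)) / l) \<longlongrightarrow> - 0 / l) at_top"
      using assms by (intro tendsto_divide tendsto_minus tendsto_const) auto
    then show ?thesis by simp
  qed
  have "(\<integral>\<^sup>+t. ennreal (exp (- l * t)) * indicator {0..} t \<partial>lborel) = ennreal (0 - (- exp (- l * 0) / l))"
  proof (rule nn_integral_FTC_atLeast[OF _ _ _ lim])
    show "((\<lambda>t. - exp (- l * t) / l) has_real_derivative exp (- l * t)) (at t)" for t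
      using assms by (auto intro!: derivative_eq_intros)
  qed auto
  then show ?thesis by simp
qed

definition limit_integrand :: "real \<Rightarrow> real \<Rightarrow> (real \<Rightarrow> real) \<Rightarrow> (real \<Rightarrow> bool) \<Rightarrow> real \<Rightarrow> ennreal" where
  "limit_integrand l \<theta> X A' t = ennreal (exp (- l * t) * (if A' t then exp (- \<theta> * (X t - t)) else 0)) * indicator {0..} t"

text \<open>
  \<open>H p m\<close> is the \<open>m\<close>-th point of the \<open>p\<close>-th skeleton and \<open>A p m\<close> says that it is in the state under consideration.
  Levels outside the countable set \<open>C\<close> of skeleton points lie strictly between two consecutive points.
\<close>

context
  fixes H :: "nat \<Rightarrow> nat \<Rightarrow> real" and A :: "nat \<Rightarrow> nat \<Rightarrow> bool" and l \<theta> :: real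
  assumes mono: "\<And>p m. H p m \<le> H p (Suc m)" and H0: "\<And>p. H p 0 = 0" and l: "0 < l" and \<theta>: "0 \<le> \<theta>" "\<theta> \<noteq> l"
begin

definition piece :: "nat \<Rightarrow> nat \<Rightarrow> real \<Rightarrow> ennreal" where
  "piece p m t = ennreal (if A p (Suc m) then 1 else 0) *
     (ennreal (exp (- l * t) * exp (- \<theta> * (H p (Suc m) - t))) * indicator {H p m..H p (Suc m)} t)"

lemma piece_measurable: "piece p m \<in> borel_measurable lborel"
  unfolding piece_def[abs_def] by measurable

lemma nn_integral_piece:
  "(\<integral>\<^sup>+t. piece p m t \<partial>lborel) =
    ennreal (if A p (Suc m) then exp (- l * H p m) * exp_quotient l \<theta> (H p (Suc m) - H p m) else 0)"
proof -
  have "(\<integral>\<^sup>+t. piece p m t \<partial>lborel) = ennreal (if A p (Suc m) then 1 else 0) *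
      (\<integral>\<^sup>+t. ennreal (exp (- l * t) * exp (- \<theta> * (H p (Suc m) - t))) * indicator {H p m..H p (Suc m)} t \<partial>lborel)"
    unfolding piece_def by (intro nn_integral_cmult) measurable
  also have "\<dots> = ennreal (if A p (Suc m) then 1 else 0) * ennreal (exp (- l * H p m) * exp_quotient l \<theta> (H p (Suc m) - H p m))"
    by (simp only: nn_integral_exp_piece[OF mono \<theta>(2)])
  finally show ?thesis by simp
qed

lemma H_nonneg: "0 \<le> H p m"
proof (induction m)
  case 0
  show ?case by (simp add: H0)
next
  case (Suc m)
  show ?case by (rule order_trans[OF Suc mono])
qed

lemma H_mono: "m \<le> n \<Longrightarrow> H p m \<le> H p n"
  by (rule lift_Suc_mono_le[of "H p"]) (rule mono)

lemma piece_other: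
  assumes "H p m0 < t" "t < H p (Suc m0)" "m \<noteq> m0"
  shows "piece p m t = 0"
proof -
  have "t \<notin> {H p m..H p (Suc m)}"
  proof (cases "m < m0")
    case True
    then show ?thesis using H_mono[of "Suc m" m0 p] assms by auto
  next
    case False
    then show ?thesis using H_mono[of "Suc m0" m p] assms by auto
  qed
  then show ?thesis by (simp add: piece_def)
qed

lemma sum_piece:
  assumes "H p m0 < t" "t < H p (Suc m0)"
  shows "(\<Sum>m. piece p m t) = ennreal (if A p (Suc m0) then exp (- l * t) * exp (- \<theta> * (H p (Suc m0) - t)) else 0)"
proof -
  have "(\<Sum>m. piece p m t) = (\<Sum>m\<in>{m0}. piece p m t)"
    by (rule suminf_finite) (use piece_other[OF assms] in auto)
  then show ?thesis using assms by (simp add: piece_def)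
qed

lemma sum_piece_negative: "t < 0 \<Longrightarrow> (\<Sum>m. piece p m t) = 0"
proof -
  assume "t < 0"
  then have "piece p m t = 0" for m using H_nonneg[of p m] by (simp add: piece_def)
  then show ?thesis by simp
qed

context
  fixes C :: "real set" and X :: "real \<Rightarrow> real" and A' :: "real \<Rightarrow> bool"
  assumes C: "countable C"
    and bracket: "\<And>t. 0 \<le> t \<Longrightarrow> t \<notin> C \<Longrightarrow> \<exists>m::nat \<Rightarrow> nat. (\<forall>p. H p (m p) < t \<and> t < H p (Suc (m p))) \<and>
      (\<lambda>p. H p (Suc (m p))) \<longlonglongrightarrow> X t \<and> (\<forall>\<^sub>F p in sequentially. A p (Suc (m p)) = A' t)"
    and X: "X \<in> borel_measurable borel" and A': "Measurable.pred borel A'"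
begin

lemma AE_not_C: "AE t in lborel. t \<notin> C"
  using countable_imp_null_set_lborel[OF C] by (rule AE_not_in)

lemma AE_sum_piece_le: "AE t in lborel. (\<Sum>m. piece p m t) \<le> ennreal (exp (- l * t)) * indicator {0..} t"
  using AE_not_C
proof eventually_elim
  case (elim t)
  show ?case
  proof (cases "t < 0")
    case True
    then show ?thesis by (simp add: sum_piece_negative)
  next
    case False
    then obtain m where m: "H p (m p) < t" "t < H p (Suc (m p))" using bracket[of t] elim by (auto simp: not_less)
    have "exp (- \<theta> * (H p (Suc (m p)) - t)) \<le> 1" using \<theta>(1) m(2) by simp
    then have "exp (- l * t) * exp (- \<theta> * (H p (Suc (m p)) - t)) \<le> exp (- l * t) * 1" by (intro mult_left_mono) auto
    then show ?thesis using False unfolding sum_piece[OF m] by (auto intro!: ennreal_leI)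
  qed
qed

lemma AE_sum_piece_tendsto: "AE t in lborel. (\<lambda>p. \<Sum>m. piece p m t) \<longlonglongrightarrow> limit_integrand l \<theta> X A' t"
  using AE_not_C
proof eventually_elim
  case (elim t)
  show ?case
  proof (cases "t < 0")
    case True
    then show ?thesis by (simp add: sum_piece_negative limit_integrand_def)
  next
    case False
    then obtain m where m: "\<And>p. H p (m p) < t" "\<And>p. t < H p (Suc (m p))"
      and lim: "(\<lambda>p. H p (Suc (m p))) \<longlonglongrightarrow> X t" and ev: "\<forall>\<^sub>F p in sequentially. A p (Suc (m p)) = A' t"
      using bracket[of t] elim by (auto simp: not_less)
    have "(\<lambda>p. ennreal (if A' t then exp (- l * t) * exp (- \<theta> * (H p (Suc (m p)) - t)) else 0))
        \<longlonglongrightarrow> ennreal (if A' t then exp (- l * t) * exp (- \<theta> * (X t - t)) else 0)"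
      by (cases "A' t") (auto intro!: tendsto_ennrealI tendsto_intros lim)
    moreover have "\<forall>\<^sub>F p in sequentially. ennreal (if A' t then exp (- l * t) * exp (- \<theta> * (H p (Suc (m p)) - t)) else 0)
        = (\<Sum>m. piece p m t)"
      using ev by eventually_elim (simp add: sum_piece[OF m])
    ultimately have "(\<lambda>p. \<Sum>m. piece p m t) \<longlonglongrightarrow> ennreal (if A' t then exp (- l * t) * exp (- \<theta> * (X t - t)) else 0)"
      by (rule Lim_transform_eventually)
    then show ?thesis using False by (cases "A' t") (simp_all add: limit_integrand_def)
  qed
qed

lemma sum_piece_measurable: "(\<lambda>t. \<Sum>m. piece p m t) \<in> borel_measurable lborel"
  using piece_measurable[measurable] by measurable

lemma skeleton_sum_eq:
  "(\<Sum>m. ennreal (if A p (Suc m) then exp (- l * H p m) * exp_quotient l \<theta> (H p (Suc m) - H p m) else 0))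
    = (\<integral>\<^sup>+t. (\<Sum>m. piece p m t) \<partial>lborel)"
  unfolding nn_integral_suminf[OF piece_measurable] nn_integral_piece ..

lemma skeleton_sum_le:
  "(\<Sum>m. ennreal (if A p (Suc m) then exp (- l * H p m) * exp_quotient l \<theta> (H p (Suc m) - H p m) else 0)) \<le> ennreal (1 / l)"
proof -
  have "(\<integral>\<^sup>+t. (\<Sum>m. piece p m t) \<partial>lborel) \<le> (\<integral>\<^sup>+t. ennreal (exp (- l * t)) * indicator {0..} t \<partial>lborel)"
    by (rule nn_integral_mono_AE[OF AE_sum_piece_le])
  then show ?thesis by (simp only: skeleton_sum_eq nn_integral_exp_half_line[OF l])
qed

text \<open>
  Integrating over the level interval by interval gives the sum; pointwise only the interval containing the level
  contributes, so dominated convergence with bound \<open>exp (- l t)\<close> applies.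
\<close>

lemma skeleton_sum_tendsto:
  "(\<lambda>p. \<Sum>m. ennreal (if A p (Suc m) then exp (- l * H p m) * exp_quotient l \<theta> (H p (Suc m) - H p m) else 0))
    \<longlonglongrightarrow> (\<integral>\<^sup>+t. limit_integrand l \<theta> X A' t \<partial>lborel)"
  unfolding skeleton_sum_eq
proof (rule nn_integral_dominated_convergence[where w="\<lambda>t. ennreal (exp (- l * t)) * indicator {0..} t"])
  show "limit_integrand l \<theta> X A' \<in> borel_measurable lborel"
    unfolding limit_integrand_def[abs_def] using X A' by measurable
  show "(\<integral>\<^sup>+t. ennreal (exp (- l * t)) * indicator {0..} t \<partial>lborel) < \<infinity>"
    unfolding nn_integral_exp_half_line[OF l] by simp
  show "(\<lambda>t. \<Sum>m. piece p m t) \<in> borel_measurable lborel" for p by (rule sum_piece_measurable)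
  show "(\<lambda>t. ennreal (exp (- l * t)) * indicator {0..} t) \<in> borel_measurable lborel" by measurable
  show "AE t in lborel. (\<Sum>m. piece p m t) \<le> ennreal (exp (- l * t)) * indicator {0..} t" for p
    by (rule AE_sum_piece_le)
  show "AE t in lborel. (\<lambda>p. \<Sum>m. piece p m t) \<longlonglongrightarrow> limit_integrand l \<theta> X A' t" by (rule AE_sum_piece_tendsto)
qed

end

end

section \<open>The ladder height process at its passage times\<close>

context markov_additive_process
begin

context
  fixes L :: "'n \<Rightarrow> real \<Rightarrow> 'w \<Rightarrow> real"
  assumes lt: "\<And>i. local_time (space M) F {P x k | x k. True} state_space (reflected \<xi> J) (0, i) (P 0 i) (L i)"
begin

abbreviation tot where "tot \<equiv> total_local_time L"

lemma ladder_eq: "ladder \<xi> J L s \<omega> = (\<xi> (first_passage tot s \<omega>) \<omega>, J (first_passage tot s \<omega>) \<omega>)"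
proof -
  have "(\<lambda>s \<omega>. \<Sum>i\<in>UNIV. L i s \<omega>) = tot" by (simp add: fun_eq_iff total_local_time_def[OF lt])
  then show ?thesis by (simp add: ladder_def inverse_time_eq_passage_time Let_def)
qed

lemma ladder_measurable: "ladder \<xi> J L s \<in> M \<rightarrow>\<^sub>M state_space"
proof -
  have "(\<lambda>\<omega>. passage_time tot s \<omega>) \<in> borel_measurable M"
    using measurable_compose[OF measurable_Pair1'[of s borel M]
      passage_time_jointly_measurable[OF total_measurable[OF lt] total_right_continuous[OF lt]]] by simp
  then have T: "(\<lambda>\<omega>. first_passage tot s \<omega>) \<in> borel_measurable M" by (intro borel_measurable_real_of_ereal)
  have "(\<lambda>\<omega>. (\<xi> (first_passage tot s \<omega>) \<omega>, J (first_passage tot s \<omega>) \<omega>)) \<in> M \<rightarrow>\<^sub>M state_space"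
    by (intro measurable_Pair process_at_measurable[where w="\<lambda>\<omega>. \<omega>"] T) auto
  moreover have "ladder \<xi> J L s = (\<lambda>\<omega>. (\<xi> (first_passage tot s \<omega>) \<omega>, J (first_passage tot s \<omega>) \<omega>))"
    by (rule ext) (rule ladder_eq)
  ultimately show ?thesis by (simp only:)
qed

context
  fixes \<omega> :: 'w
  assumes ub: "\<omega> \<in> unbounded_paths"
    and inc: "\<And>t e. 0 \<le> t \<Longrightarrow> 0 < e \<Longrightarrow> tot (first_passage \<xi> t \<omega>) \<omega> < tot (first_passage \<xi> t \<omega> + e) \<omega>"
begin

lemma \<omega>: "\<omega> \<in> space M" by (rule unbounded_pathsD(2)[OF ub])

text \<open>
  Before the local time reaches its value at the passage time, the inverse local time is below the passage
  time.
\<close>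

lemma ladder_before_passage:
  assumes t: "0 \<le> t" and s: "0 \<le> s" "s < tot (first_passage \<xi> t \<omega>) \<omega>"
  shows "fst (ladder \<xi> J L s \<omega>) \<le> t"
proof -
  let ?T = "first_passage \<xi> t \<omega>"
  have T: "0 < ?T"
    using s total_0[OF lt \<omega>] first_passage_nonneg[of \<xi> t \<omega>] by (cases "?T = 0") (auto simp: less_le)
  have "((\<lambda>u. tot u \<omega>) \<longlongrightarrow> tot ?T \<omega>) (at ?T within {0..})"
    using total_continuous[OF lt \<omega>] T by (auto simp: continuous_on_def)
  then have "((\<lambda>u. tot u \<omega>) \<longlongrightarrow> tot ?T \<omega>) (at ?T within {0..<?T})" by (rule tendsto_within_subset) auto
  then have "\<forall>\<^sub>F u in at ?T within {0..<?T}. s < tot u \<omega>" using s(2) by (rule order_tendstoD)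
  then obtain \<delta> where \<delta>: "0 < \<delta>"
      "\<forall>u\<in>{0..<?T}. u \<noteq> ?T \<and> dist u ?T < \<delta> \<longrightarrow> s < tot u \<omega>"
    unfolding eventually_at by (elim exE conjE)
  define u where "u = max 0 (?T - \<delta> / 2)"
  have u: "0 \<le> u" "u < ?T" using \<delta>(1) T by (simp_all add: u_def)
  have "dist u ?T < \<delta>" using \<delta>(1) T by (simp add: u_def dist_real_def)
  then have "s < tot u \<omega>" using \<delta>(2) u by auto
  note u = u this
  have "first_passage tot s \<omega> \<le> u"
    by (rule first_passage_properties(3)[where Z=tot and t=s and \<omega>=\<omega>]) (use u in auto)
  then have "\<xi> (first_passage tot s \<omega>) \<omega> \<le> t"
    using first_passage_properties(2)[where Z=\<xi> and t=t and \<omega>=\<omega>, OF unbounded_pathsD(1)[OF ub], of "first_passage tot s \<omega>"] u(2)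
    by simp
  then show ?thesis by (simp add: ladder_eq)
qed

text \<open>
  This is where the strict increase of the local time after the passage time enters: local time values
  slightly above its value at the passage time are reached immediately.
\<close>

lemma first_passage_total_tendsto:
  assumes t: "0 \<le> t" and s: "s \<longlonglongrightarrow> tot (first_passage \<xi> t \<omega>) \<omega>" "\<And>p. tot (first_passage \<xi> t \<omega>) \<omega> \<le> s p"
  shows "(\<lambda>p. first_passage tot (s p) \<omega>) \<longlonglongrightarrow> first_passage \<xi> t \<omega>"
    "\<forall>\<^sub>F p in sequentially. first_passage \<xi> t \<omega> \<le> first_passage tot (s p) \<omega>"
proof -
  let ?T = "first_passage \<xi> t \<omega>"
  have near: "\<forall>\<^sub>F p in sequentially. ?T \<le> first_passage tot (s p) \<omega> \<and> first_passage tot (s p) \<omega> \<le> ?T + e" if e: "0 < e" for e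
    using order_tendstoD(2)[OF s(1) inc[OF t e]]
  proof eventually_elim
    case (elim p)
    then have ex: "\<exists>u\<ge>0. s p < tot u \<omega>" using e by (intro exI[of _ "?T + e"]) auto
    have "first_passage tot (s p) \<omega> \<le> ?T + e"
      by (rule first_passage_properties(3)[where Z=tot and t="s p" and \<omega>=\<omega>, OF ex]) (use e elim in auto)
    moreover have "?T \<le> first_passage tot (s p) \<omega>"
    proof (rule ccontr)
      assume "\<not> ?T \<le> first_passage tot (s p) \<omega>"
      then have "0 < ?T - first_passage tot (s p) \<omega>" by simp
      from first_passage_properties(4)[where Z=tot and t="s p" and \<omega>=\<omega>, OF ex this]
      obtain v where v: "first_passage tot (s p) \<omega> \<le> v" "v < ?T" "s p < tot v \<omega>" by auto
      have "tot v \<omega> \<le> tot ?T \<omega>"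
        using v first_passage_nonneg[of tot "s p" \<omega>] by (intro total_mono[OF lt \<omega>]) linarith+
      with v(3) s(2)[of p] show False by simp
    qed
    ultimately show ?case by simp
  qed
  show "\<forall>\<^sub>F p in sequentially. ?T \<le> first_passage tot (s p) \<omega>"
    using near[of 1] by (auto elim: eventually_mono)
  show "(\<lambda>p. first_passage tot (s p) \<omega>) \<longlonglongrightarrow> ?T"
  proof (rule tendstoI)
    fix e :: real assume "0 < e"
    then have "0 < e / 2" by simp
    from near[OF this] show "\<forall>\<^sub>F p in sequentially. dist (first_passage tot (s p) \<omega>) ?T < e"
      by eventually_elim (use \<open>0 < e\<close> in \<open>auto simp: dist_real_def\<close>)
  qed
qed

lemma ladder_tendsto:
  assumes t: "0 \<le> t" and s: "s \<longlonglongrightarrow> tot (first_passage \<xi> t \<omega>) \<omega>" "\<And>p. tot (first_passage \<xi> t \<omega>) \<omega> \<le> s p"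
  shows "(\<lambda>p. fst (ladder \<xi> J L (s p) \<omega>)) \<longlonglongrightarrow> \<xi> (first_passage \<xi> t \<omega>) \<omega>"
    "\<forall>\<^sub>F p in sequentially. snd (ladder \<xi> J L (s p) \<omega>) = J (first_passage \<xi> t \<omega>) \<omega>"
proof -
  let ?T = "first_passage \<xi> t \<omega>"
  note fp = first_passage_total_tendsto[OF t s]
  have T0: "0 \<le> ?T" by simp
  have cont: "((\<lambda>u. \<xi> u \<omega>) \<longlongrightarrow> \<xi> ?T \<omega>) (at ?T within {?T..})"
    using xi_right_continuous[OF \<omega> T0] by (simp add: at_within_Ici_at_right)
  have evJ: "\<forall>\<^sub>F u in at_right ?T. J u \<omega> = J ?T \<omega>" by (rule J_right_continuous[OF \<omega> T0])
  then obtain b where b: "?T < b" "\<And>u. ?T < u \<Longrightarrow> u < b \<Longrightarrow> J u \<omega> = J ?T \<omega>" by (auto simp: eventually_at_right_field)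
  show "\<forall>\<^sub>F p in sequentially. snd (ladder \<xi> J L (s p) \<omega>) = J ?T \<omega>"
    using order_tendstoD(2)[OF fp(1) b(1)] fp(2)
  proof eventually_elim
    case (elim p)
    then show ?case using b(2)[of "first_passage tot (s p) \<omega>"]
      by (cases "first_passage tot (s p) \<omega> = ?T") (auto simp: ladder_eq)
  qed
  have "(\<lambda>p. \<xi> (first_passage tot (s p) \<omega>) \<omega>) \<longlonglongrightarrow> \<xi> ?T \<omega>"
  proof (rule tendstoI)
    fix e :: real assume e: "0 < e"
    have "\<forall>\<^sub>F u in at_right ?T. dist (\<xi> u \<omega>) (\<xi> ?T \<omega>) < e"
      using tendstoD[OF xi_right_continuous[OF \<omega> T0] e] .
    then obtain c where c: "?T < c" "\<And>u. ?T < u \<Longrightarrow> u < c \<Longrightarrow> dist (\<xi> u \<omega>) (\<xi> ?T \<omega>) < e"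
      by (auto simp: eventually_at_right_field)
    show "\<forall>\<^sub>F p in sequentially. dist (\<xi> (first_passage tot (s p) \<omega>) \<omega>) (\<xi> ?T \<omega>) < e"
      using order_tendstoD(2)[OF fp(1) c(1)] fp(2)
    proof eventually_elim
      case (elim p)
      then show ?case using c(2)[of "first_passage tot (s p) \<omega>"] e
        by (cases "first_passage tot (s p) \<omega> = ?T") auto
    qed
  qed
  then show "(\<lambda>p. fst (ladder \<xi> J L (s p) \<omega>)) \<longlonglongrightarrow> \<xi> ?T \<omega>" by (simp add: ladder_eq)
qed

abbreviation dyadic_ladder :: "nat \<Rightarrow> nat \<Rightarrow> real \<times> 'n" where
  "dyadic_ladder p m \<equiv> ladder \<xi> J L (real m / 2 ^ p) \<omega>"

context
  assumes mono: "\<And>p m. fst (dyadic_ladder p m) \<le> fst (dyadic_ladder p (Suc m))"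
begin

lemma dyadic_ladder_mono:
  assumes "real m / 2 ^ p \<le> real n / 2 ^ q"
  shows "fst (dyadic_ladder p m) \<le> fst (dyadic_ladder q n)"
proof -
  have eq: "real m / 2 ^ p = real (m * 2 ^ q) / 2 ^ (p + q)" "real n / 2 ^ q = real (n * 2 ^ p) / 2 ^ (p + q)"
    by (simp_all add: power_add)
  have "real (m * 2 ^ q) \<le> real (n * 2 ^ p)" using assms unfolding eq by (simp add: divide_le_cancel)
  then have "m * 2 ^ q \<le> n * 2 ^ p" by (simp only: of_nat_le_iff)
  then have "fst (dyadic_ladder (p + q) (m * 2 ^ q)) \<le> fst (dyadic_ladder (p + q) (n * 2 ^ p))"
    by (rule lift_Suc_mono_le[of "\<lambda>m. fst (dyadic_ladder (p + q) m)", rotated]) (rule mono)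
  then show ?thesis unfolding eq .
qed

lemma ladder_after_passage:
  assumes t: "0 \<le> t" and m: "tot (first_passage \<xi> t \<omega>) \<omega> < real m / 2 ^ p"
  shows "t \<le> fst (dyadic_ladder p m)"
proof -
  let ?S = "tot (first_passage \<xi> t \<omega>) \<omega>"
  have S: "0 \<le> ?S" using total_mono[OF lt \<omega>, of 0 "first_passage \<xi> t \<omega>"] total_0[OF lt \<omega>] by simp
  define s where "s q = (real (nat \<lfloor>?S * 2 ^ q\<rfloor>) + 1) / 2 ^ q" for q :: nat
  have s: "s \<longlonglongrightarrow> ?S" "\<And>q. ?S < s q" unfolding s_def using dyadic_from_right[OF S] by auto
  have lim: "(\<lambda>q. fst (ladder \<xi> J L (s q) \<omega>)) \<longlonglongrightarrow> \<xi> (first_passage \<xi> t \<omega>) \<omega>"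
    using ladder_tendsto(1)[OF t s(1)] s(2) by (simp add: less_imp_le)
  have "\<forall>\<^sub>F q in sequentially. fst (ladder \<xi> J L (s q) \<omega>) \<le> fst (dyadic_ladder p m)"
    using order_tendstoD(2)[OF s(1) m]
  proof eventually_elim
    case (elim q)
    have eq: "s q = real (Suc (nat \<lfloor>?S * 2 ^ q\<rfloor>)) / 2 ^ q" by (simp add: s_def)
    show ?case unfolding eq by (rule dyadic_ladder_mono) (use elim in \<open>simp add: eq[symmetric] del: of_nat_Suc\<close>)
  qed
  then have "\<xi> (first_passage \<xi> t \<omega>) \<omega> \<le> fst (dyadic_ladder p m)"
    by (rule tendsto_upperbound[OF lim]) simp
  moreover have "t \<le> \<xi> (first_passage \<xi> t \<omega>) \<omega>"
    by (rule at_first_passage[where Z=\<xi>, OF unbounded_pathsD(1)[OF ub] xi_right_continuous[OF \<omega>]])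
  ultimately show ?thesis by simp
qed

text \<open>
  The last dyadic clock time not beyond the local time at the passage and its successor bracket the level, and
  by right-continuity the ladder process at the successor approaches the position at the passage.
\<close>

lemma skeleton_brackets_passage:
  assumes t: "0 \<le> t" and nC: "\<And>p m. t \<noteq> fst (dyadic_ladder p m)" and H0: "fst (dyadic_ladder 0 0) = 0"
  shows "\<exists>m::nat \<Rightarrow> nat. (\<forall>p. fst (dyadic_ladder p (m p)) < t \<and> t < fst (dyadic_ladder p (Suc (m p)))) \<and>
    (\<lambda>p. fst (dyadic_ladder p (Suc (m p)))) \<longlonglongrightarrow> \<xi> (first_passage \<xi> t \<omega>) \<omega> \<and>
    (\<forall>\<^sub>F p in sequentially. snd (dyadic_ladder p (Suc (m p))) = J (first_passage \<xi> t \<omega>) \<omega>)"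
proof -
  let ?S = "tot (first_passage \<xi> t \<omega>) \<omega>"
  have before: "fst (dyadic_ladder p m) < t" if "real m / 2 ^ p < ?S" for p m
    by (rule order.not_eq_order_implies_strict[OF nC[where p=p and m=m, symmetric] ladder_before_passage[OF t _ that]]) simp
  have after: "t < fst (dyadic_ladder p m)" if "?S < real m / 2 ^ p" for p m
    by (rule order.not_eq_order_implies_strict[OF nC[where p=p and m=m] ladder_after_passage[OF t that]])
  have "\<exists>m. fst (dyadic_ladder p m) < t \<and> t < fst (dyadic_ladder p (Suc m))" for p
  proof -
    have ex: "\<exists>m. t < fst (dyadic_ladder p m)"
    proof -
      obtain m :: nat where "?S * 2 ^ p < real m" using reals_Archimedean2 by blast
      then have "?S < real m / 2 ^ p" by (simp add: field_simps)
      then show ?thesis using after by blast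
    qed
    define m where "m = (LEAST m. t < fst (dyadic_ladder p m))"
    have m: "t < fst (dyadic_ladder p m)" unfolding m_def by (rule LeastI_ex[OF ex])
    have "m \<noteq> 0"
    proof
      assume "m = 0"
      with m H0 t show False by simp
    qed
    then obtain k where k: "m = Suc k" using not0_implies_Suc by blast
    have "\<not> t < fst (dyadic_ladder p k)" using not_less_Least[of k "\<lambda>m. t < fst (dyadic_ladder p m)"] k by (simp add: m_def)
    then have "fst (dyadic_ladder p k) \<le> t" by (rule leI)
    then have "fst (dyadic_ladder p k) < t" by (rule order.not_eq_order_implies_strict[OF nC[where p=p and m=k, symmetric]])
    with m k show ?thesis by blast
  qed
  then obtain m where m: "\<And>p. fst (dyadic_ladder p (m p)) < t" "\<And>p. t < fst (dyadic_ladder p (Suc (m p)))" by metis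
  have lo: "real (m p) / 2 ^ p \<le> ?S" for p
    using after[of "m p" p] m(1)[of p] by (meson less_asym not_le)
  have hi: "?S \<le> real (Suc (m p)) / 2 ^ p" for p
    using before[of "Suc (m p)" p] m(2)[of p] by (meson less_asym not_le)
  have "(\<lambda>p. real (Suc (m p)) / 2 ^ p) \<longlonglongrightarrow> ?S"
  proof (rule tendsto_sandwich[of "\<lambda>_. ?S" _ _ "\<lambda>p. ?S + (1 / 2) ^ p"])
    have "(\<lambda>p. ?S + (1 / 2) ^ p) \<longlonglongrightarrow> ?S + 0" by (intro tendsto_add tendsto_const LIMSEQ_realpow_zero) auto
    then show "(\<lambda>p. ?S + (1 / 2) ^ p) \<longlonglongrightarrow> ?S" by simp
    have "real (Suc (m p)) / 2 ^ p \<le> ?S + (1 / 2) ^ p" for p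
      using lo[of p] by (simp add: add_divide_distrib power_one_over)
    then show "\<forall>\<^sub>F p in sequentially. real (Suc (m p)) / 2 ^ p \<le> ?S + (1 / 2) ^ p" by simp
  qed (use hi in auto)
  from ladder_tendsto[OF t this hi] m show ?thesis by blast
qed

end

end

end

end

section \<open>The overshoot resolvent from the origin\<close>

lemma distr_process_law_pair:
  assumes X: "\<And>t. 0 \<le> t \<Longrightarrow> X t \<in> A \<rightarrow>\<^sub>M S" and s: "0 \<le> s" "0 \<le> t"
  shows "distr (process_law A S X) (S \<Otimes>\<^sub>M S) (\<lambda>g. (g s, g t)) = distr A (S \<Otimes>\<^sub>M S) (\<lambda>\<omega>. (X s \<omega>, X t \<omega>))"
proof -
  have p: "(\<lambda>g. (g s, g t)) \<in> (\<Pi>\<^sub>M t\<in>{0..}. S) \<rightarrow>\<^sub>M S \<Otimes>\<^sub>M S"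
    using s by (intro measurable_Pair measurable_component_singleton) auto
  have "(\<lambda>\<omega>. \<lambda>t\<in>{0..}. X t \<omega>) \<in> A \<rightarrow>\<^sub>M (\<Pi>\<^sub>M t\<in>{0..}. S)" by (intro measurable_restrict X) simp
  then show ?thesis unfolding process_law_def using s by (simp add: distr_distr[OF p] o_def)
qed

lemma process_law_pair:
  assumes "\<And>t. 0 \<le> t \<Longrightarrow> X t \<in> A \<rightarrow>\<^sub>M S" and "\<And>t. 0 \<le> t \<Longrightarrow> Y t \<in> B \<rightarrow>\<^sub>M S"
    and "process_law A S X = process_law B S Y" and "0 \<le> s" "0 \<le> t"
  shows "distr A (S \<Otimes>\<^sub>M S) (\<lambda>\<omega>. (X s \<omega>, X t \<omega>)) = distr B (S \<Otimes>\<^sub>M S) (\<lambda>\<omega>. (Y s \<omega>, Y t \<omega>))"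
  using distr_process_law_pair[where X=X, OF assms(1,4,5)] distr_process_law_pair[where X=Y, OF assms(2,4,5)] assms(3)
  by simp

definition exp_test :: "real \<Rightarrow> 'n \<Rightarrow> real \<times> 'n \<Rightarrow> real" where
  "exp_test \<theta> k z = (if snd z = k then exp (- \<theta> * fst z) else 0)"

lemma exp_test_measurable [measurable]: "exp_test \<theta> (k :: 'n::finite) \<in> borel_measurable state_space"
  unfolding exp_test_def[abs_def] by measurable

lemma exp_test_nonneg [simp]: "0 \<le> exp_test \<theta> k z"
  by (simp add: exp_test_def)

context markov_additive_process
begin

context
  fixes L :: "'n \<Rightarrow> real \<Rightarrow> 'w \<Rightarrow> real"
    and N :: "'n \<Rightarrow> 'v measure" and Q :: "real^'n^'n" and d :: "'n \<Rightarrow> real"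
    and \<nu> :: "'n \<Rightarrow> real measure" and G :: "'n \<Rightarrow> 'n \<Rightarrow> real measure"
    and K :: "'n \<Rightarrow> real \<Rightarrow> 'v \<Rightarrow> 'n" and Y :: "'n \<Rightarrow> nat \<Rightarrow> 'n \<Rightarrow> real \<Rightarrow> 'v \<Rightarrow> real"
    and U :: "'n \<Rightarrow> nat \<Rightarrow> 'n \<Rightarrow> 'n \<Rightarrow> 'v \<Rightarrow> real"
  assumes lt: "\<And>i. local_time (space M) F {P x k | x k. True} state_space (reflected \<xi> J) (0, i) (P 0 i) (L i)"
    and char: "ma_characteristics Q d \<nu> G" and ing: "\<And>i. ma_ingredients (N i) i Q d \<nu> G (K i) (Y i) (U i)"
    and law: "\<And>i. process_law (P 0 i) state_space (ladder \<xi> J L) =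
                   process_law (N i) state_space (ma_path (K i) (Y i) (U i))"
    and ub: "\<And>x i. AE \<omega> in P x i. \<omega> \<in> unbounded_paths"
begin

abbreviation ma where "ma i \<equiv> ma_path (K i) (Y i) (U i)"

text \<open>From here on the law of the ladder process enters through its two-dimensional marginals.\<close>

lemma ladder_pair_law:
  assumes "0 \<le> s" "0 \<le> t"
  shows "distr (P 0 i) (state_space \<Otimes>\<^sub>M state_space) (\<lambda>\<omega>. (ladder \<xi> J L s \<omega>, ladder \<xi> J L t \<omega>)) =
    distr (N i) (state_space \<Otimes>\<^sub>M state_space) (\<lambda>\<omega>. (ma i s \<omega>, ma i t \<omega>))"
  by (rule process_law_pair[OF measurable_P[OF ladder_measurable[OF lt]] ma_path_measurable[OF ing char] law assms])

lemma ladder_pair_measurable: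
  "(\<lambda>\<omega>. (ladder \<xi> J L s \<omega>, ladder \<xi> J L t \<omega>)) \<in> P x i \<rightarrow>\<^sub>M state_space \<Otimes>\<^sub>M state_space"
  by (intro measurable_Pair measurable_P ladder_measurable[OF lt])

lemma ma_pair_measurable:
  "0 \<le> s \<Longrightarrow> 0 \<le> t \<Longrightarrow> (\<lambda>\<omega>. (ma i s \<omega>, ma i t \<omega>)) \<in> N i \<rightarrow>\<^sub>M state_space \<Otimes>\<^sub>M state_space"
  by (intro measurable_Pair ma_path_measurable[OF ing char])

lemma ladder_pair_AE:
  assumes s: "0 \<le> s" "0 \<le> t" and S: "{z \<in> space (state_space \<Otimes>\<^sub>M state_space). R z} \<in> sets (state_space \<Otimes>\<^sub>M state_space)"
    and AE: "AE \<omega> in N i. R (ma i s \<omega>, ma i t \<omega>)"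
  shows "AE \<omega> in P 0 i. R (ladder \<xi> J L s \<omega>, ladder \<xi> J L t \<omega>)"
  using AE_distr_iff[OF ladder_pair_measurable[of s t 0 i] S] AE_distr_iff[OF ma_pair_measurable[OF s, of i] S] AE
  unfolding ladder_pair_law[OF s] by blast

lemma ladder_mono: "AE \<omega> in P 0 i. \<forall>p m. fst (ladder \<xi> J L (real m / 2 ^ p) \<omega>) \<le> fst (ladder \<xi> J L (real (Suc m) / 2 ^ p) \<omega>)"
  unfolding AE_all_countable
proof (intro allI)
  fix p m :: nat
  have S: "{z \<in> space (state_space \<Otimes>\<^sub>M state_space). fst (fst z) \<le> fst (snd z)} \<in> sets ((state_space :: (real \<times> 'n) measure) \<Otimes>\<^sub>M (state_space :: (real \<times> 'n) measure))"
    by (rule borel_measurable_le) measurable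
  have "AE \<omega> in N i. fst (ma i (real m / real (2 ^ p)) \<omega>) \<le> fst (ma i (real (Suc m) / real (2 ^ p)) \<omega>)"
    by (rule ma_path_mono[OF ing char, of "2 ^ p" "\<lambda>r. 1 / real (2 ^ p * 2 ^ r)"]) auto
  then show "AE \<omega> in P 0 i. fst (ladder \<xi> J L (real m / 2 ^ p) \<omega>) \<le> fst (ladder \<xi> J L (real (Suc m) / 2 ^ p) \<omega>)"
    using ladder_pair_AE[OF _ _ S, of "real m / 2 ^ p" "real (Suc m) / 2 ^ p" i] by simp
qed

lemma ladder_start: "AE \<omega> in P 0 i. fst (ladder \<xi> J L 0 \<omega>) = 0"
proof -
  have S: "{z \<in> space (state_space \<Otimes>\<^sub>M state_space). fst (fst z) = 0} \<in> sets ((state_space :: (real \<times> 'n) measure) \<Otimes>\<^sub>M (state_space :: (real \<times> 'n) measure))"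
    by (rule borel_measurable_eq) measurable
  have "AE \<omega> in N i. fst (ma i 0 \<omega>) = 0" using ma_path_0[OF ing char] by (intro AE_I2)
  then show ?thesis using ladder_pair_AE[OF _ _ S, of 0 0 i] by simp
qed

definition ladder_term :: "real \<Rightarrow> real \<Rightarrow> 'n \<Rightarrow> nat \<Rightarrow> nat \<Rightarrow> 'w \<Rightarrow> ennreal" where
  "ladder_term l \<theta> k p m \<omega> = ennreal (if snd (ladder \<xi> J L (real (Suc m) / 2 ^ p) \<omega>) = k
     then exp (- l * fst (ladder \<xi> J L (real m / 2 ^ p) \<omega>)) *
       exp_quotient l \<theta> (fst (ladder \<xi> J L (real (Suc m) / 2 ^ p) \<omega>) - fst (ladder \<xi> J L (real m / 2 ^ p) \<omega>)) else 0)"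

definition overshoot_laplace :: "real \<Rightarrow> real \<Rightarrow> 'n \<Rightarrow> 'w \<Rightarrow> ennreal" where
  "overshoot_laplace l \<theta> k \<omega> = (\<integral>\<^sup>+t. ennreal (exp (- l * t) * exp_test \<theta> k (overshoot \<xi> J t \<omega>)) * indicator {0..} t \<partial>lborel)"

lemma overshoot_at_path_measurable: "\<omega> \<in> space M \<Longrightarrow> (\<lambda>t. overshoot \<xi> J t \<omega>) \<in> borel \<rightarrow>\<^sub>M state_space"
  using measurable_compose[OF measurable_Pair2'[of \<omega> M borel] overshoot_jointly_measurable] by simp

text \<open>The deterministic limit of the previous sections on almost every path.\<close>

lemma ladder_sum_limit:
  assumes l: "0 < l" and \<theta>: "0 \<le> \<theta>" "\<theta> \<noteq> l"
  shows "AE \<omega> in P 0 i. (\<forall>p. (\<Sum>m. ladder_term l \<theta> k p m \<omega>) \<le> ennreal (1 / l)) \<and>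
    (\<lambda>p. \<Sum>m. ladder_term l \<theta> k p m \<omega>) \<longlonglongrightarrow> overshoot_laplace l \<theta> k \<omega>"
  using ladder_mono[of i] ladder_start[of i] ub[of 0 i] total_local_time_increases_at_passage[OF lt, of 0 i]
proof eventually_elim
  case (elim \<omega>)
  have \<omega>: "\<omega> \<in> space M" using unbounded_pathsD(2)[OF elim(3)] .
  have inc: "total_local_time L (first_passage \<xi> t \<omega>) \<omega> < total_local_time L (first_passage \<xi> t \<omega> + e) \<omega>"
    if "0 \<le> t" "0 < e" for t e using elim(3,4) that by blast
  define H where "H p m = fst (ladder \<xi> J L (real m / 2 ^ p) \<omega>)" for p m :: nat
  define A where "A p m \<longleftrightarrow> snd (ladder \<xi> J L (real m / 2 ^ p) \<omega>) = k" for p m :: nat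
  (* the countably many levels that are skeleton points form a null set *)
  define C where "C = range (\<lambda>(p, m). H p m)"
  define X where "X t = \<xi> (first_passage \<xi> t \<omega>) \<omega>" for t
  define A' where "A' t \<longleftrightarrow> J (first_passage \<xi> t \<omega>) \<omega> = k" for t
  have H_mono: "H p m \<le> H p (Suc m)" for p m using elim(1) by (simp add: H_def)
  have H0: "H p 0 = 0" for p using elim(2) by (simp add: H_def)
  have C: "countable C" by (simp add: C_def)
  have bracket: "\<exists>m::nat \<Rightarrow> nat. (\<forall>p. H p (m p) < t \<and> t < H p (Suc (m p))) \<and>
      (\<lambda>p. H p (Suc (m p))) \<longlonglongrightarrow> X t \<and> (\<forall>\<^sub>F p in sequentially. A p (Suc (m p)) = A' t)"
    if t: "0 \<le> t" "t \<notin> C" for t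
  proof -
    have nC: "t \<noteq> fst (ladder \<xi> J L (real m / 2 ^ p) \<omega>)" for p m
    proof
      assume "t = fst (ladder \<xi> J L (real m / 2 ^ p) \<omega>)"
      then have "t = (case (p, m) of (p, m) \<Rightarrow> H p m)" by (simp add: H_def)
      then have "t \<in> C" unfolding C_def by (rule range_eqI)
      with t(2) show False by simp
    qed
    have z: "fst (ladder \<xi> J L (real 0 / 2 ^ 0) \<omega>) = 0" using elim(2) by simp
    obtain m :: "nat \<Rightarrow> nat" where m: "\<forall>p. H p (m p) < t \<and> t < H p (Suc (m p))"
      "(\<lambda>p. H p (Suc (m p))) \<longlonglongrightarrow> X t"
      "\<forall>\<^sub>F p in sequentially. snd (ladder \<xi> J L (real (Suc (m p)) / 2 ^ p) \<omega>) = J (first_passage \<xi> t \<omega>) \<omega>"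
      using skeleton_brackets_passage[OF lt elim(3) inc H_mono[unfolded H_def] t(1) nC z]
      unfolding H_def[symmetric] X_def[symmetric] by blast
    have "\<forall>\<^sub>F p in sequentially. A p (Suc (m p)) = A' t"
      using m(3) by eventually_elim (simp only: A_def A'_def)
    with m(1,2) show ?thesis by blast
  qed
  have pr: "(\<lambda>t. X t - t) \<in> borel_measurable borel" "(\<lambda>t. J (first_passage \<xi> t \<omega>) \<omega>) \<in> borel \<rightarrow>\<^sub>M count_space UNIV"
    using measurable_compose[OF overshoot_at_path_measurable[OF \<omega>] measurable_fst]
      measurable_compose[OF overshoot_at_path_measurable[OF \<omega>] measurable_snd]
    by (simp_all add: overshoot_def Let_def X_def)
  have "(\<lambda>t. (X t - t) + t) \<in> borel_measurable borel" using pr(1) by (rule borel_measurable_add) simp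
  then have Xm: "X \<in> borel_measurable borel" by simp
  have Am: "Measurable.pred borel A'"
    unfolding A'_def[abs_def] by (rule measurable_compose[OF pr(2)]) simp
  note lim = skeleton_sum_tendsto[where H=H and A=A and C=C and X=X and A'=A', OF H_mono H0 l \<theta> C bracket Xm Am]
    and bd = skeleton_sum_le[where H=H and A=A and C=C and X=X and A'=A', OF H_mono H0 l \<theta> C bracket Xm Am]
  have trm: "ladder_term l \<theta> k p m \<omega> =
      ennreal (if A p (Suc m) then exp (- l * H p m) * exp_quotient l \<theta> (H p (Suc m) - H p m) else 0)" for p m
    by (simp only: ladder_term_def A_def H_def)
  have "limit_integrand l \<theta> X A' t = ennreal (exp (- l * t) * exp_test \<theta> k (overshoot \<xi> J t \<omega>)) * indicator {0..} t" for t
    by (simp add: limit_integrand_def exp_test_def overshoot_def Let_def X_def A'_def)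
  then have "overshoot_laplace l \<theta> k \<omega> = (\<integral>\<^sup>+t. limit_integrand l \<theta> X A' t \<partial>lborel)"
    by (simp add: overshoot_laplace_def)
  with lim bd show ?case by (simp only: trm) blast
qed

lemma ladder_term_measurable: "ladder_term l \<theta> k p m \<in> borel_measurable M"
  unfolding ladder_term_def[abs_def] exp_quotient_def
  using ladder_measurable[OF lt, of "real m / 2 ^ p"] ladder_measurable[OF lt, of "real (Suc m) / 2 ^ p"] by measurable

lemma overshoot_laplace_measurable: "overshoot_laplace l \<theta> k \<in> borel_measurable M"
proof -
  have "(\<lambda>z. overshoot \<xi> J (snd z) (fst z)) \<in> M \<Otimes>\<^sub>M lborel \<rightarrow>\<^sub>M state_space"
  proof -
    have "(\<lambda>z. (snd z, fst z)) \<in> M \<Otimes>\<^sub>M lborel \<rightarrow>\<^sub>M borel \<Otimes>\<^sub>M M" by measurable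
    from measurable_compose[OF this overshoot_jointly_measurable] show ?thesis by simp
  qed
  then have "(\<lambda>(\<omega>, t). ennreal (exp (- l * t) * exp_test \<theta> k (overshoot \<xi> J t \<omega>)) * indicator {0..} t)
      \<in> borel_measurable (M \<Otimes>\<^sub>M lborel)"
    unfolding case_prod_beta by measurable
  then show ?thesis
    unfolding overshoot_laplace_def[abs_def] by (rule lborel.borel_measurable_nn_integral)
qed

abbreviation B where "B t \<theta> \<equiv> laplace_matrix N ma t \<theta>"

text \<open>
  The two-time Laplace transform with second parameter \<open>\<theta>\<close> minus the one with second parameter \<open>l\<close>.
\<close>

lemma nn_integral_ladder_term:
  assumes l: "0 < l" and \<theta>: "0 \<le> \<theta>"
  shows "(\<integral>\<^sup>+\<omega>. ladder_term l \<theta> k p m \<omega> \<partial>P 0 i) =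
      ennreal ((mat_pow (B (1 / 2 ^ p) l) m ** (B (1 / 2 ^ p) \<theta> - B (1 / 2 ^ p) l)) $ i $ k / (l - \<theta>))"
    and "0 \<le> (mat_pow (B (1 / 2 ^ p) l) m ** (B (1 / 2 ^ p) \<theta> - B (1 / 2 ^ p) l)) $ i $ k / (l - \<theta>)"
proof -
  interpret N: prob_space "N i" by (rule ma_prob_space[OF ing char])
  define s where "s = real m / 2 ^ p"
  define t where "t = real (Suc m) / 2 ^ p"
  have st: "0 \<le> s" "0 \<le> t" by (simp_all add: s_def t_def)
  define f where "f z = (if snd (snd z) = k then exp (- l * fst (fst z)) * exp_quotient l \<theta> (fst (snd z) - fst (fst z)) else 0)"
    for z :: "(real \<times> 'n) \<times> (real \<times> 'n)"
  have f: "(\<lambda>z. ennreal (f z)) \<in> borel_measurable (state_space \<Otimes>\<^sub>M state_space)"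
    unfolding f_def exp_quotient_def by measurable
  have lm: "(\<integral>\<^sup>+\<omega>. ladder_term l \<theta> k p m \<omega> \<partial>P 0 i) = (\<integral>\<^sup>+\<omega>. ennreal (f (ma i s \<omega>, ma i t \<omega>)) \<partial>N i)"
  proof -
    have "(\<integral>\<^sup>+\<omega>. ladder_term l \<theta> k p m \<omega> \<partial>P 0 i) = (\<integral>\<^sup>+\<omega>. ennreal (f (ladder \<xi> J L s \<omega>, ladder \<xi> J L t \<omega>)) \<partial>P 0 i)"
      by (simp only: ladder_term_def f_def s_def t_def fst_conv snd_conv)
    also have "\<dots> = (\<integral>\<^sup>+z. ennreal (f z) \<partial>distr (P 0 i) (state_space \<Otimes>\<^sub>M state_space) (\<lambda>\<omega>. (ladder \<xi> J L s \<omega>, ladder \<xi> J L t \<omega>)))"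
      by (rule nn_integral_distr[symmetric, OF ladder_pair_measurable]) (use f in simp)
    also have "\<dots> = (\<integral>\<^sup>+\<omega>. ennreal (f (ma i s \<omega>, ma i t \<omega>)) \<partial>N i)"
      unfolding ladder_pair_law[OF st] by (rule nn_integral_distr[OF ma_pair_measurable[OF st]]) (use f in simp)
    finally show ?thesis .
  qed
  have mono: "AE \<omega> in N i. fst (ma i s \<omega>) \<le> fst (ma i t \<omega>)"
    using ma_path_mono[OF ing[of i] char, where q="2 ^ p" and h="\<lambda>r. 1 / real (2 ^ p * 2 ^ r)" and m=m] by (simp add: s_def t_def)
  have s_nonneg: "AE \<omega> in N i. 0 \<le> fst (ma i s \<omega>)"
  proof -
    have "AE \<omega> in N i. \<forall>n. fst (ma i (real n / real (2 ^ p)) \<omega>) \<le> fst (ma i (real (Suc n) / real (2 ^ p)) \<omega>)"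
      unfolding AE_all_countable
      by (intro allI ma_path_mono[OF ing char, of "2 ^ p" "\<lambda>r. 1 / real (2 ^ p * 2 ^ r)"]) auto
    then show ?thesis using AE_space
    proof eventually_elim
      case (elim \<omega>)
      have "fst (ma i (real 0 / real (2 ^ p)) \<omega>) \<le> fst (ma i (real m / real (2 ^ p)) \<omega>)"
        by (rule lift_Suc_mono_le[of "\<lambda>n. fst (ma i (real n / real (2 ^ p)) \<omega>)"]) (use elim(1) in auto)
      then show ?case using ma_path_0[OF ing char elim(2)] by (simp add: s_def)
    qed
  qed
  have pos: "AE \<omega> in N i. 0 \<le> f (ma i s \<omega>, ma i t \<omega>)"
    using mono by eventually_elim (simp add: f_def exp_quotient_nonneg)
  define g where "g \<eta> \<omega> = (if snd (ma i t \<omega>) = k then 1 else 0) * exp (- (l * fst (ma i s \<omega>) + \<eta> * (fst (ma i t \<omega>) - fst (ma i s \<omega>))))"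
    for \<eta> \<omega>
  have g_int: "integrable (N i) (g \<eta>)" if "0 \<le> \<eta>" for \<eta>
  proof (rule N.integrable_const_bound[of _ 1])
    show "AE \<omega> in N i. norm (g \<eta> \<omega>) \<le> 1"
      using mono s_nonneg
    proof eventually_elim
      case (elim \<omega>)
      then have "0 \<le> l * fst (ma i s \<omega>) + \<eta> * (fst (ma i t \<omega>) - fst (ma i s \<omega>))" using l that by simp
      then show ?case by (simp add: g_def)
    qed
    show "g \<eta> \<in> borel_measurable (N i)"
      unfolding g_def[abs_def] using ma_path_measurable[OF ing char st(1), of i] ma_path_measurable[OF ing char st(2), of i] by measurable
  qed
  have g_E: "(\<integral>\<omega>. g \<eta> \<omega> \<partial>N i) = (mat_pow (B (1 / 2 ^ p) l) m ** B (1 / 2 ^ p) \<eta>) $ i $ k" if "0 \<le> \<eta>" for \<eta>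
    using two_time_laplace[OF char ing, where q="2 ^ p" and l=l and \<theta>=\<eta> and i=i and m=m and k=k] l that by (simp add: g_def[abs_def] s_def t_def)
  have f_g: "f (ma i s \<omega>, ma i t \<omega>) = (g \<theta> \<omega> - g l \<omega>) / (l - \<theta>)" for \<omega>
  proof -
    have "exp (- (l * a + c * b)) = exp (- l * a) * exp (- c * b)" for a b c :: real
      by (simp add: exp_add[symmetric])
    then show ?thesis unfolding f_def g_def exp_quotient_def by (simp only: fst_conv snd_conv) (simp add: right_diff_distrib[of "exp _"])
  qed
  have int: "integrable (N i) (\<lambda>\<omega>. f (ma i s \<omega>, ma i t \<omega>))"
    unfolding f_g using g_int[OF \<theta>] g_int[of l] l by (intro integrable_divide Bochner_Integration.integrable_diff) auto
  have E: "(\<integral>\<omega>. f (ma i s \<omega>, ma i t \<omega>) \<partial>N i) =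
      (mat_pow (B (1 / 2 ^ p) l) m ** (B (1 / 2 ^ p) \<theta> - B (1 / 2 ^ p) l)) $ i $ k / (l - \<theta>)"
  proof -
    have "(\<integral>\<omega>. f (ma i s \<omega>, ma i t \<omega>) \<partial>N i) = ((\<integral>\<omega>. g \<theta> \<omega> \<partial>N i) - (\<integral>\<omega>. g l \<omega> \<partial>N i)) / (l - \<theta>)"
      unfolding f_g using g_int[OF \<theta>] g_int[of l] l by simp
    also have "\<dots> = ((mat_pow (B (1 / 2 ^ p) l) m ** B (1 / 2 ^ p) \<theta>) $ i $ k - (mat_pow (B (1 / 2 ^ p) l) m ** B (1 / 2 ^ p) l) $ i $ k) / (l - \<theta>)"
      using g_E[OF \<theta>] g_E[of l] l by simp
    finally show ?thesis by (simp add: matrix_matrix_mult_def right_diff_distrib sum_subtractf)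
  qed
  show "(\<integral>\<^sup>+\<omega>. ladder_term l \<theta> k p m \<omega> \<partial>P 0 i) =
      ennreal ((mat_pow (B (1 / 2 ^ p) l) m ** (B (1 / 2 ^ p) \<theta> - B (1 / 2 ^ p) l)) $ i $ k / (l - \<theta>))"
    unfolding lm nn_integral_eq_integral[OF int pos] E ..
  show "0 \<le> (mat_pow (B (1 / 2 ^ p) l) m ** (B (1 / 2 ^ p) \<theta> - B (1 / 2 ^ p) l)) $ i $ k / (l - \<theta>)"
    unfolding E[symmetric] by (rule integral_nonneg_AE[OF pos])
qed

text \<open>The expectation is at most \<open>1 / l\<close>, so nothing is lost in passing to the reals.\<close>

definition potential :: "real \<Rightarrow> real \<Rightarrow> 'n \<Rightarrow> 'n \<Rightarrow> real" where
  "potential l \<theta> k i = enn2real (\<integral>\<^sup>+\<omega>. overshoot_laplace l \<theta> k \<omega> \<partial>P 0 i)"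

lemma skeleton_potential:
  fixes i k :: 'n
  assumes l: "0 < l" and \<theta>: "0 \<le> \<theta>" "\<theta> \<noteq> l"
  defines "v \<equiv> \<lambda>p m i. (mat_pow (B (1 / 2 ^ p) l) m ** (B (1 / 2 ^ p) \<theta> - B (1 / 2 ^ p) l)) $ i $ k / (l - \<theta>)"
  shows "summable (\<lambda>m. v p m i)" "(\<lambda>p. \<Sum>m. v p m i) \<longlonglongrightarrow> potential l \<theta> k i"
    "(\<integral>\<^sup>+\<omega>. overshoot_laplace l \<theta> k \<omega> \<partial>P 0 i) = ennreal (potential l \<theta> k i)"
proof -
  interpret prob_space "P 0 i" by (rule prob_space_P)
  have em: "emeasure (P 0 i) (space M) = 1" using emeasure_space_1 by simp
  note tm = measurable_P[OF ladder_term_measurable]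
  have AE1: "AE \<omega> in P 0 i. (\<Sum>m. ladder_term l \<theta> k p m \<omega>) \<le> ennreal (1 / l)" for p
    using ladder_sum_limit[where i=i and k=k, OF l \<theta>] by eventually_elim blast
  have AE2: "AE \<omega> in P 0 i. (\<lambda>p. \<Sum>m. ladder_term l \<theta> k p m \<omega>) \<longlonglongrightarrow> overshoot_laplace l \<theta> k \<omega>"
    using ladder_sum_limit[where i=i and k=k, OF l \<theta>] by eventually_elim blast
  have lim: "(\<lambda>p. \<integral>\<^sup>+\<omega>. (\<Sum>m. ladder_term l \<theta> k p m \<omega>) \<partial>P 0 i) \<longlonglongrightarrow> (\<integral>\<^sup>+\<omega>. overshoot_laplace l \<theta> k \<omega> \<partial>P 0 i)"
  proof (rule nn_integral_dominated_convergence[where w="\<lambda>_. ennreal (1 / l)"])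
    show "(\<lambda>\<omega>. \<Sum>m. ladder_term l \<theta> k p m \<omega>) \<in> borel_measurable (P 0 i)" for p
      using tm[measurable] by measurable
    show "overshoot_laplace l \<theta> k \<in> borel_measurable (P 0 i)" by (rule measurable_P[OF overshoot_laplace_measurable])
    show "(\<integral>\<^sup>+\<omega>. ennreal (1 / l) \<partial>P 0 i) < \<infinity>" by (simp add: em)
  qed (use AE1 AE2 in auto)
  have sum: "(\<integral>\<^sup>+\<omega>. (\<Sum>m. ladder_term l \<theta> k p m \<omega>) \<partial>P 0 i) = (\<Sum>m. ennreal (v p m i))" for p
    unfolding nn_integral_suminf[OF tm] v_def by (simp only: nn_integral_ladder_term(1)[OF l \<theta>(1)])
  have bd: "(\<Sum>m. ennreal (v p m i)) \<le> ennreal (1 / l)" for p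
  proof -
    have "(\<integral>\<^sup>+\<omega>. (\<Sum>m. ladder_term l \<theta> k p m \<omega>) \<partial>P 0 i) \<le> (\<integral>\<^sup>+\<omega>. ennreal (1 / l) \<partial>P 0 i)"
      by (rule nn_integral_mono_AE[OF AE1])
    then show ?thesis by (simp add: sum em)
  qed
  have nn: "0 \<le> v p m i" for p m unfolding v_def by (rule nn_integral_ladder_term(2)[OF l \<theta>(1)])
  show summ: "summable (\<lambda>m. v p m i)" for p
    using bd[of p] by (intro summable_suminf_not_top nn) (auto simp: top_unique)
  have eq: "(\<Sum>m. ennreal (v p m i)) = ennreal (\<Sum>m. v p m i)" for p by (rule suminf_ennreal2[OF nn summ])
  have lim': "(\<lambda>p. ennreal (\<Sum>m. v p m i)) \<longlonglongrightarrow> (\<integral>\<^sup>+\<omega>. overshoot_laplace l \<theta> k \<omega> \<partial>P 0 i)"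
    using lim unfolding sum eq .
  have "(\<integral>\<^sup>+\<omega>. overshoot_laplace l \<theta> k \<omega> \<partial>P 0 i) \<le> ennreal (1 / l)"
    by (rule tendsto_upperbound[OF lim']) (use bd eq in auto)
  then have fin: "(\<integral>\<^sup>+\<omega>. overshoot_laplace l \<theta> k \<omega> \<partial>P 0 i) < \<infinity>" by (rule le_less_trans) simp
  then show e: "(\<integral>\<^sup>+\<omega>. overshoot_laplace l \<theta> k \<omega> \<partial>P 0 i) = ennreal (potential l \<theta> k i)"
    by (simp add: potential_def)
  have "(\<lambda>p. enn2real (ennreal (\<Sum>m. v p m i))) \<longlonglongrightarrow> enn2real (ennreal (potential l \<theta> k i))"
    using lim' unfolding e by (intro tendsto_enn2real) auto
  then show "(\<lambda>p. \<Sum>m. v p m i) \<longlonglongrightarrow> potential l \<theta> k i"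
    by (simp add: suminf_nonneg[OF summ nn] potential_def)
qed

text \<open>
  The sums over the skeleton satisfy \<open>(1 - B(l)) u = (B(\<theta>) - B(l)) / (l - \<theta>)\<close>. Multiplied by \<open>2\<^sup>p\<close>, both sides
  converge, and \<open>1 - B\<close> becomes the matrix exponent.
\<close>

lemma potential_equation:
  assumes l: "0 < l" and \<theta>: "0 \<le> \<theta>" "\<theta> \<noteq> l"
  shows "(\<Sum>j\<in>UNIV. matrix_exponent Q d \<nu> G l $ i $ j * potential l \<theta> k j) =
    (matrix_exponent Q d \<nu> G l $ i $ k - matrix_exponent Q d \<nu> G \<theta> $ i $ k) / (l - \<theta>)"
proof (rule LIMSEQ_unique)
  define Bl where "Bl p = B (1 / 2 ^ p) l" for p :: nat
  define Bt where "Bt p = B (1 / 2 ^ p) \<theta>" for p :: nat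
  define v where "v p m i = (mat_pow (Bl p) m ** (Bt p - Bl p)) $ i $ k / (l - \<theta>)" for p m i
  define u where "u p i = (\<Sum>m. v p m i)" for p i
  have summ: "summable (\<lambda>m. v p m i)" and u_lim: "(\<lambda>p. u p i) \<longlonglongrightarrow> potential l \<theta> k i" for p i
    using skeleton_potential(1,2)[where i=i and k=k, OF l \<theta>] by (simp_all add: v_def u_def Bl_def Bt_def)
  have step: "(\<Sum>j\<in>UNIV. Bl p $ i $ j * v p m j) = v p (Suc m) i" for p m i
    by (simp add: v_def mat_pow_Suc matrix_mul_assoc[symmetric])
       (simp add: matrix_matrix_mult_def[of "Bl p"] sum_divide_distrib)
  have renewal: "(\<Sum>j\<in>UNIV. Bl p $ i $ j * u p j) = u p i - v p 0 i" for p i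
  proof -
    have "(\<Sum>j\<in>UNIV. Bl p $ i $ j * u p j) = (\<Sum>j\<in>UNIV. \<Sum>m. Bl p $ i $ j * v p m j)"
      unfolding u_def by (simp add: suminf_mult[OF summ])
    also have "\<dots> = (\<Sum>m. \<Sum>j\<in>UNIV. Bl p $ i $ j * v p m j)"
      using summ by (intro suminf_sum[symmetric] summable_mult)
    also have "\<dots> = u p i - v p 0 i"
      unfolding step u_def using suminf_split_head[OF summ[of p i]] by simp
    finally show ?thesis .
  qed
  have one: "(\<Sum>j\<in>UNIV. mat 1 $ i $ j * u p j) = u p i" for p i
  proof -
    have "(\<Sum>j\<in>UNIV. mat 1 $ i $ j * u p j) = (\<Sum>j\<in>UNIV. if j = i then u p j else 0)"
      by (intro sum.cong) (auto simp: mat_def)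
    then show ?thesis by simp
  qed
  have "(\<Sum>j\<in>UNIV. 2 ^ p * (mat 1 - Bl p) $ i $ j * u p j) = 2 ^ p * v p 0 i" for p i
  proof -
    have "(\<Sum>j\<in>UNIV. 2 ^ p * (mat 1 - Bl p) $ i $ j * u p j) =
        2 ^ p * ((\<Sum>j\<in>UNIV. mat 1 $ i $ j * u p j) - (\<Sum>j\<in>UNIV. Bl p $ i $ j * u p j))"
      by (simp add: sum_distrib_left sum_subtractf[symmetric] algebra_simps)
    then show ?thesis unfolding one renewal by simp
  qed
  moreover have "2 ^ p * v p 0 i = (2 ^ p * (mat 1 - Bl p) $ i $ k - 2 ^ p * (mat 1 - Bt p) $ i $ k) / (l - \<theta>)" for p
    by (simp add: v_def algebra_simps)
  ultimately have eq: "(\<lambda>p. \<Sum>j\<in>UNIV. 2 ^ p * (mat 1 - Bl p) $ i $ j * u p j) =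
      (\<lambda>p. (2 ^ p * (mat 1 - Bl p) $ i $ k - 2 ^ p * (mat 1 - Bt p) $ i $ k) / (l - \<theta>))" by simp
  note gen = laplace_matrix_generator[OF char ing]
  show "(\<lambda>p. \<Sum>j\<in>UNIV. 2 ^ p * (mat 1 - Bl p) $ i $ j * u p j) \<longlonglongrightarrow>
      (\<Sum>j\<in>UNIV. matrix_exponent Q d \<nu> G l $ i $ j * potential l \<theta> k j)"
    unfolding Bl_def using l by (intro tendsto_sum tendsto_mult u_lim gen) auto
  show "(\<lambda>p. \<Sum>j\<in>UNIV. 2 ^ p * (mat 1 - Bl p) $ i $ j * u p j) \<longlonglongrightarrow>
      (matrix_exponent Q d \<nu> G l $ i $ k - matrix_exponent Q d \<nu> G \<theta> $ i $ k) / (l - \<theta>)"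
    unfolding eq unfolding Bl_def Bt_def using l \<theta> by (intro tendsto_divide tendsto_diff gen tendsto_const) auto
qed

text \<open>The overshoot is always in some state.\<close>

lemma sum_potential_0:
  assumes l: "0 < l"
  shows "(\<Sum>k\<in>UNIV. \<integral>\<^sup>+\<omega>. overshoot_laplace l 0 k \<omega> \<partial>P 0 i) = ennreal (1 / l)"
proof -
  interpret prob_space "P 0 i" by (rule prob_space_P)
  have em: "emeasure (P 0 i) (space M) = 1" using emeasure_space_1 by simp
  have "(\<Sum>k\<in>UNIV. overshoot_laplace l 0 k \<omega>) = ennreal (1 / l)" if \<omega>: "\<omega> \<in> space M" for \<omega>
  proof -
    have m: "(\<lambda>t. ennreal (exp (- l * t) * exp_test 0 k (overshoot \<xi> J t \<omega>)) * indicator {0..} t) \<in> borel_measurable lborel" for k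
      using overshoot_at_path_measurable[OF \<omega>] by measurable
    have s: "(\<Sum>k\<in>UNIV. ennreal (exp (- l * t) * exp_test 0 k z) * indicator {0..} t) = ennreal (exp (- l * t)) * indicator {0..} t"
      for t and z :: "real \<times> 'n"
    proof -
      have "(\<Sum>k\<in>UNIV. ennreal (exp (- l * t) * exp_test 0 k z) * indicator {0..} t) =
          (\<Sum>k\<in>UNIV. if k = snd z then ennreal (exp (- l * t)) * indicator {0..} t else 0)"
        by (intro sum.cong) (auto simp: exp_test_def)
      also have "\<dots> = ennreal (exp (- l * t)) * indicator {0..} t" by (subst sum.delta) auto
      finally show ?thesis .
    qed
    show ?thesis
      unfolding overshoot_laplace_def nn_integral_sum[OF m, symmetric] s by (rule nn_integral_exp_half_line[OF l])
  qed
  then have "(\<integral>\<^sup>+\<omega>. (\<Sum>k\<in>UNIV. overshoot_laplace l 0 k \<omega>) \<partial>P 0 i) = (\<integral>\<^sup>+\<omega>. ennreal (1 / l) \<partial>P 0 i)"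
    by (intro nn_integral_cong) simp
  then show ?thesis
    by (simp add: nn_integral_sum[OF measurable_P[OF overshoot_laplace_measurable]] em)
qed

end

end

section \<open>Invertibility of the matrix exponent\<close>

context
  fixes Q :: "real^'n^'n" and d :: "'n::finite \<Rightarrow> real" and \<nu> :: "'n \<Rightarrow> real measure" and G :: "'n \<Rightarrow> 'n \<Rightarrow> real measure"
  assumes char: "ma_characteristics Q d \<nu> G"
begin

lemma characteristicsD:
  "i \<noteq> j \<Longrightarrow> 0 \<le> Q $ i $ j" "(\<Sum>j\<in>UNIV. Q $ i $ j) = 0" "0 \<le> d i" "levy_measure (\<nu> i)"
  "prob_space (G i j)" "sets (G i j) = sets borel" "emeasure (G i j) {..<0} = 0"
  "i = j \<or> Q $ i $ j = 0 \<Longrightarrow> G i j = return borel 0"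
  using char by (auto simp: ma_characteristics_def intensity_matrix_def)

lemma AE_jump_nonneg: "AE y in G i j. 0 \<le> y"
proof (rule AE_I[of _ _ "{..<0}"])
  show "{..<0} \<in> sets (G i j)" by (simp add: characteristicsD(6))
qed (use characteristicsD(7) in auto)

lemma AE_levy_pos: "AE y in \<nu> i. 0 < y"
proof (rule AE_I[of _ _ "{..0}"])
  show "{..0} \<in> sets (\<nu> i)" "emeasure (\<nu> i) {..0} = 0" using characteristicsD(4)[of i] by (auto simp: levy_measure_def)
qed auto

lemma jump_laplace:
  assumes \<theta>: "0 \<le> \<theta>"
  shows "0 < (\<integral>y. exp (- \<theta> * y) \<partial>G i j)" "(\<integral>y. exp (- \<theta> * y) \<partial>G i j) \<le> 1"
    "i = j \<or> Q $ i $ j = 0 \<Longrightarrow> (\<integral>y. exp (- \<theta> * y) \<partial>G i j) = 1" "(\<integral>y. exp (- 0 * y) \<partial>G i j) = 1"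
proof -
  interpret prob_space "G i j" by (rule characteristicsD)
  have b: "AE y in G i j. norm (exp (- \<theta> * y)) \<le> 1" using AE_jump_nonneg by eventually_elim (use \<theta> in simp)
  have "(\<lambda>y. exp (- \<theta> * y)) \<in> borel_measurable borel" by measurable
  then have m: "(\<lambda>y. exp (- \<theta> * y)) \<in> borel_measurable (G i j)"
    using measurable_cong_sets[OF characteristicsD(6) refl] by blast
  have int: "integrable (G i j) (\<lambda>y. exp (- \<theta> * y))" by (rule integrable_const_bound[OF b m])
  show "(\<integral>y. exp (- \<theta> * y) \<partial>G i j) \<le> 1"
    using integral_mono_AE[OF int integrable_const[of 1]] b by (simp add: prob_space)
  have "(\<integral>y. exp (- \<theta> * y) \<partial>G i j) \<noteq> 0"
  proof
    assume "(\<integral>y. exp (- \<theta> * y) \<partial>G i j) = 0"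
    then have "AE y in G i j. exp (- \<theta> * y) = 0" using integral_nonneg_eq_0_iff_AE[OF int] by simp
    then have "AE y in G i j. False" by simp
    then show False using not_AE_zero_E prob_space AE_False by auto
  qed
  moreover have "0 \<le> (\<integral>y. exp (- \<theta> * y) \<partial>G i j)" by simp
  ultimately show "0 < (\<integral>y. exp (- \<theta> * y) \<partial>G i j)" by linarith
  show "(\<integral>y. exp (- \<theta> * y) \<partial>G i j) = 1" if "i = j \<or> Q $ i $ j = 0"
    unfolding characteristicsD(8)[OF that] by (subst integral_return) auto
  show "(\<integral>y. exp (- 0 * y) \<partial>G i j) = 1" by (simp add: prob_space)
qed

lemma laplace_exponent_nonneg:
  assumes "0 \<le> \<theta>" shows "0 \<le> laplace_exponent (d i) (\<nu> i) \<theta>"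
proof -
  have "AE y in \<nu> i. 0 \<le> 1 - exp (- \<theta> * y)" using AE_levy_pos by eventually_elim (use assms in simp)
  then have "0 \<le> (\<integral>y. 1 - exp (- \<theta> * y) \<partial>\<nu> i)" by (rule integral_nonneg_AE)
  with assms characteristicsD(3)[of i] show ?thesis by (simp add: laplace_exponent_def)
qed

lemma matrix_exponent_row_sum:
  "(\<Sum>j\<in>UNIV. matrix_exponent Q d \<nu> G \<theta> $ i $ j) =
    laplace_exponent (d i) (\<nu> i) \<theta> + (\<Sum>j\<in>UNIV. Q $ i $ j * (1 - (\<integral>y. exp (- \<theta> * y) \<partial>G i j)))"
proof -
  have "(\<Sum>j\<in>UNIV. if i = j then laplace_exponent (d i) (\<nu> i) \<theta> else 0) = laplace_exponent (d i) (\<nu> i) \<theta>" by simp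
  then show ?thesis
    by (simp add: matrix_exponent_def sum_subtractf right_diff_distrib characteristicsD(2))
qed

lemma matrix_exponent_off_diagonal:
  assumes "0 \<le> \<theta>" "i \<noteq> j"
  shows "matrix_exponent Q d \<nu> G \<theta> $ i $ j \<le> 0" "0 < Q $ i $ j \<Longrightarrow> matrix_exponent Q d \<nu> G \<theta> $ i $ j < 0"
  using assms jump_laplace(1)[OF assms(1), of i j] characteristicsD(1)[OF assms(2)]
  by (auto simp: matrix_exponent_def)

lemma jump_term_nonneg: "0 \<le> \<theta> \<Longrightarrow> 0 \<le> Q $ i $ j * (1 - (\<integral>y. exp (- \<theta> * y) \<partial>G i j))"
  using jump_laplace(2,3)[of \<theta> i j] characteristicsD(1)[of i j] by (cases "i = j") auto

text \<open>
  A row sum is the Laplace exponent plus the sum of \<open>Q i j\<close> times \<open>1\<close> minus the transform of the jump, all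
  nonnegative. If all row sums vanish, there are no drifts, Levy measures or jumps: nothing depends on \<open>\<theta>\<close>.
\<close>

lemma row_sums_zeroD:
  assumes \<theta>: "0 \<le> \<theta>" and 0: "\<And>i. (\<Sum>j\<in>UNIV. matrix_exponent Q d \<nu> G \<theta> $ i $ j) = 0"
  shows "step_laplace d \<nu> G h \<theta> = step_laplace d \<nu> G h 0"
proof -
  have nn: "0 \<le> laplace_exponent (d i) (\<nu> i) \<theta>" "0 \<le> (\<Sum>j\<in>UNIV. Q $ i $ j * (1 - (\<integral>y. exp (- \<theta> * y) \<partial>G i j)))" for i
    using laplace_exponent_nonneg[OF \<theta>] jump_term_nonneg[OF \<theta>] by (auto intro: sum_nonneg)
  have z: "laplace_exponent (d i) (\<nu> i) \<theta> = 0" "(\<Sum>j\<in>UNIV. Q $ i $ j * (1 - (\<integral>y. exp (- \<theta> * y) \<partial>G i j))) = 0" for i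
    using 0[of i] nn[of i] unfolding matrix_exponent_row_sum by linarith+
  have "Q $ i $ j * (1 - (\<integral>y. exp (- \<theta> * y) \<partial>G i j)) = 0" for i j
    using z(2)[of i] jump_term_nonneg[OF \<theta>] by (subst (asm) sum_nonneg_eq_0_iff) auto
  then have "(\<integral>y. exp (- \<theta> * y) \<partial>G i j) = 1" for i j
    using jump_laplace(3)[OF \<theta>, of i j] by (cases "Q $ i $ j = 0") auto
  moreover have "laplace_exponent (d i) (\<nu> i) 0 = 0" for i by (simp add: laplace_exponent_def)
  ultimately show ?thesis using z(1) jump_laplace(4)[OF \<theta>] by (simp add: step_laplace_def fun_eq_iff)
qed

end

context markov_additive_process
begin

context
  fixes L :: "'n \<Rightarrow> real \<Rightarrow> 'w \<Rightarrow> real"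
    and N :: "'n \<Rightarrow> 'v measure" and Q :: "real^'n^'n" and d :: "'n \<Rightarrow> real"
    and \<nu> :: "'n \<Rightarrow> real measure" and G :: "'n \<Rightarrow> 'n \<Rightarrow> real measure"
    and K :: "'n \<Rightarrow> real \<Rightarrow> 'v \<Rightarrow> 'n" and Y :: "'n \<Rightarrow> nat \<Rightarrow> 'n \<Rightarrow> real \<Rightarrow> 'v \<Rightarrow> real"
    and U :: "'n \<Rightarrow> nat \<Rightarrow> 'n \<Rightarrow> 'n \<Rightarrow> 'v \<Rightarrow> real"
  assumes lt: "\<And>i. local_time (space M) F {P x k | x k. True} state_space (reflected \<xi> J) (0, i) (P 0 i) (L i)"
    and char: "ma_characteristics Q d \<nu> G" and ing: "\<And>i. ma_ingredients (N i) i Q d \<nu> G (K i) (Y i) (U i)"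
    and law: "\<And>i. process_law (P 0 i) state_space (ladder \<xi> J L) =
                   process_law (N i) state_space (ma_path (K i) (Y i) (U i))"
    and ub: "\<And>x i. AE \<omega> in P x i. \<omega> \<in> unbounded_paths"
begin

text \<open>
  Otherwise \<open>B(l) = B(0)\<close>, the skeleton sums with \<open>\<theta> = 0\<close> vanish, and so does the resolvent of \<open>1\<close>.
\<close>

lemma ladder_exponent_strict:
  assumes l: "0 < l"
  shows "\<exists>i. 0 < (\<Sum>j\<in>UNIV. matrix_exponent Q d \<nu> G l $ i $ j)"
proof (rule ccontr)
  assume "\<not> ?thesis"
  moreover have "0 \<le> (\<Sum>j\<in>UNIV. matrix_exponent Q d \<nu> G l $ i $ j)" for i
    unfolding matrix_exponent_row_sum[OF char] using l
    by (intro add_nonneg_nonneg sum_nonneg jump_term_nonneg[OF char] laplace_exponent_nonneg[OF char]) auto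
  ultimately have 0: "(\<Sum>j\<in>UNIV. matrix_exponent Q d \<nu> G l $ i $ j) = 0" for i
    by (meson antisym_conv not_le)
  have "skeleton_matrix Q d \<nu> G h l = skeleton_matrix Q d \<nu> G h 0" for h
    using row_sums_zeroD[OF char _ 0] l by (simp add: skeleton_matrix_def)
  then have B: "laplace_matrix N (\<lambda>i. ma_path (K i) (Y i) (U i)) (1 / real q) l $ i $ k =
      laplace_matrix N (\<lambda>i. ma_path (K i) (Y i) (U i)) (1 / real q) 0 $ i $ k" if "0 < q" for q i k
    using LIMSEQ_unique[OF laplace_matrix_limit[OF char ing that, of l i k]] laplace_matrix_limit[OF char ing that, of 0 i k] l
    by simp
  have B': "laplace_matrix N (\<lambda>i. ma_path (K i) (Y i) (U i)) (1 / 2 ^ p) l =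
      laplace_matrix N (\<lambda>i. ma_path (K i) (Y i) (U i)) (1 / 2 ^ p) 0" for p
    using B[of "2 ^ p"] by (simp add: vec_eq_iff)
  have "potential l 0 k i = 0" for i k
    using skeleton_potential(2)[OF lt char ing law ub l, where \<theta>=0 and i=i and k=k] l
    by (simp add: B' LIMSEQ_const_iff)
  then have "(\<Sum>k\<in>(UNIV::'n set). \<integral>\<^sup>+\<omega>. overshoot_laplace l 0 k \<omega> \<partial>P 0 i) = 0" for i
    using skeleton_potential(3)[OF lt char ing law ub l, where \<theta>=0 and i=i] l by simp
  with sum_potential_0[OF lt char ing law ub l, of undefined] l show False by simp
qed

lemma ladder_exponent_invertible:
  assumes l: "0 < l" and irr: "irreducible_intensity Q"
  shows "invertible (matrix_exponent Q d \<nu> G l)" "0 \<le> matrix_inv (matrix_exponent Q d \<nu> G l) $ i $ j"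
proof -
  obtain i0 where i0: "0 < (\<Sum>j\<in>UNIV. matrix_exponent Q d \<nu> G l $ i0 $ j)" using ladder_exponent_strict[OF l] ..
  have off: "matrix_exponent Q d \<nu> G l $ i $ j \<le> 0" if "i \<noteq> j" for i j
    using matrix_exponent_off_diagonal(1)[OF char _ that] l by simp
  have row: "0 \<le> (\<Sum>j\<in>UNIV. matrix_exponent Q d \<nu> G l $ i $ j)" for i
    unfolding matrix_exponent_row_sum[OF char] using l
    by (intro add_nonneg_nonneg sum_nonneg jump_term_nonneg[OF char] laplace_exponent_nonneg[OF char]) auto
  have "{(k, l). k \<noteq> l \<and> 0 < Q $ k $ l} \<subseteq> {(k, m). k \<noteq> m \<and> matrix_exponent Q d \<nu> G l $ k $ m < 0}"
    using matrix_exponent_off_diagonal(2)[OF char] l by auto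
  then have irr': "(i, j) \<in> {(k, m). k \<noteq> m \<and> matrix_exponent Q d \<nu> G l $ k $ m < 0}\<^sup>*" for i j
    using irr rtrancl_mono unfolding irreducible_intensity_def by blast
  show "invertible (matrix_exponent Q d \<nu> G l)" "0 \<le> matrix_inv (matrix_exponent Q d \<nu> G l) $ i $ j"
    using irreducible_M_matrix[OF off row i0 irr'] by blast+
qed

lemma potential_formula:
  assumes l: "0 < l" and irr: "irreducible_intensity Q" and \<theta>: "0 \<le> \<theta>" "\<theta> \<noteq> l"
  shows "potential l \<theta> k i = (\<Sum>j\<in>UNIV. matrix_inv (matrix_exponent Q d \<nu> G l) $ i $ j *
    ((matrix_exponent Q d \<nu> G l $ j $ k - matrix_exponent Q d \<nu> G \<theta> $ j $ k) / (l - \<theta>)))"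
proof -
  define u where "u = (\<chi> j. potential l \<theta> k j)"
  define r where "r = (\<chi> j. (matrix_exponent Q d \<nu> G l $ j $ k - matrix_exponent Q d \<nu> G \<theta> $ j $ k) / (l - \<theta>))"
  have "matrix_exponent Q d \<nu> G l *v u = r"
    using potential_equation[OF lt char ing law ub l \<theta>] by (simp add: vec_eq_iff matrix_vector_mult_def u_def r_def)
  then have "matrix_inv (matrix_exponent Q d \<nu> G l) *v r = u"
    using matrix_matrix_inv(2)[OF ladder_exponent_invertible(1)[OF l irr]]
    by (metis matrix_vector_mul_assoc matrix_vector_mul_lid)
  then have "u $ i = (matrix_inv (matrix_exponent Q d \<nu> G l) *v r) $ i" by simp
  then show ?thesis by (simp add: u_def r_def matrix_vector_mult_def)
qed

end

end

section \<open>Spatial homogeneity of the overshoots\<close>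

lemma right_continuous_along_sequence:
  fixes f :: "real \<Rightarrow> 'a::topological_space"
  assumes f: "(f \<longlongrightarrow> f a) (at_right a)" and s: "s \<longlonglongrightarrow> a" and ge: "\<forall>\<^sub>F n in sequentially. a \<le> s n"
  shows "(\<lambda>n. f (s n)) \<longlonglongrightarrow> f a"
proof (rule topological_tendstoI)
  fix S assume S: "open S" "f a \<in> S"
  obtain b where b: "a < b" "\<And>y. a < y \<Longrightarrow> y < b \<Longrightarrow> f y \<in> S"
    using topological_tendstoD[OF f S] by (auto simp: eventually_at_right_field)
  show "\<forall>\<^sub>F n in sequentially. f (s n) \<in> S"
    using order_tendstoD(2)[OF s b(1)] ge
  proof eventually_elim
    case (elim n)
    then show ?case using b(2)[of "s n"] S(2) by (cases "s n = a") auto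
  qed
qed

text \<open>
  \<open>\<Prod>k\<le>m. exceed g t m k (a k)\<close> is \<open>g\<close> of the overshoot if the \<open>m\<close>-th point is the first to exceed \<open>t\<close>, and zero
  otherwise. A product of functions of the single points is what the Markov property can handle.
\<close>

definition exceed :: "(real \<times> 'n \<Rightarrow> real) \<Rightarrow> real \<Rightarrow> nat \<Rightarrow> nat \<Rightarrow> real \<times> 'n \<Rightarrow> real" where
  "exceed g t m k z = (if k < m then if fst z \<le> t then 1 else 0 else if t < fst z then g (fst z - t, snd z) else 0)"

lemma exceed_shift: "exceed g (t - x) m k (y - x, j) = exceed g t m k (y, j)"
  by (simp add: exceed_def)

lemma exceed_bounds:
  assumes "\<And>z. 0 \<le> g z" "\<And>z. g z \<le> 1"
  shows "0 \<le> exceed g t m k z" "exceed g t m k z \<le> 1"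
  using assms by (simp_all add: exceed_def)

lemma exceed_measurable:
  assumes [measurable]: "g \<in> borel_measurable (state_space :: (real \<times> 'n::finite) measure)"
  shows "exceed g t m k \<in> borel_measurable state_space"
proof -
  have "(\<lambda>z. (fst z - t, snd z)) \<in> (state_space :: (real \<times> 'n) measure) \<rightarrow>\<^sub>M state_space" by measurable
  from measurable_compose[OF this assms] have [measurable]: "(\<lambda>z. g (fst z - t, snd z)) \<in> borel_measurable state_space" .
  show ?thesis unfolding exceed_def[abs_def] by measurable
qed

lemma sum_first_exceedance:
  fixes a :: "nat \<Rightarrow> real \<times> 'n"
  shows "(\<Sum>m. ennreal (\<Prod>k\<le>m. exceed g t m k (a k))) =
    (if \<exists>m. t < fst (a m) then ennreal (g (fst (a (LEAST m. t < fst (a m))) - t, snd (a (LEAST m. t < fst (a m))))) else 0)"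
proof -
  have p: "(\<Prod>k\<le>m. exceed g t m k (a k)) =
      (if (\<forall>k<m. fst (a k) \<le> t) \<and> t < fst (a m) then g (fst (a m) - t, snd (a m)) else 0)" for m
  proof -
    have "(\<Prod>k\<le>m. exceed g t m k (a k)) = (\<Prod>k<m. exceed g t m k (a k)) * exceed g t m m (a m)"
      by (simp add: lessThan_Suc_atMost[symmetric])
    also have "(\<Prod>k<m. exceed g t m k (a k)) = (\<Prod>k<m. if fst (a k) \<le> t then 1 else 0)"
      by (intro prod.cong) (auto simp: exceed_def)
    also have "\<dots> = (if \<forall>k<m. fst (a k) \<le> t then 1 else 0)" by (auto intro!: prod.neutral)
    also have "(if \<forall>k<m. fst (a k) \<le> t then 1 else 0) * exceed g t m m (a m) =
        (if (\<forall>k<m. fst (a k) \<le> t) \<and> t < fst (a m) then g (fst (a m) - t, snd (a m)) else 0)"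
      by (auto simp: exceed_def)
    finally show ?thesis .
  qed
  show ?thesis
  proof (cases "\<exists>m. t < fst (a m)")
    case True
    define n where "n = (LEAST m. t < fst (a m))"
    have n: "t < fst (a n)" unfolding n_def by (rule LeastI_ex[OF True])
    have n': "fst (a k) \<le> t" if "k < n" for k
      using not_less_Least[of k "\<lambda>m. t < fst (a m)"] that by (simp add: n_def)
    have "((\<forall>k<m. fst (a k) \<le> t) \<and> t < fst (a m)) = (m = n)" for m
    proof
      assume m: "(\<forall>k<m. fst (a k) \<le> t) \<and> t < fst (a m)"
      show "m = n" using n'[of m] m n by (meson linorder_neqE_nat not_less)
    qed (use n n' in auto)
    then have "(\<Sum>m. ennreal (\<Prod>k\<le>m. exceed g t m k (a k))) =
        (\<Sum>m\<in>{n}. ennreal (\<Prod>k\<le>m. exceed g t m k (a k)))"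
      unfolding p by (intro suminf_finite) auto
    then show ?thesis using True n n' by (simp add: p n_def[symmetric])
  next
    case False
    then show ?thesis by (simp add: p)
  qed
qed

context markov_additive_process
begin

lemma cond_exp_locale: "finite_measure_subalgebra (P x i) (F t)"
proof -
  interpret prob_space "P x i" by (rule prob_space_P)
  show ?thesis
    by unfold_locales (auto simp: subalgebra_def space_F sets_P intro: subsetD[OF filtration_sub])
qed

lemma state_measurable: "0 \<le> t \<Longrightarrow> (\<lambda>\<omega>. (\<xi> t \<omega>, J t \<omega>)) \<in> M \<rightarrow>\<^sub>M state_space"
  using xi_measurable J_measurable by simp

text \<open>The additive property at time zero, where the position is known.\<close>

lemma transition_op_homogeneous:
  fixes f :: "real \<times> 'n \<Rightarrow> real"
  assumes s: "0 \<le> s" and f: "f \<in> borel_measurable state_space" and b: "\<And>z. 0 \<le> f z" "\<And>z. f z \<le> 1"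
  shows "transition_op P \<xi> J s f (y, j) = (\<integral>\<omega>. f (y + \<xi> s \<omega>, J s \<omega>) \<partial>P 0 j)"
proof -
  interpret prob_space "P y j" by (rule prob_space_P)
  interpret finite_measure_subalgebra "P y j" "F 0" by (rule cond_exp_locale)
  define g where "g z = f (y + fst z, snd z)" for z
  have "(\<lambda>z. (y + fst z, snd z)) \<in> state_space \<rightarrow>\<^sub>M (state_space :: (real \<times> 'n) measure)" by measurable
  from measurable_compose[OF this f] have g: "g \<in> borel_measurable state_space" by (simp add: g_def[abs_def])
  have bg: "bounded (range g)" unfolding bounded_iff by (intro exI[of _ 1]) (auto simp: g_def b)
  have "(\<lambda>\<omega>. (\<xi> (0 + s) \<omega> - \<xi> 0 \<omega>, J (0 + s) \<omega>)) \<in> M \<rightarrow>\<^sub>M state_space"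
    using xi_measurable[OF s] xi_measurable[of 0] J_measurable[OF s] by simp
  from measurable_P[OF measurable_compose[OF this g]]
  have m: "(\<lambda>\<omega>. g (\<xi> (0 + s) \<omega> - \<xi> 0 \<omega>, J (0 + s) \<omega>)) \<in> borel_measurable (P y j)" .
  have int: "integrable (P y j) (\<lambda>\<omega>. g (\<xi> (0 + s) \<omega> - \<xi> 0 \<omega>, J (0 + s) \<omega>))"
    by (rule integrable_const_bound[OF _ m, of 1]) (simp add: g_def b)
  have "transition_op P \<xi> J s f (y, j) = (\<integral>\<omega>. g (\<xi> (0 + s) \<omega> - \<xi> 0 \<omega>, J (0 + s) \<omega>) \<partial>P y j)"
    unfolding transition_op_def case_prod_conv
  proof (rule integral_cong_AE)
    show "(\<lambda>\<omega>. f (\<xi> s \<omega>, J s \<omega>)) \<in> borel_measurable (P y j)"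
      by (rule measurable_P[OF measurable_compose[OF state_measurable[OF s] f]])
    show "AE \<omega> in P y j. f (\<xi> s \<omega>, J s \<omega>) = g (\<xi> (0 + s) \<omega> - \<xi> 0 \<omega>, J (0 + s) \<omega>)"
      using initial[of y j] by eventually_elim (simp add: g_def)
  qed (rule m)
  also have "\<dots> = (\<integral>\<omega>. real_cond_exp (P y j) (F 0) (\<lambda>\<omega>. g (\<xi> (0 + s) \<omega> - \<xi> 0 \<omega>, J (0 + s) \<omega>)) \<omega> \<partial>P y j)"
    by (rule real_cond_exp_int(2)[OF int, symmetric])
  also have "\<dots> = (\<integral>\<omega>. (\<integral>\<omega>'. g (\<xi> s \<omega>', J s \<omega>') \<partial>P 0 j) \<partial>P y j)"
  proof (rule integral_cong_AE)
    show "real_cond_exp (P y j) (F 0) (\<lambda>\<omega>. g (\<xi> (0 + s) \<omega> - \<xi> 0 \<omega>, J (0 + s) \<omega>)) \<in> borel_measurable (P y j)"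
      by (rule borel_measurable_cond_exp2)
    show "AE \<omega> in P y j. real_cond_exp (P y j) (F 0) (\<lambda>\<omega>. g (\<xi> (0 + s) \<omega> - \<xi> 0 \<omega>, J (0 + s) \<omega>)) \<omega> =
        (\<integral>\<omega>'. g (\<xi> s \<omega>', J s \<omega>') \<partial>P 0 j)"
      using initial[of y j] markov_additive[OF s order_refl g bg, of y j] by eventually_elim simp
  qed simp
  finally show ?thesis using prob_space by (simp add: g_def)
qed

lemma transition_op_measurable:
  fixes f :: "real \<times> 'n \<Rightarrow> real"
  assumes s: "0 \<le> s" and f: "f \<in> borel_measurable state_space" and b: "\<And>z. 0 \<le> f z" "\<And>z. f z \<le> 1"
  shows "transition_op P \<xi> J s f \<in> borel_measurable state_space"
proof -
  have "(\<lambda>y. \<integral>\<omega>. f (y + \<xi> s \<omega>, J s \<omega>) \<partial>P 0 j) \<in> borel_measurable borel" for j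
  proof -
    interpret prob_space "P 0 j" by (rule prob_space_P)
    have "(\<lambda>z. (fst z + \<xi> s (snd z), J s (snd z))) \<in> borel \<Otimes>\<^sub>M P 0 j \<rightarrow>\<^sub>M (state_space :: (real \<times> 'n) measure)"
      by (intro measurable_Pair borel_measurable_add measurable_fst
          measurable_compose[OF measurable_snd measurable_P[OF xi_measurable[OF s]]]
          measurable_compose[OF measurable_snd measurable_P[OF J_measurable[OF s]]])
    from measurable_compose[OF this f] show ?thesis
      by (intro borel_measurable_lebesgue_integral) (simp add: case_prod_beta)
  qed
  from measurable_compose[OF measurable_fst this]
  have m: "(\<lambda>z. \<integral>\<omega>. f (fst z + \<xi> s \<omega>, J s \<omega>) \<partial>P 0 j) \<in> borel_measurable (state_space :: (real \<times> 'n) measure)" for j .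
  have "transition_op P \<xi> J s f = (\<lambda>z. (\<lambda>j z. \<integral>\<omega>. f (fst z + \<xi> s \<omega>, J s \<omega>) \<partial>P 0 j) (snd z) z)"
    using transition_op_homogeneous[OF s f b] by (auto simp: fun_eq_iff)
  also have "\<dots> \<in> borel_measurable (state_space :: (real \<times> 'n) measure)"
    by (rule measurable_compose_countable[where f="\<lambda>j z. \<integral>\<omega>. f (fst z + \<xi> s \<omega>, J s \<omega>) \<partial>P 0 j" and g=snd, OF m]) simp
  finally show ?thesis .
qed

lemma transition_op_bounds:
  fixes f :: "real \<times> 'n \<Rightarrow> real"
  assumes s: "0 \<le> s" and f: "f \<in> borel_measurable state_space" and b: "\<And>z. 0 \<le> f z" "\<And>z. f z \<le> 1"
  shows "0 \<le> transition_op P \<xi> J s f z" "transition_op P \<xi> J s f z \<le> 1"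
proof -
  interpret prob_space "P (fst z) (snd z)" by (rule prob_space_P)
  have m: "(\<lambda>\<omega>. f (\<xi> s \<omega>, J s \<omega>)) \<in> borel_measurable (P (fst z) (snd z))"
    by (rule measurable_P[OF measurable_compose[OF state_measurable[OF s] f]])
  show "0 \<le> transition_op P \<xi> J s f z" by (simp add: transition_op_def case_prod_beta b)
  have "integrable (P (fst z) (snd z)) (\<lambda>\<omega>. f (\<xi> s \<omega>, J s \<omega>))"
    by (rule integrable_const_bound[OF _ m, of 1]) (simp add: b)
  then have "(\<integral>\<omega>. f (\<xi> s \<omega>, J s \<omega>) \<partial>P (fst z) (snd z)) \<le> (\<integral>\<omega>. 1 \<partial>P (fst z) (snd z))"
    by (intro integral_mono) (auto simp: b)
  then show "transition_op P \<xi> J s f z \<le> 1" using prob_space by (simp add: transition_op_def case_prod_beta)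
qed

lemma markov_integral:
  assumes s: "0 \<le> s" "0 \<le> t" and f: "f \<in> borel_measurable state_space" and b: "\<And>z. 0 \<le> f z" "\<And>z. f z \<le> 1"
    and Z: "Z \<in> borel_measurable (F t)" and bZ: "\<And>\<omega>. 0 \<le> Z \<omega>" "\<And>\<omega>. Z \<omega> \<le> 1"
  shows "(\<integral>\<omega>. Z \<omega> * f (\<xi> (t + s) \<omega>, J (t + s) \<omega>) \<partial>P x i) =
    (\<integral>\<omega>. Z \<omega> * transition_op P \<xi> J s f (\<xi> t \<omega>, J t \<omega>) \<partial>P x i)"
proof -
  interpret prob_space "P x i" by (rule prob_space_P)
  interpret finite_measure_subalgebra "P x i" "F t" by (rule cond_exp_locale)
  have bf: "bounded (range f)" unfolding bounded_iff by (intro exI[of _ 1]) (auto simp: b)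
  have m: "(\<lambda>\<omega>. f (\<xi> (t + s) \<omega>, J (t + s) \<omega>)) \<in> borel_measurable (P x i)"
    by (rule measurable_P[OF measurable_compose[OF state_measurable f]]) (use s in simp)
  have Zm: "Z \<in> borel_measurable (P x i)" by (rule measurable_P[OF F_measurable_M[OF Z]])
  have "integrable (P x i) (\<lambda>\<omega>. Z \<omega> * f (\<xi> (t + s) \<omega>, J (t + s) \<omega>))"
  proof (rule integrable_const_bound[of _ 1])
    show "AE \<omega> in P x i. norm (Z \<omega> * f (\<xi> (t + s) \<omega>, J (t + s) \<omega>)) \<le> 1"
      by (intro AE_I2) (simp add: b bZ mult_le_one)
  qed (use m Zm in measurable)
  from real_cond_exp_intg(2)[OF this Z m]
  have "(\<integral>\<omega>. Z \<omega> * f (\<xi> (t + s) \<omega>, J (t + s) \<omega>) \<partial>P x i) =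
      (\<integral>\<omega>. Z \<omega> * real_cond_exp (P x i) (F t) (\<lambda>\<omega>. f (\<xi> (t + s) \<omega>, J (t + s) \<omega>)) \<omega> \<partial>P x i)" by simp
  also have "\<dots> = (\<integral>\<omega>. Z \<omega> * transition_op P \<xi> J s f (\<xi> t \<omega>, J t \<omega>) \<partial>P x i)"
  proof (rule integral_cong_AE)
    show "(\<lambda>\<omega>. Z \<omega> * real_cond_exp (P x i) (F t) (\<lambda>\<omega>. f (\<xi> (t + s) \<omega>, J (t + s) \<omega>)) \<omega>) \<in> borel_measurable (P x i)"
      using Zm by (intro borel_measurable_times borel_measurable_cond_exp2)
    have V: "(\<lambda>z. transition_op P \<xi> J s f z) \<in> borel_measurable state_space"
      by (rule transition_op_measurable[OF s(1) f b])
    show "(\<lambda>\<omega>. Z \<omega> * transition_op P \<xi> J s f (\<xi> t \<omega>, J t \<omega>)) \<in> borel_measurable (P x i)"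
      using Zm measurable_P[OF measurable_compose[OF state_measurable[OF s(2)] V]] by (intro borel_measurable_times)
    show "AE \<omega> in P x i. Z \<omega> * real_cond_exp (P x i) (F t) (\<lambda>\<omega>. f (\<xi> (t + s) \<omega>, J (t + s) \<omega>)) \<omega> =
        Z \<omega> * transition_op P \<xi> J s f (\<xi> t \<omega>, J t \<omega>)"
      using markov[OF s f bf, of x i] by eventually_elim simp
  qed
  finally show ?thesis .
qed

text \<open>
  Induction on the number of grid points: by the Markov property the last factor can be replaced by its
  conditional expectation, a function of the last but one point, and this function commutes with
  spatial shifts.
\<close>

lemma shift_finite_dimensional:
  fixes g :: "nat \<Rightarrow> real \<times> 'n \<Rightarrow> real"
  assumes h: "0 \<le> h"
    and g: "\<And>k. g k \<in> borel_measurable state_space" "\<And>k z. 0 \<le> g k z" "\<And>k z. g k z \<le> 1"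
  shows "(\<integral>\<omega>. (\<Prod>k\<le>m. g k (\<xi> (real k * h) \<omega> - x, J (real k * h) \<omega>)) \<partial>P x i) =
    (\<integral>\<omega>. (\<Prod>k\<le>m. g k (\<xi> (real k * h) \<omega>, J (real k * h) \<omega>)) \<partial>P 0 i)"
  using g
proof (induction m arbitrary: g)
  case 0
  have "(\<integral>\<omega>. g 0 (\<xi> 0 \<omega> - x, J 0 \<omega>) \<partial>P x i) = g 0 (0, i)" for x
  proof -
    interpret prob_space "P x i" by (rule prob_space_P)
    have "(\<lambda>\<omega>. (\<xi> 0 \<omega> - x, J 0 \<omega>)) \<in> M \<rightarrow>\<^sub>M state_space" using xi_measurable[of 0] J_measurable[of 0] by simp
    from measurable_P[OF measurable_compose[OF this 0(1)[of 0]]]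
    have m: "(\<lambda>\<omega>. g 0 (\<xi> 0 \<omega> - x, J 0 \<omega>)) \<in> borel_measurable (P x i)" .
    have "AE \<omega> in P x i. g 0 (\<xi> 0 \<omega> - x, J 0 \<omega>) = g 0 (0, i)"
      using initial[of x i] by eventually_elim simp
    then have "(\<integral>\<omega>. g 0 (\<xi> 0 \<omega> - x, J 0 \<omega>) \<partial>P x i) = (\<integral>\<omega>. g 0 (0, i) \<partial>P x i)"
      by (intro integral_cong_AE m) auto
    then show ?thesis using prob_space by simp
  qed
  from this[of x] this[of 0] show ?case by simp
next
  case (Suc m)
  define V where "V z = (\<integral>\<omega>. g (Suc m) (fst z + \<xi> h \<omega>, J h \<omega>) \<partial>P 0 (snd z))" for z
  (* the conditional expectation of the last factor is absorbed into the last but one *)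
  define g' where "g' = g(m := \<lambda>z. g m z * V z)"
  have Vt: "V = transition_op P \<xi> J h (g (Suc m))"
    using transition_op_homogeneous[OF h Suc.prems, of "Suc m"] by (auto simp: V_def fun_eq_iff)
  have Vm: "V \<in> borel_measurable state_space" unfolding Vt by (rule transition_op_measurable[OF h Suc.prems])
  have V: "0 \<le> V z" "V z \<le> 1" for z
    unfolding Vt by (rule transition_op_bounds[OF h Suc.prems])+
  have g': "g' k \<in> borel_measurable state_space" "0 \<le> g' k z" "g' k z \<le> 1" for k z
    using Suc.prems Vm V by (auto simp: g'_def mult_le_one)
  have step: "(\<integral>\<omega>. (\<Prod>k\<le>Suc m. g k (\<xi> (real k * h) \<omega> - x, J (real k * h) \<omega>)) \<partial>P x i) =
      (\<integral>\<omega>. (\<Prod>k\<le>m. g' k (\<xi> (real k * h) \<omega> - x, J (real k * h) \<omega>)) \<partial>P x i)" for x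
  proof -
    define f where "f z = g (Suc m) (fst z - x, snd z)" for z
    define Z where "Z \<omega> = (\<Prod>k\<le>m. g k (\<xi> (real k * h) \<omega> - x, J (real k * h) \<omega>))" for \<omega>
    have "(\<lambda>z. (fst z - x, snd z)) \<in> state_space \<rightarrow>\<^sub>M (state_space :: (real \<times> 'n) measure)" by measurable
    from measurable_compose[OF this Suc.prems(1)] have f: "f \<in> borel_measurable state_space" by (simp add: f_def[abs_def])
    have bf: "0 \<le> f z" "f z \<le> 1" for z using Suc.prems by (auto simp: f_def)
    have Zm: "Z \<in> borel_measurable (F (real m * h))"
      unfolding Z_def[abs_def]
    proof (rule borel_measurable_prod)
      fix k assume "k \<in> {..m}"
      then have le: "real k * h \<le> real m * h" using h by (simp add: mult_right_mono)
      have "(\<lambda>\<omega>. (\<xi> (real k * h) \<omega> - x, J (real k * h) \<omega>)) \<in> F (real m * h) \<rightarrow>\<^sub>M state_space"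
        using F_mono_measurable[OF adapted_xi le] F_mono_measurable[OF adapted_J le] h by simp
      from measurable_compose[OF this Suc.prems(1)]
      show "(\<lambda>\<omega>. g k (\<xi> (real k * h) \<omega> - x, J (real k * h) \<omega>)) \<in> borel_measurable (F (real m * h))" .
    qed
    have Zb: "0 \<le> Z \<omega>" "Z \<omega> \<le> 1" for \<omega>
      using Suc.prems by (auto simp: Z_def intro!: prod_nonneg prod_le_1)
    have time: "real m * h + h = real (Suc m) * h" by (simp add: algebra_simps)
    have "(\<integral>\<omega>. (\<Prod>k\<le>Suc m. g k (\<xi> (real k * h) \<omega> - x, J (real k * h) \<omega>)) \<partial>P x i) =
        (\<integral>\<omega>. Z \<omega> * f (\<xi> (real m * h + h) \<omega>, J (real m * h + h) \<omega>) \<partial>P x i)"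
      unfolding time by (simp add: Z_def f_def)
    also have "\<dots> = (\<integral>\<omega>. Z \<omega> * transition_op P \<xi> J h f (\<xi> (real m * h) \<omega>, J (real m * h) \<omega>) \<partial>P x i)"
      by (rule markov_integral[OF h _ f bf Zm Zb]) (use h in simp)
    also have "\<dots> = (\<integral>\<omega>. (\<Prod>k\<le>m. g' k (\<xi> (real k * h) \<omega> - x, J (real k * h) \<omega>)) \<partial>P x i)"
    proof (rule Bochner_Integration.integral_cong[OF refl])
      fix \<omega>
      have t: "transition_op P \<xi> J h f (y, j) = V (y - x, j)" for y j
        unfolding transition_op_homogeneous[OF h f bf] by (simp add: V_def f_def algebra_simps)
      have "(\<Prod>k\<le>m. g' k (a k)) = (\<Prod>k\<le>m. g k (a k)) * V (a m)" for a
      proof -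
        have "(\<Prod>k\<le>m. g' k (a k)) = (\<Prod>k<m. g' k (a k)) * g' m (a m)" by (simp add: lessThan_Suc_atMost[symmetric])
        also have "(\<Prod>k<m. g' k (a k)) = (\<Prod>k<m. g k (a k))" by (intro prod.cong) (auto simp: g'_def)
        finally show ?thesis by (simp add: lessThan_Suc_atMost[symmetric] g'_def)
      qed
      from this[of "\<lambda>k. (\<xi> (real k * h) \<omega> - x, J (real k * h) \<omega>)"]
      show "Z \<omega> * transition_op P \<xi> J h f (\<xi> (real m * h) \<omega>, J (real m * h) \<omega>) =
          (\<Prod>k\<le>m. g' k (\<xi> (real k * h) \<omega> - x, J (real k * h) \<omega>))" by (simp add: t Z_def)
    qed
    finally show ?thesis .
  qed
  show ?case using step[of x] step[of 0] Suc.IH[OF g'] by simp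
qed

text \<open>
  The first grid time at which the level is exceeded decreases to the passage time as the grid is refined.
\<close>

lemma grid_overshoot_tendsto:
  fixes g :: "real \<times> 'n \<Rightarrow> real"
  assumes \<omega>: "\<omega> \<in> unbounded_paths" and c: "\<And>j. continuous_on UNIV (\<lambda>y. g (y, j))"
  shows "(\<lambda>p. \<Sum>m. ennreal (\<Prod>k\<le>m. exceed g t m k (\<xi> (real k * (1 / 2 ^ p)) \<omega>, J (real k * (1 / 2 ^ p)) \<omega>)))
    \<longlonglongrightarrow> ennreal (g (overshoot \<xi> J t \<omega>))"
proof -
  define T where "T = first_passage \<xi> t \<omega>"
  define R where "R p m \<longleftrightarrow> t < \<xi> (real m * (1 / 2 ^ p)) \<omega>" for p m :: nat
  define n where "n p = (LEAST m. R p m)" for p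
  define s where "s p = real (n p) * (1 / 2 ^ p)" for p
  define f where "f u = g (\<xi> u \<omega> - t, J u \<omega>)" for u
  note fp = first_passage_properties[where Z=\<xi> and t=t and \<omega>=\<omega>, OF unbounded_pathsD(1)[OF \<omega>]]
  have \<omega>': "\<omega> \<in> space M" using unbounded_pathsD(2)[OF \<omega>] .
  have T0: "0 \<le> T" using fp(1) passage_time_nonneg[of \<xi> t \<omega>] by (simp add: T_def)
  (* a fixed grid may miss the exceedance altogether, but every fine enough one sees it before T + e *)
  have ev: "\<forall>\<^sub>F p in sequentially. \<exists>m. R p m \<and> real m * (1 / 2 ^ p) < T + e" if e: "0 < e" for e
  proof -
    obtain u where u: "T \<le> u" "u < T + e" "t < \<xi> u \<omega>" using fp(4)[OF e] by (auto simp: T_def)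
    then have u0: "0 \<le> u" using T0 by simp
    define q where "q p = (real (nat \<lfloor>u * 2 ^ p\<rfloor>) + 1) / 2 ^ p" for p :: nat
    note q = dyadic_from_right[OF u0, folded q_def]
    have "(\<lambda>p. \<xi> (q p) \<omega>) \<longlonglongrightarrow> \<xi> u \<omega>"
      by (rule right_continuous_along_sequence[where f="\<lambda>u. \<xi> u \<omega>", OF xi_right_continuous[OF \<omega>' u0] q(1)])
        (use q(2) in \<open>auto intro!: always_eventually less_imp_le\<close>)
    from order_tendstoD(1)[OF this u(3)] order_tendstoD(2)[OF q(1) u(2)]
    show ?thesis
    proof eventually_elim
      case (elim p)
      then show ?case
        by (intro exI[of _ "Suc (nat \<lfloor>u * 2 ^ p\<rfloor>)"]) (simp add: R_def q_def add.commute)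
    qed
  qed
  have ge: "T \<le> real m * (1 / 2 ^ p)" if "R p m" for p m
    using fp(3)[of "real m * (1 / 2 ^ p)"] that by (simp add: R_def T_def)
  have s_bounds: "\<forall>\<^sub>F p in sequentially. R p (n p) \<and> T \<le> s p \<and> s p < T + e" if e: "0 < e" for e
    using ev[OF e]
  proof eventually_elim
    case (elim p)
    then obtain m where m: "R p m" "real m * (1 / 2 ^ p) < T + e" by blast
    have "R p (n p)" unfolding n_def by (rule LeastI[of "R p", OF m(1)])
    moreover have "n p \<le> m" unfolding n_def by (rule Least_le[of "R p", OF m(1)])
    then have "s p \<le> real m * (1 / 2 ^ p)" unfolding s_def by (intro mult_right_mono) auto
    ultimately show ?case using ge[of p "n p"] m(2) by (simp add: s_def)
  qed
  have s_lim: "s \<longlonglongrightarrow> T"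
  proof (rule order_tendstoI)
    fix a assume "a < T"
    with s_bounds[of 1] show "\<forall>\<^sub>F p in sequentially. a < s p" by (auto elim!: eventually_mono)
  next
    fix a assume "T < a"
    with s_bounds[of "a - T"] show "\<forall>\<^sub>F p in sequentially. s p < a" by (auto elim!: eventually_mono)
  qed
  have rc: "(f \<longlongrightarrow> f T) (at_right T)"
  proof -
    have "((\<lambda>u. g (\<xi> u \<omega> - t, J T \<omega>)) \<longlongrightarrow> f T) (at_right T)"
      unfolding f_def
      by (rule continuous_on_tendsto_compose[OF c]) (auto intro!: tendsto_diff xi_right_continuous \<omega>' T0)
    then show ?thesis
    proof (rule Lim_transform_eventually)
      show "\<forall>\<^sub>F u in at_right T. g (\<xi> u \<omega> - t, J T \<omega>) = f u"
        using J_right_continuous[OF \<omega>' T0] by eventually_elim (simp add: f_def)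
    qed
  qed
  have "\<forall>\<^sub>F p in sequentially. T \<le> s p" by (rule eventually_mono[OF s_bounds[of 1]]) auto
  then have "(\<lambda>p. f (s p)) \<longlonglongrightarrow> f T" by (rule right_continuous_along_sequence[where f=f, OF rc s_lim])
  then have "(\<lambda>p. ennreal (f (s p))) \<longlonglongrightarrow> ennreal (g (overshoot \<xi> J t \<omega>))"
    by (intro tendsto_ennrealI) (simp add: overshoot_def Let_def f_def T_def)
  then show ?thesis
  proof (rule Lim_transform_eventually)
    have e: "(\<Sum>m. ennreal (\<Prod>k\<le>m. exceed g t m k (\<xi> (real k * (1 / 2 ^ p)) \<omega>, J (real k * (1 / 2 ^ p)) \<omega>))) =
        (if \<exists>m. R p m then ennreal (f (s p)) else 0)" for p
      unfolding sum_first_exceedance fst_conv snd_conv R_def[symmetric] n_def[symmetric] by (simp only: s_def f_def)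
    show "\<forall>\<^sub>F p in sequentially. ennreal (f (s p)) =
        (\<Sum>m. ennreal (\<Prod>k\<le>m. exceed g t m k (\<xi> (real k * (1 / 2 ^ p)) \<omega>, J (real k * (1 / 2 ^ p)) \<omega>)))"
      using s_bounds[OF zero_less_one] by eventually_elim (use e in auto)
  qed
qed

lemma overshoot_shift:
  assumes ub: "\<And>x i. AE \<omega> in P x i. \<omega> \<in> unbounded_paths"
    and g: "g \<in> borel_measurable state_space" "\<And>z. 0 \<le> g z" "\<And>z. g z \<le> 1"
    and c: "\<And>j. continuous_on UNIV (\<lambda>y. g (y, j))"
  shows "(\<integral>\<^sup>+\<omega>. ennreal (g (overshoot \<xi> J t \<omega>)) \<partial>P x i) = (\<integral>\<^sup>+\<omega>. ennreal (g (overshoot \<xi> J (t - x) \<omega>)) \<partial>P 0 i)"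
proof -
  define S where "S p t \<omega> = (\<Sum>m. ennreal (\<Prod>k\<le>m. exceed g t m k (\<xi> (real k * (1 / 2 ^ p)) \<omega>, J (real k * (1 / 2 ^ p)) \<omega>)))"
    for p :: nat and t \<omega>
  have tm: "(\<lambda>\<omega>. \<Prod>k\<le>m. exceed g t m k (\<xi> (real k * (1 / 2 ^ p)) \<omega>, J (real k * (1 / 2 ^ p)) \<omega>)) \<in> borel_measurable M"
    for p m :: nat and t
    by (intro borel_measurable_prod measurable_compose[OF state_measurable exceed_measurable[OF g(1)]]) auto
  have Sm: "S p t \<in> borel_measurable M" for p t
    unfolding S_def[abs_def] by (intro borel_measurable_suminf_order measurable_compose[OF tm measurable_ennreal])
  have lim: "(\<lambda>p. \<integral>\<^sup>+\<omega>. S p t \<omega> \<partial>P x i) \<longlonglongrightarrow> (\<integral>\<^sup>+\<omega>. ennreal (g (overshoot \<xi> J t \<omega>)) \<partial>P x i)" for t x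
  proof (rule nn_integral_dominated_convergence[where w="\<lambda>_. 1"])
    interpret prob_space "P x i" by (rule prob_space_P)
    show "(\<integral>\<^sup>+\<omega>. 1 \<partial>P x i) < \<infinity>" using emeasure_space_1 by simp
    show "S p t \<in> borel_measurable (P x i)" for p by (rule measurable_P[OF Sm])
    show "(\<lambda>\<omega>. ennreal (g (overshoot \<xi> J t \<omega>))) \<in> borel_measurable (P x i)"
      using measurable_P[OF measurable_compose[OF overshoot_measurable g(1)]] by simp
    show "AE \<omega> in P x i. S p t \<omega> \<le> 1" for p
      by (intro AE_I2) (simp add: S_def sum_first_exceedance g)
    show "AE \<omega> in P x i. (\<lambda>p. S p t \<omega>) \<longlonglongrightarrow> ennreal (g (overshoot \<xi> J t \<omega>))"
      using ub[of x i] by eventually_elim (simp only: S_def, rule grid_overshoot_tendsto[OF _ c])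
  qed simp
  have int: "(\<integral>\<^sup>+\<omega>. S p t \<omega> \<partial>P x i) = (\<Sum>m. ennreal (\<integral>\<omega>. (\<Prod>k\<le>m. exceed g t m k (\<xi> (real k * (1 / 2 ^ p)) \<omega>, J (real k * (1 / 2 ^ p)) \<omega>)) \<partial>P x i))"
    for p t x
  proof -
    interpret prob_space "P x i" by (rule prob_space_P)
    have nn: "0 \<le> (\<Prod>k\<le>m. exceed g t m k (a k))" "(\<Prod>k\<le>m. exceed g t m k (a k)) \<le> 1" for m a
      by (intro prod_nonneg prod_le_1 conjI exceed_bounds g)+
    have i: "integrable (P x i) (\<lambda>\<omega>. \<Prod>k\<le>m. exceed g t m k (\<xi> (real k * (1 / 2 ^ p)) \<omega>, J (real k * (1 / 2 ^ p)) \<omega>))" for m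
      by (rule integrable_const_bound[of _ 1, OF _ measurable_P[OF tm]]) (intro AE_I2, simp add: nn del: prod.atMost_Suc)
    show ?thesis
      unfolding S_def nn_integral_suminf[OF measurable_P[OF measurable_compose[OF tm measurable_ennreal]]]
      by (simp only: nn_integral_eq_integral[OF i AE_I2[OF nn(1)]])
  qed
  have "(\<integral>\<omega>. (\<Prod>k\<le>m. exceed g t m k (\<xi> (real k * (1 / 2 ^ p)) \<omega>, J (real k * (1 / 2 ^ p)) \<omega>)) \<partial>P x i) =
      (\<integral>\<omega>. (\<Prod>k\<le>m. exceed g (t - x) m k (\<xi> (real k * (1 / 2 ^ p)) \<omega>, J (real k * (1 / 2 ^ p)) \<omega>)) \<partial>P 0 i)"
    for p m :: nat
    using shift_finite_dimensional[where h="1 / 2 ^ p" and g="exceed g (t - x) m" and m=m and x=x and i=i,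
        OF _ exceed_measurable[OF g(1)] exceed_bounds[of g, OF g(2,3)]]
    unfolding exceed_shift by simp
  then have "(\<integral>\<^sup>+\<omega>. S p t \<omega> \<partial>P x i) = (\<integral>\<^sup>+\<omega>. S p (t - x) \<omega> \<partial>P 0 i)" for p
    by (simp only: int)
  with LIMSEQ_unique[OF lim[of x t]] lim[of 0 "t - x"] show ?thesis by simp
qed

end

section \<open>The two sides of the identity as integral functionals\<close>

text \<open>\<open>nn_Q_op\<close> as a functional of an \<open>ennreal\<close>-valued integrand.\<close>

definition occupation :: "real \<Rightarrow> real \<Rightarrow> 'n \<Rightarrow> (real \<times> 'n \<Rightarrow> ennreal) \<Rightarrow> ennreal" where
  "occupation l y j g = (\<integral>\<^sup>+t. ennreal (exp (- l * t)) * indicator {0..y} t * g (y - t, j) \<partial>lborel)"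

text \<open>The functional \<open>\<psi>\<close> for \<open>ennreal\<close>-valued integrands.\<close>

definition jump_functional ::
  "real^'n^'n \<Rightarrow> ('n::finite \<Rightarrow> real) \<Rightarrow> ('n \<Rightarrow> real measure) \<Rightarrow> ('n \<Rightarrow> 'n \<Rightarrow> real measure) \<Rightarrow>
   real \<Rightarrow> 'n \<Rightarrow> (real \<times> 'n \<Rightarrow> ennreal) \<Rightarrow> ennreal" where
  "jump_functional Q d \<nu> G l i g = ennreal (d i) * g (0, i) + (\<integral>\<^sup>+y. occupation l y i g \<partial>\<nu> i)
     + (\<Sum>j\<in>UNIV - {i}. ennreal (Q $ i $ j) * (\<integral>\<^sup>+y. occupation l y j g \<partial>G i j))"

lemma nn_Q_op_eq_occupation: "nn_Q_op l f (y, j) = occupation l y j (\<lambda>z. ennreal (f z))"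
  unfolding nn_Q_op_def occupation_def case_prod_conv
  by (intro nn_integral_cong) (simp only: ennreal_mult'[OF exp_ge_zero] mult_ac)

lemma nn_psi_eq_jump_functional:
  assumes "\<And>i. 0 \<le> d i"
  shows "nn_psi Q d \<nu> G f l i = jump_functional Q d \<nu> G l i (\<lambda>z. ennreal (f z))"
  unfolding nn_psi_def jump_functional_def nn_Q_op_eq_occupation ennreal_mult'[OF assms] ..

lemma is_integral_cong:
  assumes "is_integral \<Lambda>" "\<And>g. g \<in> borel_measurable state_space \<Longrightarrow> \<Lambda> g = \<Lambda>' g"
  shows "is_integral \<Lambda>'"
proof -
  obtain \<mu> where "sets \<mu> = sets state_space" "\<forall>g\<in>borel_measurable state_space. \<Lambda> g = (\<integral>\<^sup>+z. g z \<partial>\<mu>)"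
    using assms(1) unfolding is_integral_def by blast
  with assms(2) show ?thesis unfolding is_integral_def by (intro exI[of _ \<mu>]) simp
qed

lemma is_integral_point: "is_integral (\<lambda>g. g (z :: real \<times> 'n::finite))"
proof -
  have "is_integral (\<lambda>g. \<integral>\<^sup>+a. \<integral>\<^sup>+b. (\<lambda>_. 1) (a, b) * g ((\<lambda>_. z) (a, b)) \<partial>count_space {()} \<partial>count_space {()})"
    by (rule is_integral_kernel) (auto intro: sigma_finite_measure_count_space_finite simp: space_pair_measure)
  then show ?thesis by (simp add: nn_integral_count_space_finite)
qed

lemma is_integral_occupation_mixture:
  assumes A: "sets A = sets borel"
  shows "is_integral (\<lambda>g. \<integral>\<^sup>+y. occupation l y (j :: 'n::finite) g \<partial>A)"
proof -
  have f: "(\<lambda>z. fst z) \<in> borel_measurable (A \<Otimes>\<^sub>M lborel)"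
    using measurable_fst[of A "lborel :: real measure"] measurable_cong_sets[OF refl A] by blast
  have s: "(\<lambda>z. snd z) \<in> borel_measurable (A \<Otimes>\<^sub>M lborel)"
    using measurable_snd[of A "lborel :: real measure"] measurable_cong_sets[OF refl sets_lborel] by blast
  have S: "{z \<in> space (A \<Otimes>\<^sub>M lborel). 0 \<le> snd z \<and> snd z \<le> fst z} \<in> sets (A \<Otimes>\<^sub>M lborel)"
    using f s by measurable
  have w: "(\<lambda>z. ennreal (exp (- l * snd z)) * indicator {0..fst z} (snd z)) \<in> borel_measurable (A \<Otimes>\<^sub>M lborel)"
  proof (rule borel_measurable_times_ennreal)
    show "(\<lambda>z. indicator {0..fst z} (snd z) :: ennreal) \<in> borel_measurable (A \<Otimes>\<^sub>M lborel)"
      by (rule borel_measurable_indicator') (simp only: atLeastAtMost_iff S)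
  qed (use s in measurable)
  have h: "(\<lambda>z. (fst z - snd z, j)) \<in> A \<Otimes>\<^sub>M lborel \<rightarrow>\<^sub>M state_space"
    using f s by measurable
  from is_integral_kernel[OF lborel.sigma_finite_measure_axioms w h]
  show ?thesis by (simp add: occupation_def)
qed

lemma is_integral_occupation: "is_integral (occupation l y (j :: 'n::finite))"
proof -
  have w: "(\<lambda>z. ennreal (exp (- l * fst z)) * indicator {0..y} (fst z)) \<in> borel_measurable (lborel \<Otimes>\<^sub>M count_space {()})"
    by measurable
  have h: "(\<lambda>z. (y - fst z, j)) \<in> lborel \<Otimes>\<^sub>M count_space {()} \<rightarrow>\<^sub>M state_space" by measurable
  have "sigma_finite_measure (count_space {()})" by (rule sigma_finite_measure_count_space_finite) simp
  from is_integral_kernel[OF this w h]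
  show ?thesis by (simp add: nn_integral_count_space_finite occupation_def[abs_def])
qed

lemma occupation_negative: "occupation l y j (indicator ({..<0} \<times> UNIV)) = 0"
proof -
  have "ennreal (exp (- l * t)) * indicator {0..y} t * indicator ({..<0} \<times> UNIV) (y - t, j) = 0" for t
    by (simp add: indicator_def)
  then show ?thesis by (simp only: occupation_def) simp
qed

lemma occupation_exp_test:
  assumes "0 \<le> y" "\<theta> \<noteq> l"
  shows "occupation l y j (\<lambda>z. ennreal (exp_test \<theta> k z)) = ennreal (if j = k then exp_quotient l \<theta> y else 0)"
proof (cases "j = k")
  case True
  have "ennreal (exp (- l * t)) * indicator {0..y} t * ennreal (exp_test \<theta> k (y - t, j)) =
      ennreal (exp (- l * t) * exp (- \<theta> * (y - t))) * indicator {0..y} t" for t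
    using True by (simp add: exp_test_def ennreal_mult mult_ac)
  then show ?thesis
    unfolding occupation_def using nn_integral_exp_piece[OF assms] True by simp
qed (simp add: occupation_def exp_test_def)

context
  fixes Q :: "real^'n^'n" and d :: "'n::finite \<Rightarrow> real" and \<nu> :: "'n \<Rightarrow> real measure" and G :: "'n \<Rightarrow> 'n \<Rightarrow> real measure"
  assumes char: "ma_characteristics Q d \<nu> G"
begin

lemma is_integral_jump_functional: "is_integral (jump_functional Q d \<nu> G l i)"
  unfolding jump_functional_def[abs_def]
  using characteristicsD(4)[OF char, of i] characteristicsD(6)[OF char]
  by (intro is_integral_add is_integral_sum is_integral_cmult is_integral_point is_integral_occupation_mixture)
     (auto simp: levy_measure_def)

lemma levy_min_integrable: "integrable (\<nu> i) (\<lambda>y. min 1 y)"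
proof (rule integrableI_nonneg)
  have s: "sets (\<nu> i) = sets borel" and f: "(\<integral>\<^sup>+y. ennreal (min 1 y) \<partial>\<nu> i) < \<infinity>"
    using characteristicsD(4)[OF char, of i] by (auto simp: levy_measure_def)
  have "(\<lambda>y::real. min 1 y) \<in> borel_measurable borel" by measurable
  then show "(\<lambda>y. min 1 y) \<in> borel_measurable (\<nu> i)" using measurable_cong_sets[OF s refl] by blast
  show "AE y in \<nu> i. 0 \<le> min 1 y" using AE_levy_pos[OF char, of i] by eventually_elim simp
  show "(\<integral>\<^sup>+y. ennreal (min 1 y) \<partial>\<nu> i) < \<infinity>" by (rule f)
qed

lemma levy_exp_integrable:
  assumes "0 \<le> \<theta>"
  shows "integrable (\<nu> i) (\<lambda>y. 1 - exp (- \<theta> * y))"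
proof (rule Bochner_Integration.integrable_bound[OF integrable_mult_right[OF levy_min_integrable, where c="max 1 \<theta>"]])
  have s: "sets (\<nu> i) = sets borel" using characteristicsD(4)[OF char, of i] by (auto simp: levy_measure_def)
  have "(\<lambda>y. 1 - exp (- \<theta> * y)) \<in> borel_measurable borel" by measurable
  then show "(\<lambda>y. 1 - exp (- \<theta> * y)) \<in> borel_measurable (\<nu> i)" using measurable_cong_sets[OF s refl] by blast
  show "AE y in \<nu> i. norm (1 - exp (- \<theta> * y)) \<le> norm (max 1 \<theta> * min 1 y)"
    using AE_levy_pos[OF char, of i]
  proof eventually_elim
    case (elim y)
    have "0 \<le> \<theta> * y" using assms elim by simp
    then have n: "norm (1 - exp (- \<theta> * y)) = 1 - exp (- \<theta> * y)" by simp
    have a: "1 - exp (- \<theta> * y) \<le> \<theta> * y" using exp_ge_add_one_self[of "- \<theta> * y"] by simp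
    have b: "1 - exp (- \<theta> * y) \<le> 1" by simp
    have "1 - exp (- \<theta> * y) \<le> max 1 \<theta> * min 1 y"
    proof (cases "y \<le> 1")
      case True
      have "\<theta> * y \<le> max 1 \<theta> * y" using elim by (intro mult_right_mono) auto
      with a True show ?thesis by (simp add: min_absorb2)
    next
      case False
      with order_trans[OF b max.cobounded1[of 1 \<theta>]] show ?thesis by (simp add: min_absorb1)
    qed
    moreover have "0 \<le> max 1 \<theta> * min 1 y" using elim by simp
    ultimately show ?case unfolding n by simp
  qed
qed

text \<open>
  The drift is the part of the difference quotient of the Laplace exponent that the integral with respect to the
  Levy measure does not see; \<open>\<psi>\<close> adds it back as \<open>d i * f (0, i)\<close>.
\<close>

lemma levy_exp_quotient:
  assumes l: "0 \<le> l" and \<theta>: "0 \<le> \<theta>" "\<theta> \<noteq> l"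
  shows "(\<integral>\<^sup>+y. ennreal (exp_quotient l \<theta> y) \<partial>\<nu> i) =
      ennreal ((laplace_exponent (d i) (\<nu> i) l - laplace_exponent (d i) (\<nu> i) \<theta>) / (l - \<theta>) - d i)" (is ?eq)
    and "0 \<le> (laplace_exponent (d i) (\<nu> i) l - laplace_exponent (d i) (\<nu> i) \<theta>) / (l - \<theta>) - d i" (is ?nn)
proof -
  have e: "exp_quotient l \<theta> y = ((1 - exp (- l * y)) - (1 - exp (- \<theta> * y))) / (l - \<theta>)" for y
    by (simp add: exp_quotient_def)
  have int: "integrable (\<nu> i) (exp_quotient l \<theta>)"
    unfolding e[abs_def]
    by (rule integrable_divide[OF Bochner_Integration.integrable_diff[OF levy_exp_integrable[OF l] levy_exp_integrable[OF \<theta>(1)]]])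
  have nn: "AE y in \<nu> i. 0 \<le> exp_quotient l \<theta> y"
    using AE_levy_pos[OF char, of i] by eventually_elim (simp add: exp_quotient_nonneg)
  have "(\<integral>y. exp_quotient l \<theta> y \<partial>\<nu> i) =
      ((\<integral>y. 1 - exp (- l * y) \<partial>\<nu> i) - (\<integral>y. 1 - exp (- \<theta> * y) \<partial>\<nu> i)) / (l - \<theta>)"
    unfolding e
    by (simp only: integral_divide_zero Bochner_Integration.integral_diff[OF levy_exp_integrable[OF l] levy_exp_integrable[OF \<theta>(1)]])
  also have "\<dots> = (laplace_exponent (d i) (\<nu> i) l - laplace_exponent (d i) (\<nu> i) \<theta>) / (l - \<theta>) - d i"
    using \<theta>(2) by (simp add: laplace_exponent_def field_simps)
  finally have E: "(\<integral>y. exp_quotient l \<theta> y \<partial>\<nu> i) =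
      (laplace_exponent (d i) (\<nu> i) l - laplace_exponent (d i) (\<nu> i) \<theta>) / (l - \<theta>) - d i" .
  show ?eq unfolding nn_integral_eq_integral[OF int nn] E ..
  show ?nn unfolding E[symmetric] by (rule integral_nonneg_AE[OF nn])
qed

lemma jump_exp_quotient:
  assumes l: "0 \<le> l" and \<theta>: "0 \<le> \<theta>"
  shows "(\<integral>\<^sup>+y. ennreal (exp_quotient l \<theta> y) \<partial>G i j) =
      ennreal (((\<integral>y. exp (- \<theta> * y) \<partial>G i j) - (\<integral>y. exp (- l * y) \<partial>G i j)) / (l - \<theta>))" (is ?eq)
    and "0 \<le> ((\<integral>y. exp (- \<theta> * y) \<partial>G i j) - (\<integral>y. exp (- l * y) \<partial>G i j)) / (l - \<theta>)" (is ?nn)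
proof -
  interpret prob_space "G i j" by (rule characteristicsD[OF char])
  have i: "integrable (G i j) (\<lambda>y. exp (- \<eta> * y))" if "0 \<le> \<eta>" for \<eta>
  proof (rule integrable_const_bound[of _ 1])
    show "AE y in G i j. norm (exp (- \<eta> * y)) \<le> 1"
      using AE_jump_nonneg[OF char] by eventually_elim (use that in simp)
    have "(\<lambda>y. exp (- \<eta> * y)) \<in> borel_measurable borel" by measurable
    then show "(\<lambda>y. exp (- \<eta> * y)) \<in> borel_measurable (G i j)"
      using measurable_cong_sets[OF characteristicsD(6)[OF char] refl] by blast
  qed
  have int: "integrable (G i j) (exp_quotient l \<theta>)"
    unfolding exp_quotient_def[abs_def] using i[OF l] i[OF \<theta>] by (intro integrable_divide Bochner_Integration.integrable_diff)
  have nn: "AE y in G i j. 0 \<le> exp_quotient l \<theta> y"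
    using AE_jump_nonneg[OF char] by eventually_elim (simp add: exp_quotient_nonneg)
  have E: "(\<integral>y. exp_quotient l \<theta> y \<partial>G i j) = ((\<integral>y. exp (- \<theta> * y) \<partial>G i j) - (\<integral>y. exp (- l * y) \<partial>G i j)) / (l - \<theta>)"
    unfolding exp_quotient_def using i[OF l] i[OF \<theta>] by simp
  show ?eq unfolding nn_integral_eq_integral[OF int nn] E ..
  show ?nn unfolding E[symmetric] by (rule integral_nonneg_AE[OF nn])
qed

text \<open>
  Entry by entry the difference quotient of the matrix exponent is what \<open>\<psi>\<close> integrates: the diagonal gives drift
  and Levy measure, the off-diagonal the jumps.
\<close>

lemma jump_functional_exp_test:
  assumes l: "0 \<le> l" and \<theta>: "0 \<le> \<theta>" "\<theta> \<noteq> l"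
  shows "jump_functional Q d \<nu> G l i (\<lambda>z. ennreal (exp_test \<theta> k z)) =
      ennreal ((matrix_exponent Q d \<nu> G l $ i $ k - matrix_exponent Q d \<nu> G \<theta> $ i $ k) / (l - \<theta>))" (is ?eq)
    and "0 \<le> (matrix_exponent Q d \<nu> G l $ i $ k - matrix_exponent Q d \<nu> G \<theta> $ i $ k) / (l - \<theta>)" (is ?nn)
proof -
  define D where "D j = ((\<integral>y. exp (- \<theta> * y) \<partial>G i j) - (\<integral>y. exp (- l * y) \<partial>G i j)) / (l - \<theta>)" for j
  define e where "e = (laplace_exponent (d i) (\<nu> i) l - laplace_exponent (d i) (\<nu> i) \<theta>) / (l - \<theta>)"
  have D: "0 \<le> D j" "(\<integral>\<^sup>+y. ennreal (exp_quotient l \<theta> y) \<partial>G i j) = ennreal (D j)" for j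
    using jump_exp_quotient[OF l \<theta>(1), of i j] by (simp_all add: D_def)
  have e: "0 \<le> e - d i" "(\<integral>\<^sup>+y. ennreal (exp_quotient l \<theta> y) \<partial>\<nu> i) = ennreal (e - d i)"
    using levy_exp_quotient[OF l \<theta>, of i] by (simp_all add: e_def)
  have d: "0 \<le> d i" by (rule characteristicsD[OF char])
  have target: "(matrix_exponent Q d \<nu> G l $ i $ k - matrix_exponent Q d \<nu> G \<theta> $ i $ k) / (l - \<theta>) =
      (if i = k then e else 0) + Q $ i $ k * D k"
    by (simp add: matrix_exponent_def e_def D_def diff_divide_distrib right_diff_distrib)
  have oG: "(\<integral>\<^sup>+y. occupation l y j (\<lambda>z. ennreal (exp_test \<theta> k z)) \<partial>G i j) = (if j = k then ennreal (D j) else 0)" for j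
  proof -
    have "(\<integral>\<^sup>+y. occupation l y j (\<lambda>z. ennreal (exp_test \<theta> k z)) \<partial>G i j) =
        (\<integral>\<^sup>+y. ennreal (if j = k then exp_quotient l \<theta> y else 0) \<partial>G i j)"
      by (rule nn_integral_cong_AE, rule AE_mp[OF AE_jump_nonneg[OF char, of i j]])
        (intro AE_I2 impI occupation_exp_test \<theta>(2))
    then show ?thesis using D(2) by simp
  qed
  have o\<nu>: "(\<integral>\<^sup>+y. occupation l y i (\<lambda>z. ennreal (exp_test \<theta> k z)) \<partial>\<nu> i) = (if i = k then ennreal (e - d i) else 0)"
  proof -
    have "(\<integral>\<^sup>+y. occupation l y i (\<lambda>z. ennreal (exp_test \<theta> k z)) \<partial>\<nu> i) =
        (\<integral>\<^sup>+y. ennreal (if i = k then exp_quotient l \<theta> y else 0) \<partial>\<nu> i)"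
      by (rule nn_integral_cong_AE, rule AE_mp[OF AE_levy_pos[OF char, of i]])
        (intro AE_I2 impI occupation_exp_test \<theta>(2) less_imp_le)
    then show ?thesis using e(2) by (cases "i = k") simp_all
  qed
  have J: "jump_functional Q d \<nu> G l i (\<lambda>z. ennreal (exp_test \<theta> k z)) =
      ennreal (d i) * ennreal (if i = k then 1 else 0) + (if i = k then ennreal (e - d i) else 0) +
      (\<Sum>j\<in>UNIV - {i}. if j = k then ennreal (Q $ i $ k) * ennreal (D k) else 0)"
  proof -
    have "exp_test \<theta> k (0, i) = (if i = k then 1 else 0)" by (simp add: exp_test_def)
    moreover have "ennreal (Q $ i $ j) * (if j = k then ennreal (D j) else 0) =
        (if j = k then ennreal (Q $ i $ k) * ennreal (D k) else 0)" for j by simp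
    ultimately show ?thesis unfolding jump_functional_def oG o\<nu> by simp
  qed
  show ?eq
  proof (cases "i = k")
    case True
    have "D k = 0"
      using True jump_laplace(3)[OF char l, of i k] jump_laplace(3)[OF char \<theta>(1), of i k] by (simp add: D_def)
    then show ?thesis
      unfolding J target using True d e(1) by (simp add: ennreal_plus[symmetric] del: ennreal_plus)
  next
    case False
    then have "(\<Sum>j\<in>UNIV - {i}. if j = k then ennreal (Q $ i $ k) * ennreal (D k) else 0) = ennreal (Q $ i $ k) * ennreal (D k)"
      by simp
    then show ?thesis
      unfolding J target using False characteristicsD(1)[OF char False] D(1)[of k] by (simp add: ennreal_mult)
  qed
  show ?nn
  proof (cases "i = k")
    case True
    have "D k = 0"
      using True jump_laplace(3)[OF char l, of i k] jump_laplace(3)[OF char \<theta>(1), of i k] by (simp add: D_def)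
    with True d e(1) show ?thesis unfolding target by simp
  next
    case False
    then show ?thesis unfolding target using characteristicsD(1)[OF char False] D(1)[of k] by simp
  qed
qed

lemma jump_functional_negative: "jump_functional Q d \<nu> G l i (indicator ({..<0} \<times> UNIV)) = 0"
  by (simp add: jump_functional_def occupation_negative)

end

lemma occupation_cong: "(\<And>y. 0 \<le> y \<Longrightarrow> g (y, j) = g' (y, j)) \<Longrightarrow> occupation l y j g = occupation l y j g'"
  unfolding occupation_def by (rule nn_integral_cong) (simp add: indicator_def)

lemma jump_functional_cong:
  assumes "\<And>y j. 0 \<le> y \<Longrightarrow> g (y, j) = g' (y, j)"
  shows "jump_functional Q d \<nu> G l i g = jump_functional Q d \<nu> G l i g'"
  unfolding jump_functional_def
  using assms[of 0] occupation_cong[of g _ g', OF assms] by simp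

context markov_additive_process
begin

definition overshoot_functional :: "real \<Rightarrow> real \<Rightarrow> 'n \<Rightarrow> (real \<times> 'n \<Rightarrow> ennreal) \<Rightarrow> ennreal" where
  "overshoot_functional l x i g =
    (\<integral>\<^sup>+t. ennreal (exp (- l * t)) * indicator {0..} t * (\<integral>\<^sup>+\<omega>. g (overshoot \<xi> J t \<omega>) \<partial>P x i) \<partial>lborel)"

lemma nn_resolvent_eq_overshoot_functional:
  "nn_resolvent P \<xi> J l f (x, i) = overshoot_functional l x i (\<lambda>z. ennreal (f z))"
  by (simp add: nn_resolvent_def overshoot_functional_def mult_ac)

lemma overshoot_pair_measurable: "(\<lambda>z. overshoot \<xi> J (fst z) (snd z)) \<in> lborel \<Otimes>\<^sub>M P x i \<rightarrow>\<^sub>M state_space"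
proof -
  have "sets (lborel \<Otimes>\<^sub>M P x i) = sets (borel \<Otimes>\<^sub>M M)" by (intro sets_pair_measure_cong sets_lborel sets_P)
  from measurable_cong_sets[OF this refl] overshoot_jointly_measurable show ?thesis by blast
qed

lemma is_integral_overshoot_functional: "is_integral (overshoot_functional l x i)"
proof (rule is_integral_cong)
  interpret prob_space "P x i" by (rule prob_space_P)
  show "is_integral (\<lambda>g. \<integral>\<^sup>+t. \<integral>\<^sup>+\<omega>. (\<lambda>z. ennreal (exp (- l * fst z)) * indicator {0..} (fst z)) (t, \<omega>) *
      g ((\<lambda>z. overshoot \<xi> J (fst z) (snd z)) (t, \<omega>)) \<partial>P x i \<partial>lborel)"
    by (rule is_integral_kernel[OF sigma_finite_measure_axioms _ overshoot_pair_measurable]) measurable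
  fix g :: "real \<times> 'n \<Rightarrow> ennreal" assume "g \<in> borel_measurable state_space"
  from measurable_P[OF measurable_compose[OF overshoot_measurable this]]
  show "(\<integral>\<^sup>+t. \<integral>\<^sup>+\<omega>. (\<lambda>z. ennreal (exp (- l * fst z)) * indicator {0..} (fst z)) (t, \<omega>) *
      g ((\<lambda>z. overshoot \<xi> J (fst z) (snd z)) (t, \<omega>)) \<partial>P x i \<partial>lborel) = overshoot_functional l x i g"
    by (simp add: overshoot_functional_def nn_integral_cmult)
qed

lemma overshoot_functional_one:
  assumes "0 < l" shows "overshoot_functional l x i (\<lambda>_. 1) = ennreal (1 / l)"
proof -
  interpret prob_space "P x i" by (rule prob_space_P)
  show ?thesis
    unfolding overshoot_functional_def using emeasure_space_1 nn_integral_exp_half_line[OF assms] by simp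
qed

lemma overshoot_functional_negative:
  assumes "\<And>x i. AE \<omega> in P x i. \<omega> \<in> unbounded_paths"
  shows "overshoot_functional l x i (indicator ({..<0} \<times> UNIV)) = 0"
proof -
  have "(\<integral>\<^sup>+\<omega>. indicator ({..<0} \<times> UNIV) (overshoot \<xi> J t \<omega>) \<partial>P x i) = (\<integral>\<^sup>+\<omega>. 0 \<partial>P x i)" for t
  proof (rule nn_integral_cong_AE)
    show "AE \<omega> in P x i. indicator ({..<0} \<times> UNIV) (overshoot \<xi> J t \<omega>) = (0 :: ennreal)"
      using assms[of x i]
    proof eventually_elim
      case (elim \<omega>)
      from overshoot_nonneg[OF elim, of t] show ?case by (cases "overshoot \<xi> J t \<omega>") simp
    qed
  qed
  then show ?thesis by (simp add: overshoot_functional_def)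
qed

lemma overshoot_functional_cong:
  assumes "\<And>x i. AE \<omega> in P x i. \<omega> \<in> unbounded_paths" and "\<And>y j. 0 \<le> y \<Longrightarrow> g (y, j) = g' (y, j)"
  shows "overshoot_functional l x i g = overshoot_functional l x i g'"
proof -
  have "(\<integral>\<^sup>+\<omega>. g (overshoot \<xi> J t \<omega>) \<partial>P x i) = (\<integral>\<^sup>+\<omega>. g' (overshoot \<xi> J t \<omega>) \<partial>P x i)" for t
  proof (rule nn_integral_cong_AE)
    show "AE \<omega> in P x i. g (overshoot \<xi> J t \<omega>) = g' (overshoot \<xi> J t \<omega>)"
      using assms(1)[of x i]
    proof eventually_elim
      case (elim \<omega>)
      from overshoot_nonneg[OF elim, of t] assms(2) show ?case by (cases "overshoot \<xi> J t \<omega>") simp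
    qed
  qed
  then show ?thesis by (simp only: overshoot_functional_def)
qed

lemma overshoot_below_start:
  assumes "\<xi> 0 \<omega> = y" "J 0 \<omega> = i" "s < y"
  shows "overshoot \<xi> J s \<omega> = (y - s, i)"
proof -
  have ex: "\<exists>u\<ge>0. s < \<xi> u \<omega>" using assms by (intro exI[of _ 0]) simp
  have "first_passage \<xi> s \<omega> \<le> 0"
    using first_passage_properties(3)[where Z=\<xi> and t=s and \<omega>=\<omega>, OF ex, of 0] assms by simp
  moreover have "0 \<le> first_passage \<xi> s \<omega>" using passage_time_nonneg[of \<xi> s \<omega>] by (simp add: real_of_ereal_pos)
  ultimately have "first_passage \<xi> s \<omega> = 0" by (rule antisym)
  with assms show ?thesis by (simp add: overshoot_def Let_def)
qed

text \<open>
  Levels below \<open>x\<close> are exceeded at time zero; for the others substitute \<open>t - x\<close> for \<open>t\<close>.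
\<close>

lemma overshoot_functional_shift:
  fixes g :: "real \<times> 'n \<Rightarrow> real"
  assumes ub: "\<And>x i. AE \<omega> in P x i. \<omega> \<in> unbounded_paths" and x: "0 \<le> x"
    and g: "g \<in> borel_measurable state_space" "\<And>z. 0 \<le> g z" "\<And>z. g z \<le> 1"
    and c: "\<And>j. continuous_on UNIV (\<lambda>y. g (y, j))"
  shows "overshoot_functional l x i (\<lambda>z. ennreal (g z)) =
    occupation l x i (\<lambda>z. ennreal (g z)) + ennreal (exp (- l * x)) * overshoot_functional l 0 i (\<lambda>z. ennreal (g z))"
proof -
  define \<phi> where "\<phi> t = (\<integral>\<^sup>+\<omega>. ennreal (g (overshoot \<xi> J t \<omega>)) \<partial>P 0 i)" for t
  interpret prob_space "P 0 i" by (rule prob_space_P)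
  have \<phi>m: "\<phi> \<in> borel_measurable lborel"
    unfolding \<phi>_def[abs_def]
    by (rule borel_measurable_nn_integral)
      (use measurable_compose[OF measurable_compose[OF overshoot_pair_measurable g(1)] measurable_ennreal] in \<open>simp add: case_prod_beta\<close>)
  have neg: "\<phi> s = ennreal (g (- s, i))" if "s < 0" for s
  proof -
    have "\<phi> s = (\<integral>\<^sup>+\<omega>. ennreal (g (- s, i)) \<partial>P 0 i)"
      unfolding \<phi>_def
    proof (rule nn_integral_cong_AE)
      show "AE \<omega> in P 0 i. ennreal (g (overshoot \<xi> J s \<omega>)) = ennreal (g (- s, i))"
        using initial[of 0 i]
      proof eventually_elim
        case (elim \<omega>)
        then show ?case using overshoot_below_start[of \<omega> 0 i s] that by simp
      qed
    qed
    then show ?thesis using emeasure_space_1 by simp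
  qed
  have "overshoot_functional l x i (\<lambda>z. ennreal (g z)) = (\<integral>\<^sup>+t. ennreal (exp (- l * t)) * indicator {0..} t * \<phi> (t - x) \<partial>lborel)"
  proof -
    have "(\<integral>\<^sup>+\<omega>. ennreal (g (overshoot \<xi> J t \<omega>)) \<partial>P x i) = \<phi> (t - x)" for t
      unfolding \<phi>_def by (rule overshoot_shift[OF ub g c])
    then show ?thesis by (simp only: overshoot_functional_def)
  qed
  also have "\<dots> = (\<integral>\<^sup>+t. ennreal (exp (- l * t)) * indicator {0..x} t * ennreal (g (x - t, i)) +
      ennreal (exp (- l * t)) * indicator {x..} t * \<phi> (t - x) \<partial>lborel)"
  proof (rule nn_integral_cong_AE)
    show "AE t in lborel. ennreal (exp (- l * t)) * indicator {0..} t * \<phi> (t - x) =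
        ennreal (exp (- l * t)) * indicator {0..x} t * ennreal (g (x - t, i)) +
        ennreal (exp (- l * t)) * indicator {x..} t * \<phi> (t - x)"
      using AE_lborel_singleton[of x]
    proof eventually_elim
      case (elim t)
      show ?case
      proof (cases "t < x")
        case True
        then show ?thesis using neg[of "t - x"] by (auto simp: indicator_def)
      next
        case False
        then show ?thesis using elim x by (auto simp: indicator_def)
      qed
    qed
  qed
  also have "\<dots> = occupation l x i (\<lambda>z. ennreal (g z)) +
      (\<integral>\<^sup>+t. ennreal (exp (- l * t)) * indicator {x..} t * \<phi> (t - x) \<partial>lborel)"
  proof -
    have "(\<lambda>t. (x - t, i)) \<in> borel \<rightarrow>\<^sub>M state_space" by measurable
    from measurable_compose[OF this g(1)] have [measurable]: "(\<lambda>t. g (x - t, i)) \<in> borel_measurable borel" .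
    have [measurable]: "(\<lambda>t. \<phi> (t - x)) \<in> borel_measurable borel"
      using measurable_compose[of "\<lambda>t. t - x" borel lborel \<phi> borel] \<phi>m by simp
    show ?thesis unfolding occupation_def by (rule nn_integral_add) measurable
  qed
  also have "(\<integral>\<^sup>+t. ennreal (exp (- l * t)) * indicator {x..} t * \<phi> (t - x) \<partial>lborel) =
      ennreal (exp (- l * x)) * overshoot_functional l 0 i (\<lambda>z. ennreal (g z))"
  proof -
    have [measurable]: "(\<lambda>t. \<phi> (t - x)) \<in> borel_measurable borel"
      using measurable_compose[of "\<lambda>t. t - x" borel lborel \<phi> borel] \<phi>m by simp
    have m: "(\<lambda>t. ennreal (exp (- l * t)) * indicator {x..} t * \<phi> (t - x)) \<in> borel_measurable borel"
      by measurable
    have "(\<integral>\<^sup>+t. ennreal (exp (- l * t)) * indicator {x..} t * \<phi> (t - x) \<partial>lborel) =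
        (\<integral>\<^sup>+t. ennreal (exp (- l * (x + 1 * t))) * indicator {x..} (x + 1 * t) * \<phi> (x + 1 * t - x) \<partial>lborel)"
      using nn_integral_real_affine[OF m, of 1 x] by simp
    also have "\<dots> = (\<integral>\<^sup>+t. ennreal (exp (- l * x)) * (ennreal (exp (- l * t)) * indicator {0..} t * \<phi> t) \<partial>lborel)"
    proof (rule nn_integral_cong)
      fix t :: real
      have "exp (- l * (x + 1 * t)) = exp (- l * x) * exp (- l * t)" by (simp add: exp_add[symmetric] algebra_simps)
      then show "ennreal (exp (- l * (x + 1 * t))) * indicator {x..} (x + 1 * t) * \<phi> (x + 1 * t - x) =
          ennreal (exp (- l * x)) * (ennreal (exp (- l * t)) * indicator {0..} t * \<phi> t)"
        by (simp add: ennreal_mult indicator_def mult.assoc)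
    qed
    also have "\<dots> = ennreal (exp (- l * x)) * (\<integral>\<^sup>+t. ennreal (exp (- l * t)) * indicator {0..} t * \<phi> t \<partial>lborel)"
    proof (rule nn_integral_cmult)
      have [measurable]: "\<phi> \<in> borel_measurable borel" using \<phi>m by simp
      show "(\<lambda>t. ennreal (exp (- l * t)) * indicator {0..} t * \<phi> t) \<in> borel_measurable lborel" by measurable
    qed
    finally show ?thesis by (simp add: overshoot_functional_def \<phi>_def)
  qed
  finally show ?thesis .
qed

end

section \<open>Bounded functions\<close>

lemma occupation_integrand_integrable:
  fixes h :: "real \<times> 'n::finite \<Rightarrow> real"
  assumes l: "0 < l" and h: "h \<in> borel_measurable state_space" "\<And>z. \<bar>h z\<bar> \<le> D"
  shows "integrable lborel (\<lambda>t. indicator {0..y} t *\<^sub>R (exp (- l * t) * h (y - t, j)))"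
proof (rule Bochner_Integration.integrable_bound[of lborel "\<lambda>t. D * indicator {0..y} t"])
  have "emeasure lborel {0..y} < \<infinity>" by (cases "0 \<le> y") simp_all
  then show "integrable lborel (\<lambda>t. D * indicator {0..y} t)"
    by (intro integrable_mult_right integrable_real_indicator) simp_all
  have "(\<lambda>t. (y - t, j)) \<in> borel \<rightarrow>\<^sub>M state_space" by measurable
  from measurable_compose[OF this h(1)] have [measurable]: "(\<lambda>t. h (y - t, j)) \<in> borel_measurable borel" .
  show "(\<lambda>t. indicator {0..y} t *\<^sub>R (exp (- l * t) * h (y - t, j))) \<in> borel_measurable lborel" by measurable
  show "AE t in lborel. norm (indicator {0..y} t *\<^sub>R (exp (- l * t) * h (y - t, j))) \<le> norm (D * indicator {0..y} t)"
  proof (intro AE_I2)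
    fix t
    show "norm (indicator {0..y} t *\<^sub>R (exp (- l * t) * h (y - t, j))) \<le> norm (D * indicator {0..y} t)"
    proof (cases "t \<in> {0..y}")
      case True
      then have "exp (- l * t) * \<bar>h (y - t, j)\<bar> \<le> 1 * D" using l h(2) by (intro mult_mono) auto
      with True show ?thesis by (simp add: abs_mult)
    qed simp
  qed
qed

lemma Q_op_eq: "Q_op l h (y, j) = (\<integral>t. indicator {0..y} t *\<^sub>R (exp (- l * t) * h (y - t, j)) \<partial>lborel)"
  by (simp add: Q_op_def set_lebesgue_integral_def)

lemma Q_op_nonneg: "(\<And>z. 0 \<le> h z) \<Longrightarrow> 0 \<le> Q_op l h (y, j)"
  unfolding Q_op_eq by (intro integral_nonneg_AE AE_I2) simp

lemma nn_Q_op_eq_Q_op: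
  assumes l: "0 < l" and h: "h \<in> borel_measurable (state_space :: (real \<times> 'n::finite) measure)" "\<And>z. 0 \<le> h z" "\<And>z. h z \<le> D"
  shows "nn_Q_op l h (y, j) = ennreal (Q_op l h (y, j))"
proof -
  have b: "\<bar>h z\<bar> \<le> D" for z using h(2,3)[of z] by simp
  have "nn_Q_op l h (y, j) = (\<integral>\<^sup>+t. ennreal (indicator {0..y} t *\<^sub>R (exp (- l * t) * h (y - t, j))) \<partial>lborel)"
    unfolding nn_Q_op_def case_prod_conv by (intro nn_integral_cong) (simp add: indicator_def)
  also have "\<dots> = ennreal (Q_op l h (y, j))"
    unfolding Q_op_eq using h(2) by (intro nn_integral_eq_integral occupation_integrand_integrable[OF l h(1) b] AE_I2) simp
  finally show ?thesis .
qed

text \<open>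
  Adding the bound reduces a bounded function to two nonnegative ones; all the functionals respect this.
\<close>

lemma Q_op_shift:
  assumes l: "0 < l" and h: "h \<in> borel_measurable (state_space :: (real \<times> 'n::finite) measure)" "\<And>z. \<bar>h z\<bar> \<le> D"
  shows "Q_op l h (y, j) = Q_op l (\<lambda>z. h z + D) (y, j) - Q_op l (\<lambda>_. D) (y, j)"
proof -
  have "0 \<le> D" using h(2)[of "(0, j)"] by linarith
  moreover have "\<bar>h z + D\<bar> \<le> 2 * D" for z using h(2)[of z] by linarith
  ultimately have i: "integrable lborel (\<lambda>t. indicator {0..y} t *\<^sub>R (exp (- l * t) * (h (y - t, j) + D)))"
      "integrable lborel (\<lambda>t. indicator {0..y} t *\<^sub>R (exp (- l * t) * D))"
    using occupation_integrand_integrable[where h="\<lambda>z. h z + D" and D="2 * D" and y=y and j=j, OF l]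
      occupation_integrand_integrable[where h="\<lambda>_. D" and D=D and y=y and j=j, OF l] h(1) by auto
  show ?thesis
    unfolding Q_op_eq Bochner_Integration.integral_diff[OF i, symmetric]
    by (intro Bochner_Integration.integral_cong) (simp_all add: algebra_simps)
qed

text \<open>Levy measures only integrate functions that are dominated by \<open>min 1 y\<close>.\<close>

lemma Q_op_bound:
  assumes l: "0 < l" and h: "h \<in> borel_measurable (state_space :: (real \<times> 'n::finite) measure)" "\<And>z. 0 \<le> h z" "\<And>z. h z \<le> D"
    and y: "0 \<le> y"
  shows "Q_op l h (y, j) \<le> D * max 1 (1 / l) * min 1 y"
proof -
  have D: "0 \<le> D" using h(2,3)[of "(0, j)"] by linarith
  have e: "ennreal (exp (- l * t) * h (y - t, j)) * indicator {0..y} t \<le> ennreal D * (ennreal (exp (- l * t)) * indicator {0..} t)"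
    "ennreal (exp (- l * t) * h (y - t, j)) * indicator {0..y} t \<le> ennreal D * indicator {0..y} t" for t
  proof -
    have "exp (- l * t) * h (y - t, j) \<le> exp (- l * t) * D" using h by (intro mult_left_mono) auto
    then have 1: "ennreal (exp (- l * t) * h (y - t, j)) \<le> ennreal D * ennreal (exp (- l * t))"
      using D by (simp add: ennreal_mult[symmetric] mult.commute)
    then show "ennreal (exp (- l * t) * h (y - t, j)) * indicator {0..y} t \<le> ennreal D * (ennreal (exp (- l * t)) * indicator {0..} t)"
      by (simp add: indicator_def)
    have "exp (- l * t) * h (y - t, j) \<le> 1 * D" if "0 \<le> t" using h l that by (intro mult_mono) auto
    then show "ennreal (exp (- l * t) * h (y - t, j)) * indicator {0..y} t \<le> ennreal D * indicator {0..y} t"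
      by (simp add: indicator_def ennreal_leI)
  qed
  have "ennreal (Q_op l h (y, j)) \<le> (\<integral>\<^sup>+t. ennreal D * (ennreal (exp (- l * t)) * indicator {0..} t) \<partial>lborel)"
    unfolding nn_Q_op_eq_Q_op[OF l h, symmetric] nn_Q_op_def case_prod_conv by (intro nn_integral_mono e)
  also have "\<dots> = ennreal D * ennreal (1 / l)"
  proof -
    have m: "(\<lambda>t. ennreal (exp (- l * t)) * indicator {0..} t) \<in> borel_measurable lborel" by measurable
    show ?thesis unfolding nn_integral_cmult[OF m] nn_integral_exp_half_line[OF l] ..
  qed
  finally have 1: "Q_op l h (y, j) \<le> D * (1 / l)" using D l by (simp add: ennreal_mult[symmetric])
  have "ennreal (Q_op l h (y, j)) \<le> (\<integral>\<^sup>+t. ennreal D * indicator {0..y} t \<partial>lborel)"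
    unfolding nn_Q_op_eq_Q_op[OF l h, symmetric] nn_Q_op_def case_prod_conv by (intro nn_integral_mono e)
  also have "\<dots> = ennreal D * ennreal y" using y by (simp add: nn_integral_cmult)
  finally have 2: "Q_op l h (y, j) \<le> D * y" using D y by (simp add: ennreal_mult[symmetric])
  have a: "1 / l \<le> max 1 (1 / l)" "1 * y \<le> max 1 (1 / l) * y"
    using mult_right_mono[OF max.cobounded1[of 1 "1 / l"] y] by simp_all
  show ?thesis
  proof (cases "y \<le> 1")
    case True
    have "D * y \<le> D * (max 1 (1 / l) * y)" using D a(2) by (intro mult_left_mono) auto
    with 2 True show ?thesis by (simp add: min_absorb2 mult.assoc)
  next
    case False
    have "D * (1 / l) \<le> D * max 1 (1 / l)" using D a(1) by (intro mult_left_mono) auto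
    with 1 False show ?thesis by (simp add: min_absorb1)
  qed
qed

lemma Q_op_measurable:
  assumes h: "h \<in> borel_measurable (state_space :: (real \<times> 'n::finite) measure)"
  shows "(\<lambda>y. Q_op l h (y, j)) \<in> borel_measurable borel"
proof -
  have "(\<lambda>z. (fst z - snd z, j)) \<in> borel \<Otimes>\<^sub>M borel \<rightarrow>\<^sub>M (state_space :: (real \<times> 'n) measure)" by measurable
  from measurable_compose[OF this h] have [measurable]: "(\<lambda>z. h (fst z - snd z, j)) \<in> borel_measurable (borel \<Otimes>\<^sub>M borel)" .
  have [measurable]: "(\<lambda>z::real \<times> real. indicator {0..fst z} (snd z) :: real) \<in> borel_measurable (borel \<Otimes>\<^sub>M borel)"
  proof (rule borel_measurable_indicator')
    have "{z \<in> space (borel \<Otimes>\<^sub>M borel). 0 \<le> snd z \<and> snd z \<le> fst z} \<in> sets (borel \<Otimes>\<^sub>M (borel :: real measure))" by measurable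
    then show "{z \<in> space (borel \<Otimes>\<^sub>M borel). snd z \<in> {0..fst z}} \<in> sets (borel \<Otimes>\<^sub>M (borel :: real measure))"
      by (simp only: atLeastAtMost_iff)
  qed
  have "(\<lambda>z. indicator {0..fst z} (snd z) *\<^sub>R (exp (- l * snd z) * h (fst z - snd z, j))) \<in> borel_measurable (borel \<Otimes>\<^sub>M borel)"
    by measurable
  then have "(\<lambda>(y, t). indicator {0..y} t *\<^sub>R (exp (- l * t) * h (y - t, j))) \<in> borel_measurable (borel \<Otimes>\<^sub>M lborel)"
    using measurable_cong_sets[OF sets_pair_measure_cong[OF refl sets_lborel] refl] by (simp add: case_prod_beta)
  from lborel.borel_measurable_lebesgue_integral[OF this] show ?thesis unfolding Q_op_eq .
qed

context
  fixes Q :: "real^'n^'n" and d :: "'n::finite \<Rightarrow> real" and \<nu> :: "'n \<Rightarrow> real measure" and G :: "'n \<Rightarrow> 'n \<Rightarrow> real measure"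
    and l :: real
  assumes char: "ma_characteristics Q d \<nu> G" and l: "0 < l"
begin

lemma Q_op_levy_integrable:
  assumes h: "h \<in> borel_measurable state_space" "\<And>z. 0 \<le> h z" "\<And>z. h z \<le> D"
  shows "integrable (\<nu> i) (\<lambda>y. Q_op l h (y, i))"
proof (rule Bochner_Integration.integrable_bound[OF integrable_mult_right[OF levy_min_integrable[OF char], where c="D * max 1 (1 / l)"]])
  have s: "sets (\<nu> i) = sets borel" using characteristicsD(4)[OF char, of i] by (auto simp: levy_measure_def)
  from measurable_cong_sets[OF s refl] Q_op_measurable[OF h(1)]
  show "(\<lambda>y. Q_op l h (y, i)) \<in> borel_measurable (\<nu> i)" by blast
  show "AE y in \<nu> i. norm (Q_op l h (y, i)) \<le> norm (D * max 1 (1 / l) * min 1 y)"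
    using AE_levy_pos[OF char, of i]
  proof eventually_elim
    case (elim y)
    have "norm (Q_op l h (y, i)) = Q_op l h (y, i)"
        by (simp only: real_norm_def abs_of_nonneg[OF Q_op_nonneg[of h, OF h(2)]])
    also have "\<dots> \<le> D * max 1 (1 / l) * min 1 y" using elim by (intro Q_op_bound[OF l h]) simp
    also have "\<dots> \<le> norm (D * max 1 (1 / l) * min 1 y)" by simp
    finally show ?case .
  qed
qed

lemma Q_op_jump_integrable:
  assumes h: "h \<in> borel_measurable state_space" "\<And>z. 0 \<le> h z" "\<And>z. h z \<le> D"
  shows "integrable (G i j) (\<lambda>y. Q_op l h (y, j))"
proof -
  interpret prob_space "G i j" by (rule characteristicsD[OF char])
  have D: "0 \<le> D" using h(2,3)[of "(0, j)"] by linarith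
  show ?thesis
  proof (rule integrable_const_bound[of _ "D * max 1 (1 / l)"])
    from measurable_cong_sets[OF characteristicsD(6)[OF char] refl] Q_op_measurable[OF h(1)]
    show "(\<lambda>y. Q_op l h (y, j)) \<in> borel_measurable (G i j)" by blast
    show "AE y in G i j. norm (Q_op l h (y, j)) \<le> D * max 1 (1 / l)"
      using AE_jump_nonneg[OF char, of i j]
    proof eventually_elim
      case (elim y)
      have "norm (Q_op l h (y, j)) = Q_op l h (y, j)"
        by (simp only: real_norm_def abs_of_nonneg[OF Q_op_nonneg[of h, OF h(2)]])
      also have "\<dots> \<le> D * max 1 (1 / l) * min 1 y" using elim by (rule Q_op_bound[OF l h])
      also have "\<dots> \<le> D * max 1 (1 / l) * 1" using D by (intro mult_left_mono) auto
      finally show ?case by simp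
    qed
  qed
qed

lemma psi_nonneg: "(\<And>z. 0 \<le> h z) \<Longrightarrow> 0 \<le> psi Q d \<nu> G h l $ i"
  using characteristicsD(1,3)[OF char, of i]
  by (auto simp: psi_def intro!: add_nonneg_nonneg sum_nonneg mult_nonneg_nonneg integral_nonneg_AE AE_I2 Q_op_nonneg)

lemma nn_psi_eq_psi:
  assumes h: "h \<in> borel_measurable state_space" "\<And>z. 0 \<le> h z" "\<And>z. h z \<le> D"
  shows "nn_psi Q d \<nu> G h l i = ennreal (psi Q d \<nu> G h l $ i)"
proof -
  note Q = nn_Q_op_eq_Q_op[OF l h]
  have a: "(\<integral>\<^sup>+y. nn_Q_op l h (y, i) \<partial>\<nu> i) = ennreal (\<integral>y. Q_op l h (y, i) \<partial>\<nu> i)"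
    unfolding Q by (intro nn_integral_eq_integral Q_op_levy_integrable[OF h] AE_I2 Q_op_nonneg h)
  have b: "(\<integral>\<^sup>+y. nn_Q_op l h (y, j) \<partial>G i j) = ennreal (\<integral>y. Q_op l h (y, j) \<partial>G i j)" for j
    unfolding Q by (intro nn_integral_eq_integral Q_op_jump_integrable[OF h] AE_I2 Q_op_nonneg h)
  have nn: "0 \<le> d i * h (0, i)" "0 \<le> (\<integral>y. Q_op l h (y, i) \<partial>\<nu> i)" "0 \<le> (\<integral>y. Q_op l h (y, j) \<partial>G i j)" for j
    using characteristicsD(3)[OF char, of i] h(2) by (auto intro!: integral_nonneg_AE AE_I2 Q_op_nonneg)
  have "(\<Sum>j\<in>UNIV - {i}. ennreal (Q $ i $ j) * ennreal (\<integral>y. Q_op l h (y, j) \<partial>G i j)) =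
      (\<Sum>j\<in>UNIV - {i}. ennreal (Q $ i $ j * (\<integral>y. Q_op l h (y, j) \<partial>G i j)))"
    using characteristicsD(1)[OF char, of i] nn(3) by (intro sum.cong) (auto simp: ennreal_mult)
  also have "\<dots> = ennreal (\<Sum>j\<in>UNIV - {i}. Q $ i $ j * (\<integral>y. Q_op l h (y, j) \<partial>G i j))"
    using characteristicsD(1)[OF char, of i] nn(3) by (intro sum_ennreal) auto
  finally have c: "(\<Sum>j\<in>UNIV - {i}. ennreal (Q $ i $ j) * ennreal (\<integral>y. Q_op l h (y, j) \<partial>G i j)) =
      ennreal (\<Sum>j\<in>UNIV - {i}. Q $ i $ j * (\<integral>y. Q_op l h (y, j) \<partial>G i j))" .
  have s: "0 \<le> (\<Sum>j\<in>UNIV - {i}. Q $ i $ j * (\<integral>y. Q_op l h (y, j) \<partial>G i j))"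
    using characteristicsD(1)[OF char, of i] nn(3) by (intro sum_nonneg mult_nonneg_nonneg) auto
  show ?thesis
    unfolding nn_psi_def a b c psi_def vec_lambda_beta
    by (simp only: ennreal_plus[symmetric] nn s add_nonneg_nonneg)
qed

lemma psi_shift:
  assumes h: "h \<in> borel_measurable state_space" "\<And>z. \<bar>h z\<bar> \<le> D"
  shows "psi Q d \<nu> G h l $ i = psi Q d \<nu> G (\<lambda>z. h z + D) l $ i - psi Q d \<nu> G (\<lambda>_. D) l $ i"
proof -
  have D: "0 \<le> D" using h(2)[of "(0, i)"] by linarith
  have b: "0 \<le> h z + D" "h z + D \<le> 2 * D" for z using h(2)[of z] by linarith+
  have m: "(\<lambda>z. h z + D) \<in> borel_measurable state_space" using h(1) by simp
  have n1: "(\<integral>y. Q_op l h (y, i) \<partial>\<nu> i) = (\<integral>y. Q_op l (\<lambda>z. h z + D) (y, i) \<partial>\<nu> i) - (\<integral>y. Q_op l (\<lambda>_. D) (y, i) \<partial>\<nu> i)"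
    unfolding Q_op_shift[OF l h]
    by (rule Bochner_Integration.integral_diff[OF Q_op_levy_integrable[OF m b] Q_op_levy_integrable[where D=D]]) (simp_all add: D)
  have n2: "(\<integral>y. Q_op l h (y, j) \<partial>G i j) = (\<integral>y. Q_op l (\<lambda>z. h z + D) (y, j) \<partial>G i j) - (\<integral>y. Q_op l (\<lambda>_. D) (y, j) \<partial>G i j)" for j
    unfolding Q_op_shift[OF l h]
    by (rule Bochner_Integration.integral_diff[OF Q_op_jump_integrable[OF m b] Q_op_jump_integrable[where D=D]]) (simp_all add: D)
  show ?thesis
    unfolding psi_def vec_lambda_beta n1 n2 by (simp add: algebra_simps sum_subtractf)
qed

end

context markov_additive_process
begin

lemma resolvent_eq:
  "resolvent P \<xi> J l h (x, i) = (\<integral>t. indicator {0..} t *\<^sub>R (exp (- l * t) * (\<integral>\<omega>. h (overshoot \<xi> J t \<omega>) \<partial>P x i)) \<partial>lborel)"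
  by (simp add: resolvent_def set_lebesgue_integral_def)

lemma overshoot_integrable:
  fixes h :: "real \<times> 'n \<Rightarrow> real"
  assumes h: "h \<in> borel_measurable state_space" "\<And>z. \<bar>h z\<bar> \<le> D"
  shows "integrable (P x i) (\<lambda>\<omega>. h (overshoot \<xi> J t \<omega>))"
proof -
  interpret prob_space "P x i" by (rule prob_space_P)
  show ?thesis
    by (rule integrable_const_bound[of _ D, OF _ measurable_P[OF measurable_compose[OF overshoot_measurable h(1)]]])
      (use h(2) in simp)
qed

lemma resolvent_integrand_integrable:
  fixes h :: "real \<times> 'n \<Rightarrow> real"
  assumes l: "0 < l" and h: "h \<in> borel_measurable state_space" "\<And>z. \<bar>h z\<bar> \<le> D"
  shows "integrable lborel (\<lambda>t. indicator {0..} t *\<^sub>R (exp (- l * t) * (\<integral>\<omega>. h (overshoot \<xi> J t \<omega>) \<partial>P x i)))"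
proof -
  interpret prob_space "P x i" by (rule prob_space_P)
  have bd: "\<bar>\<integral>\<omega>. h (overshoot \<xi> J t \<omega>) \<partial>P x i\<bar> \<le> D" for t
  proof -
    have "\<bar>\<integral>\<omega>. h (overshoot \<xi> J t \<omega>) \<partial>P x i\<bar> \<le> (\<integral>\<omega>. \<bar>h (overshoot \<xi> J t \<omega>)\<bar> \<partial>P x i)" by (rule integral_abs_bound)
    also have "\<dots> \<le> (\<integral>\<omega>. D \<partial>P x i)"
      using overshoot_integrable[OF h] by (intro integral_mono integrable_abs) (auto simp: h(2))
    finally show ?thesis using prob_space by simp
  qed
  have e: "integrable lborel (\<lambda>t. exp (- l * t) * indicator {0..} t)"
  proof (rule integrableI_nonneg)
    have "(\<integral>\<^sup>+t. ennreal (exp (- l * t) * indicator {0..} t) \<partial>lborel) = (\<integral>\<^sup>+t. ennreal (exp (- l * t)) * indicator {0..} t \<partial>lborel)"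
      by (intro nn_integral_cong) (simp add: indicator_def)
    then show "(\<integral>\<^sup>+t. ennreal (exp (- l * t) * indicator {0..} t) \<partial>lborel) < \<infinity>"
      unfolding nn_integral_exp_half_line[OF l] by simp
  qed simp_all
  show ?thesis
  proof (rule Bochner_Integration.integrable_bound[OF integrable_mult_right[OF e, where c=D]])
    have "(\<lambda>z. h (overshoot \<xi> J (fst z) (snd z))) \<in> borel_measurable (lborel \<Otimes>\<^sub>M P x i)"
      by (rule measurable_compose[OF overshoot_pair_measurable h(1)])
    then have "(\<lambda>t. \<integral>\<omega>. h (overshoot \<xi> J t \<omega>) \<partial>P x i) \<in> borel_measurable lborel"
      by (intro borel_measurable_lebesgue_integral) (simp add: case_prod_beta)
    then have [measurable]: "(\<lambda>t. \<integral>\<omega>. h (overshoot \<xi> J t \<omega>) \<partial>P x i) \<in> borel_measurable borel" by simp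
    show "(\<lambda>t. indicator {0..} t *\<^sub>R (exp (- l * t) * (\<integral>\<omega>. h (overshoot \<xi> J t \<omega>) \<partial>P x i))) \<in> borel_measurable lborel"
      by measurable
    show "AE t in lborel. norm (indicator {0..} t *\<^sub>R (exp (- l * t) * (\<integral>\<omega>. h (overshoot \<xi> J t \<omega>) \<partial>P x i))) \<le>
        norm (D * (exp (- l * t) * indicator {0..} t))"
    proof (intro AE_I2)
      fix t
      have "exp (- l * t) * \<bar>\<integral>\<omega>. h (overshoot \<xi> J t \<omega>) \<partial>P x i\<bar> \<le> exp (- l * t) * \<bar>D\<bar>"
        using bd[of t] by (intro mult_left_mono) auto
      then show "norm (indicator {0..} t *\<^sub>R (exp (- l * t) * (\<integral>\<omega>. h (overshoot \<xi> J t \<omega>) \<partial>P x i))) \<le>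
          norm (D * (exp (- l * t) * indicator {0..} t))"
        by (simp add: indicator_def abs_mult mult.commute)
    qed
  qed
qed

lemma resolvent_nonneg: "(\<And>z. 0 \<le> h z) \<Longrightarrow> 0 \<le> resolvent P \<xi> J l h (x, i)"
  unfolding resolvent_eq by (intro integral_nonneg_AE AE_I2) simp

lemma nn_resolvent_eq_resolvent:
  assumes l: "0 < l" and h: "h \<in> borel_measurable state_space" "\<And>z. 0 \<le> h z" "\<And>z. h z \<le> D"
  shows "nn_resolvent P \<xi> J l h (x, i) = ennreal (resolvent P \<xi> J l h (x, i))"
proof -
  have b: "\<bar>h z\<bar> \<le> D" for z using h(2,3)[of z] by simp
  have e: "(\<integral>\<^sup>+\<omega>. ennreal (h (overshoot \<xi> J t \<omega>)) \<partial>P x i) = ennreal (\<integral>\<omega>. h (overshoot \<xi> J t \<omega>) \<partial>P x i)" for t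
    by (intro nn_integral_eq_integral overshoot_integrable[OF h(1) b] AE_I2 h)
  have "nn_resolvent P \<xi> J l h (x, i) =
      (\<integral>\<^sup>+t. ennreal (indicator {0..} t *\<^sub>R (exp (- l * t) * (\<integral>\<omega>. h (overshoot \<xi> J t \<omega>) \<partial>P x i))) \<partial>lborel)"
    unfolding nn_resolvent_def case_prod_conv e by (intro nn_integral_cong) (simp add: indicator_def ennreal_mult')
  also have "\<dots> = ennreal (resolvent P \<xi> J l h (x, i))"
    unfolding resolvent_eq using h(2)
    by (intro nn_integral_eq_integral resolvent_integrand_integrable[OF l h(1) b] AE_I2) simp
  finally show ?thesis .
qed

lemma resolvent_shift:
  assumes l: "0 < l" and h: "h \<in> borel_measurable state_space" "\<And>z. \<bar>h z\<bar> \<le> D"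
  shows "resolvent P \<xi> J l h (x, i) = resolvent P \<xi> J l (\<lambda>z. h z + D) (x, i) - resolvent P \<xi> J l (\<lambda>_. D) (x, i)"
proof -
  have D: "\<bar>D\<bar> \<le> D" using h(2)[of "(0, i)"] by linarith
  have b: "\<bar>h z + D\<bar> \<le> 2 * D" for z using h(2)[of z] by linarith
  have m: "(\<lambda>z. h z + D) \<in> borel_measurable state_space" "(\<lambda>_. D) \<in> borel_measurable (state_space :: (real \<times> 'n) measure)"
    using h(1) by simp_all
  have e: "(\<integral>\<omega>. h (overshoot \<xi> J t \<omega>) \<partial>P x i) = (\<integral>\<omega>. h (overshoot \<xi> J t \<omega>) + D \<partial>P x i) - (\<integral>\<omega>. D \<partial>P x i)" for t
  proof -
    have 1: "integrable (P x i) (\<lambda>\<omega>. h (overshoot \<xi> J t \<omega>) + D)" by (rule overshoot_integrable[OF m(1) b])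
    have 2: "integrable (P x i) (\<lambda>\<omega>. D)" by (rule overshoot_integrable[OF m(2) D])
    from Bochner_Integration.integral_diff[OF 1 2] show ?thesis by simp
  qed
  show ?thesis
    unfolding resolvent_eq e
      Bochner_Integration.integral_diff[OF resolvent_integrand_integrable[OF l m(1) b] resolvent_integrand_integrable[OF l m(2) D], symmetric]
    by (intro Bochner_Integration.integral_cong) (simp_all add: right_diff_distrib)
qed

lemma unbounded_paths_measurable: "unbounded_paths \<in> sets M"
proof -
  have p: "(\<lambda>\<omega>. passage_time \<xi> t \<omega>) \<in> borel_measurable M" for t
    using measurable_compose[OF measurable_Pair1'[of t borel M] passage_time_jointly_measurable[OF xi_measurable xi_right_continuous]]
    by simp
  have "(\<exists>s\<ge>0. t < \<xi> s \<omega>) \<longleftrightarrow> passage_time \<xi> t \<omega> < \<infinity>" for t \<omega>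
    unfolding passage_time_less_iff by auto
  then have "unbounded_paths = {\<omega> \<in> space M. \<forall>n. passage_time \<xi> (real n) \<omega> < \<infinity>}"
    unfolding unbounded_paths_def
    by (auto, metis less_trans reals_Archimedean2)
  then show ?thesis using p by simp
qed

text \<open>
  The overshoot leaves the right half line only on a set that is null under all laws; by completeness of the
  filtration all its subsets are measurable, so arbitrary values of \<open>f\<close> there do no harm.
\<close>

lemma half_line_function_measurable:
  assumes ub: "\<And>x i. AE \<omega> in P x i. \<omega> \<in> unbounded_paths"
    and h: "h \<in> borel_measurable state_space" and eq: "\<And>y j. 0 \<le> y \<Longrightarrow> f (y, j) = h (y, j)"
  shows "(\<lambda>\<omega>. f (overshoot \<xi> J t \<omega>) :: real) \<in> borel_measurable M"
proof (rule measurableI)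
  fix S :: "real set" assume S: "S \<in> sets borel"
  let ?A = "(\<lambda>\<omega>. f (overshoot \<xi> J t \<omega>)) -` S \<inter> space M"
  let ?B = "(\<lambda>\<omega>. h (overshoot \<xi> J t \<omega>)) -` S \<inter> space M"
  have U: "space M - unbounded_paths \<in> sets M" using unbounded_paths_measurable by simp
  have "emeasure (P x i) (space M - unbounded_paths) = 0" for x i
    using ub[of x i] U by (subst (asm) AE_iff_measurable[where N="space M - unbounded_paths"]) (auto simp: sets_P)
  from filtration_complete[OF U this, of "?A - unbounded_paths"] filtration_sub
  have N: "?A - unbounded_paths \<in> sets M" by blast
  have B: "?B \<in> sets M" by (rule measurable_sets[OF measurable_compose[OF overshoot_measurable h] S])
  have "f (overshoot \<xi> J t \<omega>) = h (overshoot \<xi> J t \<omega>)" if "\<omega> \<in> unbounded_paths" for \<omega>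
    using overshoot_nonneg[OF that, of t] eq by (cases "overshoot \<xi> J t \<omega>") simp
  then have "?A = (?B \<inter> unbounded_paths) \<union> (?A - unbounded_paths)" by auto
  with N B unbounded_paths_measurable show "?A \<in> sets M" by (metis sets.Int sets.Un)
qed simp

lemma resolvent_cong:
  assumes ub: "\<And>x i. AE \<omega> in P x i. \<omega> \<in> unbounded_paths"
    and h: "h \<in> borel_measurable state_space" and eq: "\<And>y j. 0 \<le> y \<Longrightarrow> f (y, j) = h (y, j)"
  shows "resolvent P \<xi> J l f (x, i) = resolvent P \<xi> J l h (x, i)"
proof -
  have "(\<integral>\<omega>. f (overshoot \<xi> J t \<omega>) \<partial>P x i) = (\<integral>\<omega>. h (overshoot \<xi> J t \<omega>) \<partial>P x i)" for t
  proof (rule integral_cong_AE)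
    show "(\<lambda>\<omega>. f (overshoot \<xi> J t \<omega>)) \<in> borel_measurable (P x i)"
      by (rule measurable_P[OF half_line_function_measurable[OF ub h eq]])
    show "(\<lambda>\<omega>. h (overshoot \<xi> J t \<omega>)) \<in> borel_measurable (P x i)"
      by (rule measurable_P[OF measurable_compose[OF overshoot_measurable h]])
    show "AE \<omega> in P x i. f (overshoot \<xi> J t \<omega>) = h (overshoot \<xi> J t \<omega>)"
      using ub[of x i]
    proof eventually_elim
      case (elim \<omega>)
      from overshoot_nonneg[OF elim, of t] eq show ?case by (cases "overshoot \<xi> J t \<omega>") simp
    qed
  qed
  then show ?thesis unfolding resolvent_eq by simp
qed

end

lemma Q_op_cong: "(\<And>y j. 0 \<le> y \<Longrightarrow> f (y, j) = h (y, j)) \<Longrightarrow> Q_op l f (y, j) = Q_op l h (y, j)"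
  unfolding Q_op_eq by (rule Bochner_Integration.integral_cong) (simp_all add: indicator_def)

lemma psi_cong: "(\<And>y j. 0 \<le> y \<Longrightarrow> f (y, j) = h (y, j)) \<Longrightarrow> psi Q d \<nu> G f l = psi Q d \<nu> G h l"
  unfolding psi_def by (simp add: Q_op_cong[of f h])

section \<open>The identity\<close>

context markov_additive_process
begin

context
  fixes L :: "'n \<Rightarrow> real \<Rightarrow> 'w \<Rightarrow> real"
    and N :: "'n \<Rightarrow> 'v measure" and Q :: "real^'n^'n" and d :: "'n \<Rightarrow> real"
    and \<nu> :: "'n \<Rightarrow> real measure" and G :: "'n \<Rightarrow> 'n \<Rightarrow> real measure"
    and K :: "'n \<Rightarrow> real \<Rightarrow> 'v \<Rightarrow> 'n" and Y :: "'n \<Rightarrow> nat \<Rightarrow> 'n \<Rightarrow> real \<Rightarrow> 'v \<Rightarrow> real"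
    and U :: "'n \<Rightarrow> nat \<Rightarrow> 'n \<Rightarrow> 'n \<Rightarrow> 'v \<Rightarrow> real"
  assumes lt: "\<And>i. local_time (space M) F {P x k | x k. True} state_space (reflected \<xi> J) (0, i) (P 0 i) (L i)"
    and char: "ma_characteristics Q d \<nu> G" and ing: "\<And>i. ma_ingredients (N i) i Q d \<nu> G (K i) (Y i) (U i)"
    and law: "\<And>i. process_law (P 0 i) state_space (ladder \<xi> J L) =
                   process_law (N i) state_space (ma_path (K i) (Y i) (U i))"
    and ub: "\<And>x i. AE \<omega> in P x i. \<omega> \<in> unbounded_paths"
begin

lemma overshoot_functional_origin:
  assumes l: "0 < l" and \<theta>: "0 \<le> \<theta>" "\<theta> \<noteq> l"
  shows "overshoot_functional l 0 i (\<lambda>z. ennreal (exp_test \<theta> k z)) = ennreal (potential l \<theta> k i)"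
proof -
  interpret prob_space "P 0 i" by (rule prob_space_P)
  interpret pair_sigma_finite lborel "P 0 i" ..
  have m: "(\<lambda>(t, \<omega>). ennreal (exp (- l * t) * exp_test \<theta> k (overshoot \<xi> J t \<omega>)) * indicator {0..} t) \<in> borel_measurable (lborel \<Otimes>\<^sub>M P 0 i)"
  proof -
    have [measurable]: "(\<lambda>z. exp_test \<theta> k (overshoot \<xi> J (fst z) (snd z))) \<in> borel_measurable (lborel \<Otimes>\<^sub>M P 0 i)"
      by (rule measurable_compose[OF overshoot_pair_measurable exp_test_measurable])
    show ?thesis unfolding case_prod_beta by measurable
  qed
  have "(\<integral>\<^sup>+\<omega>. ennreal (exp (- l * t) * exp_test \<theta> k (overshoot \<xi> J t \<omega>)) * indicator {0..} t \<partial>P 0 i) =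
      ennreal (exp (- l * t)) * indicator {0..} t * (\<integral>\<^sup>+\<omega>. ennreal (exp_test \<theta> k (overshoot \<xi> J t \<omega>)) \<partial>P 0 i)" for t
  proof -
    have "(\<lambda>\<omega>. ennreal (exp_test \<theta> k (overshoot \<xi> J t \<omega>))) \<in> borel_measurable (P 0 i)"
      by (rule measurable_P[OF measurable_compose[OF measurable_compose[OF overshoot_measurable exp_test_measurable] measurable_ennreal]])
    from nn_integral_cmult[OF this, of "ennreal (exp (- l * t)) * indicator {0..} t", symmetric]
    show ?thesis by (simp add: ennreal_mult indicator_def)
  qed
  then have "overshoot_functional l 0 i (\<lambda>z. ennreal (exp_test \<theta> k z)) =
      (\<integral>\<^sup>+t. \<integral>\<^sup>+\<omega>. ennreal (exp (- l * t) * exp_test \<theta> k (overshoot \<xi> J t \<omega>)) * indicator {0..} t \<partial>P 0 i \<partial>lborel)"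
    by (simp only: overshoot_functional_def)
  also have "\<dots> = (\<integral>\<^sup>+\<omega>. \<integral>\<^sup>+t. ennreal (exp (- l * t) * exp_test \<theta> k (overshoot \<xi> J t \<omega>)) * indicator {0..} t \<partial>lborel \<partial>P 0 i)"
    by (rule Fubini'[OF m, symmetric])
  also have "\<dots> = (\<integral>\<^sup>+\<omega>. overshoot_laplace l \<theta> k \<omega> \<partial>P 0 i)"
    by (rule nn_integral_cong) (simp only: overshoot_laplace_def[OF lt char ing law ub])
  finally show ?thesis using skeleton_potential(3)[OF lt char ing law ub l \<theta>, of i k] by simp
qed

text \<open>
  The shift is available for functions bounded by one, which \<open>exp_test\<close> is only on the right half line; the clipped
  function agrees with it wherever the overshoot can be.
\<close>

lemma overshoot_functional_exp_test:
  assumes l: "0 < l" and x: "0 \<le> x" and \<theta>: "0 \<le> \<theta>" "\<theta> \<noteq> l"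
  shows "overshoot_functional l x i (\<lambda>z. ennreal (exp_test \<theta> k z)) =
    occupation l x i (\<lambda>z. ennreal (exp_test \<theta> k z)) + ennreal (exp (- l * x)) * ennreal (potential l \<theta> k i)"
proof -
  define g where "g z = exp_test \<theta> k (max 0 (fst z), snd z)" for z
  have eq: "ennreal (exp_test \<theta> k (y, j)) = ennreal (g (y, j))" if "0 \<le> y" for y j
    using that by (simp add: g_def max_absorb2)
  have gm: "g \<in> borel_measurable state_space"
  proof -
    have "(\<lambda>z. (max 0 (fst z), snd z)) \<in> state_space \<rightarrow>\<^sub>M (state_space :: (real \<times> 'n) measure)" by measurable
    from measurable_compose[OF this exp_test_measurable] show ?thesis by (simp add: g_def[abs_def])
  qed
  have g1: "0 \<le> g z" "g z \<le> 1" for z using \<theta> by (auto simp: g_def exp_test_def)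
  have c: "continuous_on UNIV (\<lambda>y. g (y, j))" for j
    by (cases "j = k") (auto simp: g_def exp_test_def intro!: continuous_intros)
  note cong = overshoot_functional_cong[where g="\<lambda>z. ennreal (exp_test \<theta> k z)" and g'="\<lambda>z. ennreal (g z)", OF ub eq]
  have "overshoot_functional l x i (\<lambda>z. ennreal (exp_test \<theta> k z)) = overshoot_functional l x i (\<lambda>z. ennreal (g z))"
    by (rule cong)
  also have "\<dots> = occupation l x i (\<lambda>z. ennreal (g z)) + ennreal (exp (- l * x)) * overshoot_functional l 0 i (\<lambda>z. ennreal (g z))"
    by (rule overshoot_functional_shift[OF ub x gm g1 c])
  also have "occupation l x i (\<lambda>z. ennreal (g z)) = occupation l x i (\<lambda>z. ennreal (exp_test \<theta> k z))"
    by (rule occupation_cong) (simp only: eq)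
  also have "overshoot_functional l 0 i (\<lambda>z. ennreal (g z)) = ennreal (potential l \<theta> k i)"
    by (rule trans[OF cong[symmetric] overshoot_functional_origin[OF l \<theta>]])
  finally show ?thesis .
qed

text \<open>Uniqueness of Laplace transforms, applied to the two sides as functionals of \<open>g\<close>.\<close>

lemma overshoot_resolvent_identity:
  assumes l: "0 < l" and x: "0 \<le> x" and irr: "irreducible_intensity Q" and g: "g \<in> borel_measurable state_space"
  defines "V \<equiv> matrix_inv (matrix_exponent Q d \<nu> G l)"
  shows "overshoot_functional l x i g =
    occupation l x i g + ennreal (exp (- l * x)) * (\<Sum>j\<in>UNIV. ennreal (V $ i $ j) * jump_functional Q d \<nu> G l j g)"
proof (rule is_integral_eqI_laplace[where c="2 * l" and \<Lambda>="overshoot_functional l x i" and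
      \<Lambda>'="\<lambda>g. occupation l x i g + ennreal (exp (- l * x)) * (\<Sum>j\<in>UNIV. ennreal (V $ i $ j) * jump_functional Q d \<nu> G l j g)"])
  show "is_integral (overshoot_functional l x i)" by (rule is_integral_overshoot_functional)
  show "is_integral (\<lambda>g. occupation l x i g + ennreal (exp (- l * x)) * (\<Sum>j\<in>UNIV. ennreal (V $ i $ j) * jump_functional Q d \<nu> G l j g))"
    by (rule is_integral_add[OF is_integral_occupation
        is_integral_cmult[OF is_integral_sum[OF finite is_integral_cmult[OF is_integral_jump_functional[OF char]]]]])
  (* exponents 2 * l * k with natural k never hit l, where the difference quotients degenerate *)
  show "0 < 2 * l" using l by simp
  show "overshoot_functional l x i (indicator ({..<0} \<times> UNIV)) = 0" by (rule overshoot_functional_negative[OF ub])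
  show "occupation l x i (indicator ({..<0} \<times> UNIV)) +
      ennreal (exp (- l * x)) * (\<Sum>j\<in>UNIV. ennreal (V $ i $ j) * jump_functional Q d \<nu> G l j (indicator ({..<0} \<times> UNIV))) = 0"
    by (simp only: occupation_negative jump_functional_negative[OF char]) simp
  show "overshoot_functional l x i (\<lambda>_. 1) < \<infinity>" using overshoot_functional_one[OF l] by simp
  show "g \<in> borel_measurable state_space" by (rule g)
next
  fix k :: nat and m :: 'n
  define \<theta> where "\<theta> = 2 * l * real k"
  have "2 * real k \<noteq> 1"
  proof
    assume "2 * real k = 1"
    then have "real (2 * k) = real 1" by simp
    then have "2 * k = 1" by (simp only: of_nat_eq_iff)
    then show False by presburger
  qed
  then have \<theta>: "0 \<le> \<theta>" "\<theta> \<noteq> l" using l by (auto simp: \<theta>_def)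
  have t: "(\<lambda>z. ennreal (exp (- (2 * l * real k) * fst z)) * indicator {m} (snd z)) = (\<lambda>z. ennreal (exp_test \<theta> m z))"
    by (auto simp: fun_eq_iff exp_test_def \<theta>_def indicator_def)
  define r where "r j = (matrix_exponent Q d \<nu> G l $ j $ m - matrix_exponent Q d \<nu> G \<theta> $ j $ m) / (l - \<theta>)" for j
  have r: "jump_functional Q d \<nu> G l j (\<lambda>z. ennreal (exp_test \<theta> m z)) = ennreal (r j)" "0 \<le> r j" for j
    using jump_functional_exp_test[OF char _ \<theta>, of j m] l by (simp_all add: r_def)
  have V: "0 \<le> V $ i $ j" for j
    unfolding V_def by (rule ladder_exponent_invertible(2)[OF lt char ing law ub l irr])
  have "ennreal (potential l \<theta> m i) = (\<Sum>j\<in>UNIV. ennreal (V $ i $ j * r j))"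
    using potential_formula[OF lt char ing law ub l irr \<theta>, of m i] V r(2)
    by (simp add: sum_ennreal V_def[symmetric] r_def[symmetric])
  also have "\<dots> = (\<Sum>j\<in>UNIV. ennreal (V $ i $ j) * ennreal (r j))"
    by (intro sum.cong refl ennreal_mult V r)
  finally have "ennreal (potential l \<theta> m i) = (\<Sum>j\<in>UNIV. ennreal (V $ i $ j) * ennreal (r j))" .
  then show "overshoot_functional l x i (\<lambda>z. ennreal (exp (- (2 * l * real k) * fst z)) * indicator {m} (snd z)) =
      occupation l x i (\<lambda>z. ennreal (exp (- (2 * l * real k) * fst z)) * indicator {m} (snd z)) +
      ennreal (exp (- l * x)) * (\<Sum>j\<in>UNIV. ennreal (V $ i $ j) *
        jump_functional Q d \<nu> G l j (\<lambda>z. ennreal (exp (- (2 * l * real k) * fst z)) * indicator {m} (snd z)))"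
    unfolding t overshoot_functional_exp_test[OF l x \<theta>] r(1) by simp
qed

end

end

lemma clipped_measurable:
  assumes "f \<in> borel_measurable (restrict_space borel {0..} \<Otimes>\<^sub>M count_space (UNIV :: 'n::finite set))"
  shows "(\<lambda>z. f (max 0 (fst z), snd z)) \<in> borel_measurable (state_space :: (real \<times> 'n) measure)"
proof -
  have "(\<lambda>z. max 0 (fst z)) \<in> (state_space :: (real \<times> 'n) measure) \<rightarrow>\<^sub>M restrict_space borel {0..}"
    by (rule measurable_restrict_space2) auto
  from measurable_compose[OF measurable_Pair[OF this measurable_snd] assms] show ?thesis .
qed

theorem theorem3p6:
  fixes M :: "'w measure" and F :: "real \<Rightarrow> 'w measure"
    and P :: "real \<Rightarrow> 'n::finite \<Rightarrow> 'w measure"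
    and \<xi> :: "real \<Rightarrow> 'w \<Rightarrow> real" and J :: "real \<Rightarrow> 'w \<Rightarrow> 'n"
    and L :: "'n \<Rightarrow> real \<Rightarrow> 'w \<Rightarrow> real"
    and Q :: "real^'n^'n" and d :: "'n \<Rightarrow> real"
    and \<nu> :: "'n \<Rightarrow> real measure" and G :: "'n \<Rightarrow> 'n \<Rightarrow> real measure"
    and N :: "'n \<Rightarrow> 'v measure" and K :: "'n \<Rightarrow> real \<Rightarrow> 'v \<Rightarrow> 'n"
    and Y :: "'n \<Rightarrow> nat \<Rightarrow> 'n \<Rightarrow> real \<Rightarrow> 'v \<Rightarrow> real"
    and U :: "'n \<Rightarrow> nat \<Rightarrow> 'n \<Rightarrow> 'n \<Rightarrow> 'v \<Rightarrow> real"
    and l x :: real and f :: "real \<times> 'n \<Rightarrow> real"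
  assumes map: "markov_additive_process M F P \<xi> J"
    and nonlattice: "\<not> lattice_support P \<xi>"
    and upward_regular: "\<And>i. AE \<omega> in P 0 i. passage_time \<xi> 0 \<omega> = 0"
    and limsup: "\<And>x i. AE \<omega> in P x i. Limsup at_top (\<lambda>t. ereal (\<xi> t \<omega>)) = \<infinity>"
    and local_time: "\<And>i. local_time (space M) F {P x k | x k. True} state_space
                           (reflected \<xi> J) (0, i) (P 0 i) (L i)"
    and characteristics: "ma_characteristics Q d \<nu> G"
    and ingredients: "\<And>i. ma_ingredients (N i) i Q d \<nu> G (K i) (Y i) (U i)"
    and ladder_law: "\<And>i. process_law (P 0 i) state_space (ladder \<xi> J L) =
                         process_law (N i) state_space (ma_path (K i) (Y i) (U i))"
    and irreducible: "irreducible_intensity Q"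
    and l: "l > 0" and x: "x \<ge> 0"
    and f: "f \<in> borel_measurable (restrict_space borel {0..} \<Otimes>\<^sub>M count_space UNIV)"
  shows "invertible (matrix_exponent Q d \<nu> G l) \<and>
    (bounded (f ` ({0..} \<times> UNIV)) \<longrightarrow>
       (\<chi> i. resolvent P \<xi> J l f (x, i)) =
       (\<chi> i. Q_op l f (x, i)) +
         exp (- l * x) *\<^sub>R (matrix_inv (matrix_exponent Q d \<nu> G l) *v psi Q d \<nu> G f l)) \<and>
    ((\<forall>z\<in>{0..} \<times> UNIV. 0 \<le> f z) \<longrightarrow>
       (\<forall>i. enn2ereal (nn_resolvent P \<xi> J l f (x, i)) =
            enn2ereal (nn_Q_op l f (x, i)) +
              ereal (exp (- l * x)) *
                (\<Sum>j\<in>UNIV. ereal (matrix_inv (matrix_exponent Q d \<nu> G l) $ i $ j) *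
                            enn2ereal (nn_psi Q d \<nu> G f l j))))"
proof -
  interpret markov_additive_process M F P \<xi> J by (rule map)
  have ub: "AE \<omega> in P x i. \<omega> \<in> unbounded_paths" for x i
    using limsup[of x i] AE_space by eventually_elim (rule limsup_imp_unbounded, simp_all)
  note ctx = local_time characteristics ingredients ladder_law ub
  define V where "V = matrix_inv (matrix_exponent Q d \<nu> G l)"
  (* f is only measurable on the right half line, so it is replaced by a function on the whole line *)
  define h where "h z = f (max 0 (fst z), snd z)" for z
  have hm: "h \<in> borel_measurable state_space"
    unfolding h_def[abs_def] by (rule clipped_measurable[OF f])
  have fh: "f (y, j) = h (y, j)" if "0 \<le> y" for y j using that by (simp add: h_def max_absorb2)
  have V: "0 \<le> V $ i $ j" for i j
    unfolding V_def by (rule ladder_exponent_invertible(2)[OF ctx l irreducible])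
  have identity: "nn_resolvent P \<xi> J l g (x, i) = nn_Q_op l g (x, i) +
      ennreal (exp (- l * x)) * (\<Sum>j\<in>UNIV. ennreal (V $ i $ j) * nn_psi Q d \<nu> G g l j)"
    if "g \<in> borel_measurable state_space" for g i
    unfolding nn_resolvent_eq_overshoot_functional nn_Q_op_eq_occupation
      nn_psi_eq_jump_functional[where d=d, OF characteristicsD(3)[OF characteristics]] V_def
    by (rule overshoot_resolvent_identity[OF ctx l x irreducible measurable_compose[OF that measurable_ennreal]])
  have real_identity: "resolvent P \<xi> J l g (x, i) = Q_op l g (x, i) +
      exp (- l * x) * (\<Sum>j\<in>UNIV. V $ i $ j * psi Q d \<nu> G g l $ j)"
    if g: "g \<in> borel_measurable state_space" "\<And>z. 0 \<le> g z" "\<And>z. g z \<le> D" for g D i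
  proof -
    have p: "0 \<le> psi Q d \<nu> G g l $ j" for j by (rule psi_nonneg[OF characteristics l g(2)])
    have s: "0 \<le> (\<Sum>j\<in>UNIV. V $ i $ j * psi Q d \<nu> G g l $ j)" by (intro sum_nonneg mult_nonneg_nonneg V p)
    have q: "0 \<le> Q_op l g (x, i)" by (rule Q_op_nonneg[OF g(2)])
    have "(\<Sum>j\<in>UNIV. ennreal (V $ i $ j) * ennreal (psi Q d \<nu> G g l $ j)) = ennreal (\<Sum>j\<in>UNIV. V $ i $ j * psi Q d \<nu> G g l $ j)"
      using V p by (simp add: sum_ennreal ennreal_mult[symmetric])
    with identity[OF g(1), of i]
    have "ennreal (resolvent P \<xi> J l g (x, i)) = ennreal (Q_op l g (x, i)) +
        ennreal (exp (- l * x)) * ennreal (\<Sum>j\<in>UNIV. V $ i $ j * psi Q d \<nu> G g l $ j)"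
      by (simp only: nn_resolvent_eq_resolvent[OF l g] nn_Q_op_eq_Q_op[OF l g] nn_psi_eq_psi[OF characteristics l g])
    also have "\<dots> = ennreal (Q_op l g (x, i) + exp (- l * x) * (\<Sum>j\<in>UNIV. V $ i $ j * psi Q d \<nu> G g l $ j))"
      using q s by (simp add: ennreal_mult)
    finally show ?thesis
      using q s by (subst (asm) ennreal_inj) (auto intro!: resolvent_nonneg g(2) add_nonneg_nonneg mult_nonneg_nonneg)
  qed
  have bounded: "(\<chi> i. resolvent P \<xi> J l f (x, i)) =
      (\<chi> i. Q_op l f (x, i)) + exp (- l * x) *\<^sub>R (V *v psi Q d \<nu> G f l)"
    if bd: "bounded (f ` ({0..} \<times> UNIV))"
  proof -
    obtain D where D: "\<And>y j. 0 \<le> y \<Longrightarrow> \<bar>f (y, j)\<bar> \<le> D" using bd by (auto simp: bounded_iff)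
    have hb: "\<bar>h z\<bar> \<le> D" for z unfolding h_def by (rule D) simp
    have D0: "0 \<le> D" using hb[of "(0, undefined)"] by linarith
    have 1: "0 \<le> h z + D" "h z + D \<le> 2 * D" for z using hb[of z] by linarith+
    have m: "(\<lambda>z. h z + D) \<in> borel_measurable state_space" using hm by simp
    have i1: "resolvent P \<xi> J l (\<lambda>z. h z + D) (x, i) = Q_op l (\<lambda>z. h z + D) (x, i) +
        exp (- l * x) * (\<Sum>j\<in>UNIV. V $ i $ j * psi Q d \<nu> G (\<lambda>z. h z + D) l $ j)" for i
      by (rule real_identity[OF m 1])
    have i2: "resolvent P \<xi> J l (\<lambda>_. D) (x, i) = Q_op l (\<lambda>_. D) (x, i) +
        exp (- l * x) * (\<Sum>j\<in>UNIV. V $ i $ j * psi Q d \<nu> G (\<lambda>_. D) l $ j)" for i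
      by (rule real_identity, simp, rule D0, rule order_refl)
    have "resolvent P \<xi> J l h (x, i) = Q_op l h (x, i) + exp (- l * x) * (\<Sum>j\<in>UNIV. V $ i $ j * psi Q d \<nu> G h l $ j)" for i
    proof -
      have "(\<Sum>j\<in>UNIV. V $ i $ j * psi Q d \<nu> G h l $ j) =
          (\<Sum>j\<in>UNIV. V $ i $ j * psi Q d \<nu> G (\<lambda>z. h z + D) l $ j) - (\<Sum>j\<in>UNIV. V $ i $ j * psi Q d \<nu> G (\<lambda>_. D) l $ j)"
        unfolding psi_shift[OF characteristics l hm hb] by (simp only: right_diff_distrib sum_subtractf)
      then show ?thesis
        unfolding resolvent_shift[OF l hm hb] Q_op_shift[OF l hm hb] i1 i2 by (simp only: right_diff_distrib)
    qed
    then show ?thesis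
      using resolvent_cong[OF ub hm fh] Q_op_cong[of f h, OF fh] psi_cong[of f h, OF fh]
      by (simp add: vec_eq_iff matrix_vector_mult_def)
  qed
  have nonneg: "enn2ereal (nn_resolvent P \<xi> J l f (x, i)) = enn2ereal (nn_Q_op l f (x, i)) +
      ereal (exp (- l * x)) * (\<Sum>j\<in>UNIV. ereal (V $ i $ j) * enn2ereal (nn_psi Q d \<nu> G f l j))" for i
  proof -
    note psi_eq = nn_psi_eq_jump_functional[where d=d, OF characteristicsD(3)[OF characteristics]]
    have "nn_resolvent P \<xi> J l f (x, i) = nn_resolvent P \<xi> J l h (x, i)"
      unfolding nn_resolvent_eq_overshoot_functional by (rule overshoot_functional_cong[OF ub]) (simp only: fh)
    moreover have "nn_Q_op l f (x, i) = nn_Q_op l h (x, i)"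
      unfolding nn_Q_op_eq_occupation by (rule occupation_cong) (simp only: fh)
    moreover have "nn_psi Q d \<nu> G f l j = nn_psi Q d \<nu> G h l j" for j
      unfolding psi_eq by (rule jump_functional_cong) (simp only: fh)
    ultimately have e: "nn_resolvent P \<xi> J l f (x, i) = nn_Q_op l f (x, i) +
        ennreal (exp (- l * x)) * (\<Sum>j\<in>UNIV. ennreal (V $ i $ j) * nn_psi Q d \<nu> G f l j)"
      using identity[OF hm, of i] by (simp only:)
    have "(\<Sum>j\<in>UNIV. ereal (V $ i $ j) * enn2ereal (nn_psi Q d \<nu> G f l j)) =
        (\<Sum>j\<in>UNIV. enn2ereal (ennreal (V $ i $ j) * nn_psi Q d \<nu> G f l j))"
      by (simp only: times_ennreal.rep_eq enn2ereal_ennreal[OF V])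
    also have "\<dots> = enn2ereal (\<Sum>j\<in>UNIV. ennreal (V $ i $ j) * nn_psi Q d \<nu> G f l j)"
      by (rule sum_enn2ereal) simp
    finally show ?thesis
      unfolding e by (simp only: plus_ennreal.rep_eq times_ennreal.rep_eq enn2ereal_ennreal[OF exp_ge_zero])
  qed
  show ?thesis
    using ladder_exponent_invertible(1)[OF ctx l irreducible] bounded nonneg unfolding V_def by blast
qed

end
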